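(* Assume (i)-(iii) of the context, and assume that the quadratic form $\tilde K_{ij}\theta_{,i}\theta_{,j}+\tilde C_{ijkl}M_{l,k}M_{i,j}$ is positive definite. Let $(u_i,\tau,R_i)$ be a solution on $\Omega\times(0,\infty)$ of the system (without sources) $$\rho\ddot u_i=(A_{jikl}e_{kl}-a_{ji}\dot\tau+B_{jikl}R_{l,k})_{,j},$$ $$c\,\ddot\tau=-a_{ij}\dot e_{ij}+(-d_{ij}\dot R_j+K_{ij}\tau_{,j}+\tilde K_{ij}\dot\tau_{,j})_{,i}-b_{ij}\dot R_{i,j},$$ $$c_{ij}\ddot R_j=(B_{klji}e_{kl}-b_{ji}\dot\tau+C_{jikl}R_{k,l}+\tilde C_{jikl}\dot R_{k,l})_{,j}-d_{ij}\dot\tau_{,j},$$ with initial conditions $u_i(\cdot,0)=u_i^0$, $\dot u_i(\cdot,0)=v_i^0$, $\tau(\cdot,0)=\tau^0$, $\dot\tau(\cdot,0)=\theta^0$, $R_i(\cdot,0)=R_i^0$, $\dot R_i(\cdot,0)=M_i^0$ in $\Omega$ (given data) and boundary conditions $u_i=0$, $\tau=0$, $R_i=0$ on $\partial\Omega\times(0,\infty)$, which vanishes after a finite time $t_0$. Then $(u_i,\tau,R_i)\equiv(0,0,0)$ for every $t\ge0$.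
   Context: Conventions: $\Omega\subset\mathbb{R}^3$ is a bounded region with smooth boundary $\partial\Omega$; Latin indices range over $1,2,3$; repeated indices are summed; $g_{,j}=\partial g/\partial x_j$; a dot is the partial time derivative; $e_{ij}=\frac12(u_{i,j}+u_{j,i})$. $W_0^{1,2}(\Omega)$ is the usual Sobolev space. The system is that of linear anisotropic thermoelasticity with microtemperatures of type III: $u_i$ is the displacement, $\tau$ the time-integrated temperature variation (thermal displacement), $R_i$ the time-integrated microtemperatures. The constitutive coefficients are $\rho, c, c_{ij}, A_{ijkl}, a_{ij}, B_{ijkl}, b_{ij}, C_{ijkl}, d_{ij}, K_{ij},\tilde K_{ij},\tilde C_{ijkl}$, with $c=\rho c_E/T_0$, where $c_E$ is the specific heat at constant strain and $T_0$ the constant absolute reference temperature. Assumptions: (i) $A_{ijkl}=A_{jikl}=A_{klij}$, $B_{ijkl}=B_{jikl}=B_{klij}$, $C_{ijkl}=C_{jikl}=C_{klij}$, $a_{ij}=a_{ji}$, $b_{ij}=b_{ji}$, $c_{ij}=c_{ji}$, $d_{ij}=d_{ji}$, $K_{ij}=K_{ji}$, $\tilde K_{ij}=\tilde K_{ji}$, $\tilde C_{ijkl}=\tilde C_{klij}$; (ii) $\rho>0$ and $\tilde K_{ij}\theta_{,i}\theta_{,j}+\tilde C_{ijkl}M_{l,k}M_{i,j}\ge0$ (for all scalar fields $\theta$ and vector fields $M_i$; strengthened in the claim to positive definiteness); (iii) there is a positive constant $c_0$ such that, for all $u_i,\tau,R_i\in W_0^{1,2}(\Omega)$, $$\int_\Omega\big(A_{ijkl}e_{kl}e_{ij}+2B_{ijkl}e_{ij}R_{k,l}+K_{ij}\tau_{,i}\tau_{,j}+C_{ijkl}R_{i,j}R_{k,l}\big)dv\ge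 c_0\int_\Omega\big(e_{ij}e_{ij}+\tau_{,i}\tau_{,i}+R_{i,j}R_{i,j}\big)dv.$$ *)

theory Defs
  imports "HOL-Analysis.Analysis"
begin

text \<open>
  Indices are elements of the three-element type \<open>3\<close>; vector and tensor fields are
  index families of scalar fields. Repeated indices are summed over \<open>UNIV\<close>.
  A space-time field has type \<open>real^3 \<Rightarrow> real \<Rightarrow> real\<close>; only its values at points of the
  closure of \<open>\<Omega>\<close> and times \<open>t \<ge> 0\<close> matter.
\<close>

definition pdiff :: "3 \<Rightarrow> (real^3 \<Rightarrow> real) \<Rightarrow> real^3 \<Rightarrow> bool" where
  "pdiff j f x \<longleftrightarrow> (\<lambda>h. f (x + h *\<^sub>R axis j 1)) differentiable (at 0)"

definition pd :: "3 \<Rightarrow> (real^3 \<Rightarrow> real) \<Rightarrow> real^3 \<Rightarrow> real" where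
  "pd j f x = deriv (\<lambda>h. f (x + h *\<^sub>R axis j 1)) 0"

primrec Ck_on :: "nat \<Rightarrow> (real^3) set \<Rightarrow> (real^3 \<Rightarrow> real) \<Rightarrow> bool" where
  "Ck_on 0 U f \<longleftrightarrow> continuous_on U f"
| "Ck_on (Suc k) U f \<longleftrightarrow>
     continuous_on U f \<and> (\<forall>j. (\<forall>x\<in>U. pdiff j f x) \<and> Ck_on k U (pd j f))"

text \<open>For open \<open>U\<close>, this is \<open>C\<close>-infinity on \<open>U\<close>.\<close>

definition smooth_on :: "(real^3) set \<Rightarrow> (real^3 \<Rightarrow> real) \<Rightarrow> bool" where
  "smooth_on U f \<longleftrightarrow> (\<forall>k. Ck_on k U f)"

text \<open>
  Smoothness of the boundary: near each boundary point, \<open>\<Omega>\<close> is the sublevel set of a smooth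
  function with nowhere vanishing gradient.
\<close>

definition smooth_boundary :: "(real^3) set \<Rightarrow> bool" where
  "smooth_boundary \<Omega> \<longleftrightarrow>
     (\<forall>p\<in>frontier \<Omega>. \<exists>U g. open U \<and> p \<in> U \<and> smooth_on U g \<and>
        (\<forall>x\<in>U. \<exists>j. pd j g x \<noteq> 0) \<and> \<Omega> \<inter> U = {x\<in>U. g x < 0})"

definition smooth_bounded_region :: "(real^3) set \<Rightarrow> bool" where
  "smooth_bounded_region \<Omega> \<longleftrightarrow> open \<Omega> \<and> connected \<Omega> \<and> bounded \<Omega> \<and> smooth_boundary \<Omega>"

text \<open>Continuously differentiable in \<open>\<Omega>\<close>, with first derivatives continuous up to the boundary.\<close>

definition C1_closure :: "(real^3) set \<Rightarrow> (real^3 \<Rightarrow> real) \<Rightarrow> bool" where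
  "C1_closure \<Omega> f \<longleftrightarrow> continuous_on (closure \<Omega>) f \<and>
     (\<forall>j. (\<forall>x\<in>\<Omega>. pdiff j f x) \<and>
          (\<exists>F. continuous_on (closure \<Omega>) F \<and> (\<forall>x\<in>\<Omega>. F x = pd j f x)))"

definition L2_fun :: "(real^3) set \<Rightarrow> (real^3 \<Rightarrow> real) \<Rightarrow> bool" where
  "L2_fun \<Omega> f \<longleftrightarrow> set_borel_measurable lborel \<Omega> f \<and> set_integrable lborel \<Omega> (\<lambda>x. (f x)\<^sup>2)"

definition test_function :: "(real^3) set \<Rightarrow> (real^3 \<Rightarrow> real) \<Rightarrow> bool" where
  "test_function \<Omega> \<phi> \<longleftrightarrow> smooth_on UNIV \<phi> \<and>
     compact (closure {x. \<phi> x \<noteq> 0}) \<and> closure {x. \<phi> x \<noteq> 0} \<subseteq> \<Omega>"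

text \<open>\<open>f\<close> has the square integrable functions \<open>g j\<close> as weak partial derivatives on \<open>\<Omega>\<close>.\<close>

definition weak_gradient :: "(real^3) set \<Rightarrow> (real^3 \<Rightarrow> real) \<Rightarrow> (3 \<Rightarrow> real^3 \<Rightarrow> real) \<Rightarrow> bool" where
  "weak_gradient \<Omega> f g \<longleftrightarrow>
     (\<forall>j. L2_fun \<Omega> (g j) \<and>
       (\<forall>\<phi>. test_function \<Omega> \<phi> \<longrightarrow>
          (LINT x:\<Omega>|lborel. f x * pd j \<phi> x) = - (LINT x:\<Omega>|lborel. g j x * \<phi> x)))"

text \<open>Closure of the test functions in the norm of \<open>W\<^sup>1\<^sup>,\<^sup>2\<close>.\<close>

definition W0_12 :: "(real^3) set \<Rightarrow> (real^3 \<Rightarrow> real) \<Rightarrow> bool" where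
  "W0_12 \<Omega> f \<longleftrightarrow> L2_fun \<Omega> f \<and>
     (\<exists>g. weak_gradient \<Omega> f g \<and>
       (\<exists>\<phi> :: nat \<Rightarrow> real^3 \<Rightarrow> real.
          (\<forall>n. test_function \<Omega> (\<phi> n)) \<and>
          (\<lambda>n. LINT x:\<Omega>|lborel. (\<phi> n x - f x)\<^sup>2) \<longlonglongrightarrow> 0 \<and>
          (\<forall>j. (\<lambda>n. LINT x:\<Omega>|lborel. (pd j (\<phi> n) x - g j x)\<^sup>2) \<longlonglongrightarrow> 0)))"

text \<open>
  The coefficients may depend on the point. The tensors with two and four indices that carry a
  tilde in the literature are \<open>Kt_co\<close> and \<open>Ct_co\<close>; \<open>cM\<close> is the tensor
  \<open>c\<^sub>i\<^sub>j\<close>, and the scalar \<open>c\<close> is \<open>c_heat\<close> below. No sign of the specific heat, of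
  \<open>c\<close> or of \<open>c\<^sub>i\<^sub>j\<close> is assumed.
\<close>

record material =
  rho :: "real^3 \<Rightarrow> real"
  cE :: "real^3 \<Rightarrow> real"
  T0 :: real
  cM :: "real^3 \<Rightarrow> 3 \<Rightarrow> 3 \<Rightarrow> real"
  A_co :: "real^3 \<Rightarrow> 3 \<Rightarrow> 3 \<Rightarrow> 3 \<Rightarrow> 3 \<Rightarrow> real"
  a_co :: "real^3 \<Rightarrow> 3 \<Rightarrow> 3 \<Rightarrow> real"
  B_co :: "real^3 \<Rightarrow> 3 \<Rightarrow> 3 \<Rightarrow> 3 \<Rightarrow> 3 \<Rightarrow> real"
  b_co :: "real^3 \<Rightarrow> 3 \<Rightarrow> 3 \<Rightarrow> real"
  C_co :: "real^3 \<Rightarrow> 3 \<Rightarrow> 3 \<Rightarrow> 3 \<Rightarrow> 3 \<Rightarrow> real"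
  d_co :: "real^3 \<Rightarrow> 3 \<Rightarrow> 3 \<Rightarrow> real"
  K_co :: "real^3 \<Rightarrow> 3 \<Rightarrow> 3 \<Rightarrow> real"
  Kt_co :: "real^3 \<Rightarrow> 3 \<Rightarrow> 3 \<Rightarrow> real"
  Ct_co :: "real^3 \<Rightarrow> 3 \<Rightarrow> 3 \<Rightarrow> 3 \<Rightarrow> 3 \<Rightarrow> real"

definition c_heat :: "material \<Rightarrow> real^3 \<Rightarrow> real" where
  "c_heat m x = rho m x * cE m x / T0 m"

definition regular_coefficients :: "(real^3) set \<Rightarrow> material \<Rightarrow> bool" where
  "regular_coefficients \<Omega> m \<longleftrightarrow>
     T0 m > 0 \<and> C1_closure \<Omega> (rho m) \<and> C1_closure \<Omega> (cE m) \<and>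
     (\<forall>i j. \<forall>f\<in>{cM m, a_co m, b_co m, d_co m, K_co m, Kt_co m}. C1_closure \<Omega> (\<lambda>x. f x i j)) \<and>
     (\<forall>i j k l. \<forall>f\<in>{A_co m, B_co m, C_co m, Ct_co m}. C1_closure \<Omega> (\<lambda>x. f x i j k l))"

definition symmetric_coefficients :: "(real^3) set \<Rightarrow> material \<Rightarrow> bool" where
  "symmetric_coefficients \<Omega> m \<longleftrightarrow>
     (\<forall>x\<in>closure \<Omega>. \<forall>i j k l.
        (\<forall>f\<in>{A_co m, B_co m, C_co m}. f x i j k l = f x j i k l \<and> f x i j k l = f x k l i j) \<and>
        (\<forall>f\<in>{a_co m, b_co m, cM m, d_co m, K_co m, Kt_co m}. f x i j = f x j i) \<and>
        Ct_co m x i j k l = Ct_co m x k l i j)"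

text \<open>
  The dissipation form at a point, where \<open>\<xi> i\<close> stands for \<open>\<theta>\<^sub>,\<^sub>i\<close> and \<open>\<eta> i j\<close> for
  \<open>M\<^sub>i\<^sub>,\<^sub>j\<close>. Gradients of fields at a given point are arbitrary, so (semi)definiteness
  is expressed for all \<open>\<xi>\<close> and \<open>\<eta>\<close>.
\<close>

definition dissipation :: "material \<Rightarrow> real^3 \<Rightarrow> (3 \<Rightarrow> real) \<Rightarrow> (3 \<Rightarrow> 3 \<Rightarrow> real) \<Rightarrow> real" where
  "dissipation m x \<xi> \<eta> =
     (\<Sum>i\<in>UNIV. \<Sum>j\<in>UNIV. Kt_co m x i j * \<xi> i * \<xi> j) +
     (\<Sum>i\<in>UNIV. \<Sum>j\<in>UNIV. \<Sum>k\<in>UNIV. \<Sum>l\<in>UNIV. Ct_co m x i j k l * \<eta> l k * \<eta> i j)"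

definition positive_density :: "(real^3) set \<Rightarrow> material \<Rightarrow> bool" where
  "positive_density \<Omega> m \<longleftrightarrow> (\<forall>x\<in>closure \<Omega>. rho m x > 0)"

definition dissipation_nonneg :: "(real^3) set \<Rightarrow> material \<Rightarrow> bool" where
  "dissipation_nonneg \<Omega> m \<longleftrightarrow> (\<forall>x\<in>closure \<Omega>. \<forall>\<xi> \<eta>. dissipation m x \<xi> \<eta> \<ge> 0)"

definition dissipation_posdef :: "(real^3) set \<Rightarrow> material \<Rightarrow> bool" where
  "dissipation_posdef \<Omega> m \<longleftrightarrow>
     (\<forall>x\<in>closure \<Omega>. \<forall>\<xi> \<eta>. (\<exists>i. \<xi> i \<noteq> 0) \<or> (\<exists>i j. \<eta> i j \<noteq> 0) \<longrightarrow> dissipation m x \<xi> \<eta> > 0)"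

text \<open>
  Coercivity of the stored energy: \<open>Du i j\<close>, \<open>D\<tau> j\<close>, \<open>DR i j\<close> are the weak derivatives
  \<open>u\<^sub>i\<^sub>,\<^sub>j\<close>, \<open>\<tau>\<^sub>,\<^sub>j\<close>, \<open>R\<^sub>i\<^sub>,\<^sub>j\<close>.
\<close>

definition sym_part :: "(3 \<Rightarrow> 3 \<Rightarrow> real^3 \<Rightarrow> real) \<Rightarrow> 3 \<Rightarrow> 3 \<Rightarrow> real^3 \<Rightarrow> real" where
  "sym_part G i j x = (G i j x + G j i x) / 2"

definition coercive_energy :: "(real^3) set \<Rightarrow> material \<Rightarrow> bool" where
  "coercive_energy \<Omega> m \<longleftrightarrow>
     (\<exists>c0>0. \<forall>u \<tau> R Du D\<tau> DR.
        (\<forall>i. W0_12 \<Omega> (u i) \<and> weak_gradient \<Omega> (u i) (Du i)) \<and>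
        W0_12 \<Omega> \<tau> \<and> weak_gradient \<Omega> \<tau> D\<tau> \<and>
        (\<forall>i. W0_12 \<Omega> (R i) \<and> weak_gradient \<Omega> (R i) (DR i)) \<longrightarrow>
        (LINT x:\<Omega>|lborel.
           (\<Sum>i\<in>UNIV. \<Sum>j\<in>UNIV. \<Sum>k\<in>UNIV. \<Sum>l\<in>UNIV.
              A_co m x i j k l * sym_part Du k l x * sym_part Du i j x
              + 2 * B_co m x i j k l * sym_part Du i j x * DR k l x
              + C_co m x i j k l * DR i j x * DR k l x)
           + (\<Sum>i\<in>UNIV. \<Sum>j\<in>UNIV. K_co m x i j * D\<tau> i x * D\<tau> j x))
        \<ge> c0 * (LINT x:\<Omega>|lborel.
           (\<Sum>i\<in>UNIV. \<Sum>j\<in>UNIV. (sym_part Du i j x)\<^sup>2)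
           + (\<Sum>i\<in>UNIV. (D\<tau> i x)\<^sup>2)
           + (\<Sum>i\<in>UNIV. \<Sum>j\<in>UNIV. (DR i j x)\<^sup>2)))"

definition dt :: "(real^3 \<Rightarrow> real \<Rightarrow> real) \<Rightarrow> real^3 \<Rightarrow> real \<Rightarrow> real" where
  "dt f x t = deriv (\<lambda>s. f x s) t"

definition dx :: "3 \<Rightarrow> (real^3 \<Rightarrow> real \<Rightarrow> real) \<Rightarrow> real^3 \<Rightarrow> real \<Rightarrow> real" where
  "dx j f x t = pd j (\<lambda>y. f y t) x"

definition has_dt :: "(real^3) set \<Rightarrow> (real^3 \<Rightarrow> real \<Rightarrow> real) \<Rightarrow> bool" where
  "has_dt \<Omega> f \<longleftrightarrow> (\<forall>x\<in>\<Omega>. \<forall>t>0. (\<lambda>s. f x s) differentiable (at t))"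

definition has_dx :: "(real^3) set \<Rightarrow> 3 \<Rightarrow> (real^3 \<Rightarrow> real \<Rightarrow> real) \<Rightarrow> bool" where
  "has_dx \<Omega> j f \<longleftrightarrow> (\<forall>x\<in>\<Omega>. \<forall>t>0. pdiff j (\<lambda>y. f y t) x)"

text \<open>\<open>f\<close>, restricted to \<open>\<Omega>\<close> and positive times, extends continuously up to the boundary.\<close>

definition cont_ext :: "(real^3) set \<Rightarrow> (real^3 \<Rightarrow> real \<Rightarrow> real) \<Rightarrow> bool" where
  "cont_ext \<Omega> f \<longleftrightarrow>
     (\<exists>F :: (real^3) \<times> real \<Rightarrow> real. continuous_on (closure \<Omega> \<times> {0<..}) F \<and>
        (\<forall>x\<in>\<Omega>. \<forall>t>0. F (x, t) = f x t))"

definition C1_spacetime :: "(real^3) set \<Rightarrow> (real^3 \<Rightarrow> real \<Rightarrow> real) \<Rightarrow> bool" where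
  "C1_spacetime \<Omega> f \<longleftrightarrow> cont_ext \<Omega> f \<and> has_dt \<Omega> f \<and> cont_ext \<Omega> (dt f) \<and>
     (\<forall>j. has_dx \<Omega> j f \<and> cont_ext \<Omega> (dx j f))"

text \<open>
  Besides \<open>C\<^sup>2\<close> regularity up to the boundary, the values on the boundary (which enter the
  boundary conditions) must be the continuous limits of the values inside. Nothing is required
  at \<open>t = 0\<close>.
\<close>

definition C2_spacetime :: "(real^3) set \<Rightarrow> (real^3 \<Rightarrow> real \<Rightarrow> real) \<Rightarrow> bool" where
  "C2_spacetime \<Omega> f \<longleftrightarrow> continuous_on (closure \<Omega> \<times> {0<..}) (\<lambda>(x, t). f x t) \<and>
     C1_spacetime \<Omega> f \<and> C1_spacetime \<Omega> (dt f) \<and> (\<forall>j. C1_spacetime \<Omega> (dx j f))"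

text \<open>
  The rates of \<open>\<tau>\<close> and \<open>R\<close> are differentiated twice in space by the system, so for these fields
  a third, mixed derivative is needed.
\<close>

definition C2_rate :: "(real^3) set \<Rightarrow> (real^3 \<Rightarrow> real \<Rightarrow> real) \<Rightarrow> bool" where
  "C2_rate \<Omega> f \<longleftrightarrow> C2_spacetime \<Omega> f \<and>
     (\<forall>j k. has_dx \<Omega> k (dx j (dt f)) \<and> cont_ext \<Omega> (dx k (dx j (dt f))))"

definition strain :: "(3 \<Rightarrow> real^3 \<Rightarrow> real \<Rightarrow> real) \<Rightarrow> 3 \<Rightarrow> 3 \<Rightarrow> real^3 \<Rightarrow> real \<Rightarrow> real" where
  "strain u i j x t = (dx j (u i) x t + dx i (u j) x t) / 2"

definition momentum_eq :: "(real^3) set \<Rightarrow> material \<Rightarrow> (3 \<Rightarrow> real^3 \<Rightarrow> real \<Rightarrow> real) \<Rightarrow>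
    (real^3 \<Rightarrow> real \<Rightarrow> real) \<Rightarrow> (3 \<Rightarrow> real^3 \<Rightarrow> real \<Rightarrow> real) \<Rightarrow> bool" where
  "momentum_eq \<Omega> m u \<tau> R \<longleftrightarrow> (\<forall>x\<in>\<Omega>. \<forall>t>0. \<forall>i.
     rho m x * dt (dt (u i)) x t =
     (\<Sum>j\<in>UNIV. dx j (\<lambda>y s.
        (\<Sum>k\<in>UNIV. \<Sum>l\<in>UNIV. A_co m y j i k l * strain u k l y s)
        - a_co m y j i * dt \<tau> y s
        + (\<Sum>k\<in>UNIV. \<Sum>l\<in>UNIV. B_co m y j i k l * dx k (R l) y s)) x t))"

definition energy_eq :: "(real^3) set \<Rightarrow> material \<Rightarrow> (3 \<Rightarrow> real^3 \<Rightarrow> real \<Rightarrow> real) \<Rightarrow>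
    (real^3 \<Rightarrow> real \<Rightarrow> real) \<Rightarrow> (3 \<Rightarrow> real^3 \<Rightarrow> real \<Rightarrow> real) \<Rightarrow> bool" where
  "energy_eq \<Omega> m u \<tau> R \<longleftrightarrow> (\<forall>x\<in>\<Omega>. \<forall>t>0.
     c_heat m x * dt (dt \<tau>) x t =
     - (\<Sum>i\<in>UNIV. \<Sum>j\<in>UNIV. a_co m x i j * dt (strain u i j) x t)
     + (\<Sum>i\<in>UNIV. dx i (\<lambda>y s.
          \<Sum>j\<in>UNIV. - d_co m y i j * dt (R j) y s + K_co m y i j * dx j \<tau> y s
                   + Kt_co m y i j * dx j (dt \<tau>) y s) x t)
     - (\<Sum>i\<in>UNIV. \<Sum>j\<in>UNIV. b_co m x i j * dx j (dt (R i)) x t))"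

definition moment_eq :: "(real^3) set \<Rightarrow> material \<Rightarrow> (3 \<Rightarrow> real^3 \<Rightarrow> real \<Rightarrow> real) \<Rightarrow>
    (real^3 \<Rightarrow> real \<Rightarrow> real) \<Rightarrow> (3 \<Rightarrow> real^3 \<Rightarrow> real \<Rightarrow> real) \<Rightarrow> bool" where
  "moment_eq \<Omega> m u \<tau> R \<longleftrightarrow> (\<forall>x\<in>\<Omega>. \<forall>t>0. \<forall>i.
     (\<Sum>j\<in>UNIV. cM m x i j * dt (dt (R j)) x t) =
     (\<Sum>j\<in>UNIV. dx j (\<lambda>y s.
        (\<Sum>k\<in>UNIV. \<Sum>l\<in>UNIV. B_co m y k l j i * strain u k l y s)
        - b_co m y j i * dt \<tau> y s
        + (\<Sum>k\<in>UNIV. \<Sum>l\<in>UNIV. C_co m y j i k l * dx l (R k) y s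
                              + Ct_co m y j i k l * dx l (dt (R k)) y s)) x t)
     - (\<Sum>j\<in>UNIV. d_co m x i j * dx j (dt \<tau>) x t))"

definition boundary_zero :: "(real^3) set \<Rightarrow> (real^3 \<Rightarrow> real \<Rightarrow> real) \<Rightarrow> bool" where
  "boundary_zero \<Omega> f \<longleftrightarrow> (\<forall>x\<in>frontier \<Omega>. \<forall>t>0. f x t = 0)"

text \<open>The initial rate is the one-sided time derivative at \<open>0\<close>.\<close>

definition initial_data ::
    "(real^3) set \<Rightarrow> (real^3 \<Rightarrow> real \<Rightarrow> real) \<Rightarrow> (real^3 \<Rightarrow> real) \<Rightarrow> (real^3 \<Rightarrow> real) \<Rightarrow> bool" where
  "initial_data \<Omega> f f0 f1 \<longleftrightarrow>
     (\<forall>x\<in>\<Omega>. f x 0 = f0 x \<and> ((\<lambda>t. f x t) has_real_derivative f1 x) (at 0 within {0..}))"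

definition is_solution :: "(real^3) set \<Rightarrow> material \<Rightarrow> (3 \<Rightarrow> real^3 \<Rightarrow> real \<Rightarrow> real) \<Rightarrow>
    (real^3 \<Rightarrow> real \<Rightarrow> real) \<Rightarrow> (3 \<Rightarrow> real^3 \<Rightarrow> real \<Rightarrow> real) \<Rightarrow> bool" where
  "is_solution \<Omega> m u \<tau> R \<longleftrightarrow>
     (\<forall>i. C2_spacetime \<Omega> (u i)) \<and> C2_rate \<Omega> \<tau> \<and> (\<forall>i. C2_rate \<Omega> (R i)) \<and>
     momentum_eq \<Omega> m u \<tau> R \<and> energy_eq \<Omega> m u \<tau> R \<and> moment_eq \<Omega> m u \<tau> R"

end

(*
  Fix 0 < d < T with T > t0. The Laplace transforms over [d, T] of u, tau and R are entire of
  exponential type and satisfy a static system in which the values at time d act as sources.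

  Write mu for the Laplace variable and v, theta, M for the transformed rates. Testing the
  transformed momentum equation with v gives
      mu <rho v, v> + conj(mu) <A e, e> = (coupling and initial terms),
  whose left side has size at least |Re mu| times a positive definite form in (v, e). Testing the
  two thermal equations with theta and M gives
      mu (real number) + Q = (terms of vanishing real part) + (coupling and initial terms),
  where Q comes from the dissipation. On the rays |Re mu| = k |Im mu| multiplication by 1 + i k or
  1 - i k makes the first term purely imaginary, so that its unknown sign is harmless, and for small
  k > 0 it leaves the real part of Q dominant. For large |mu| the coupling terms are absorbed, so
  the transforms are bounded on these four rays.

  Phragmen-Lindelof and Liouville make the transforms constant in mu, a constant that must vanish
  because the transform of a function on [d, T] tends to 0 along the positive axis; Laplace
  injectivity makes the solution vanish on [d, T], and d > 0 is arbitrary. No sign of c or of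
  c_ij enters, and only the symmetry C~_ijkl = C~_klij of the dissipation tensor is available, which
  is why the proof does not go through Lagrange identities.
*)
theory Submission
  imports Defs "HOL-Complex_Analysis.Conformal_Mappings"
begin

section \<open>Laplace transforms bounded on rays\<close>

text \<open>Regularity is assumed at positive times only, hence d > 0. Since the solution and its
  rate vanish at T, the window has no upper end-point terms; they would carry exp (- mu (T - d)),
  exponentially large on the two left rays. How the couplings close: let X measure v and e, and Y
  the gradients of theta and M. The gradient of v is mu times that of u up to data, so the term <a
  theta, grad v> would cost a factor |mu|; moving the derivative to theta bounds it by X Y. In the B
  term the factor is paid for by grad R = (grad M + data) / mu. This gives X = O((Y + 1) / |mu|),
  and then the mechanical couplings in the thermal equations are small against the dissipation,
  which is of order Y^2. The momentum equation wants |Re mu| comparable to |mu|, the thermal ones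
  want rays near the imaginary axis; a fixed small k serves both. Integration by parts and
  membership in the Sobolev space both come from truncating small values of a field that vanishes on
  the boundary, which makes its support compact. The truncated gradients converge except where the
  field vanishes but its gradient does not, a negligible set.\<close>

lemma exp_linear_minus_powr_tendsto:
  fixes B c \<gamma> :: real
  assumes "c > 0" "\<gamma> > 1"
  shows "((\<lambda>R. exp (B * R - c * R powr \<gamma>)) \<longlongrightarrow> 0) at_top"
proof (rule tendsto_sandwich[OF _ _ tendsto_const])
  \<comment> \<open>Beyond this radius \<open>c * R powr (\<gamma> - 1)\<close> is at least
    \<open>\<bar>B\<bar> + 1\<close>, so the exponent is at most \<open>- R\<close>.\<close>
  define R1 where "R1 = ((\<bar>B\<bar> + 1) / c) powr (1 / (\<gamma> - 1))"
  have "exp (B * R - c * R powr \<gamma>) \<le> exp (- R)" if R: "R \<ge> max 1 R1" for R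
  proof -
    have "(\<bar>B\<bar> + 1) / c = R1 powr (\<gamma> - 1)" using assms by (simp add: R1_def powr_powr)
    also have "\<dots> \<le> R powr (\<gamma> - 1)" using assms R by (intro powr_mono2) (auto simp: R1_def)
    finally have "\<bar>B\<bar> + 1 \<le> c * R powr (\<gamma> - 1)" using assms by (simp add: field_simps)
    then have "R * (\<bar>B\<bar> + 1) \<le> R * (c * R powr (\<gamma> - 1))" using R by (intro mult_left_mono) auto
    also have "\<dots> = c * R powr \<gamma>" using R by (simp add: powr_diff)
    finally have "R * (\<bar>B\<bar> + 1) \<le> c * R powr \<gamma>" .
    moreover have "B * R \<le> R * \<bar>B\<bar>" using R by (simp add: mult.commute mult_left_mono)
    ultimately show ?thesis by (simp add: algebra_simps)
  qed
  then show "\<forall>\<^sub>F R in at_top. exp (B * R - c * R powr \<gamma>) \<le> exp (- R)"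
    unfolding eventually_at_top_linorder by blast
  show "((\<lambda>R::real. exp (- R)) \<longlongrightarrow> 0) at_top"
    by (rule filterlim_compose[OF exp_at_bot filterlim_uminus_at_bot_at_top])
qed simp

text \<open>Maximum principle for \<open>f z * exp (- \<epsilon> * (z + 1) powr \<gamma>)\<close>, where \<open>\<gamma> > 1\<close> is so small
  that \<open>(z + 1) powr \<gamma>\<close> keeps a positive real part in the sector.\<close>

lemma phragmen_lindelof_sector:
  fixes f :: "complex \<Rightarrow> complex" and A B C K :: real
  assumes hol: "f holomorphic_on UNIV"
    and growth: "\<And>z. norm (f z) \<le> A * exp (B * norm z)"
    and K: "K > 0" and C: "C > 0"
    and bdry: "\<And>z. Re z \<ge> 0 \<Longrightarrow> \<bar>Im z\<bar> = K * Re z \<Longrightarrow> norm (f z) \<le> C"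
    and z: "Re z \<ge> 0" "\<bar>Im z\<bar> \<le> K * Re z"
  shows "norm (f z) \<le> C"
proof -
  define \<alpha> where "\<alpha> = arctan K"
  have \<alpha>: "0 < \<alpha>" "\<alpha> < pi/2" using K arctan_ubound[of K] by (simp_all add: \<alpha>_def)
  \<comment> \<open>The mean of 1 and \<open>pi / (2 * \<alpha>)\<close>: larger than 1, while
    \<open>\<gamma> * \<alpha>\<close> stays below a right angle. Here \<alpha> is half the opening
    of the sector.\<close>
  define \<gamma> where "\<gamma> = (1 + pi/(2*\<alpha>))/2"
  have \<gamma>: "\<gamma> > 1" using \<alpha> by (simp add: \<gamma>_def field_simps)
  have \<gamma>\<alpha>: "\<gamma> * \<alpha> < pi/2" using \<alpha> by (simp add: \<gamma>_def field_simps)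
  define c where "c = cos (\<gamma> * \<alpha>)"
  have c: "c > 0" unfolding c_def using \<gamma> \<gamma>\<alpha> \<alpha> by (intro cos_gt_zero_pi) (auto intro: less_le_trans[of _ 0])
  define S where "S = {z. Re z \<ge> 0 \<and> \<bar>Im z\<bar> \<le> K * Re z}"
  have A: "A \<ge> 0" using order_trans[OF norm_ge_zero growth[of 0]] by simp
  \<comment> \<open>The shift by 1 keeps the sector away from the branch cut of the power and leaves
    the argument within \<alpha>.\<close>
  have Rebound: "Re ((w + 1) powr of_real \<gamma>) \<ge> c * norm (w+1) powr \<gamma>" if "w \<in> S" for w
  proof -
    have w: "Re (w+1) > 0" "\<bar>Im (w+1)\<bar> \<le> K * Re (w+1)" using that K by (auto simp: S_def algebra_simps)
    have "w + 1 \<noteq> 0" using w(1) by (metis less_irrefl zero_complex.simps(1))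
    have eq: "Re ((w + 1) powr of_real \<gamma>) = norm (w+1) powr \<gamma> * cos (\<gamma> * Arg (w+1))"
      using \<open>w+1 \<noteq> 0\<close> by (simp add: powr_def Re_exp Arg_eq_Im_Ln)
    have "\<bar>Im (w+1) / Re (w+1)\<bar> \<le> K" using w by (simp add: field_simps)
    then have "\<bar>Arg (w+1)\<bar> \<le> \<alpha>"
      unfolding \<alpha>_def arg_conv_arctan[OF w(1)]
      by (metis abs_le_iff arctan_le_iff arctan_minus)
    then have ab: "\<bar>\<gamma> * Arg (w+1)\<bar> \<le> \<gamma> * \<alpha>" using \<gamma> by (simp add: abs_mult)
    have "cos (\<gamma> * \<alpha>) \<le> cos \<bar>\<gamma> * Arg (w+1)\<bar>"
      by (rule cos_monotone_0_pi_le[OF _ ab]) (use \<gamma>\<alpha> pi_gt_zero in linarith)+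
    then show ?thesis unfolding eq c_def
      by (subst mult.commute) (intro mult_left_mono, auto)
  qed
  have main: "norm (f z) * exp (- \<epsilon> * Re ((z + 1) powr of_real \<gamma>)) \<le> C" if \<epsilon>: "\<epsilon> > 0" for \<epsilon>
  proof -
    define g where "g = (\<lambda>w. f w * exp (- of_real \<epsilon> * (w + 1) powr of_real \<gamma>))"
    have ng: "norm (g w) = norm (f w) * exp (- \<epsilon> * Re ((w + 1) powr of_real \<gamma>))" for w
      by (simp add: g_def norm_mult norm_exp_eq_Re)
    have ng_le: "norm (g w) \<le> norm (f w) * exp (- \<epsilon> * c * norm (w+1) powr \<gamma>)" if "w \<in> S" for w
      unfolding ng using Rebound[OF that] \<epsilon> by (intro mult_left_mono) (auto simp: mult.assoc mult_left_mono)
    have "((\<lambda>R. A * exp (B * R - \<epsilon> * c * R powr \<gamma>)) \<longlongrightarrow> A * 0) at_top"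
      by (intro tendsto_intros exp_linear_minus_powr_tendsto) (use \<epsilon> c \<gamma> in auto)
    then have "\<forall>\<^sub>F R in at_top. A * exp (B * R - \<epsilon> * c * R powr \<gamma>) < C"
      using C by (simp add: order_tendstoD(2))
    then obtain R0 where R0: "\<And>R. R \<ge> R0 \<Longrightarrow> A * exp (B * R - \<epsilon> * c * R powr \<gamma>) < C"
      by (auto simp: eventually_at_top_linorder)
    \<comment> \<open>Large enough that the damped growth bound is below \<open>C\<close> on the
      outer arc and that \<open>z\<close> lies in the truncated sector.\<close>
    define R where "R = max (max R0 1) (norm z)"
    define D where "D = S \<inter> cball 0 R"
    have closedS: "closed S" unfolding S_def
      by (intro closed_Collect_conj closed_Collect_le continuous_intros)
    have closedD: "closed D" unfolding D_def using closedS by auto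
    have holg: "g holomorphic_on D"
    proof -
      have "w + 1 \<notin> \<real>\<^sub>\<le>\<^sub>0" if "w \<in> D" for w
        using that by (auto simp: D_def S_def complex_nonpos_Reals_iff)
      moreover have "f holomorphic_on D" using hol holomorphic_on_subset by blast
      ultimately show ?thesis unfolding g_def
        by (auto intro!: holomorphic_intros)
    qed
    have "norm (g z) \<le> C"
    proof (rule maximum_modulus_frontier[where S=D and f=g and \<xi>=z])
      show "g holomorphic_on interior D" using holg holomorphic_on_subset interior_subset by blast
      show "continuous_on (closure D) g" using holg closedD by (simp add: holomorphic_on_imp_continuous_on)
      show "bounded D" by (auto simp: D_def)
      show "z \<in> D" using z by (auto simp: D_def S_def R_def)
      fix w assume "w \<in> frontier D"
      then have wD: "w \<in> D" and wi: "w \<notin> interior D" using closedD by (auto simp: frontier_def)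
      then have wS: "w \<in> S" and wR: "norm w \<le> R" by (auto simp: D_def)
      show "norm (g w) \<le> C"
      proof (cases "\<bar>Im w\<bar> = K * Re w")
        case True
        then have f: "norm (f w) \<le> C" using bdry wS by (auto simp: S_def)
        have "exp (- \<epsilon> * c * norm (w+1) powr \<gamma>) \<le> 1" using \<epsilon> c by simp
        then have "norm (f w) * exp (- \<epsilon> * c * norm (w+1) powr \<gamma>) \<le> C * 1"
          using f C by (intro mult_mono) auto
        then show ?thesis using ng_le[OF wS] by simp
      next
        case False
        \<comment> \<open>\<open>U\<close> is open and contained in \<open>D\<close>, so a frontier
          point of \<open>D\<close> off the two rays must lie on the arc of radius
          \<open>R\<close>.\<close>
        define U where "U = {w. \<bar>Im w\<bar> < K * Re w} \<inter> ball 0 R"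
        have "open U" unfolding U_def by (intro open_Int open_Collect_less continuous_intros) auto
        moreover have "U \<subseteq> D"
        proof
          fix x assume "x \<in> U"
          then have *: "\<bar>Im x\<bar> < K * Re x" "norm x < R" by (auto simp: U_def)
          then have "K * Re x > 0" by linarith
          then show "x \<in> D" using * K by (auto simp: D_def S_def zero_less_mult_iff)
        qed
        ultimately have "w \<notin> U" using wi interior_maximal by blast
        then have wR': "norm w = R" using False wS wR by (auto simp: U_def S_def)
        have le: "R powr \<gamma> \<le> norm (w+1) powr \<gamma>"
        proof (rule powr_mono2)
          have "norm w \<le> norm (w+1)" using wS by (auto simp: S_def cmod_def power2_eq_square algebra_simps)
          then show "R \<le> norm (w+1)" using wR' by simp
        qed (use \<gamma> in \<open>auto simp: R_def\<close>)
        have "norm (g w) \<le> A * exp (B * R) * exp (- \<epsilon> * c * R powr \<gamma>)"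
        proof -
          have "norm (g w) \<le> norm (f w) * exp (- \<epsilon> * c * norm (w+1) powr \<gamma>)" by (rule ng_le[OF wS])
          also have "\<dots> \<le> (A * exp (B * norm w)) * exp (- \<epsilon> * c * R powr \<gamma>)"
            using le \<epsilon> c A by (intro mult_mono growth) auto
          finally show ?thesis using wR' by simp
        qed
        also have "\<dots> = A * exp (B * R - \<epsilon> * c * R powr \<gamma>)" by (simp add: exp_diff exp_minus field_simps)
        also have "\<dots> \<le> C" using R0[of R] unfolding R_def by (meson less_imp_le max.cobounded1 order_trans)
        finally show ?thesis .
      qed
    qed
    then show ?thesis by (simp add: ng)
  qed
  \<comment> \<open>With \<open>z\<close> fixed the damping factor tends to 1 as \<epsilon> tends to
    0.\<close>
  have lim: "((\<lambda>\<epsilon>. norm (f z) * exp (- \<epsilon> * Re ((z + 1) powr of_real \<gamma>))) \<longlongrightarrow> norm (f z) * exp (- 0 * Re ((z + 1) powr of_real \<gamma>))) (at_right 0)"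
    by (intro tendsto_intros)
  have "norm (f z) * exp (- 0 * Re ((z + 1) powr of_real \<gamma>)) \<le> C"
    by (rule tendsto_upperbound[OF lim eventually_mono[OF eventually_at_right_less[of 0]]]) (erule main, simp)
  then show ?thesis by simp
qed

text \<open>The four rays cut the plane into sectors of angle less than \<open>pi\<close>, where functions of
  exponential type obey the maximum principle.\<close>

lemma exponential_type_bounded_on_rays_const:
  fixes f :: "complex \<Rightarrow> complex"
  assumes hol: "f holomorphic_on UNIV"
    and growth: "\<And>z. norm (f z) \<le> A * exp (B * norm z)"
    and k: "k > 0"
    and rays: "\<And>z. \<bar>Re z\<bar> = k * \<bar>Im z\<bar> \<Longrightarrow> norm (f z) \<le> C"
  shows "f z = f w"
proof -
  define C' where "C' = \<bar>C\<bar> + 1"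
  have C': "C' > 0" "\<And>z. \<bar>Re z\<bar> = k * \<bar>Im z\<bar> \<Longrightarrow> norm (f z) \<le> C'"
    using rays abs_ge_self[of C] by (simp add: C'_def, smt (verit) C'_def rays)
  \<comment> \<open>\<open>u\<close> turns a sector about the positive real axis into one of the
    four sectors cut out by the rays. \<open>K\<close> is the tangent of its half opening:
    \<open>1 / k\<close> about the real axis, \<open>k\<close> about the imaginary axis.\<close>
  have rot: "norm (f (u * z)) \<le> C'"
    if u: "norm u = 1" and K: "K > 0" and z: "Re z \<ge> 0" "\<bar>Im z\<bar> \<le> K * Re z"
      and bd: "\<And>z. Re z \<ge> 0 \<Longrightarrow> \<bar>Im z\<bar> = K * Re z \<Longrightarrow> \<bar>Re (u * z)\<bar> = k * \<bar>Im (u * z)\<bar>" for u z K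
  proof (rule phragmen_lindelof_sector[where f="\<lambda>z. f (u * z)" and A=A and B=B, OF _ _ K C'(1)])
    have "(f \<circ> (\<lambda>z. u * z)) holomorphic_on UNIV"
      by (rule holomorphic_on_compose) (auto intro!: holomorphic_intros holomorphic_on_subset[OF hol])
    then show "(\<lambda>z. f (u * z)) holomorphic_on UNIV" by (simp add: o_def)
    show "norm (f (u * z)) \<le> A * exp (B * norm z)" for z using growth[of "u*z"] u by (simp add: norm_mult)
  qed (use z bd C' in auto)
  have bound: "norm (f z) \<le> C'" for z
  proof (cases "k * \<bar>Im z\<bar> \<le> \<bar>Re z\<bar>")
    case True
    then have z: "\<bar>Im z\<bar> \<le> 1/k * \<bar>Re z\<bar>" using k by (simp add: field_simps)
    have bd: "\<bar>Re w\<bar> = k * \<bar>Im w\<bar>" if "Re w \<ge> 0" "\<bar>Im w\<bar> = 1/k * Re w" for w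
      using that k by simp
    show ?thesis
    proof (cases "Re z \<ge> 0")
      case True
      have "norm (f (1 * z)) \<le> C'" by (rule rot[of _ "1/k"]) (use z bd True k in simp_all)
      then show ?thesis by simp
    next
      case False
      have "norm (f (-1 * (- z))) \<le> C'" by (rule rot[of _ "1/k"]) (use z bd False k in simp_all)
      then show ?thesis by simp
    qed
  next
    case False
    then have z: "\<bar>Re z\<bar> \<le> k * \<bar>Im z\<bar>" by simp
    show ?thesis
    proof (cases "Im z \<ge> 0")
      case True
      have "norm (f (\<i> * (- \<i> * z))) \<le> C'" by (rule rot[of _ k]) (use z True k in simp_all)
      then show ?thesis by simp
    next
      case False
      have "norm (f (- \<i> * (\<i> * z))) \<le> C'" by (rule rot[of _ k]) (use z False k in simp_all)
      then show ?thesis by simp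
    qed
  qed
  have "bounded (range f)" using bound by (auto intro!: boundedI[of _ C'])
  then have "f constant_on UNIV" using Liouville_theorem[OF hol] by blast
  then show ?thesis by (auto simp: constant_on_def)
qed

text \<open>In the variable \<open>s = exp (- (t - a))\<close> the hypothesis says that
  \<open>h\<close> is orthogonal to all powers of \<open>s\<close>. By Weierstrass approximation
  \<open>h\<close> is then orthogonal to itself.\<close>

lemma laplace_integral_eq_0:
  fixes h :: "real \<Rightarrow> real"
  assumes ab: "a < b" and cont: "continuous_on {a..b} h"
    and zero: "\<And>n::nat. integral {a..b} (\<lambda>t. exp (- real n * (t - a)) * h t) = 0"
    and t: "t \<in> {a..b}"
  shows "h t = 0"
proof -
  define S where "S = (\<lambda>t. exp (- (t - a))) ` {a..b}"
  have "compact S" unfolding S_def by (intro compact_continuous_image continuous_intros) auto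
  \<comment> \<open>This is \<open>h\<close> in the variable \<open>s\<close>, since
    \<open>t = a - ln s\<close>.\<close>
  have contS: "continuous_on S (\<lambda>s. h (a - ln s))"
    by (rule continuous_on_compose2[OF cont]) (auto simp: S_def intro!: continuous_intros)
  define J where "J = integral {a..b} (\<lambda>t. h t * h t)"
  have int1: "(\<lambda>t. h t * h t) integrable_on {a..b}"
    by (intro integrable_continuous_interval continuous_intros cont)
  obtain M where M: "\<And>t. t \<in> {a..b} \<Longrightarrow> \<bar>h t\<bar> \<le> M" "M > 0"
    using compact_imp_bounded[OF compact_continuous_image[OF cont compact_Icc]] that
    unfolding bounded_pos by fastforce
  have small: "J \<le> e * (M * (b - a))" if e: "e > 0" for e
  proof -
    obtain g where g: "real_polynomial_function g" "\<And>s. s \<in> S \<Longrightarrow> \<bar>h (a - ln s) - g s\<bar> < e"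
      using Stone_Weierstrass_real_polynomial_function[OF \<open>compact S\<close> contS e] by blast
    then obtain c n where gs: "g = (\<lambda>x. \<Sum>i\<le>n::nat. c i * x ^ i)"
      unfolding real_polynomial_function_iff_sum by blast
    have gt: "g (exp (- (t - a))) * h t = (\<Sum>i\<le>n. c i * (exp (- real i * (t - a)) * h t))" for t
      unfolding gs sum_distrib_right
      by (intro sum.cong refl) (simp add: exp_of_nat_mult[symmetric] algebra_simps)
    have "integral {a..b} (\<lambda>t. g (exp (- (t - a))) * h t)
        = (\<Sum>i\<le>n. integral {a..b} (\<lambda>t. c i * (exp (- real i * (t - a)) * h t)))"
      unfolding gt
      by (intro integral_sum integrable_continuous_interval continuous_intros cont) auto
    also have "\<dots> = (\<Sum>i\<le>n. c i * integral {a..b} (\<lambda>t. exp (- real i * (t - a)) * h t))"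
      by (simp only: integral_mult_right)
    also have "\<dots> = 0" by (simp only: zero) simp
    finally have gz: "integral {a..b} (\<lambda>t. g (exp (- (t - a))) * h t) = 0" .
    have ig: "(\<lambda>t. g (exp (- (t - a))) * h t) integrable_on {a..b}"
      unfolding gt by (intro integrable_continuous_interval continuous_intros cont)
    have "J = integral {a..b} (\<lambda>t. h t * h t - g (exp (- (t - a))) * h t)"
      unfolding J_def using integral_diff[OF int1 ig] gz by simp
    also have "\<dots> \<le> integral {a..b} (\<lambda>t. e * M)"
    proof (rule integral_le)
      fix t assume t: "t \<in> {a..b}"
      then have "\<bar>h t - g (exp (- (t - a)))\<bar> < e" using g(2)[of "exp (- (t - a))"] by (auto simp: S_def)
      then have "\<bar>h t - g (exp (- (t - a)))\<bar> * \<bar>h t\<bar> \<le> e * M" using M(1)[OF t] M(2) e by (intro mult_mono) auto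
      then show "h t * h t - g (exp (- (t - a))) * h t \<le> e * M"
        using abs_ge_self[of "(h t - g (exp (- (t - a)))) * h t"] by (simp add: abs_mult[symmetric] left_diff_distrib)
    qed (rule integrable_diff[OF int1 ig], rule integrable_const_ivl)
    also have "\<dots> = e * (M * (b - a))" using ab by simp
    finally show ?thesis .
  qed
  have J0: "J \<le> 0"
  proof (rule ccontr)
    assume "\<not> J \<le> 0"
    \<comment> \<open>With this \<open>e\<close> the inequality \<open>small\<close> would give
      \<open>J \<le> J / 2\<close>, impossible for positive \<open>J\<close>.\<close>
    define e where "e = J / (2 * (M * (b - a) + 1))"
    have p: "M * (b - a) \<ge> 0" using M(2) ab by simp
    then have "e > 0" using \<open>\<not> J \<le> 0\<close> by (simp add: e_def)
    have "e * (M * (b - a)) \<le> e * (M * (b - a) + 1)" using \<open>e > 0\<close> by simp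
    also have "\<dots> = J / 2"
    proof -
      have *: "J / (2 * X) * X = J / 2" if "X \<noteq> 0" for X using that by simp
      show ?thesis unfolding e_def by (rule *) (use p in linarith)
    qed
    finally show False using small[OF \<open>e > 0\<close>] \<open>\<not> J \<le> 0\<close> by simp
  qed
  have "J \<ge> 0" unfolding J_def by (rule integral_nonneg[OF int1]) auto
  then have "J = 0" using J0 by simp
  then have "h t * h t = 0"
    using integral_eq_0_iff[OF continuous_on_mult[OF cont cont] ab] t by (simp add: J_def)
  then show ?thesis by simp
qed

lemma laplace_bounded_on_rays_imp_zero:
  fixes h :: "real \<Rightarrow> real"
  assumes ab: "a < b" and cont: "continuous_on {a..b} h" and k: "k > 0"
    and rays: "\<And>\<mu>::complex. \<bar>Re \<mu>\<bar> = k * \<bar>Im \<mu>\<bar> \<Longrightarrow> norm \<mu> \<ge> L \<Longrightarrow>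
       norm (integral {a..b} (\<lambda>t. exp (- \<mu> * of_real (t - a)) * of_real (h t))) \<le> C"
    and t: "t \<in> {a..b}"
  shows "h t = 0"
proof -
  define F where "F = (\<lambda>\<mu>::complex. integral {a..b} (\<lambda>t. exp (- \<mu> * of_real (t - a)) * of_real (h t)))"
  have int: "(\<lambda>t. exp (- \<mu> * of_real (t - a)) * of_real (h t)) integrable_on {a..b}" for \<mu> :: complex
    by (intro integrable_continuous_interval continuous_intros cont)
  obtain M where M: "\<And>t. t \<in> {a..b} \<Longrightarrow> \<bar>h t\<bar> \<le> M" "M > 0"
    using compact_imp_bounded[OF compact_continuous_image[OF cont compact_Icc]] that
    unfolding bounded_pos by fastforce
  have nF: "norm (F \<mu>) \<le> integral {a..b} (\<lambda>t. M * exp (- Re \<mu> * (t - a)))" for \<mu>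
    unfolding F_def
  proof (rule integral_norm_bound_integral[OF int])
    show "(\<lambda>t. M * exp (- Re \<mu> * (t - a))) integrable_on {a..b}"
      by (intro integrable_continuous_interval continuous_intros)
    fix t assume "t \<in> {a..b}"
    then show "norm (exp (- \<mu> * of_real (t - a)) * of_real (h t)) \<le> M * exp (- Re \<mu> * (t - a))"
      using M(1)[of t] by (simp add: norm_mult mult.commute[of M] mult_left_mono)
  qed
  have growth: "norm (F \<mu>) \<le> (M * (b - a)) * exp ((b - a) * norm \<mu>)" for \<mu>
  proof -
    have "integral {a..b} (\<lambda>t. M * exp (- Re \<mu> * (t - a))) \<le> integral {a..b} (\<lambda>t. M * exp ((b - a) * norm \<mu>))"
    proof (rule integral_le)
      fix t assume t: "t \<in> {a..b}"
      have "- Re \<mu> * (t - a) \<le> norm \<mu> * (t - a)"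
        using t abs_Re_le_cmod[of \<mu>] by (intro mult_right_mono) auto
      also have "\<dots> \<le> norm \<mu> * (b - a)" using t by (intro mult_left_mono) auto
      finally show "M * exp (- Re \<mu> * (t - a)) \<le> M * exp ((b - a) * norm \<mu>)"
        using M(2) by (simp add: mult.commute)
    qed (rule integrable_continuous_interval, intro continuous_intros, rule integrable_const_ivl)
    also have "\<dots> = (M * (b - a)) * exp ((b - a) * norm \<mu>)" using ab by simp
    finally show ?thesis using nF[of \<mu>] by linarith
  qed
  have hol: "F holomorphic_on UNIV"
    unfolding F_def
  proof (rule leibniz_rule_holomorphic[where a=a and b=b, unfolded cbox_interval])
    show "((\<lambda>\<mu>. exp (- \<mu> * of_real (t - a)) * of_real (h t)) has_field_derivative
        - of_real (t - a) * exp (- \<mu> * of_real (t - a)) * of_real (h t)) (at \<mu> within UNIV)" for \<mu> t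
      by (auto intro!: derivative_eq_intros)
    show "continuous_on (UNIV \<times> {a..b}) (\<lambda>(\<mu>, t). - of_real (t - a) * exp (- \<mu> * of_real (t - a)) * of_real (h t) :: complex)"
      unfolding split_beta
      by (intro continuous_intros continuous_on_compose2[OF cont continuous_on_snd[OF continuous_on_id]]) auto
  qed (use int in auto)
  \<comment> \<open>The second entry is the exponential-type bound, which serves on the part of the
    rays with \<open>norm z < L\<close>.\<close>
  define C' where "C' = max C ((M * (b - a)) * exp ((b - a) * L))"
  have rays': "norm (F z) \<le> C'" if "\<bar>Re z\<bar> = k * \<bar>Im z\<bar>" for z
  proof (cases "norm z \<ge> L")
    case True
    then show ?thesis using rays[OF that] by (auto simp: F_def C'_def)
  next
    case False
    then have "(M * (b - a)) * exp ((b - a) * norm z) \<le> (M * (b - a)) * exp ((b - a) * L)"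
      using M(2) ab by simp
    then show ?thesis using growth[of z] by (auto simp: C'_def)
  qed
  have const: "F z = F w" for z w
    by (rule exponential_type_bounded_on_rays_const[OF hol growth k rays'])
  have "F 0 = 0"
  proof -
    \<comment> \<open>Constancy transfers the decay along the positive axis to the value at
      0.\<close>
    have "norm (F 0) \<le> M / r" if "r > 0" for r
    proof -
      have "norm (F 0) = norm (F (of_real r))" using const by metis
      also have "\<dots> \<le> integral {a..b} (\<lambda>t. M * exp (- r * (t - a)))" using nF[of "of_real r"] by simp
      also have "\<dots> = M / r - M / r * exp (- r * (b - a))"
      proof (rule integral_unique)
        have "((\<lambda>t. M * exp (- r * (t - a))) has_integral
           (- (M / r) * exp (- r * (b - a))) - (- (M / r) * exp (- r * (a - a)))) {a..b}"
          using that ab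
          by (intro fundamental_theorem_of_calculus)
            (auto intro!: derivative_eq_intros simp: has_real_derivative_iff_has_vector_derivative[symmetric])
        then show "((\<lambda>t. M * exp (- r * (t - a))) has_integral M / r - M / r * exp (- r * (b - a))) {a..b}"
          by simp
      qed
      also have "\<dots> \<le> M / r" using that M(2) by simp
      finally show ?thesis .
    qed
    then have "norm (F 0) * r \<le> M" if "r > 0" for r using that by (simp add: field_simps)
    \<comment> \<open>For this \<open>r\<close> the inequality would read
      \<open>M + 1 \<le> M\<close>.\<close>
    from this[of "(M + 1) / norm (F 0)"] show ?thesis using M(2) by (cases "F 0 = 0") auto
  qed
  then have F0: "F z = 0" for z using const by metis
  show ?thesis
  proof (rule laplace_integral_eq_0[OF ab cont _ t])
    fix n :: nat
    have "(\<lambda>t. exp (- real n * (t - a)) * h t) integrable_on {a..b}"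
      by (intro integrable_continuous_interval continuous_intros cont)
    then have "((\<lambda>t. of_real (exp (- real n * (t - a)) * h t) :: complex) has_integral
        of_real (integral {a..b} (\<lambda>t. exp (- real n * (t - a)) * h t))) {a..b}"
      using has_integral_linear[OF integrable_integral bounded_linear_of_real] by (simp only: o_def)
    moreover have "exp (- of_nat n * of_real (t - a)) * of_real (h t)
        = (of_real (exp (- real n * (t - a)) * h t) :: complex)" for t
    proof -
      have "- of_nat n * of_real (t - a) = (of_real (- real n * (t - a)) :: complex)" by simp
      then have "exp (- of_nat n * of_real (t - a)) = (of_real (exp (- real n * (t - a))) :: complex)"
        by (simp only: exp_of_real)
      then show ?thesis unfolding of_real_mult by (rule arg_cong)
    qed
    ultimately have "((\<lambda>t. exp (- of_nat n * of_real (t - a)) * of_real (h t) :: complex) has_integral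
        of_real (integral {a..b} (\<lambda>t. exp (- real n * (t - a)) * h t))) {a..b}"
      by (simp only:)
    then have "F (of_nat n) = of_real (integral {a..b} (\<lambda>t. exp (- real n * (t - a)) * h t))"
      unfolding F_def by (rule integral_unique)
    then show "integral {a..b} (\<lambda>t. exp (- real n * (t - a)) * h t) = 0"
      using F0[of "of_nat n"] by (metis of_real_eq_0_iff)
  qed
qed

section \<open>Directional derivatives\<close>

text \<open>A vector-valued form of \<^const>\<open>pdiff\<close> and \<^const>\<open>pd\<close> that names the derivative.\<close>

definition hpd :: "3 \<Rightarrow> (real^3 \<Rightarrow> 'a::real_normed_vector) \<Rightarrow> 'a \<Rightarrow> real^3 \<Rightarrow> bool" where
  "hpd j f d x \<longleftrightarrow> ((\<lambda>h. f (x + h *\<^sub>R axis j 1)) has_vector_derivative d) (at 0)"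

lemma hpd_shift:
  assumes "hpd j f d (x + s *\<^sub>R axis j 1)"
  shows "((\<lambda>h. f (x + h *\<^sub>R axis j 1)) has_vector_derivative d) (at s)"
proof -
  have "((\<lambda>h. f ((x + s *\<^sub>R axis j 1) + h *\<^sub>R axis j 1)) \<circ> (\<lambda>h. h - s) has_vector_derivative 1 *\<^sub>R d) (at s)"
    by (rule vector_diff_chain_at)
      (use assms in \<open>auto simp: hpd_def intro!: derivative_eq_intros\<close>)
  then show ?thesis by (simp add: o_def algebra_simps)
qed

text \<open>Near a point of the set the translates of the zero set along the axis are pairwise disjoint, so
  infinitely many copies of it fit into a ball.\<close>

lemma negligible_regular_zero_set:
  fixes g g' :: "real^3 \<Rightarrow> real"
  assumes \<Omega>: "open \<Omega>" and g: "continuous_on \<Omega> g" and g': "continuous_on \<Omega> g'"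
    and d: "\<And>x. x \<in> \<Omega> \<Longrightarrow> hpd j g (g' x) x"
  shows "negligible {x\<in>\<Omega>. g x = 0 \<and> g' x \<noteq> 0}"
proof (subst locally_negligible_alt, rule ballI)
  let ?S = "{x\<in>\<Omega>. g x = 0 \<and> g' x \<noteq> 0}"
  let ?e = "axis j 1 :: real^3"
  fix p assume p: "p \<in> ?S"
  have "open (\<Omega> \<inter> g' -` (- {0}))" using continuous_open_preimage[OF g' \<Omega>] by auto
  then obtain R where R: "R > 0" "ball p R \<subseteq> \<Omega> \<inter> g' -` (- {0})"
    using p by (metis (mono_tags, lifting) ComplI IntI mem_Collect_eq open_contains_ball singletonD vimageI)
  define r where "r = R / 2"
  have r: "r > 0" "r < R" using R by (auto simp: r_def)
  have sub: "cball p r \<subseteq> ball p R" using r by auto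
  define Z where "Z = {x \<in> cball p r. g x = 0}"
  have "continuous_on (cball p r) g" using g sub R by (meson continuous_on_subset le_inf_iff order_trans)
  then have "closed Z" unfolding Z_def
    using continuous_closed_preimage_constant[of "cball p r" g 0] by simp
  then have "compact Z" unfolding compact_eq_bounded_closed by (auto simp: Z_def intro: bounded_subset[OF bounded_cball])
  then have Zm: "Z \<in> lmeasurable" by (rule lmeasurable_compact)
  \<comment> \<open>The shifts \<open>1 / real (Suc n)\<close> are distinct and at most 1, so the
    copies turn out disjoint and all lie in the ball of radius \<open>r + 1\<close>.\<close>
  define T where "T = (\<lambda>n::nat. (+) ((1 / real (Suc n)) *\<^sub>R ?e) ` Z)"
  \<comment> \<open>Two distinct points of \<open>Z\<close> on one line parallel to the axis would,
    by the mean value theorem, enclose a zero of \<open>g'\<close> inside the ball.\<close>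
  have inj: "y = x" if x: "x \<in> Z" and y: "y = x + s *\<^sub>R ?e" "y \<in> Z" for x y s
  proof (rule ccontr)
    assume "y \<noteq> x"
    then have s: "s \<noteq> 0" using y by auto
    have seg: "x + t *\<^sub>R ?e \<in> ball p R" if "t \<in> closed_segment 0 s" for t
    proof -
      have "x + t *\<^sub>R ?e \<in> closed_segment x y"
      proof -
        obtain v where "0 \<le> v" "v \<le> 1" "t = v * s" using \<open>t \<in> closed_segment 0 s\<close> by (auto simp: in_segment)
        then show ?thesis unfolding y in_segment by (intro exI[of _ v]) (auto simp: algebra_simps)
      qed
      moreover have "closed_segment x y \<subseteq> ball p R"
        using x y sub by (intro closed_segment_subset) (auto simp: Z_def)
      ultimately show ?thesis by auto
    qed
    define \<phi> where "\<phi> = (\<lambda>t. g (x + t *\<^sub>R ?e))"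
    have der: "(\<phi> has_real_derivative g' (x + t *\<^sub>R ?e)) (at t)" if "t \<in> closed_segment 0 s" for t
      unfolding \<phi>_def has_real_derivative_iff_has_vector_derivative
      by (rule hpd_shift, rule d) (use seg[OF that] R in auto)
    have "\<exists>t \<in> closed_segment 0 s. \<phi> s - \<phi> 0 = g' (x + t *\<^sub>R ?e) * (s - 0)"
    proof (cases "s > 0")
      case True
      then obtain z where "0 < z" "z < s" "\<phi> s - \<phi> 0 = (s - 0) * g' (x + z *\<^sub>R ?e)"
        using MVT2[of 0 s \<phi> "\<lambda>t. g' (x + t *\<^sub>R ?e)"] der by (auto simp: closed_segment_eq_real_ivl)
      then show ?thesis using True by (intro bexI[of _ z]) (auto simp: closed_segment_eq_real_ivl)
    next
      case False
      then have "s < 0" using s by simp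
      then obtain z where "s < z" "z < 0" "\<phi> 0 - \<phi> s = (0 - s) * g' (x + z *\<^sub>R ?e)"
        using MVT2[of s 0 \<phi> "\<lambda>t. g' (x + t *\<^sub>R ?e)"] der by (auto simp: closed_segment_eq_real_ivl)
      then show ?thesis using \<open>s < 0\<close> by (intro bexI[of _ z]) (auto simp: closed_segment_eq_real_ivl algebra_simps)
    qed
    moreover have "\<phi> s = 0" "\<phi> 0 = 0" using x y by (auto simp: \<phi>_def Z_def)
    moreover have "g' y \<noteq> 0" if "y \<in> ball p R" for y using that R by auto
    ultimately show False using s seg by fastforce
  qed
  have disj: "disjoint_family_on T UNIV"
  proof (unfold disjoint_family_on_def, intro ballI impI)
    fix a b :: nat assume "a \<noteq> b"
    have "False" if zT: "z \<in> T a" "z \<in> T b" for z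
    proof -
      obtain x y where xy: "x \<in> Z" "y \<in> Z" "z = (1 / real (Suc a)) *\<^sub>R ?e + x" "z = (1 / real (Suc b)) *\<^sub>R ?e + y"
        using zT unfolding T_def by (elim imageE) (rule that)
      then have y: "y = x + (1 / real (Suc a) - 1 / real (Suc b)) *\<^sub>R ?e" by (simp add: algebra_simps)
      have "y = x" by (rule inj[OF xy(1) y xy(2)])
      then have "(1 / real (Suc a) - 1 / real (Suc b)) = 0" using y by (simp add: axis_eq_0_iff)
      then show False using \<open>a \<noteq> b\<close> by simp
    qed
    then show "T a \<inter> T b = {}" by blast
  qed
  have Tm: "T n \<in> lmeasurable" for n unfolding T_def by (rule measurable_translation[OF Zm])
  have Tfin: "emeasure lebesgue (T n) \<noteq> \<infinity>" for n using fmeasurableD2[OF Tm] by simp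
  have Teq: "measure lebesgue (T n) = measure lebesgue Z" for n unfolding T_def by (rule measure_translation)
  have Tsub: "T n \<subseteq> cball p (r + 1)" for n
  proof
    fix z assume "z \<in> T n"
    then obtain x where x: "x \<in> Z" "z = (1 / real (Suc n)) *\<^sub>R ?e + x" by (auto simp: T_def)
    have "dist p z \<le> dist p x + dist x z" by (rule dist_triangle)
    also have "dist x z \<le> 1" using x by (simp add: dist_norm)
    also have "dist p x \<le> r" using x by (simp add: Z_def)
    finally show "z \<in> cball p (r+1)" by simp
  qed
  have le: "real n * measure lebesgue Z \<le> measure lebesgue (cball p (r + 1))" for n :: nat
  proof -
    have "real n * measure lebesgue Z = (\<Sum>i<n. measure lebesgue (T i))" by (simp add: Teq)
    also have "\<dots> = measure lebesgue (\<Union>i<n. T i)"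
      by (rule measure_finite_Union[symmetric])
        (use disj Tm Tfin in \<open>auto simp: disjoint_family_on_def simp del: emeasure_completion\<close>)
    also have "\<dots> \<le> measure lebesgue (cball p (r + 1))"
      using Tsub Tm by (intro measure_mono_fmeasurable) (auto intro!: fmeasurableD sets.finite_UN)
    finally show ?thesis .
  qed
  have "measure lebesgue Z = 0"
  proof (rule ccontr)
    assume "measure lebesgue Z \<noteq> 0"
    then have pos: "measure lebesgue Z > 0" by (simp add: zero_less_measure_iff)
    obtain n :: nat where "real n > measure lebesgue (cball p (r + 1)) / measure lebesgue Z"
      using reals_Archimedean2 by blast
    then show False using le[of n] pos by (simp add: field_simps)
  qed
  then have "negligible Z" using Zm negligible_iff_measure by blast
  then have "negligible (?S \<inter> ball p r)" by (rule negligible_subset) (auto simp: Z_def)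
  moreover have "openin (top_of_set ?S) (?S \<inter> ball p r)" by auto
  moreover have "p \<in> ?S \<inter> ball p r" using p r by auto
  ultimately show "\<exists>U. openin (top_of_set ?S) U \<and> p \<in> U \<and> negligible U" by blast
qed

lemma hpd_unique: "hpd j f d x \<Longrightarrow> hpd j f d' x \<Longrightarrow> d = d'"
  unfolding hpd_def by (rule vector_derivative_unique_at)

lemma hpd_cong:
  assumes "open U" "x \<in> U" "\<And>y. y \<in> U \<Longrightarrow> f y = g y" "hpd j f d x"
  shows "hpd j g d x"
proof -
  define V where "V = (\<lambda>h. x + h *\<^sub>R axis j (1::real)) -` U"
  have "open V" unfolding V_def by (intro open_vimage assms continuous_intros)
  moreover have "0 \<in> V" using assms by (simp add: V_def)
  ultimately show ?thesis using assms(3,4) unfolding hpd_def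
    by (auto elim!: has_vector_derivative_transform_within_open simp: V_def)
qed

lemma hpd_const [simp]: "hpd j (\<lambda>_. c) 0 x"
  by (simp add: hpd_def)

text \<open>A \<open>C\<^sup>1\<close> truncation that vanishes near 0: applied to a field with zero boundary values it
  yields a compactly supported field, whatever the regularity of the boundary.\<close>

definition ramp :: "real \<Rightarrow> real \<Rightarrow> real" where
  "ramp \<epsilon> x = (max 0 x)^3 / (x\<^sup>2 + \<epsilon>\<^sup>2)"

definition ramp' :: "real \<Rightarrow> real \<Rightarrow> real" where
  "ramp' \<epsilon> x = (3 * (max 0 x)\<^sup>2 * (x\<^sup>2 + \<epsilon>\<^sup>2) - (max 0 x)^3 * (2 * x)) / (x\<^sup>2 + \<epsilon>\<^sup>2)\<^sup>2"

lemma DERIV_max0_cubed: "((\<lambda>x. (max 0 x)^3) has_real_derivative 3 * (max 0 x)\<^sup>2) (at (x::real))"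
proof -
  consider "x < 0" | "x > 0" | "x = 0" by linarith
  then show ?thesis
  proof cases
    case 1
    then have "((\<lambda>x. 0) has_real_derivative 3 * (max 0 x)\<^sup>2) (at x)" by simp
    then show ?thesis
      by (rule has_field_derivative_transform_within_open[where S="{..<0}"]) (use 1 in auto)
  next
    case 2
    then have "((\<lambda>x. x^3) has_real_derivative 3 * (max 0 x)\<^sup>2) (at x)"
      by (auto intro!: derivative_eq_intros)
    then show ?thesis
      by (rule has_field_derivative_transform_within_open[where S="{0<..}"]) (use 2 in auto)
  next
    case 3
    have "((\<lambda>h::real. (max 0 h)^3 / h) \<longlongrightarrow> 0) (at 0)"
    proof (rule Lim_null_comparison)
      have "norm ((max 0 h)^3 / h) \<le> h\<^sup>2" for h :: real
        by (cases "h > 0") (auto simp: power3_eq_cube power2_eq_square)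
      then show "\<forall>\<^sub>F h in at 0. norm ((max 0 h)^3 / h) \<le> h\<^sup>2" for h :: real by simp
      show "((\<lambda>h. h\<^sup>2) \<longlongrightarrow> 0) (at (0::real))" by (auto intro!: tendsto_eq_intros)
    qed
    then show ?thesis using 3 by (simp add: DERIV_def)
  qed
qed

lemma
  assumes \<epsilon>: "\<epsilon> > 0"
  shows DERIV_ramp: "(ramp \<epsilon> has_real_derivative ramp' \<epsilon> x) (at x)"
    and ramp'_bounds: "0 \<le> ramp' \<epsilon> x" "ramp' \<epsilon> x \<le> 3"
    and ramp_near: "\<bar>ramp \<epsilon> x - max 0 x\<bar> \<le> \<epsilon>"
    and continuous_ramp': "continuous_on UNIV (ramp' \<epsilon>)"
proof -
  have pos: "x\<^sup>2 + \<epsilon>\<^sup>2 > 0" for x using \<epsilon> by (simp add: add_nonneg_pos)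
  have nz: "x\<^sup>2 + \<epsilon>\<^sup>2 \<noteq> 0" for x using pos[of x] by linarith
  show "(ramp \<epsilon> has_real_derivative ramp' \<epsilon> x) (at x)"
  proof -
    have "((\<lambda>x. x\<^sup>2 + \<epsilon>\<^sup>2) has_real_derivative 2 * x) (at x)" by (auto intro!: derivative_eq_intros)
    from DERIV_divide[OF DERIV_max0_cubed this nz] show ?thesis
      unfolding ramp_def[abs_def] ramp'_def power2_eq_square[of "x\<^sup>2 + \<epsilon>\<^sup>2"] .
  qed
  have e1: "ramp' \<epsilon> x = (x^4 + 3 * x\<^sup>2 * \<epsilon>\<^sup>2) / (x\<^sup>2 + \<epsilon>\<^sup>2)\<^sup>2" if "x > 0"
    unfolding ramp'_def using that by (simp add: power2_eq_square power3_eq_cube power4_eq_xxxx algebra_simps)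
  show "0 \<le> ramp' \<epsilon> x"
    by (cases "x > 0") (simp add: e1, simp add: ramp'_def)
  show "ramp' \<epsilon> x \<le> 3"
  proof (cases "x > 0")
    case True
    have "x^4 + 3 * x\<^sup>2 * \<epsilon>\<^sup>2 \<le> 3 * (x\<^sup>2 + \<epsilon>\<^sup>2)\<^sup>2"
    proof -
      have "3 * (x\<^sup>2 + \<epsilon>\<^sup>2)\<^sup>2 - (x^4 + 3 * x\<^sup>2 * \<epsilon>\<^sup>2) = 2 * x^4 + 3 * x\<^sup>2 * \<epsilon>\<^sup>2 + 3 * \<epsilon>^4"
        by (simp add: power2_eq_square power4_eq_xxxx algebra_simps)
      also have "\<dots> \<ge> 0" by simp
      finally show ?thesis by linarith
    qed
    then show ?thesis using pos[of x] unfolding e1[OF True] by (simp add: divide_le_eq)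
  qed (simp add: ramp'_def)
  show "\<bar>ramp \<epsilon> x - max 0 x\<bar> \<le> \<epsilon>"
  proof (cases "x > 0")
    case True
    have "ramp \<epsilon> x - max 0 x = - (x * \<epsilon>\<^sup>2) / (x\<^sup>2 + \<epsilon>\<^sup>2)"
      unfolding ramp_def using True nz[of x] by (simp add: field_simps power2_eq_square power3_eq_cube)
    moreover have "x * \<epsilon>\<^sup>2 \<le> \<epsilon> * (x\<^sup>2 + \<epsilon>\<^sup>2)"
    proof -
      have "0 \<le> (x - \<epsilon>)\<^sup>2 + x * \<epsilon>" using True \<epsilon> by simp
      then have "x * \<epsilon> \<le> x\<^sup>2 + \<epsilon>\<^sup>2" by (simp add: power2_eq_square algebra_simps)
      then have "\<epsilon> * (x * \<epsilon>) \<le> \<epsilon> * (x\<^sup>2 + \<epsilon>\<^sup>2)" using \<epsilon> by (intro mult_left_mono) auto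
      then show ?thesis by (simp add: power2_eq_square mult.left_commute mult.commute)
    qed
    ultimately show ?thesis using True \<epsilon> pos[of x] by (simp add: abs_mult divide_le_eq)
  qed (use \<epsilon> in \<open>simp add: ramp_def\<close>)
  show "continuous_on UNIV (ramp' \<epsilon>)"
    unfolding ramp'_def using nz by (intro continuous_intros) auto
qed

text \<open>Shifting both one-sided ramps by \<epsilon> leaves a dead zone
  \<open>\<bar>s\<bar> \<le> \<epsilon>\<close>, so the truncation of a field with zero boundary
  values vanishes near the boundary. The function is odd and stays within a multiple of \<epsilon>
  of the identity.\<close>

definition trunc :: "real \<Rightarrow> real \<Rightarrow> real" where
  "trunc \<epsilon> s = ramp \<epsilon> (s - \<epsilon>) - ramp \<epsilon> (- s - \<epsilon>)"

definition trunc' :: "real \<Rightarrow> real \<Rightarrow> real" where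
  "trunc' \<epsilon> s = ramp' \<epsilon> (s - \<epsilon>) + ramp' \<epsilon> (- s - \<epsilon>)"

lemma
  assumes \<epsilon>: "\<epsilon> > 0"
  shows DERIV_trunc: "(trunc \<epsilon> has_real_derivative trunc' \<epsilon> s) (at s)"
    and trunc'_bound: "\<bar>trunc' \<epsilon> s\<bar> \<le> 6"
    and trunc_near: "\<bar>trunc \<epsilon> s - s\<bar> \<le> 4 * \<epsilon>"
    and trunc_eq_0: "\<bar>s\<bar> \<le> \<epsilon> \<Longrightarrow> trunc \<epsilon> s = 0"
    and trunc'_eq_0: "\<bar>s\<bar> \<le> \<epsilon> \<Longrightarrow> trunc' \<epsilon> s = 0"
    and continuous_trunc: "continuous_on UNIV (trunc \<epsilon>)"
    and continuous_trunc': "continuous_on UNIV (trunc' \<epsilon>)"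
proof -
  have c1: "((\<lambda>s. ramp \<epsilon> (s - \<epsilon>)) has_real_derivative ramp' \<epsilon> (s - \<epsilon>) * 1) (at s)" for s
    by (rule DERIV_chain2[OF DERIV_ramp[OF \<epsilon>]]) (auto intro!: derivative_eq_intros)
  have c2: "((\<lambda>s. ramp \<epsilon> (- s - \<epsilon>)) has_real_derivative ramp' \<epsilon> (- s - \<epsilon>) * (-1)) (at s)" for s
    by (rule DERIV_chain2[OF DERIV_ramp[OF \<epsilon>]]) (auto intro!: derivative_eq_intros)
  show D: "(trunc \<epsilon> has_real_derivative trunc' \<epsilon> s) (at s)" for s
    unfolding trunc_def trunc'_def using DERIV_diff[OF c1 c2, of s] by simp
  show "continuous_on UNIV (trunc \<epsilon>)" using D DERIV_continuous_on has_field_derivative_at_within by blast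
  show "continuous_on UNIV (trunc' \<epsilon>)" unfolding trunc'_def
    by (intro continuous_intros continuous_on_compose2[OF continuous_ramp'[OF \<epsilon>]]) auto
  show "\<bar>trunc' \<epsilon> s\<bar> \<le> 6" unfolding trunc'_def
    using ramp'_bounds[OF \<epsilon>, of "s - \<epsilon>"] ramp'_bounds[OF \<epsilon>, of "- s - \<epsilon>"] by linarith
  show "\<bar>trunc \<epsilon> s - s\<bar> \<le> 4 * \<epsilon>" unfolding trunc_def
    using ramp_near[OF \<epsilon>, of "s - \<epsilon>"] ramp_near[OF \<epsilon>, of "- s - \<epsilon>"] \<epsilon> by linarith
  show "trunc \<epsilon> s = 0" "trunc' \<epsilon> s = 0" if "\<bar>s\<bar> \<le> \<epsilon>"
    using that by (auto simp: trunc_def trunc'_def ramp_def ramp'_def)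
qed

lemma ramp'_tendsto:
  fixes e :: "nat \<Rightarrow> real"
  assumes "e \<longlonglongrightarrow> 0" "s \<noteq> 0"
  shows "(\<lambda>n. ramp' (e n) (s - e n)) \<longlonglongrightarrow> (if s > 0 then 1 else 0)"
proof -
  have "(\<lambda>n. ramp' (e n) (s - e n)) \<longlonglongrightarrow> (3 * (max 0 (s - 0))\<^sup>2 * ((s-0)\<^sup>2 + 0\<^sup>2) - (max 0 (s-0))^3 * (2 * (s-0))) / ((s-0)\<^sup>2 + 0\<^sup>2)\<^sup>2"
    unfolding ramp'_def using assms by (intro tendsto_intros) auto
  moreover have "(3 * (max 0 (s - 0))\<^sup>2 * ((s-0)\<^sup>2 + 0\<^sup>2) - (max 0 (s-0))^3 * (2 * (s-0))) / ((s-0)\<^sup>2 + 0\<^sup>2)\<^sup>2 = (if s > 0 then 1 else 0)"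
    using assms(2) by (simp add: power2_eq_square power3_eq_cube)
  ultimately show ?thesis by simp
qed

text \<open>At \<open>s = 0\<close> the derivatives at positive levels are 0 instead of approaching
  1. This is the reason for controlling the zero set of a field by
  \<open>negligible_regular_zero_set\<close>.\<close>

lemma trunc'_tendsto:
  fixes e :: "nat \<Rightarrow> real"
  assumes "e \<longlonglongrightarrow> 0" "s \<noteq> 0"
  shows "(\<lambda>n. trunc' (e n) s) \<longlonglongrightarrow> 1"
  using tendsto_add[OF ramp'_tendsto[OF assms] ramp'_tendsto[OF assms(1), of "-s"]] assms(2)
  by (auto simp: trunc'_def split: if_splits)

definition ext0 :: "(real^3) set \<Rightarrow> (real^3 \<Rightarrow> real) \<Rightarrow> real^3 \<Rightarrow> real" where
  "ext0 \<Omega> f x = (if x \<in> \<Omega> then f x else 0)"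

text \<open>As \<open>g\<close> vanishes on the frontier, \<open>K\<close> is a compact subset of
  \<Omega>. The open sets \<Omega> and \<open>- K\<close> cover the space, and the extensions are
  identically 0 on \<open>- K\<close>, so regularity can be checked on each of the two
  separately.\<close>

lemma
  fixes g g' :: "real^3 \<Rightarrow> real"
  assumes \<Omega>: "open \<Omega>" "bounded \<Omega>" and \<epsilon>: "\<epsilon> > 0"
    and g: "continuous_on (closure \<Omega>) g" and g0: "\<And>x. x \<in> frontier \<Omega> \<Longrightarrow> g x = 0"
  defines "K \<equiv> {x\<in>closure \<Omega>. \<epsilon> \<le> \<bar>g x\<bar>}"
  shows trunc_compact: "compact K" and trunc_subset: "K \<subseteq> \<Omega>"
    and trunc_outside: "x \<notin> K \<Longrightarrow> ext0 \<Omega> (\<lambda>x. trunc \<epsilon> (g x)) x = 0"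
    and continuous_ext0_trunc: "continuous_on UNIV (ext0 \<Omega> (\<lambda>x. trunc \<epsilon> (g x)))"
    and trunc'_outside: "x \<notin> K \<Longrightarrow> ext0 \<Omega> (\<lambda>x. trunc' \<epsilon> (g x) * g' x) x = 0"
    and continuous_ext0_trunc': "continuous_on \<Omega> g' \<Longrightarrow> continuous_on UNIV (ext0 \<Omega> (\<lambda>x. trunc' \<epsilon> (g x) * g' x))"
    and hpd_ext0_trunc: "(\<And>x. x \<in> \<Omega> \<Longrightarrow> hpd j g (g' x) x) \<Longrightarrow>
       hpd j (ext0 \<Omega> (\<lambda>x. trunc \<epsilon> (g x))) (ext0 \<Omega> (\<lambda>x. trunc' \<epsilon> (g x) * g' x) x) x"
proof -
  have "closed K" unfolding K_def
    by (intro continuous_on_closed_Collect_le continuous_intros g) auto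
  then show K: "compact K" unfolding compact_eq_bounded_closed
    using \<Omega>(2) by (auto simp: K_def intro: bounded_subset[OF bounded_closure])
  show K\<Omega>: "K \<subseteq> \<Omega>"
    using g0 \<epsilon> \<Omega>(1) by (force simp: K_def frontier_def interior_open)
  have small: "\<bar>g x\<bar> \<le> \<epsilon>" if "x \<in> \<Omega>" "x \<notin> K" for x
    using that closure_subset by (fastforce simp: K_def)
  show z1: "ext0 \<Omega> (\<lambda>x. trunc \<epsilon> (g x)) x = 0" if "x \<notin> K" for x
    using that small trunc_eq_0[OF \<epsilon>] by (auto simp: ext0_def)
  show z2: "ext0 \<Omega> (\<lambda>x. trunc' \<epsilon> (g x) * g' x) x = 0" if "x \<notin> K" for x
    using that small trunc'_eq_0[OF \<epsilon>] by (auto simp: ext0_def)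
  have U: "\<Omega> \<union> - K = UNIV" using K\<Omega> by auto
  have oK: "open (- K)" using K by (simp add: compact_imp_closed open_Compl)
  have gO: "continuous_on \<Omega> g" using g closure_subset continuous_on_subset by blast
  have glue: "continuous_on UNIV F" if F: "continuous_on \<Omega> F" "\<And>x. x \<notin> K \<Longrightarrow> F x = 0" for F :: "real^3 \<Rightarrow> real"
  proof -
    have "continuous_on (- K) F" using F(2) by (auto intro: continuous_on_eq[OF continuous_on_const[of _ 0]])
    then show ?thesis using continuous_on_open_Un[OF \<Omega>(1) oK F(1)] U by metis
  qed
  show c1: "continuous_on UNIV (ext0 \<Omega> (\<lambda>x. trunc \<epsilon> (g x)))"
  proof (rule glue[OF _ z1])
    have "continuous_on \<Omega> (\<lambda>x. trunc \<epsilon> (g x))"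
      by (rule continuous_on_compose2[OF continuous_trunc[OF \<epsilon>] gO]) auto
    then show "continuous_on \<Omega> (ext0 \<Omega> (\<lambda>x. trunc \<epsilon> (g x)))"
      by (rule continuous_on_eq) (auto simp: ext0_def)
  qed
  show c2: "continuous_on UNIV (ext0 \<Omega> (\<lambda>x. trunc' \<epsilon> (g x) * g' x))" if "continuous_on \<Omega> g'"
  proof (rule glue[OF _ z2])
    have "continuous_on \<Omega> (\<lambda>x. trunc' \<epsilon> (g x) * g' x)"
      by (intro continuous_on_mult that) (rule continuous_on_compose2[OF continuous_trunc'[OF \<epsilon>] gO], auto)
    then show "continuous_on \<Omega> (ext0 \<Omega> (\<lambda>x. trunc' \<epsilon> (g x) * g' x))"
      by (rule continuous_on_eq) (auto simp: ext0_def)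
  qed
  show "hpd j (ext0 \<Omega> (\<lambda>x. trunc \<epsilon> (g x))) (ext0 \<Omega> (\<lambda>x. trunc' \<epsilon> (g x) * g' x) x) x"
    if g': "\<And>x. x \<in> \<Omega> \<Longrightarrow> hpd j g (g' x) x" for x
  proof (cases "x \<in> \<Omega>")
    case True
    have "((\<lambda>h. g (x + h *\<^sub>R axis j 1)) has_real_derivative g' x) (at 0)"
      using g'[OF True] by (simp add: hpd_def has_real_derivative_iff_has_vector_derivative)
    then have "((\<lambda>h. trunc \<epsilon> (g (x + h *\<^sub>R axis j 1))) has_real_derivative trunc' \<epsilon> (g (x + 0 *\<^sub>R axis j 1)) * g' x) (at 0)"
      by (rule DERIV_chain2[OF DERIV_trunc[OF \<epsilon>]])
    then have "hpd j (\<lambda>x. trunc \<epsilon> (g x)) (trunc' \<epsilon> (g x) * g' x) x"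
      by (simp add: hpd_def has_real_derivative_iff_has_vector_derivative)
    from hpd_cong[OF \<Omega>(1) True _ this, of "ext0 \<Omega> (\<lambda>x. trunc \<epsilon> (g x))"] True
    show ?thesis by (simp add: ext0_def)
  next
    case False
    then have xK: "x \<in> - K" using K\<Omega> by auto
    have "hpd j (ext0 \<Omega> (\<lambda>x. trunc \<epsilon> (g x))) 0 x"
      by (rule hpd_cong[OF oK xK _ hpd_const[of _ 0]]) (use z1 in auto)
    then show ?thesis using z2 xK by simp
  qed
qed

section \<open>Derivatives of compactly supported fields have integral zero\<close>

lemma lborel_integral_translate:
  fixes f :: "'a::euclidean_space \<Rightarrow> 'b::{banach,second_countable_topology}"
  assumes "f \<in> borel_measurable borel"
  shows "(LINT x|lborel. f (c + x)) = (LINT x|lborel. f x)"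
proof -
  have "(LINT x|lborel. f (c + x)) = (LINT x|distr lborel borel ((+) c). f x)"
    by (rule integral_distr[symmetric]) (use assms in auto)
  then show ?thesis by (simp add: lborel_distr_plus)
qed

lemma integrable_continuous_compact_support:
  fixes f :: "real^3 \<Rightarrow> real"
  assumes "continuous_on UNIV f" "compact K" "\<And>x. x \<notin> K \<Longrightarrow> f x = 0"
  shows "integrable lborel f"
proof -
  have "set_integrable lborel K f"
    unfolding set_integrable_def
    by (rule borel_integrable_compact[OF assms(2)]) (use assms(1) continuous_on_subset in blast)
  moreover have "(\<lambda>x. indicator K x *\<^sub>R f x) = f" using assms(3) by (force simp: indicator_def)
  ultimately show ?thesis by (simp add: set_integrable_def)
qed

lemma hpd_lipschitz:
  fixes f :: "real^3 \<Rightarrow> real"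
  assumes "\<And>x. hpd j f (f' x) x" "\<And>x. \<bar>f' x\<bar> \<le> M"
  shows "\<bar>f (x + h *\<^sub>R axis j 1) - f x\<bar> \<le> M * \<bar>h\<bar>"
proof -
  have "norm ((\<lambda>h. f (x + h *\<^sub>R axis j 1)) h - (\<lambda>h. f (x + h *\<^sub>R axis j 1)) 0) \<le> M * norm (h - 0)"
    by (rule field_differentiable_bound[of UNIV _ "\<lambda>h. f' (x + h *\<^sub>R axis j 1)"])
      (use hpd_shift[OF assms(1)] assms(2) in \<open>auto simp: has_real_derivative_iff_has_vector_derivative intro: has_vector_derivative_at_within\<close>)
  then show ?thesis by simp
qed

text \<open>Translation invariance makes every difference quotient integrate to 0, and the quotients
  converge to \<open>f'\<close> under the common bound given by
  \<open>hpd_lipschitz\<close>.\<close>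

lemma integral_hpd_eq_0:
  fixes f f' :: "real^3 \<Rightarrow> real"
  assumes f: "continuous_on UNIV f" and f': "continuous_on UNIV f'"
    and d: "\<And>x. hpd j f (f' x) x"
    and K: "compact K" "\<And>x. x \<notin> K \<Longrightarrow> f x = 0" "\<And>x. x \<notin> K \<Longrightarrow> f' x = 0"
  shows "(LINT x|lborel. f' x) = 0"
proof -
  let ?e = "axis j 1 :: real^3"
  obtain M0 where M0: "\<And>x. x \<in> K \<Longrightarrow> \<bar>f' x\<bar> \<le> M0"
    using compact_imp_bounded[OF compact_continuous_image[OF continuous_on_subset[OF f' subset_UNIV] K(1)]]
    by (auto simp: bounded_iff)
  define M where "M = max 0 M0"
  have M: "\<bar>f' x\<bar> \<le> M" for x using M0[of x] K(3)[of x] by (cases "x \<in> K") (auto simp: M_def)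
  obtain r where r: "K \<subseteq> cball 0 r" using bounded_subset_ballD[OF compact_imp_bounded[OF K(1)], of 0] ball_subset_cball by blast
  define q where "q = (\<lambda>n x. (f (x + (1 / real (Suc n)) *\<^sub>R ?e) - f x) * real (Suc n))"
  have intf: "integrable lborel f" by (rule integrable_continuous_compact_support[OF f K(1,2)])
  have fm: "f \<in> borel_measurable borel" using f borel_measurable_continuous_onI by blast
  have "(\<lambda>n. LINT x|lborel. q n x) \<longlonglongrightarrow> (LINT x|lborel. f' x)"
  \<comment> \<open>The shifts have length at most 1, so all quotients are supported in the ball of
    radius \<open>r + 1\<close>.\<close>
  proof (rule integral_dominated_convergence[where w="\<lambda>x. M * indicator (cball 0 (r+1)) x"])
    show "f' \<in> borel_measurable lborel" using f' borel_measurable_continuous_onI by auto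
    show "q n \<in> borel_measurable lborel" for n
      unfolding q_def using fm by measurable
    show "integrable lborel (\<lambda>x. M * indicator (cball 0 (r+1)) (x::real^3))"
      using emeasure_lborel_cball_finite[of "0::real^3" "r+1"] by (intro integrable_mult_right integrable_real_indicator) auto
    show "AE x in lborel. (\<lambda>n. q n x) \<longlonglongrightarrow> f' x"
    proof (rule AE_I2)
      fix x
      have "((\<lambda>h. (f (x + h *\<^sub>R ?e) - f x) / h) \<longlongrightarrow> f' x) (at 0)"
        using d[of x] unfolding hpd_def has_real_derivative_iff_has_vector_derivative[symmetric] DERIV_def by simp
      moreover have "filterlim (\<lambda>n. 1 / real (Suc n)) (at 0) sequentially"
        using LIMSEQ_inverse_real_of_nat by (auto simp: filterlim_at inverse_eq_divide)
      ultimately have "(\<lambda>n. (f (x + (1 / real (Suc n)) *\<^sub>R ?e) - f x) / (1 / real (Suc n))) \<longlonglongrightarrow> f' x"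
        by (rule filterlim_compose)
      then show "(\<lambda>n. q n x) \<longlonglongrightarrow> f' x" by (simp add: q_def)
    qed
    show "AE x in lborel. norm (q n x) \<le> M * indicator (cball 0 (r+1)) x" for n
    proof (rule AE_I2)
      fix x
      have h: "\<bar>1 / real (Suc n)\<bar> \<le> 1" by simp
      show "norm (q n x) \<le> M * indicator (cball 0 (r+1)) x"
      proof (cases "x \<in> cball 0 (r+1)")
        case True
        have "\<bar>q n x\<bar> \<le> (M * \<bar>1 / real (Suc n)\<bar>) * real (Suc n)"
          unfolding q_def abs_mult by (intro mult_mono hpd_lipschitz[OF d M]) (auto simp: M_def)
        then show ?thesis using True by simp
      next
        case False
        then have "norm x > r + 1" by simp
        moreover have "norm x \<le> norm (x + (1 / real (Suc n)) *\<^sub>R ?e) + norm ((1 / real (Suc n)) *\<^sub>R ?e)"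
          by (metis add_diff_cancel_right' norm_triangle_ineq4)
        moreover have "norm ((1 / real (Suc n)) *\<^sub>R ?e) \<le> 1" using h by simp
        ultimately have "norm x > r" "norm (x + (1 / real (Suc n)) *\<^sub>R ?e) > r" by linarith+
        then have "x \<notin> K" "x + (1 / real (Suc n)) *\<^sub>R ?e \<notin> K" using r mem_cball_0 not_less by (metis subsetD)+
        then show ?thesis using K(2) False by (simp add: q_def)
      qed
    qed
  qed
  moreover have "(LINT x|lborel. q n x) = 0" for n
  proof -
    have m: "(\<lambda>x. f (c + x)) \<in> borel_measurable borel" for c using fm by measurable
    have i2: "integrable lborel (\<lambda>x. f (c + x))" for c
    proof -
      have "integrable (distr lborel borel ((+) c)) f" using intf by (simp add: lborel_distr_plus)
      then show ?thesis using fm by (subst (asm) integrable_distr_eq) auto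
    qed
    have "(LINT x|lborel. q n x) = ((LINT x|lborel. f ((1 / real (Suc n)) *\<^sub>R ?e + x)) - (LINT x|lborel. f x)) * real (Suc n)"
    proof -
      have "q n = (\<lambda>x. (f ((1 / real (Suc n)) *\<^sub>R ?e + x) - f x) * real (Suc n))"
        by (simp add: q_def add.commute)
      then show ?thesis
        using Bochner_Integration.integral_diff[OF i2 intf] by (simp only: integral_mult_left_zero)
    qed
    then show ?thesis by (simp add: lborel_integral_translate[OF fm])
  qed
  ultimately show ?thesis using LIMSEQ_unique[OF _ tendsto_const] by auto
qed

section \<open>Mollification\<close>

text \<open>These functions span a space closed under differentiation, hence are smooth.\<close>

definition flat :: "nat \<Rightarrow> real \<Rightarrow> real" where
  "flat k s = (if s > 0 then (1/s)^k * exp (- (1/s)) else 0)"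

lemma flat_tendsto_0: "(flat k \<longlongrightarrow> 0) (at 0)"
proof -
  have "((\<lambda>s. (1/s)^k / exp (1/s)) \<longlongrightarrow> 0) (at_right (0::real))"
    by (rule filterlim_compose[OF tendsto_power_div_exp_0])
      (use filterlim_inverse_at_top_right in \<open>simp add: inverse_eq_divide\<close>)
  then have "((\<lambda>s. (1/s)^k * exp (- (1/s))) \<longlongrightarrow> 0) (at_right (0::real))" by (simp add: exp_minus divide_inverse)
  then have r: "(flat k \<longlongrightarrow> 0) (at_right 0)"
    by (rule Lim_transform_eventually) (auto simp: flat_def eventually_at_right_field intro: exI[of _ 1])
  have "((\<lambda>_. 0::real) \<longlongrightarrow> 0) (at_left (0::real))" by simp
  then have l: "(flat k \<longlongrightarrow> 0) (at_left 0)"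
    by (rule Lim_transform_eventually) (auto simp: flat_def eventually_at_left_field intro: exI[of _ "-1"])
  show ?thesis using l r by (simp add: filterlim_at_split)
qed

lemma DERIV_flat: "(flat k has_real_derivative flat (k+2) s - real k * flat (k+1) s) (at s)"
proof -
  consider "s < 0" | "s > 0" | "s = 0" by linarith
  then show ?thesis
  proof cases
    case 1
    then have "((\<lambda>x. 0) has_real_derivative flat (k+2) s - real k * flat (k+1) s) (at s)" by (simp add: flat_def)
    then show ?thesis
      by (rule has_field_derivative_transform_within_open[where S="{..<0}"]) (use 1 in \<open>auto simp: flat_def\<close>)
  next
    case 2
    have i: "((\<lambda>x. 1 / x) has_real_derivative - (1/s)\<^sup>2) (at s)"
      using 2 by (auto intro!: derivative_eq_intros simp: power2_eq_square field_simps)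
    have p: "((\<lambda>x. (1/x)^k) has_real_derivative real k * (- (1/s)\<^sup>2 * (1/s)^(k-1))) (at s)"
      using DERIV_power[OF i, of k] by simp
    have e: "((\<lambda>x. exp (- (1/x))) has_real_derivative exp (- (1/s)) * (- (- (1/s)\<^sup>2))) (at s)"
      by (rule DERIV_fun_exp[OF DERIV_minus[OF i]])
    have "(1/s)\<^sup>2 * (1/s)^(k-1) * real k = real k * (1/s)^(k+1)"
      by (cases k) (auto simp: power2_eq_square)
    then have eq: "real k * (- (1/s)\<^sup>2 * (1/s)^(k-1)) * exp (- (1/s)) + exp (- (1/s)) * (- (- (1/s)\<^sup>2)) * (1/s)^k
       = flat (k+2) s - real k * flat (k+1) s"
      using 2 by (simp add: flat_def power_add algebra_simps power2_eq_square)
    have "((\<lambda>x. (1/x)^k * exp (- (1/x))) has_real_derivative flat (k+2) s - real k * flat (k+1) s) (at s)"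
      using DERIV_mult[OF p e] unfolding eq .
    then show ?thesis
      by (rule has_field_derivative_transform_within_open[where S="{0<..}"]) (use 2 in \<open>auto simp: flat_def\<close>)
  next
    case 3
    \<comment> \<open>Division by \<open>h\<close> only raises the index, so
      \<open>flat_tendsto_0\<close> also yields the derivative at 0.\<close>
    have "flat k h / h = flat (k+1) h" for h by (simp add: flat_def)
    then have "((\<lambda>h. (flat k (0 + h) - flat k 0) / h) \<longlongrightarrow> 0) (at 0)"
      using flat_tendsto_0[of "k+1"] by (simp add: flat_def[of _ 0])
    then show ?thesis using 3 by (simp add: DERIV_def flat_def[of _ 0])
  qed
qed

text \<open>An algebra stable under partial derivatives, by \<open>flat_generated_hpd\<close>; this
  turns smoothness into an induction on the order of differentiation.\<close>

inductive flat_generated :: "(real^3 \<Rightarrow> real) \<Rightarrow> bool" where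
  gen: "flat_generated (\<lambda>x. flat k (\<sigma> * x$i + c))"
| const: "flat_generated (\<lambda>x. c)"
| add: "flat_generated f \<Longrightarrow> flat_generated g \<Longrightarrow> flat_generated (\<lambda>x. f x + g x)"
| mult: "flat_generated f \<Longrightarrow> flat_generated g \<Longrightarrow> flat_generated (\<lambda>x. f x * g x)"

lemma hpd_real_iff: "hpd j f d x \<longleftrightarrow> ((\<lambda>h. f (x + h *\<^sub>R axis j 1)) has_real_derivative d) (at 0)"
  by (simp add: hpd_def has_real_derivative_iff_has_vector_derivative)

lemma hpd_imp_pd: "hpd j f d x \<Longrightarrow> pdiff j f x \<and> pd j f x = d"
  unfolding hpd_real_iff pdiff_def pd_def
  using DERIV_imp_deriv real_differentiable_def by blast

lemma pdiff_imp_hpd: "pdiff j f x \<Longrightarrow> hpd j f (pd j f x) x"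
  unfolding hpd_real_iff pdiff_def pd_def
  by (simp add: DERIV_deriv_iff_real_differentiable)

lemma hpd_add: "hpd j f a x \<Longrightarrow> hpd j g b x \<Longrightarrow> hpd j (\<lambda>x. f x + g x) (a + b) x"
  unfolding hpd_def by (rule has_vector_derivative_add)

lemma hpd_mult:
  fixes f g :: "real^3 \<Rightarrow> 'a::real_normed_algebra"
  assumes "hpd j f a x" "hpd j g b x"
  shows "hpd j (\<lambda>x. f x * g x) (f x * b + a * g x) x"
  using has_vector_derivative_mult[OF assms[unfolded hpd_def]] by (simp add: hpd_def)

lemma flat_generated_hpd:
  "flat_generated f \<Longrightarrow> continuous_on UNIV f \<and> (\<forall>j. \<exists>f'. flat_generated f' \<and> (\<forall>x. hpd j f (f' x) x))"
proof (induction rule: flat_generated.induct)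
  case (gen k \<sigma> i c)
  have "continuous_on UNIV (flat k)" by (rule DERIV_continuous_on[OF has_field_derivative_at_within[OF DERIV_flat]])
  then have 1: "continuous_on UNIV (\<lambda>x. flat k (\<sigma> * x$i + c))"
    by (rule continuous_on_compose2) (auto intro!: continuous_intros)
  have 2: "\<exists>f'. flat_generated f' \<and> (\<forall>x. hpd j (\<lambda>x. flat k (\<sigma> * x$i + c)) (f' x) x)" for j
  proof -
    define s where "s = \<sigma> * (axis j (1::real) $ i)"
    define f' where "f' = (\<lambda>x::real^3. s * flat (k+2) (\<sigma> * x$i + c) + (- s * real k) * flat (k+1) (\<sigma> * x$i + c))"
    have "flat_generated f'" unfolding f'_def by (intro flat_generated.intros)
    moreover have "hpd j (\<lambda>x. flat k (\<sigma> * x$i + c)) (f' x) x" for x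
    proof -
      have lin: "((\<lambda>h. \<sigma> * (x + h *\<^sub>R axis j 1)$i + c) has_real_derivative s) (at 0)"
        by (auto intro!: derivative_eq_intros simp: s_def)
      show ?thesis unfolding hpd_real_iff
        using DERIV_chain2[OF DERIV_flat lin] by (simp add: f'_def algebra_simps)
    qed
    ultimately show ?thesis by blast
  qed
  show ?case using 1 2 by blast
next
  case (const c)
  show ?case by (intro conjI allI exI[of _ "\<lambda>_. 0"] flat_generated.const hpd_const continuous_on_const)
next
  case (add f g)
  have "\<exists>h. flat_generated h \<and> (\<forall>x. hpd j (\<lambda>x. f x + g x) (h x) x)" for j
  proof -
    obtain f' g' where "flat_generated f'" "\<forall>x. hpd j f (f' x) x" "flat_generated g'" "\<forall>x. hpd j g (g' x) x"
      using add.IH by meson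
    then show ?thesis by (intro exI[of _ "\<lambda>x. f' x + g' x"]) (auto intro: flat_generated.add hpd_add)
  qed
  then show ?case using add.IH by (auto intro: continuous_on_add)
next
  case (mult f g)
  have "\<exists>h. flat_generated h \<and> (\<forall>x. hpd j (\<lambda>x. f x * g x) (h x) x)" for j
  proof -
    obtain f' g' where "flat_generated f'" "\<forall>x. hpd j f (f' x) x" "flat_generated g'" "\<forall>x. hpd j g (g' x) x"
      using mult.IH by meson
    then show ?thesis using mult.hyps
      by (intro exI[of _ "\<lambda>x. f x * g' x + f' x * g x"]) (auto intro: flat_generated.intros hpd_mult)
  qed
  then show ?case using mult.IH by (auto intro: continuous_on_mult)
qed

lemma flat_generated_continuous: "flat_generated f \<Longrightarrow> continuous_on UNIV f"
  using flat_generated_hpd by blast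

section \<open>Convolution with smooth kernels\<close>

lemma convolution_hpd:
  fixes f \<rho> \<rho>' :: "real^3 \<Rightarrow> real"
  assumes f: "continuous_on UNIV f" and \<rho>: "continuous_on UNIV \<rho>" and \<rho>': "continuous_on UNIV \<rho>'"
    and d: "\<And>x. hpd j \<rho> (\<rho>' x) x"
  shows "hpd j (\<lambda>x. integral (cbox a b) (\<lambda>y. f y * \<rho> (x - y))) (integral (cbox a b) (\<lambda>y. f y * \<rho>' (x - y))) x"
proof -
  let ?e = "axis j 1 :: real^3"
  have "((\<lambda>h. integral (cbox a b) (\<lambda>y. f y * \<rho> (x + h *\<^sub>R ?e - y))) has_vector_derivative
      integral (cbox a b) (\<lambda>y. f y * \<rho>' (x + 0 *\<^sub>R ?e - y))) (at 0 within UNIV)"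
  proof (rule leibniz_rule_vector_derivative)
    fix h y
    have "((\<lambda>h. \<rho> (x - y + h *\<^sub>R ?e)) has_vector_derivative \<rho>' (x - y + h *\<^sub>R ?e)) (at h)"
      by (rule hpd_shift[OF d])
    then have "((\<lambda>h. \<rho> (x + h *\<^sub>R ?e - y)) has_vector_derivative \<rho>' (x + h *\<^sub>R ?e - y)) (at h)"
      by (simp add: algebra_simps)
    then show "((\<lambda>h. f y * \<rho> (x + h *\<^sub>R ?e - y)) has_vector_derivative f y * \<rho>' (x + h *\<^sub>R ?e - y)) (at h within UNIV)"
      by (rule has_vector_derivative_mult_right)
  next
    fix h show "(\<lambda>y. f y * \<rho> (x + h *\<^sub>R ?e - y)) integrable_on cbox a b"
      by (intro integrable_continuous continuous_intros continuous_on_compose2[OF \<rho>] continuous_on_subset[OF f]) auto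
  next
    show "continuous_on (UNIV \<times> cbox a b) (\<lambda>(h, y). f y * \<rho>' (x + h *\<^sub>R ?e - y))"
      unfolding split_beta
      by (intro continuous_intros continuous_on_compose2[OF \<rho>'] continuous_on_compose2[OF f]) auto
  qed auto
  then show ?thesis by (simp add: hpd_def)
qed

lemma convolution_continuous:
  fixes f \<rho> :: "real^3 \<Rightarrow> real"
  assumes f: "continuous_on UNIV f" and \<rho>: "continuous_on UNIV \<rho>"
  shows "continuous_on UNIV (\<lambda>x. integral (cbox a b) (\<lambda>y. f y * \<rho> (x - y)))"
  by (rule integral_continuous_on_param, unfold split_beta)
    (intro continuous_intros continuous_on_compose2[OF \<rho>] continuous_on_compose2[OF f]; auto)

text \<open>Every derivative is thrown onto the kernel, which stays in the class
  \<open>flat_generated\<close>, so continuity of \<open>f\<close> is enough. The induction varies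
  the kernel.\<close>

lemma convolution_Ck:
  assumes f: "continuous_on UNIV f" and \<rho>: "flat_generated \<rho>"
  shows "Ck_on k UNIV (\<lambda>x. integral (cbox a b) (\<lambda>y. f y * \<rho> (x - y)))"
  using \<rho>
proof (induction k arbitrary: \<rho>)
  case 0
  then show ?case using convolution_continuous[OF f flat_generated_continuous] by simp
next
  case (Suc k)
  let ?F = "\<lambda>\<rho> x. integral (cbox a b) (\<lambda>y. f y * \<rho> (x - y))"
  have c: "continuous_on UNIV \<rho>" by (rule flat_generated_continuous[OF Suc.prems])
  have "(\<forall>x. pdiff j (?F \<rho>) x) \<and> Ck_on k UNIV (pd j (?F \<rho>))" for j
  proof -
    obtain \<rho>' where r: "flat_generated \<rho>'" "\<And>x. hpd j \<rho> (\<rho>' x) x" using flat_generated_hpd[OF Suc.prems] by blast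
    have h: "hpd j (?F \<rho>) (?F \<rho>' x) x" for x
      by (rule convolution_hpd[OF f c flat_generated_continuous[OF r(1)] r(2)])
    then have "pd j (?F \<rho>) = ?F \<rho>'" by (intro ext) (rule conjunct2[OF hpd_imp_pd])
    moreover have "pdiff j (?F \<rho>) x" for x by (rule conjunct1[OF hpd_imp_pd[OF h]])
    ultimately show ?thesis using Suc.IH[OF r(1)] by auto
  qed
  then show ?case using convolution_continuous[OF f c] by simp
qed

text \<open>Each pair of factors confines one coordinate to the interval from \<open>- r\<close> to
  \<open>r\<close>, so the support sits in a cube inside the ball of radius \<open>3 * r\<close>.
  The coefficients \<open>1\<close> and \<open>-1\<close> keep the shape of the rule
  \<open>gen\<close>.\<close>

definition bump :: "real \<Rightarrow> real^3 \<Rightarrow> real" where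
  "bump r x = (flat 0 (1 * x$1 + r) * flat 0 ((-1) * x$1 + r)) * (flat 0 (1 * x$2 + r) * flat 0 ((-1) * x$2 + r))
     * (flat 0 (1 * x$3 + r) * flat 0 ((-1) * x$3 + r))"

lemma flat_generated_bump: "flat_generated (bump r)"
  unfolding bump_def[abs_def] by (intro flat_generated.intros)

lemma bump_nonneg: "bump r x \<ge> 0"
  by (simp add: bump_def flat_def)

lemma bump_minus: "bump r (- x) = bump r x"
  by (simp add: bump_def mult.commute mult.left_commute)

lemma bump_pos_0: "r > 0 \<Longrightarrow> bump r 0 > 0"
  by (simp add: bump_def flat_def)

lemma bump_eq_0:
  assumes "norm x \<ge> 3 * r" shows "bump r x = 0"
proof (rule ccontr)
  assume "bump r x \<noteq> 0"
  then have "\<bar>x$1\<bar> < r" "\<bar>x$2\<bar> < r" "\<bar>x$3\<bar> < r"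
    by (auto simp: bump_def flat_def split: if_splits)
  moreover have "norm x \<le> \<bar>x$1\<bar> + \<bar>x$2\<bar> + \<bar>x$3\<bar>"
    using norm_le_l1_cart[of x] by (simp add: sum_3)
  ultimately show False using assms by linarith
qed

lemma continuous_bump: "continuous_on UNIV (bump r)"
  by (rule flat_generated_continuous[OF flat_generated_bump])

lemma integrable_bump: "integrable lborel (bump r)"
  by (rule integrable_continuous_compact_support[OF continuous_bump compact_cball[of 0 "3*r"]])
    (auto intro: bump_eq_0)

text \<open>The part of \<Omega> where \<open>f\<close> differs from \<open>c\<close> is open and
  negligible, hence empty.\<close>

lemma AE_eq_0_imp_eq_0_on_open:
  fixes f :: "'a::euclidean_space \<Rightarrow> 'b::t1_space"
  assumes ae: "AE x in lborel. x \<in> \<Omega> \<longrightarrow> f x = c" and \<Omega>: "open \<Omega>" and f: "continuous_on \<Omega> f" and x: "x \<in> \<Omega>"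
  shows "f x = c"
proof (rule ccontr)
  assume ne: "f x \<noteq> c"
  let ?U = "\<Omega> \<inter> f -` (- {c})"
  have "open ?U" by (rule continuous_open_preimage[OF f \<Omega>]) auto
  moreover have "?U \<noteq> {}" using x ne by auto
  moreover have "negligible ?U"
  proof -
    obtain N where N: "{x \<in> space lborel. \<not> (x \<in> \<Omega> \<longrightarrow> f x = c)} \<subseteq> N" "emeasure lborel N = 0" "N \<in> sets lborel"
      using ae by (rule AE_E)
    have "N \<in> null_sets lebesgue" by (rule null_sets_completionI) (use N in auto)
    then have "negligible N" by (simp add: negligible_iff_null_sets)
    moreover have "?U \<subseteq> N" using N(1) by auto
    ultimately show ?thesis using negligible_subset by blast
  qed
  ultimately show False using open_not_negligible by blast
qed

lemma integral_bump_pos: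
  assumes "r > 0" shows "(LINT x|lborel. bump r x) > 0"
proof -
  have "(LINT x|lborel. bump r x) \<noteq> 0"
  proof
    assume "(LINT x|lborel. bump r x) = 0"
    then have "AE x in lborel. bump r x = 0"
      using integral_nonneg_eq_0_iff_AE[OF integrable_bump] bump_nonneg by auto
    then have "bump r 0 = 0"
      using AE_eq_0_imp_eq_0_on_open[of UNIV "bump r" 0 0] continuous_bump by simp
    then show False using bump_pos_0[OF assms] by simp
  qed
  moreover have "(LINT x|lborel. bump r x) \<ge> 0" by (simp add: bump_nonneg)
  ultimately show ?thesis by simp
qed

lemma uniformly_continuous_compact_support:
  fixes f :: "real^3 \<Rightarrow> real"
  assumes f: "continuous_on UNIV f" and K: "compact K" "\<And>x. x \<notin> K \<Longrightarrow> f x = 0" and e: "e > 0"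
  obtains d where "d > 0" "\<And>x z. norm z \<le> d \<Longrightarrow> \<bar>f (x + z) - f x\<bar> < e"
proof -
  obtain r where r: "K \<subseteq> ball 0 r"
    using bounded_subset_ballD[OF compact_imp_bounded[OF K(1)], of 0] by blast
  have "uniformly_continuous_on (cball 0 (r+1)) f"
    using f by (intro compact_uniformly_continuous) (auto intro: continuous_on_subset)
  then have "\<exists>d>0. \<forall>x\<in>cball 0 (r+1). \<forall>y\<in>cball 0 (r+1). dist y x < d \<longrightarrow> dist (f y) (f x) < e"
    unfolding uniformly_continuous_on_def using e by (elim allE impE) simp_all
  then obtain d0 where d0: "d0 > 0" and d0': "\<forall>x\<in>cball 0 (r+1). \<forall>y\<in>cball 0 (r+1). dist y x < d0 \<longrightarrow> dist (f y) (f x) < e"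
    by (elim exE conjE) (rule that)
  \<comment> \<open>The cap at 1 guarantees that the two points either both lie in
    \<open>cball 0 (r+1)\<close> or both lie outside \<open>K\<close>.\<close>
  show thesis
  proof (rule that[of "min (d0/2) 1"])
    show "min (d0/2) 1 > 0" using d0 by simp
    fix x z :: "real^3" assume z: "norm z \<le> min (d0/2) 1"
    have n1: "norm (x + z) \<le> norm x + norm z" by (rule norm_triangle_ineq)
    have n2: "norm x \<le> norm (x + z) + norm z" using norm_triangle_ineq4[of "x + z" z] by simp
    show "\<bar>f (x + z) - f x\<bar> < e"
    proof (cases "norm x \<le> r \<or> norm (x + z) \<le> r")
      case True
      then have "x \<in> cball 0 (r+1)" "x + z \<in> cball 0 (r+1)" using z n1 n2 by auto
      moreover have "dist (x + z) x < d0" using z d0 by (simp add: dist_norm)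
      ultimately have "dist (f (x + z)) (f x) < e" using d0' by simp
      then show ?thesis by (simp add: dist_real_def)
    next
      case False
      then have "x \<notin> K" "x + z \<notin> K" using r by (auto simp: subset_iff)
      then show ?thesis using K(2) e by simp
    qed
  qed
qed

lemma integral_cbox_eq_lborel:
  fixes g :: "real^3 \<Rightarrow> real"
  assumes "continuous_on UNIV g" "\<And>y. y \<notin> cbox a b \<Longrightarrow> g y = 0"
  shows "integral (cbox a b) g = (LINT y|lborel. g y)"
proof -
  have "set_integrable lborel (cbox a b) g"
    unfolding set_integrable_def
    by (rule borel_integrable_compact[OF compact_cbox]) (use assms(1) continuous_on_subset in blast)
  then have "integral (cbox a b) g = (LINT y:cbox a b|lborel. g y)"
    by (simp add: set_borel_integral_eq_integral(2))
  also have "\<dots> = (LINT y|lborel. g y)"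
    unfolding set_lebesgue_integral_def
    by (rule Bochner_Integration.integral_cong) (use assms(2) in \<open>auto simp: indicator_def\<close>)
  finally show ?thesis .
qed

text \<open>The convolution is used in two forms. With the kernel shifted it is smooth although
  \<open>f\<close> is merely C1. With \<open>f\<close> shifted the derivative falls on
  \<open>f\<close>, so the gradient of the convolution is the convolution of the gradient, which is
  close to the gradient by uniform continuity.\<close>

lemma mollify:
  fixes f :: "real^3 \<Rightarrow> real" and f' :: "3 \<Rightarrow> real^3 \<Rightarrow> real"
  assumes \<Omega>: "open \<Omega>" and f: "continuous_on UNIV f" and f': "\<And>j. continuous_on UNIV (f' j)"
    and d: "\<And>j x. hpd j f (f' j x) x"
    and K: "compact K" "K \<subseteq> \<Omega>" "\<And>x. x \<notin> K \<Longrightarrow> f x = 0" "\<And>j x. x \<notin> K \<Longrightarrow> f' j x = 0"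
    and e: "e > 0"
  obtains \<phi> where "test_function \<Omega> \<phi>" "\<And>x. \<bar>\<phi> x - f x\<bar> \<le> e" "\<And>j x. \<bar>pd j \<phi> x - f' j x\<bar> \<le> e"
proof -
  obtain d0 where d0: "d0 > 0" "\<And>x z. norm z \<le> d0 \<Longrightarrow> \<bar>f (x + z) - f x\<bar> < e"
    using uniformly_continuous_compact_support[OF f K(1,3) e] by blast
  have "\<forall>j. \<exists>d>0. \<forall>x z. norm z \<le> d \<longrightarrow> \<bar>f' j (x + z) - f' j x\<bar> < e"
    using uniformly_continuous_compact_support[OF f' K(1,4) e] by metis
  then obtain dj where dj: "\<And>j. dj j > 0" "\<And>j x z. norm z \<le> dj j \<Longrightarrow> \<bar>f' j (x + z) - f' j x\<bar> < e"
    by metis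
  obtain d1 where d1: "d1 > 0" "(\<Union>x\<in>K. cball x d1) \<subseteq> \<Omega>"
    using compact_subset_open_imp_cball_epsilon_subset[OF K(1) \<Omega> K(2)] by blast
  \<comment> \<open>One radius for everything: uniform continuity of \<open>f\<close> and of each
    \<open>f' j\<close> at scale \<open>e\<close>, and room around \<open>K\<close> inside
    \<Omega>.\<close>
  define D where "D = Min (insert d0 (insert d1 (range dj)))"
  have D: "D > 0" "D \<le> d0" "D \<le> d1" "\<And>j. D \<le> dj j"
  proof -
    have fin: "finite (insert d0 (insert d1 (range dj)))" by simp
    show "D \<le> d0" "D \<le> d1" "\<And>j. D \<le> dj j" unfolding D_def by (rule Min_le[OF fin], simp)+
    show "D > 0" unfolding D_def using d0(1) d1(1) dj(1) fin by (subst Min_gr_iff) auto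
  qed
  define r where "r = D / 3"
  have r: "r > 0" "3 * r = D" using D by (auto simp: r_def)
  define c where "c = (LINT x|lborel. bump r x)"
  have c: "c > 0" unfolding c_def by (rule integral_bump_pos[OF r(1)])
  define \<rho> where "\<rho> = (\<lambda>x. (1/c) * bump r x)"
  have fg: "flat_generated \<rho>" unfolding \<rho>_def by (intro flat_generated.intros flat_generated_bump)
  have c\<rho>: "continuous_on UNIV \<rho>" by (rule flat_generated_continuous[OF fg])
  have \<rho>0: "\<rho> x = 0" if "norm x \<ge> D" for x using bump_eq_0[of r x] that r by (simp add: \<rho>_def)
  have \<rho>nn: "\<rho> x \<ge> 0" for x using bump_nonneg c by (simp add: \<rho>_def)
  have \<rho>m: "\<rho> (- x) = \<rho> x" for x by (simp add: \<rho>_def bump_minus)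
  have \<rho>i: "integrable lborel \<rho>" unfolding \<rho>_def using integrable_bump by simp
  have \<rho>1: "(LINT x|lborel. \<rho> x) = 1" unfolding \<rho>_def using c by (simp add: c_def[symmetric])
  obtain a b where ab: "K \<subseteq> cbox a b" using bounded_subset_cbox_symmetric[OF compact_imp_bounded[OF K(1)]] by metis
  \<comment> \<open>This box contains the support of the kernel and does not depend on
    \<open>x\<close>, as differentiation in the form with shifted \<open>f\<close> requires.\<close>
  obtain a' b' where ab': "cball 0 D \<subseteq> cbox a' (b'::real^3)" using bounded_subset_cbox_symmetric[OF bounded_cball] by metis
  define conv where "conv = (\<lambda>g x. integral (cbox a b) (\<lambda>y. g y * \<rho> (x - y)))"
  have conv_lborel: "conv g x = (LINT z|lborel. g (x + z) * \<rho> z)"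
    and conv_alt: "conv g x = integral (cbox a' b') (\<lambda>z. g (x + z) * \<rho> z)"
    and conv_int: "integrable lborel (\<lambda>z. g (x + z) * \<rho> z)"
    if g: "continuous_on UNIV g" "\<And>x. x \<notin> K \<Longrightarrow> g x = 0" for g x
  proof -
    have cg: "continuous_on UNIV (\<lambda>y. g y * \<rho> (x - y))"
      by (intro continuous_intros g(1) continuous_on_compose2[OF c\<rho>]) auto
    have cg2: "continuous_on UNIV (\<lambda>z. g (x + z) * \<rho> z)"
      by (intro continuous_intros c\<rho> continuous_on_compose2[OF g(1)]) auto
    have "conv g x = (LINT y|lborel. g y * \<rho> (x - y))"
      unfolding conv_def by (rule integral_cbox_eq_lborel[OF cg]) (use g(2) ab in auto)
    also have "\<dots> = (LINT z|lborel. g (x + z) * \<rho> (x - (x + z)))"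
      by (rule lborel_integral_translate[symmetric]) (use cg borel_measurable_continuous_onI in blast)
    finally show 1: "conv g x = (LINT z|lborel. g (x + z) * \<rho> z)" by (simp add: \<rho>m)
    have zero: "g (x + z) * \<rho> z = 0" if "z \<notin> cball 0 D" for z using that \<rho>0[of z] by simp
    show "conv g x = integral (cbox a' b') (\<lambda>z. g (x + z) * \<rho> z)"
      unfolding 1 by (rule integral_cbox_eq_lborel[OF cg2, symmetric]) (use zero ab' in blast)
    show "integrable lborel (\<lambda>z. g (x + z) * \<rho> z)"
      by (rule integrable_continuous_compact_support[OF cg2 compact_cball zero])
  qed
  have near: "\<bar>conv g x - g x\<bar> \<le> e"
    if g: "continuous_on UNIV g" "\<And>x. x \<notin> K \<Longrightarrow> g x = 0" and u: "\<And>x z. norm z \<le> D \<Longrightarrow> \<bar>g (x + z) - g x\<bar> < e" for g x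
  proof -
    have "conv g x - g x = (LINT z|lborel. g (x + z) * \<rho> z) - (LINT z|lborel. g x * \<rho> z)"
      by (simp add: conv_lborel[OF g] \<rho>1)
    also have "\<dots> = (LINT z|lborel. g (x + z) * \<rho> z - g x * \<rho> z)"
      by (rule Bochner_Integration.integral_diff[symmetric]) (use conv_int[OF g] \<rho>i in auto)
    finally have "\<bar>conv g x - g x\<bar> \<le> (LINT z|lborel. norm (g (x + z) * \<rho> z - g x * \<rho> z))"
      using integral_norm_bound[of lborel "\<lambda>z. g (x + z) * \<rho> z - g x * \<rho> z"] by simp
    also have "\<dots> \<le> (LINT z|lborel. e * \<rho> z)"
    proof (rule integral_mono)
      fix z
      show "norm (g (x + z) * \<rho> z - g x * \<rho> z) \<le> e * \<rho> z"
      proof (cases "norm z \<le> D")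
        case True
        then show ?thesis using u[OF True, of x] \<rho>nn[of z]
          by (simp add: left_diff_distrib[symmetric] abs_mult mult_right_mono)
      next
        case False
        then show ?thesis using \<rho>0[of z] by simp
      qed
    qed (use conv_int[OF g] \<rho>i in auto)
    also have "\<dots> = e" by (simp add: \<rho>1)
    finally show ?thesis .
  qed
  have hp: "hpd j (conv f) (conv (f' j) x) x" for j x
  proof -
    let ?e = "axis j 1 :: real^3"
    have "((\<lambda>h. integral (cbox a' b') (\<lambda>z. f (x + h *\<^sub>R ?e + z) * \<rho> z)) has_vector_derivative
        integral (cbox a' b') (\<lambda>z. f' j (x + 0 *\<^sub>R ?e + z) * \<rho> z)) (at 0 within UNIV)"
    proof (rule leibniz_rule_vector_derivative)
      fix h z
      have "((\<lambda>h. f (x + z + h *\<^sub>R ?e)) has_vector_derivative f' j (x + z + h *\<^sub>R ?e)) (at h)"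
        by (rule hpd_shift[OF d])
      then have "((\<lambda>h. f (x + h *\<^sub>R ?e + z)) has_vector_derivative f' j (x + h *\<^sub>R ?e + z)) (at h)"
        by (simp add: algebra_simps)
      then show "((\<lambda>h. f (x + h *\<^sub>R ?e + z) * \<rho> z) has_vector_derivative f' j (x + h *\<^sub>R ?e + z) * \<rho> z) (at h within UNIV)"
        by (rule has_vector_derivative_mult_left)
    next
      fix h show "(\<lambda>z. f (x + h *\<^sub>R ?e + z) * \<rho> z) integrable_on cbox a' b'"
        by (intro integrable_continuous continuous_intros continuous_on_compose2[OF f] continuous_on_subset[OF c\<rho>]) auto
    next
      show "continuous_on (UNIV \<times> cbox a' b') (\<lambda>(h, z). f' j (x + h *\<^sub>R ?e + z) * \<rho> z)"
        unfolding split_beta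
        by (intro continuous_intros continuous_on_compose2[OF f'] continuous_on_compose2[OF c\<rho>]) auto
    qed auto
    then show ?thesis by (simp add: hpd_def conv_alt[OF f K(3)] conv_alt[OF f' K(4)])
  qed
  \<comment> \<open>The support grows by at most \<open>D\<close>, and \<open>D \<le> d1\<close>
    keeps it inside \<Omega>.\<close>
  have supp: "x \<in> (\<Union>x\<in>K. cball x D)" if "conv f x \<noteq> 0" for x
  proof (rule ccontr)
    assume x: "x \<notin> (\<Union>x\<in>K. cball x D)"
    have "f y * \<rho> (x - y) = 0" for y
    proof (cases "y \<in> K")
      case True
      then have "norm (x - y) > D" using x by (auto simp: dist_norm norm_minus_commute)
      then show ?thesis using \<rho>0 by simp
    qed (use K(3) in auto)
    then have "conv f x = integral (cbox a b) (\<lambda>y. 0)"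
      unfolding conv_def by (intro Henstock_Kurzweil_Integration.integral_cong)
    then show False using that by simp
  qed
  have "compact (\<Union>x\<in>K. cball x D)"
  proof -
    have eq: "(\<Union>x\<in>K. cball x D) = {x + y |x y. x \<in> K \<and> y \<in> cball 0 D}"
    proof (intro set_eqI iffI)
      fix z assume "z \<in> (\<Union>x\<in>K. cball x D)"
      then obtain x where "x \<in> K" "dist x z \<le> D" by auto
      then show "z \<in> {x + y |x y. x \<in> K \<and> y \<in> cball 0 D}"
        by (intro CollectI exI[of _ x] exI[of _ "z - x"]) (auto simp: dist_norm norm_minus_commute)
    next
      fix z assume "z \<in> {x + y |x y. x \<in> K \<and> y \<in> cball 0 D}"
      then obtain x y where "x \<in> K" "norm y \<le> D" "z = x + y" by auto
      then show "z \<in> (\<Union>x\<in>K. cball x D)" by (intro UN_I[of x]) (auto simp: dist_norm)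
    qed
    show ?thesis unfolding eq by (rule compact_sums[OF K(1) compact_cball])
  qed
  then have cl: "closure {x. conv f x \<noteq> 0} \<subseteq> (\<Union>x\<in>K. cball x D)"
    using supp by (intro closure_minimal) (auto intro: compact_imp_closed)
  have "(\<Union>x\<in>K. cball x D) \<subseteq> \<Omega>"
    by (rule subset_trans[OF UN_mono[OF order_refl subset_cball[OF D(3)]] d1(2)])
  then have "closure {x. conv f x \<noteq> 0} \<subseteq> \<Omega>" by (rule subset_trans[OF cl])
  moreover have "compact (closure {x. conv f x \<noteq> 0})"
    using bounded_subset[OF compact_imp_bounded[OF \<open>compact (\<Union>x\<in>K. cball x D)\<close>] cl]
    by (simp add: compact_eq_bounded_closed)
  moreover have "smooth_on UNIV (conv f)"
    unfolding smooth_on_def conv_def by (intro allI convolution_Ck[OF f fg])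
  ultimately have T: "test_function \<Omega> (conv f)" by (simp add: test_function_def)
  show thesis
  proof (rule that[OF T])
    show "\<bar>conv f x - f x\<bar> \<le> e" for x by (rule near[OF f K(3)]) (use d0(2) D(2) in auto)
    have "\<bar>conv (f' j) x - f' j x\<bar> \<le> e" for j x
      by (rule near[OF f' K(4)]) (assumption, rule dj(2), use D(4)[of j] in linarith)
    then show "\<bar>pd j (conv f) x - f' j x\<bar> \<le> e" for j x using hpd_imp_pd[OF hp] by simp
  qed
qed

section \<open>Vanishing boundary values and Sobolev spaces\<close>

text \<open>On a bounded open set this gives integrability, and the class is stable under products,
  conjugation and real and imaginary parts. It spares carrying continuous extensions to the closure
  through every computation.\<close>

definition bc :: "(real^3) set \<Rightarrow> (real^3 \<Rightarrow> 'a::real_normed_vector) \<Rightarrow> bool" where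
  "bc \<Omega> f \<longleftrightarrow> continuous_on \<Omega> f \<and> bounded (f ` \<Omega>)"

lemma bc_bound: assumes "bc \<Omega> f" obtains B where "B > 0" "\<And>x. x \<in> \<Omega> \<Longrightarrow> norm (f x) \<le> B"
  using assms unfolding bc_def bounded_pos by auto

lemma bcI: "continuous_on \<Omega> f \<Longrightarrow> (\<And>x. x \<in> \<Omega> \<Longrightarrow> norm (f x) \<le> B) \<Longrightarrow> bc \<Omega> f"
  unfolding bc_def bounded_iff by auto

lemma bc_cong: "bc \<Omega> f \<Longrightarrow> (\<And>x. x \<in> \<Omega> \<Longrightarrow> f x = g x) \<Longrightarrow> bc \<Omega> g"
  unfolding bc_def by (metis (no_types, lifting) continuous_on_cong image_cong)

lemma bc_const [simp]: "bc \<Omega> (\<lambda>_. c)"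
  by (rule bcI[of _ _ "norm c"]) auto

lemma bc_linear: "bounded_linear L \<Longrightarrow> bc \<Omega> f \<Longrightarrow> bc \<Omega> (\<lambda>x. L (f x))"
  unfolding bc_def
  by (auto intro: bounded_linear.continuous_on dest: bounded_linear_image simp: image_image[symmetric, of L f])

lemma bc_add: "bc \<Omega> f \<Longrightarrow> bc \<Omega> g \<Longrightarrow> bc \<Omega> (\<lambda>x. f x + g x)"
  unfolding bc_def by (auto intro: continuous_on_add bounded_plus_comp)

lemma bc_minus: "bc \<Omega> f \<Longrightarrow> bc \<Omega> (\<lambda>x. - f x)"
  by (rule bc_linear[OF bounded_linear_minus[OF bounded_linear_ident]])

lemma bc_diff: "bc \<Omega> f \<Longrightarrow> bc \<Omega> g \<Longrightarrow> bc \<Omega> (\<lambda>x. f x - g x)"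
  using bc_add[OF _ bc_minus, of \<Omega> f g] by simp

lemma bc_mult:
  fixes f g :: "real^3 \<Rightarrow> 'a::real_normed_algebra"
  assumes f: "bc \<Omega> f" and g: "bc \<Omega> g" shows "bc \<Omega> (\<lambda>x. f x * g x)"
proof -
  obtain A where A: "A > 0" "\<And>x. x \<in> \<Omega> \<Longrightarrow> norm (f x) \<le> A" using bc_bound[OF f] by blast
  obtain B where B: "B > 0" "\<And>x. x \<in> \<Omega> \<Longrightarrow> norm (g x) \<le> B" using bc_bound[OF g] by blast
  show ?thesis
  proof (rule bcI[of _ _ "A * B"])
    show "continuous_on \<Omega> (\<lambda>x. f x * g x)" using f g by (auto simp: bc_def intro: continuous_on_mult)
    show "norm (f x * g x) \<le> A * B" if "x \<in> \<Omega>" for x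
      using A B that by (intro order_trans[OF norm_mult_ineq] mult_mono) (auto intro: less_imp_le)
  qed
qed

lemma bc_cnj: "bc \<Omega> f \<Longrightarrow> bc \<Omega> (\<lambda>x. cnj (f x))" by (rule bc_linear[OF bounded_linear_cnj])
lemma bc_Re: "bc \<Omega> f \<Longrightarrow> bc \<Omega> (\<lambda>x. Re (f x))" by (rule bc_linear[OF bounded_linear_Re])
lemma bc_Im: "bc \<Omega> f \<Longrightarrow> bc \<Omega> (\<lambda>x. Im (f x))" by (rule bc_linear[OF bounded_linear_Im])
lemma bc_of_real: "bc \<Omega> f \<Longrightarrow> bc \<Omega> (\<lambda>x. of_real (f x) :: complex)" by (rule bc_linear[OF bounded_linear_of_real])

lemma bc_sum: "(\<And>i. i \<in> I \<Longrightarrow> bc \<Omega> (f i)) \<Longrightarrow> bc \<Omega> (\<lambda>x. \<Sum>i\<in>I. f i x)"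
  by (induction I rule: infinite_finite_induct) (auto intro: bc_add)

lemma bc_power: "bc \<Omega> f \<Longrightarrow> bc \<Omega> (\<lambda>x. f x ^ n)" for f :: "real^3 \<Rightarrow> 'a::{real_normed_algebra_1}"
  by (induction n) (auto intro: bc_mult)

lemma bc_norm_square: "bc \<Omega> f \<Longrightarrow> bc \<Omega> (\<lambda>x. (norm (f x))\<^sup>2)"
proof -
  assume f: "bc \<Omega> f"
  obtain A where A: "A > 0" "\<And>x. x \<in> \<Omega> \<Longrightarrow> norm (f x) \<le> A" using bc_bound[OF f] by blast
  show ?thesis
    by (rule bcI[of _ _ "A\<^sup>2"])
      (use f A in \<open>auto simp: bc_def intro!: continuous_intros power_mono\<close>)
qed

lemmas bc_intros = bc_const bc_add bc_minus bc_diff bc_mult bc_cnj bc_Re bc_Im bc_of_real bc_sum bc_power bc_norm_square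

lemma bc_closure:
  assumes "bounded \<Omega>" "continuous_on (closure \<Omega>) f" shows "bc \<Omega> f"
proof -
  have "bounded (f ` closure \<Omega>)"
    using assms by (intro compact_imp_bounded compact_continuous_image) (auto simp: compact_closure)
  then show ?thesis using assms closure_subset unfolding bc_def
    by (meson bounded_subset continuous_on_subset image_mono)
qed

lemma bc_measurable:
  fixes f :: "real^3 \<Rightarrow> 'a::{banach,second_countable_topology}"
  assumes "open \<Omega>" "bc \<Omega> f" shows "(\<lambda>x. indicator \<Omega> x *\<^sub>R f x) \<in> borel_measurable lborel"
  using borel_measurable_continuous_on_indicator[of \<Omega> f] assms by (simp add: bc_def)

lemma emeasure_lborel_open_bounded:
  assumes "open \<Omega>" "bounded \<Omega>" shows "emeasure lborel \<Omega> < \<infinity>"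
  using emeasure_bounded_finite[OF assms(2)] by simp

lemma bc_set_integrable:
  fixes f :: "real^3 \<Rightarrow> 'a::{banach,second_countable_topology}"
  assumes \<Omega>: "open \<Omega>" "bounded \<Omega>" and f: "bc \<Omega> f" shows "set_integrable lborel \<Omega> f"
proof -
  obtain A where A: "A > 0" "\<And>x. x \<in> \<Omega> \<Longrightarrow> norm (f x) \<le> A" using bc_bound[OF f] by blast
  show ?thesis unfolding set_integrable_def
    by (rule integrableI_bounded_set[where A=\<Omega> and B=A])
      (use A \<Omega> bc_measurable[OF \<Omega>(1) f] emeasure_lborel_open_bounded[OF \<Omega>] in \<open>auto simp: indicator_def\<close>)
qed

lemma bc_dominated_convergence:
  fixes f :: "real^3 \<Rightarrow> real"
  assumes \<Omega>: "open \<Omega>" "bounded \<Omega>" and s: "\<And>n. bc \<Omega> (s n)" and f: "bc \<Omega> f"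
    and B: "\<And>n x. x \<in> \<Omega> \<Longrightarrow> \<bar>s n x\<bar> \<le> B"
    and lim: "AE x in lborel. x \<in> \<Omega> \<longrightarrow> (\<lambda>n. s n x) \<longlonglongrightarrow> f x"
  shows "(\<lambda>n. LINT x:\<Omega>|lborel. s n x) \<longlonglongrightarrow> (LINT x:\<Omega>|lborel. f x)"
  unfolding set_lebesgue_integral_def
proof (rule integral_dominated_convergence[where w="\<lambda>x. B * indicator \<Omega> x"])
  show "(\<lambda>x. indicator \<Omega> x *\<^sub>R f x) \<in> borel_measurable lborel" by (rule bc_measurable[OF \<Omega>(1) f])
  show "(\<lambda>x. indicator \<Omega> x *\<^sub>R s n x) \<in> borel_measurable lborel" for n by (rule bc_measurable[OF \<Omega>(1) s])
  show "integrable lborel (\<lambda>x. B * indicator \<Omega> x)"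
    using \<Omega> emeasure_lborel_open_bounded[OF \<Omega>] by (intro integrable_mult_right integrable_real_indicator) auto
  show "AE x in lborel. (\<lambda>n. indicator \<Omega> x *\<^sub>R s n x) \<longlonglongrightarrow> indicator \<Omega> x *\<^sub>R f x"
    using lim by eventually_elim (auto simp: indicator_def)
  show "AE x in lborel. norm (indicator \<Omega> x *\<^sub>R s n x) \<le> B * indicator \<Omega> x" for n
    using B by (auto simp: indicator_def)
qed

lemma negligible_imp_AE_lborel:
  assumes "negligible N" shows "AE x in lborel. x \<notin> N"
proof -
  have "N \<in> null_sets (completion lborel)"
    by (rule iffD1[OF negligible_iff_null_sets assms])
  then obtain N' where N': "N' \<in> null_sets lborel" "N \<subseteq> N'"
    by (auto simp: null_sets_completion_iff2)
  show ?thesis by (rule AE_I'[OF N'(1)]) (use N'(2) in auto)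
qed

text \<open>Apply \<open>integral_hpd_eq_0\<close> to the truncations of \<open>g\<close> and let
  the level tend to 0. Their derivatives converge to \<open>g'\<close> where \<open>g\<close> is
  nonzero, and also where \<open>g\<close> and \<open>g'\<close> both vanish; the remaining points
  form a negligible set.\<close>

lemma integral_gradient_eq_0:
  fixes g g' :: "real^3 \<Rightarrow> real"
  assumes \<Omega>: "open \<Omega>" "bounded \<Omega>" and g: "continuous_on (closure \<Omega>) g"
    and g0: "\<And>x. x \<in> frontier \<Omega> \<Longrightarrow> g x = 0"
    and d: "\<And>x. x \<in> \<Omega> \<Longrightarrow> hpd j g (g' x) x" and g': "bc \<Omega> g'"
  shows "(LINT x:\<Omega>|lborel. g' x) = 0"
proof -
  define e where "e = (\<lambda>n. 1 / real (Suc n))"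
  have e: "e n > 0" for n by (simp add: e_def)
  have e0: "e \<longlonglongrightarrow> 0" unfolding e_def using LIMSEQ_inverse_real_of_nat by (simp add: inverse_eq_divide)
  have c': "continuous_on \<Omega> g'" using g' by (simp add: bc_def)
  have gc: "continuous_on \<Omega> g" by (rule continuous_on_subset[OF g closure_subset])
  obtain B where B: "B > 0" "\<And>x. x \<in> \<Omega> \<Longrightarrow> norm (g' x) \<le> B" by (rule bc_bound[OF g'], rule that)
  have zero: "(LINT x:\<Omega>|lborel. trunc' (e n) (g x) * g' x) = 0" for n
  proof -
    have "(LINT x|lborel. ext0 \<Omega> (\<lambda>x. trunc' (e n) (g x) * g' x) x) = 0"
      by (rule integral_hpd_eq_0[OF continuous_ext0_trunc[OF \<Omega> e g g0] continuous_ext0_trunc'[OF \<Omega> e g g0 c']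
            hpd_ext0_trunc[OF \<Omega> e g g0 d] trunc_compact[OF \<Omega> e g g0]
            trunc_outside[OF \<Omega> e g g0] trunc'_outside[OF \<Omega> e g g0]])
    also have "ext0 \<Omega> (\<lambda>x. trunc' (e n) (g x) * g' x) = (\<lambda>x. indicator \<Omega> x *\<^sub>R (trunc' (e n) (g x) * g' x))"
      by (auto simp: ext0_def indicator_def)
    finally show ?thesis by (simp add: set_lebesgue_integral_def)
  qed
  have "(\<lambda>n. LINT x:\<Omega>|lborel. trunc' (e n) (g x) * g' x) \<longlonglongrightarrow> (LINT x:\<Omega>|lborel. g' x)"
  proof (rule bc_dominated_convergence[OF \<Omega> _ g', where B="6 * B"])
    show b: "\<bar>trunc' (e n) (g x) * g' x\<bar> \<le> 6 * B" if "x \<in> \<Omega>" for n x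
      unfolding abs_mult using B that trunc'_bound[OF e] by (intro mult_mono) auto
    show "bc \<Omega> (\<lambda>x. trunc' (e n) (g x) * g' x)" for n
      by (rule bcI[of _ _ "6 * B"])
        (auto intro!: continuous_on_mult c' continuous_on_compose2[OF continuous_trunc'[OF e] gc] b[simplified])
    have "AE x in lborel. x \<notin> {x\<in>\<Omega>. g x = 0 \<and> g' x \<noteq> 0}"
      by (rule negligible_imp_AE_lborel[OF negligible_regular_zero_set[OF \<Omega>(1) gc c' d]])
    then show "AE x in lborel. x \<in> \<Omega> \<longrightarrow> (\<lambda>n. trunc' (e n) (g x) * g' x) \<longlonglongrightarrow> g' x"
    proof eventually_elim
      case (elim x)
      show ?case
      proof
        assume x: "x \<in> \<Omega>"
        show "(\<lambda>n. trunc' (e n) (g x) * g' x) \<longlonglongrightarrow> g' x"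
        proof (cases "g x = 0")
          case False
          from tendsto_mult[OF trunc'_tendsto[OF e0 False] tendsto_const, of "g' x"] show ?thesis by simp
        qed (use elim x in auto)
      qed
    qed
  qed
  then have "(\<lambda>n. 0) \<longlonglongrightarrow> (LINT x:\<Omega>|lborel. g' x)" by (simp only: zero)
  then show ?thesis by (simp add: LIMSEQ_const_iff)
qed

lemma test_function_hpd:
  assumes "test_function \<Omega> \<phi>"
  shows "continuous_on UNIV \<phi>" "hpd j \<phi> (pd j \<phi> x) x" "continuous_on UNIV (pd j \<phi>)"
proof -
  have "Ck_on (Suc 0) UNIV \<phi>" using assms unfolding test_function_def smooth_on_def by blast
  then show "continuous_on UNIV \<phi>" "hpd j \<phi> (pd j \<phi> x) x" "continuous_on UNIV (pd j \<phi>)"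
    by (auto intro: pdiff_imp_hpd)
qed

text \<open>This is \<open>integral_gradient_eq_0\<close> for \<open>g x * \<phi> x\<close>, which
  inherits the zero boundary values of \<open>g\<close>.\<close>

lemma vanishing_trace_weak_gradient:
  fixes g :: "real^3 \<Rightarrow> real"
  assumes \<Omega>: "open \<Omega>" "bounded \<Omega>" and g: "continuous_on (closure \<Omega>) g"
    and g0: "\<And>x. x \<in> frontier \<Omega> \<Longrightarrow> g x = 0"
    and d: "\<And>j x. x \<in> \<Omega> \<Longrightarrow> hpd j g (G j x) x" and G: "\<And>j. bc \<Omega> (G j)"
  shows "weak_gradient \<Omega> g G"
  unfolding weak_gradient_def
proof (intro allI conjI impI)
  fix j
  show "L2_fun \<Omega> (G j)" unfolding L2_fun_def set_borel_measurable_def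
    using bc_measurable[OF \<Omega>(1) G] bc_set_integrable[OF \<Omega> bc_power[OF G]] by auto
  fix \<phi> assume t: "test_function \<Omega> \<phi>"
  note \<phi> = test_function_hpd[OF t]
  have bg: "bc \<Omega> g" by (rule bc_closure[OF \<Omega>(2) g])
  have b\<phi>: "bc \<Omega> \<phi>" by (rule bc_closure[OF \<Omega>(2) continuous_on_subset[OF \<phi>(1) subset_UNIV]])
  have b\<phi>': "bc \<Omega> (pd j \<phi>)" by (rule bc_closure[OF \<Omega>(2) continuous_on_subset[OF \<phi>(3) subset_UNIV]])
  have "(LINT x:\<Omega>|lborel. g x * pd j \<phi> x + G j x * \<phi> x) = 0"
  proof (rule integral_gradient_eq_0[OF \<Omega>, of "\<lambda>x. g x * \<phi> x"])
    show "continuous_on (closure \<Omega>) (\<lambda>x. g x * \<phi> x)"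
      by (intro continuous_on_mult g continuous_on_subset[OF \<phi>(1)]) auto
    show "hpd j (\<lambda>x. g x * \<phi> x) (g x * pd j \<phi> x + G j x * \<phi> x) x" if "x \<in> \<Omega>" for x
      by (rule hpd_mult[OF d[OF that] \<phi>(2)])
  qed (use g0 in \<open>auto intro!: bc_intros bg b\<phi> b\<phi>' G\<close>)
  moreover have "(LINT x:\<Omega>|lborel. g x * pd j \<phi> x + G j x * \<phi> x)
      = (LINT x:\<Omega>|lborel. g x * pd j \<phi> x) + (LINT x:\<Omega>|lborel. G j x * \<phi> x)"
    by (intro set_integral_add bc_set_integrable[OF \<Omega>] bc_intros bg b\<phi> b\<phi>' G)
  ultimately show "(LINT x:\<Omega>|lborel. g x * pd j \<phi> x) = - (LINT x:\<Omega>|lborel. G j x * \<phi> x)" by simp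
qed

text \<open>The approximating test functions are mollified truncations, with truncation level and
  mollification error both equal to \<open>e n\<close>. The mean square convergence of the gradients
  again rests on \<open>negligible_regular_zero_set\<close>.\<close>

lemma vanishing_trace_W0_12:
  fixes g :: "real^3 \<Rightarrow> real"
  assumes \<Omega>: "open \<Omega>" "bounded \<Omega>" and g: "continuous_on (closure \<Omega>) g"
    and g0: "\<And>x. x \<in> frontier \<Omega> \<Longrightarrow> g x = 0"
    and d: "\<And>j x. x \<in> \<Omega> \<Longrightarrow> hpd j g (G j x) x" and G: "\<And>j. bc \<Omega> (G j)"
  shows "W0_12 \<Omega> g"
proof -
  define e where "e = (\<lambda>n. 1 / real (Suc n))"
  have e: "e n > 0" "e n \<le> 1" for n by (auto simp: e_def)
  have e0: "e \<longlonglongrightarrow> 0" unfolding e_def using LIMSEQ_inverse_real_of_nat by (simp add: inverse_eq_divide)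
  have gc: "continuous_on \<Omega> g" by (rule continuous_on_subset[OF g closure_subset])
  have bg: "bc \<Omega> g" by (rule bc_closure[OF \<Omega>(2) g])
  have c': "continuous_on \<Omega> (G j)" for j using G by (simp add: bc_def)
  have "\<exists>\<phi>. test_function \<Omega> \<phi> \<and> (\<forall>x\<in>\<Omega>. \<bar>\<phi> x - trunc (e n) (g x)\<bar> \<le> e n) \<and>
      (\<forall>j. \<forall>x\<in>\<Omega>. \<bar>pd j \<phi> x - trunc' (e n) (g x) * G j x\<bar> \<le> e n)" for n
  proof -
    note t = \<Omega> e(1)[of n] g g0
    obtain \<phi> where \<phi>: "test_function \<Omega> \<phi>" "\<And>x. \<bar>\<phi> x - ext0 \<Omega> (\<lambda>x. trunc (e n) (g x)) x\<bar> \<le> e n"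
      "\<And>j x. \<bar>pd j \<phi> x - ext0 \<Omega> (\<lambda>x. trunc' (e n) (g x) * G j x) x\<bar> \<le> e n"
    proof (rule mollify[where K="{x\<in>closure \<Omega>. e n \<le> \<bar>g x\<bar>}" and f'="\<lambda>j. ext0 \<Omega> (\<lambda>x. trunc' (e n) (g x) * G j x)"])
      show "open \<Omega>" "e n > 0" using \<Omega> e by auto
      show "continuous_on UNIV (ext0 \<Omega> (\<lambda>x. trunc (e n) (g x)))" by (rule continuous_ext0_trunc[OF t])
      show "continuous_on UNIV (ext0 \<Omega> (\<lambda>x. trunc' (e n) (g x) * G j x))" for j
        by (rule continuous_ext0_trunc'[OF t c'])
      show "hpd j (ext0 \<Omega> (\<lambda>x. trunc (e n) (g x))) (ext0 \<Omega> (\<lambda>x. trunc' (e n) (g x) * G j x) x) x" for j x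
        by (rule hpd_ext0_trunc[OF t d])
      show "compact {x\<in>closure \<Omega>. e n \<le> \<bar>g x\<bar>}" by (rule trunc_compact[OF t])
      show "{x\<in>closure \<Omega>. e n \<le> \<bar>g x\<bar>} \<subseteq> \<Omega>" by (rule trunc_subset[OF t])
      show "ext0 \<Omega> (\<lambda>x. trunc (e n) (g x)) x = 0" if "x \<notin> {x\<in>closure \<Omega>. e n \<le> \<bar>g x\<bar>}" for x
        by (rule trunc_outside[OF t that])
      show "ext0 \<Omega> (\<lambda>x. trunc' (e n) (g x) * G j x) x = 0" if "x \<notin> {x\<in>closure \<Omega>. e n \<le> \<bar>g x\<bar>}" for j x
        by (rule trunc'_outside[OF t that])
    qed (rule that)
    have "\<bar>\<phi> x - trunc (e n) (g x)\<bar> \<le> e n" if "x \<in> \<Omega>" for x using \<phi>(2)[of x] that by (simp add: ext0_def)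
    moreover have "\<bar>pd j \<phi> x - trunc' (e n) (g x) * G j x\<bar> \<le> e n" if "x \<in> \<Omega>" for x j
      using \<phi>(3)[of j x] that by (simp add: ext0_def)
    ultimately show ?thesis using \<phi>(1) by blast
  qed
  then obtain \<phi> where \<phi>: "\<And>n. test_function \<Omega> (\<phi> n)"
    and \<phi>1: "\<And>n x. x \<in> \<Omega> \<Longrightarrow> \<bar>\<phi> n x - trunc (e n) (g x)\<bar> \<le> e n"
    and \<phi>2: "\<And>n j x. x \<in> \<Omega> \<Longrightarrow> \<bar>pd j (\<phi> n) x - trunc' (e n) (g x) * G j x\<bar> \<le> e n" by metis
  have b\<phi>: "bc \<Omega> (\<phi> n)" for n
    by (rule bc_closure[OF \<Omega>(2) continuous_on_subset[OF test_function_hpd(1)[OF \<phi>] subset_UNIV]])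
  have b\<phi>': "bc \<Omega> (pd j (\<phi> n))" for n j
    by (rule bc_closure[OF \<Omega>(2) continuous_on_subset[OF test_function_hpd(3)[OF \<phi>] subset_UNIV]])
  \<comment> \<open>One \<open>e n\<close> comes from mollifying and four from truncating.\<close>
  have n1: "\<bar>\<phi> n x - g x\<bar> \<le> 5 * e n" if "x \<in> \<Omega>" for n x
    using \<phi>1[OF that, of n] trunc_near[OF e(1), of n "g x"] by linarith
  have sq: "(\<lambda>n. (a n)\<^sup>2) \<longlonglongrightarrow> 0" if "a \<longlonglongrightarrow> 0" for a :: "nat \<Rightarrow> real"
    using tendsto_power[OF that, of 2] by simp
  have sqb: "\<bar>a\<^sup>2\<bar> \<le> b\<^sup>2" if "\<bar>a\<bar> \<le> b" for a b :: real
    using power_mono[OF that abs_ge_zero, of 2] by simp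
  have "(\<lambda>n. LINT x:\<Omega>|lborel. (\<phi> n x - g x)\<^sup>2) \<longlonglongrightarrow> (LINT x:\<Omega>|lborel. 0)"
  proof (rule bc_dominated_convergence[OF \<Omega>, where B="5\<^sup>2"])
    show "\<bar>(\<phi> n x - g x)\<^sup>2\<bar> \<le> 5\<^sup>2" if "x \<in> \<Omega>" for n x
      by (rule sqb) (use n1[OF that, of n] e(2)[of n] in linarith)
    have "(\<lambda>n. \<phi> n x - g x) \<longlonglongrightarrow> 0" if "x \<in> \<Omega>" for x
      by (rule Lim_null_comparison[of _ "\<lambda>n. 5 * e n"])
        (use n1[OF that] tendsto_mult_right_zero[OF e0] in auto)
    then show "AE x in lborel. x \<in> \<Omega> \<longrightarrow> (\<lambda>n. (\<phi> n x - g x)\<^sup>2) \<longlonglongrightarrow> 0" using sq by blast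
  qed (auto intro!: bc_intros b\<phi> bg)
  then have A: "(\<lambda>n. LINT x:\<Omega>|lborel. (\<phi> n x - g x)\<^sup>2) \<longlonglongrightarrow> 0" by (simp add: set_lebesgue_integral_def)
  have "(\<lambda>n. LINT x:\<Omega>|lborel. (pd j (\<phi> n) x - G j x)\<^sup>2) \<longlonglongrightarrow> (LINT x:\<Omega>|lborel. 0)" for j
  proof -
    obtain B where B: "B > 0" "\<And>x. x \<in> \<Omega> \<Longrightarrow> norm (G j x) \<le> B" by (rule bc_bound[OF G[of j]], rule that)
    show ?thesis
    \<comment> \<open>The 7 collects 6 from \<open>trunc'_bound\<close> and 1 from
      \<open>G j\<close> itself; the summand 1 bounds \<open>e n\<close>.\<close>
    proof (rule bc_dominated_convergence[OF \<Omega>, where B="(1 + 7 * B)\<^sup>2"])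
      show "\<bar>(pd j (\<phi> n) x - G j x)\<^sup>2\<bar> \<le> (1 + 7 * B)\<^sup>2" if x: "x \<in> \<Omega>" for n x
      proof -
        have "\<bar>trunc' (e n) (g x) * G j x\<bar> \<le> 6 * B"
          unfolding abs_mult using B x trunc'_bound[OF e(1)] by (intro mult_mono) auto
        then have "\<bar>pd j (\<phi> n) x - G j x\<bar> \<le> 1 + 7 * B"
          using \<phi>2[OF x, of j n] e(2)[of n] B(2)[OF x] by simp
        then show ?thesis by (rule sqb)
      qed
      have "AE x in lborel. x \<notin> {x\<in>\<Omega>. g x = 0 \<and> G j x \<noteq> 0}"
        by (rule negligible_imp_AE_lborel[OF negligible_regular_zero_set[OF \<Omega>(1) gc c' d]])
      then show "AE x in lborel. x \<in> \<Omega> \<longrightarrow> (\<lambda>n. (pd j (\<phi> n) x - G j x)\<^sup>2) \<longlonglongrightarrow> 0"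
      proof eventually_elim
        case (elim x)
        show ?case
        proof
          assume x: "x \<in> \<Omega>"
          have "(\<lambda>n. trunc' (e n) (g x) * G j x) \<longlonglongrightarrow> G j x"
          proof (cases "g x = 0")
            case False
            from tendsto_mult[OF trunc'_tendsto[OF e0 False] tendsto_const, of "G j x"] show ?thesis by simp
          qed (use elim x in auto)
          then have "(\<lambda>n. trunc' (e n) (g x) * G j x - G j x) \<longlonglongrightarrow> 0" by (simp add: LIM_zero)
          moreover have "(\<lambda>n. pd j (\<phi> n) x - trunc' (e n) (g x) * G j x) \<longlonglongrightarrow> 0"
            by (rule Lim_null_comparison[OF _ e0]) (use \<phi>2[OF x] in auto)
          ultimately have "(\<lambda>n. (pd j (\<phi> n) x - trunc' (e n) (g x) * G j x) + (trunc' (e n) (g x) * G j x - G j x)) \<longlonglongrightarrow> 0 + 0"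
            by (intro tendsto_add)
          then show "(\<lambda>n. (pd j (\<phi> n) x - G j x)\<^sup>2) \<longlonglongrightarrow> 0" by (intro sq) simp
        qed
      qed
    qed (auto intro!: bc_intros b\<phi>' G)
  qed
  then have Bj: "(\<lambda>n. LINT x:\<Omega>|lborel. (pd j (\<phi> n) x - G j x)\<^sup>2) \<longlonglongrightarrow> 0" for j by (simp add: set_lebesgue_integral_def)
  have L: "L2_fun \<Omega> g" unfolding L2_fun_def set_borel_measurable_def
    using bc_measurable[OF \<Omega>(1) bg] bc_set_integrable[OF \<Omega> bc_power[OF bg]] by auto
  have W: "weak_gradient \<Omega> g G" by (rule vanishing_trace_weak_gradient[OF \<Omega> g g0 d G])
  show ?thesis unfolding W0_12_def
    by (intro conjI exI[of _ G] exI[of _ \<phi>] allI L W \<phi> A Bj)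
qed

section \<open>The weighted L2 pairing, integration by parts and the Poincare inequality\<close>

lemma cauchy_schwarz_bc:
  fixes p q :: "real^3 \<Rightarrow> real"
  assumes \<Omega>: "open \<Omega>" "bounded \<Omega>" and p: "bc \<Omega> p" and q: "bc \<Omega> q"
  shows "(LINT x:\<Omega>|lborel. p x * q x) \<le> sqrt (LINT x:\<Omega>|lborel. (p x)\<^sup>2) * sqrt (LINT x:\<Omega>|lborel. (q x)\<^sup>2)"
proof -
  define P Q I where "P = (LINT x:\<Omega>|lborel. (p x)\<^sup>2)" and "Q = (LINT x:\<Omega>|lborel. (q x)\<^sup>2)"
    and "I = (LINT x:\<Omega>|lborel. p x * q x)"
  note int = bc_set_integrable[OF \<Omega>]
  \<comment> \<open>Integrate the square of \<open>s * p x - t * q x\<close>. The generic case takes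
    \<open>s = sqrt Q\<close> and \<open>t = sqrt P\<close>; in the degenerate case one parameter is
    free and can be made arbitrarily large.\<close>
  have key: "2 * (s * t) * I \<le> s\<^sup>2 * P + t\<^sup>2 * Q" for s t
  proof -
    have "0 \<le> (LINT x:\<Omega>|lborel. (s * p x - t * q x)\<^sup>2)"
      unfolding set_lebesgue_integral_def by (rule Bochner_Integration.integral_nonneg) (simp add: indicator_def)
    also have "\<dots> = (LINT x:\<Omega>|lborel. (s\<^sup>2 * (p x)\<^sup>2 + t\<^sup>2 * (q x)\<^sup>2) - (2 * (s * t)) * (p x * q x))"
      by (intro arg_cong[where f="set_lebesgue_integral lborel \<Omega>"] ext) (simp add: power2_eq_square algebra_simps)
    also have "\<dots> = (LINT x:\<Omega>|lborel. s\<^sup>2 * (p x)\<^sup>2 + t\<^sup>2 * (q x)\<^sup>2) - (LINT x:\<Omega>|lborel. (2 * (s * t)) * (p x * q x))"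
      by (rule set_integral_diff(2)) (intro int bc_intros p q)+
    also have "(LINT x:\<Omega>|lborel. s\<^sup>2 * (p x)\<^sup>2 + t\<^sup>2 * (q x)\<^sup>2) = s\<^sup>2 * P + t\<^sup>2 * Q"
      unfolding P_def Q_def
      by (subst set_integral_add(2)) (intro int bc_intros p q | simp)+
    also have "(LINT x:\<Omega>|lborel. (2 * (s * t)) * (p x * q x)) = (2 * (s * t)) * I" by (simp add: I_def)
    finally show ?thesis by simp
  qed
  have nn: "P \<ge> 0" "Q \<ge> 0"
    unfolding P_def Q_def set_lebesgue_integral_def
    by (auto intro!: Bochner_Integration.integral_nonneg simp: indicator_def)
  have deg: "I \<le> 0" if "\<And>s::real. 2 * s * I \<le> c" for c
  proof (rule ccontr)
    assume "\<not> I \<le> 0"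
    then show False using that[of "(\<bar>c\<bar> + 1) / (2 * I)"] by simp
  qed
  have "I \<le> sqrt P * sqrt Q"
  proof (cases "P = 0 \<or> Q = 0")
    case True
    have "I \<le> 0"
    proof (cases "P = 0")
      case P: True
      show ?thesis by (rule deg[of Q]) (use key[of _ 1] P in simp)
    next
      case False
      then have "Q = 0" using True by simp
      then show ?thesis by (intro deg[of P]) (use key[of 1] in simp)
    qed
    then show ?thesis using True nn by auto
  next
    case False
    then have pos: "P > 0" "Q > 0" using nn by auto
    have "2 * (sqrt Q * sqrt P) * I \<le> 2 * (P * Q)" using key[of "sqrt Q" "sqrt P"] nn by simp
    also have "P * Q = (sqrt Q * sqrt P) * (sqrt P * sqrt Q)"
    proof -
      have "sqrt P * sqrt P = P" "sqrt Q * sqrt Q = Q" using nn by auto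
      moreover have "(sqrt Q * sqrt P) * (sqrt P * sqrt Q) = (sqrt P * sqrt P) * (sqrt Q * sqrt Q)" by (simp only: mult_ac)
      ultimately show ?thesis by simp
    qed
    finally have "(sqrt Q * sqrt P) * I \<le> (sqrt Q * sqrt P) * (sqrt P * sqrt Q)" by simp
    then show ?thesis by (rule mult_left_le_imp_le) (use pos in simp)
  qed
  then show ?thesis by (simp add: P_def Q_def I_def)
qed

definition ip :: "(real^3) set \<Rightarrow> (real^3 \<Rightarrow> real) \<Rightarrow> (real^3 \<Rightarrow> complex) \<Rightarrow> (real^3 \<Rightarrow> complex) \<Rightarrow> complex" where
  "ip \<Omega> a f g = (LINT x:\<Omega>|lborel. of_real (a x) * f x * cnj (g x))"

definition nn2 :: "(real^3) set \<Rightarrow> (real^3 \<Rightarrow> complex) \<Rightarrow> real" where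
  "nn2 \<Omega> f = sqrt (LINT x:\<Omega>|lborel. (cmod (f x))\<^sup>2)"

lemma hpd_linear: "bounded_linear L \<Longrightarrow> hpd j f d x \<Longrightarrow> hpd j (\<lambda>x. L (f x)) (L d) x"
  unfolding hpd_def by (rule bounded_linear.has_vector_derivative)

lemma hpd_diff: "hpd j f a x \<Longrightarrow> hpd j g b x \<Longrightarrow> hpd j (\<lambda>x. f x - g x) (a - b) x"
  unfolding hpd_def by (rule has_vector_derivative_diff)

lemma hpd_cmult: "hpd j f a x \<Longrightarrow> hpd j (\<lambda>x. c * f x) (c * a) x" for c :: "'a::real_normed_algebra"
  by (rule hpd_linear[OF bounded_linear_mult_right])

lemma set_integral_linear:
  fixes f :: "'a \<Rightarrow> 'b::{banach,second_countable_topology}" and L :: "'b \<Rightarrow> 'c::{banach,second_countable_topology}"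
  assumes "bounded_linear L" "set_integrable M A f"
  shows "(LINT x:A|M. L (f x)) = L (LINT x:A|M. f x)"
proof -
  have "(LINT x|M. L (indicator A x *\<^sub>R f x)) = L (LINT x|M. indicator A x *\<^sub>R f x)"
    by (rule integral_bounded_linear[OF assms(1)]) (use assms(2) in \<open>simp add: set_integrable_def\<close>)
  then show ?thesis
    by (simp add: set_lebesgue_integral_def linear_simps(5)[OF assms(1)])
qed

lemma set_integral_norm_bound':
  fixes f :: "'a \<Rightarrow> 'b::{banach,second_countable_topology}"
  assumes "set_integrable M A g" "\<And>x. x \<in> A \<Longrightarrow> norm (f x) \<le> g x" "set_integrable M A f"
  shows "norm (LINT x:A|M. f x) \<le> (LINT x:A|M. g x)"
proof -
  have "norm (LINT x:A|M. f x) \<le> (LINT x|M. norm (indicator A x *\<^sub>R f x))"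
    unfolding set_lebesgue_integral_def by (rule integral_norm_bound)
  also have "\<dots> \<le> (LINT x|M. indicator A x *\<^sub>R g x)"
  proof (rule integral_mono)
    show "integrable M (\<lambda>x. norm (indicator A x *\<^sub>R f x))"
      by (rule integrable_norm) (use assms(3) in \<open>simp only: set_integrable_def\<close>)
    show "integrable M (\<lambda>x. indicator A x *\<^sub>R g x)" using assms(1) by (simp only: set_integrable_def)
  qed (use assms(2) in \<open>simp add: indicator_def\<close>)
  finally show ?thesis by (simp add: set_lebesgue_integral_def)
qed

lemma bc_norm: "bc \<Omega> f \<Longrightarrow> bc \<Omega> (\<lambda>x. norm (f x))"
  unfolding bc_def by (auto intro: continuous_on_norm simp: bounded_iff)

lemma integral_gradient_eq_0_complex:
  fixes g g' :: "real^3 \<Rightarrow> complex"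
  assumes \<Omega>: "open \<Omega>" "bounded \<Omega>" and g: "continuous_on (closure \<Omega>) g"
    and g0: "\<And>x. x \<in> frontier \<Omega> \<Longrightarrow> g x = 0"
    and d: "\<And>x. x \<in> \<Omega> \<Longrightarrow> hpd j g (g' x) x" and g': "bc \<Omega> g'"
  shows "(LINT x:\<Omega>|lborel. g' x) = 0"
proof (rule complex_eqI)
  have "(LINT x:\<Omega>|lborel. Re (g' x)) = 0"
    by (rule integral_gradient_eq_0[OF \<Omega>, of "\<lambda>x. Re (g x)"])
      (use g g0 in \<open>auto intro!: continuous_on_Re bc_Re g' hpd_linear[OF bounded_linear_Re] d\<close>)
  then show "Re (LINT x:\<Omega>|lborel. g' x) = Re 0"
    using set_integral_linear[OF bounded_linear_Re bc_set_integrable[OF \<Omega> g']] by simp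
  have "(LINT x:\<Omega>|lborel. Im (g' x)) = 0"
    by (rule integral_gradient_eq_0[OF \<Omega>, of "\<lambda>x. Im (g x)"])
      (use g g0 in \<open>auto intro!: continuous_on_Im bc_Im g' hpd_linear[OF bounded_linear_Im] d\<close>)
  then show "Im (LINT x:\<Omega>|lborel. g' x) = Im 0"
    using set_integral_linear[OF bounded_linear_Im bc_set_integrable[OF \<Omega> g']] by simp
qed

text \<open>The gradient is a separate argument because transforms and rates come with explicit
  formulas for theirs.\<close>

definition trace0 :: "(real^3) set \<Rightarrow> (real^3 \<Rightarrow> complex) \<Rightarrow> (3 \<Rightarrow> real^3 \<Rightarrow> complex) \<Rightarrow> bool" where
  "trace0 \<Omega> w dw \<longleftrightarrow> continuous_on (closure \<Omega>) w \<and> (\<forall>x\<in>frontier \<Omega>. w x = 0) \<and>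
     (\<forall>j. bc \<Omega> (dw j) \<and> (\<forall>x\<in>\<Omega>. hpd j w (dw j x) x))"

text \<open>\<open>S\<close> is bounded but need not extend to the boundary. The product with
  \<open>cnj (w x)\<close>, extended by 0, is continuous up to the boundary all the same, since it
  is dominated by a multiple of \<open>norm (w x)\<close>.\<close>

lemma integration_by_parts:
  fixes S S' w :: "real^3 \<Rightarrow> complex"
  assumes \<Omega>: "open \<Omega>" "bounded \<Omega>" and w: "trace0 \<Omega> w dw"
    and S: "bc \<Omega> S" "bc \<Omega> S'" "\<And>x. x \<in> \<Omega> \<Longrightarrow> hpd j S (S' x) x"
  shows "(LINT x:\<Omega>|lborel. S' x * cnj (w x)) = - (LINT x:\<Omega>|lborel. S x * cnj (dw j x))"
proof -
  have wc: "continuous_on (closure \<Omega>) w" and w0: "\<And>x. x \<in> frontier \<Omega> \<Longrightarrow> w x = 0"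
    and dw: "bc \<Omega> (dw j)" "\<And>x. x \<in> \<Omega> \<Longrightarrow> hpd j w (dw j x) x"
    using w by (auto simp: trace0_def)
  have bw: "bc \<Omega> w" by (rule bc_closure[OF \<Omega>(2) wc])
  obtain B where B: "B > 0" "\<And>x. x \<in> \<Omega> \<Longrightarrow> norm (S x) \<le> B" by (rule bc_bound[OF S(1)], rule that)
  define h where "h = (\<lambda>x. if x \<in> \<Omega> then S x * cnj (w x) else 0)"
  have hB: "norm (h y) \<le> B * norm (w y)" for y
    using B by (auto simp: h_def norm_mult intro: mult_right_mono)
  have "continuous_on (closure \<Omega>) h"
    unfolding continuous_on_def
  proof
    fix x assume x: "x \<in> closure \<Omega>"
    show "(h \<longlongrightarrow> h x) (at x within closure \<Omega>)"
    proof (cases "x \<in> \<Omega>")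
      case True
      have "continuous_on \<Omega> h"
        by (rule continuous_on_eq[of _ "\<lambda>x. S x * cnj (w x)"])
          (use S(1) bw in \<open>auto simp: bc_def h_def intro!: continuous_intros\<close>)
      then have "continuous (at x) h" using True \<Omega>(1) by (simp add: continuous_on_eq_continuous_at)
      then show ?thesis by (simp add: continuous_at tendsto_within_subset[of _ _ _ UNIV])
    next
      case False
      then have "x \<in> frontier \<Omega>" using x \<Omega>(1) by (simp add: frontier_def interior_open)
      then have "w x = 0" by (rule w0)
      have "((\<lambda>y. B * norm (w y)) \<longlongrightarrow> B * norm (w x)) (at x within closure \<Omega>)"
        using wc x by (intro tendsto_intros) (auto simp: continuous_on_def)
      then have "((\<lambda>y. B * norm (w y)) \<longlongrightarrow> 0) (at x within closure \<Omega>)" using \<open>w x = 0\<close> by simp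
      then have "(h \<longlongrightarrow> 0) (at x within closure \<Omega>)"
        by (rule Lim_null_comparison[rotated]) (use hB in auto)
      then show ?thesis using False by (simp add: h_def)
    qed
  qed
  moreover have "h x = 0" if "x \<in> frontier \<Omega>" for x using that w0 by (simp add: h_def)
  moreover have "hpd j h (S x * cnj (dw j x) + S' x * cnj (w x)) x" if x: "x \<in> \<Omega>" for x
    by (rule hpd_cong[OF \<Omega>(1) x _ hpd_mult[OF S(3)[OF x] hpd_linear[OF bounded_linear_cnj dw(2)[OF x]]]])
      (simp add: h_def)
  moreover have "bc \<Omega> (\<lambda>x. S x * cnj (dw j x) + S' x * cnj (w x))" by (intro bc_intros S dw bw)
  ultimately have "(LINT x:\<Omega>|lborel. S x * cnj (dw j x) + S' x * cnj (w x)) = 0"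
    by (rule integral_gradient_eq_0_complex[OF \<Omega>])
  moreover have "(LINT x:\<Omega>|lborel. S x * cnj (dw j x) + S' x * cnj (w x))
     = (LINT x:\<Omega>|lborel. S x * cnj (dw j x)) + (LINT x:\<Omega>|lborel. S' x * cnj (w x))"
    by (intro set_integral_add(2) bc_set_integrable[OF \<Omega>] bc_intros S dw bw)
  ultimately show ?thesis by (simp add: add_eq_0_iff)
qed

lemma ip_cnj: assumes "open \<Omega>" "bounded \<Omega>" "bc \<Omega> a" "bc \<Omega> f" "bc \<Omega> g" shows "cnj (ip \<Omega> a f g) = ip \<Omega> a g f"
proof -
  have "cnj (ip \<Omega> a f g) = (LINT x:\<Omega>|lborel. cnj (of_real (a x) * f x * cnj (g x)))"
    unfolding ip_def
    by (rule set_integral_linear[OF bounded_linear_cnj, symmetric]) (intro bc_set_integrable assms bc_intros)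
  then show ?thesis by (simp add: ip_def mult.assoc mult.commute[of "f _"])
qed

lemma ip_cong:
  assumes "\<And>x. x \<in> \<Omega> \<Longrightarrow> a x = a' x" "\<And>x. x \<in> \<Omega> \<Longrightarrow> f x = f' x" "\<And>x. x \<in> \<Omega> \<Longrightarrow> g x = g' x"
  shows "ip \<Omega> a f g = ip \<Omega> a' f' g'"
  unfolding ip_def set_lebesgue_integral_def
  by (rule Bochner_Integration.integral_cong) (use assms in \<open>auto simp: indicator_def\<close>)

lemma ip_lin_left:
  assumes "open \<Omega>" "bounded \<Omega>" "bc \<Omega> a" "bc \<Omega> f" "bc \<Omega> p" "bc \<Omega> g"
  shows "ip \<Omega> a (\<lambda>x. c * f x - p x) g = c * ip \<Omega> a f g - ip \<Omega> a p g"
proof -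
  have "ip \<Omega> a (\<lambda>x. c * f x - p x) g = (LINT x:\<Omega>|lborel. c * (of_real (a x) * f x * cnj (g x)) - of_real (a x) * p x * cnj (g x))"
    unfolding ip_def by (intro arg_cong[where f="set_lebesgue_integral lborel \<Omega>"] ext) (simp add: algebra_simps)
  also have "\<dots> = (LINT x:\<Omega>|lborel. c * (of_real (a x) * f x * cnj (g x))) - (LINT x:\<Omega>|lborel. of_real (a x) * p x * cnj (g x))"
    by (rule set_integral_diff(2)) (intro bc_set_integrable bc_intros assms)+
  finally show ?thesis by (simp add: ip_def)
qed

lemma ip_lin_right:
  assumes "open \<Omega>" "bounded \<Omega>" "bc \<Omega> a" "bc \<Omega> f" "bc \<Omega> p" "bc \<Omega> g"
  shows "ip \<Omega> a g (\<lambda>x. c * f x - p x) = cnj c * ip \<Omega> a g f - ip \<Omega> a g p"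
proof -
  have "ip \<Omega> a g (\<lambda>x. c * f x - p x) = cnj (ip \<Omega> a (\<lambda>x. c * f x - p x) g)"
    by (rule ip_cnj[symmetric]) (intro assms bc_intros)+
  also have "\<dots> = cnj c * cnj (ip \<Omega> a f g) - cnj (ip \<Omega> a p g)"
    by (simp add: ip_lin_left[OF assms])
  finally show ?thesis using assms by (simp add: ip_cnj)
qed

lemma nn2_nonneg: "nn2 \<Omega> f \<ge> 0"
  unfolding nn2_def set_lebesgue_integral_def
  by (auto intro!: Bochner_Integration.integral_nonneg simp: indicator_def)

lemma nn2_square: "(nn2 \<Omega> f)\<^sup>2 = (LINT x:\<Omega>|lborel. (cmod (f x))\<^sup>2)"
proof -
  have "(LINT x:\<Omega>|lborel. (cmod (f x))\<^sup>2) \<ge> 0"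
    unfolding set_lebesgue_integral_def by (auto intro!: Bochner_Integration.integral_nonneg simp: indicator_def)
  then show ?thesis by (simp add: nn2_def)
qed

lemma ip_bound:
  assumes \<Omega>: "open \<Omega>" "bounded \<Omega>" and b: "bc \<Omega> a" "bc \<Omega> f" "bc \<Omega> g"
    and B: "\<And>x. x \<in> \<Omega> \<Longrightarrow> \<bar>a x\<bar> \<le> B"
  shows "cmod (ip \<Omega> a f g) \<le> \<bar>B\<bar> * nn2 \<Omega> f * nn2 \<Omega> g"
proof -
  have "cmod (ip \<Omega> a f g) \<le> (LINT x:\<Omega>|lborel. \<bar>B\<bar> * (cmod (f x) * cmod (g x)))"
    unfolding ip_def
  proof (rule set_integral_norm_bound')
    show "norm (of_real (a x) * f x * cnj (g x)) \<le> \<bar>B\<bar> * (cmod (f x) * cmod (g x))" if "x \<in> \<Omega>" for x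
      using B[OF that] by (simp add: norm_mult mult.assoc mult_right_mono)
  qed (intro bc_set_integrable[OF \<Omega>] bc_intros b bc_norm)+
  also have "\<dots> = \<bar>B\<bar> * (LINT x:\<Omega>|lborel. cmod (f x) * cmod (g x))" by simp
  also have "\<dots> \<le> \<bar>B\<bar> * (nn2 \<Omega> f * nn2 \<Omega> g)"
    unfolding nn2_def by (intro mult_left_mono cauchy_schwarz_bc[OF \<Omega>] bc_norm b) auto
  finally show ?thesis by (simp add: mult.assoc)
qed

lemma ip_same: "ip \<Omega> (\<lambda>_. 1) f f = of_real ((nn2 \<Omega> f)\<^sup>2)"
proof -
  have "ip \<Omega> (\<lambda>_. 1) f f = (LINT x:\<Omega>|lborel. of_real ((cmod (f x))\<^sup>2))"
    unfolding ip_def by (intro arg_cong[where f="set_lebesgue_integral lborel \<Omega>"] ext) (simp add: complex_norm_square del: of_real_power)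
  then show ?thesis unfolding nn2_square set_lebesgue_integral_def
    by (simp add: scaleR_conv_of_real flip: of_real_mult of_real_power)
qed

text \<open>The derivative in direction 1 of \<open>x$1\<close> times the squared modulus of
  \<open>w\<close> integrates to 0. This expresses the squared norm of \<open>w\<close> by two
  pairings of \<open>w\<close> with \<open>dw 1\<close>, each weighted by
  \<open>x$1\<close>.\<close>

lemma poincare:
  assumes \<Omega>: "open \<Omega>" "bounded \<Omega>" and w: "trace0 \<Omega> w dw" and D: "\<And>x. x \<in> \<Omega> \<Longrightarrow> \<bar>x$1\<bar> \<le> D"
  shows "nn2 \<Omega> w \<le> 2 * \<bar>D\<bar> * nn2 \<Omega> (dw 1)"
proof -
  have bw: "bc \<Omega> w" and dw: "bc \<Omega> (dw 1)" "\<And>x. x \<in> \<Omega> \<Longrightarrow> hpd 1 w (dw 1 x) x"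
    using w bc_closure[OF \<Omega>(2)] by (auto simp: trace0_def)
  have b1: "bc \<Omega> (\<lambda>x. x$1)" using D by (intro bcI[of _ _ D]) (auto intro!: continuous_intros)
  have h1: "hpd 1 (\<lambda>x. of_real (x$1) :: complex) 1 x" for x :: "real^3"
    unfolding hpd_def by (auto intro!: derivative_eq_intros simp: axis_def)
  have e1: "(LINT x:\<Omega>|lborel. (of_real (x$1) * dw 1 x + 1 * w x) * cnj (w x)) = - (LINT x:\<Omega>|lborel. (of_real (x$1) * w x) * cnj (dw 1 x))"
    by (rule integration_by_parts[OF \<Omega> w]) (intro bc_intros b1 bw dw hpd_mult h1 | assumption)+
  have e2: "(LINT x:\<Omega>|lborel. (of_real (x$1) * dw 1 x + 1 * w x) * cnj (w x)) = ip \<Omega> (\<lambda>x. x$1) (dw 1) w + ip \<Omega> (\<lambda>_. 1) w w"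
    unfolding ip_def distrib_right of_real_1
    by (rule set_integral_add(2)) (intro bc_set_integrable[OF \<Omega>] bc_intros b1 bw dw)+
  have "ip \<Omega> (\<lambda>x. x$1) (dw 1) w + ip \<Omega> (\<lambda>_. 1) w w = - ip \<Omega> (\<lambda>x. x$1) w (dw 1)"
    unfolding ip_def[of _ _ w "dw 1"] by (rule trans[OF e2[symmetric] e1])
  then have "ip \<Omega> (\<lambda>_. 1) w w = - ip \<Omega> (\<lambda>x. x$1) (dw 1) w - ip \<Omega> (\<lambda>x. x$1) w (dw 1)"
    by algebra
  then have "cmod (of_real ((nn2 \<Omega> w)\<^sup>2)) = cmod (- ip \<Omega> (\<lambda>x. x$1) (dw 1) w - ip \<Omega> (\<lambda>x. x$1) w (dw 1))"
    unfolding ip_same by simp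
  also have "\<dots> \<le> cmod (ip \<Omega> (\<lambda>x. x$1) (dw 1) w) + cmod (ip \<Omega> (\<lambda>x. x$1) w (dw 1))"
    using norm_triangle_ineq4[of "- ip \<Omega> (\<lambda>x. x$1) (dw 1) w" "ip \<Omega> (\<lambda>x. x$1) w (dw 1)"] by simp
  also have "\<dots> \<le> \<bar>D\<bar> * nn2 \<Omega> (dw 1) * nn2 \<Omega> w + \<bar>D\<bar> * nn2 \<Omega> w * nn2 \<Omega> (dw 1)"
    by (intro add_mono ip_bound[OF \<Omega> b1] bw dw D)
  finally have "nn2 \<Omega> w * nn2 \<Omega> w \<le> (2 * \<bar>D\<bar> * nn2 \<Omega> (dw 1)) * nn2 \<Omega> w"
    by (simp add: power2_eq_square algebra_simps norm_mult)
  then show ?thesis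
    using nn2_nonneg[of \<Omega> w] nn2_nonneg[of \<Omega> "dw 1"]
    by (cases "nn2 \<Omega> w = 0") (auto dest: mult_right_le_imp_le)
qed

text \<open>Pairing with \<open>h\<close> itself and cancelling one factor
  \<open>nn2 \<Omega> h\<close> replaces the triangle inequality for \<open>nn2\<close>. The lemma
  serves to recover a field from its rate with a gain of \<open>1 / cmod \<mu>\<close>.\<close>

lemma nn2_div:
  assumes \<Omega>: "open \<Omega>" "bounded \<Omega>" and b: "bc \<Omega> h" "bc \<Omega> f" "bc \<Omega> g" and c: "c \<noteq> 0"
    and eq: "\<And>x. x \<in> \<Omega> \<Longrightarrow> c * h x = f x + g x"
  shows "nn2 \<Omega> h \<le> (nn2 \<Omega> f + nn2 \<Omega> g) / cmod c"
proof -
  have "ip \<Omega> (\<lambda>_. 1) (\<lambda>x. c * h x - 0) h = ip \<Omega> (\<lambda>_. 1) (\<lambda>x. 1 * f x - (- g x)) h"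
    by (rule ip_cong) (use eq in auto)
  then have "c * ip \<Omega> (\<lambda>_. 1) h h - ip \<Omega> (\<lambda>_. 1) (\<lambda>_. 0) h = ip \<Omega> (\<lambda>_. 1) f h - ip \<Omega> (\<lambda>_. 1) (\<lambda>x. - g x) h"
    by (simp only: ip_lin_left[OF \<Omega> bc_const b(1) bc_const b(1)] ip_lin_left[OF \<Omega> bc_const b(2) bc_minus[OF b(3)] b(1)]) simp
  moreover have "ip \<Omega> (\<lambda>_. 1) (\<lambda>_. 0) h = 0" by (simp add: ip_def)
  ultimately have "cmod (c * ip \<Omega> (\<lambda>_. 1) h h) = cmod (ip \<Omega> (\<lambda>_. 1) f h - ip \<Omega> (\<lambda>_. 1) (\<lambda>x. - g x) h)" by simp
  also have "\<dots> \<le> cmod (ip \<Omega> (\<lambda>_. 1) f h) + cmod (ip \<Omega> (\<lambda>_. 1) (\<lambda>x. - g x) h)" by (rule norm_triangle_ineq4)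
  also have "\<dots> \<le> \<bar>1\<bar> * nn2 \<Omega> f * nn2 \<Omega> h + \<bar>1\<bar> * nn2 \<Omega> (\<lambda>x. - g x) * nn2 \<Omega> h"
    by (intro add_mono ip_bound[OF \<Omega>] b bc_const bc_minus) auto
  also have "nn2 \<Omega> (\<lambda>x. - g x) = nn2 \<Omega> g" by (simp add: nn2_def)
  finally have *: "cmod c * nn2 \<Omega> h * nn2 \<Omega> h \<le> (nn2 \<Omega> f + nn2 \<Omega> g) * nn2 \<Omega> h"
    by (simp add: ip_same norm_mult power2_eq_square algebra_simps)
  have "cmod c * nn2 \<Omega> h \<le> nn2 \<Omega> f + nn2 \<Omega> g"
  proof (cases "nn2 \<Omega> h = 0")
    case False
    then have "nn2 \<Omega> h > 0" using nn2_nonneg[of \<Omega> h] by simp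
    then show ?thesis using * by (rule mult_right_le_imp_le[rotated])
  qed (simp add: nn2_nonneg)
  then show ?thesis using c by (simp add: pos_le_divide_eq mult.commute)
qed

section \<open>Scalar inequalities behind the resolvent estimate\<close>

lemma norm_sum3_le:
  fixes f :: "3 \<Rightarrow> 'a::real_normed_vector"
  assumes "\<And>i. norm (f i) \<le> K" shows "norm (\<Sum>i\<in>UNIV. f i) \<le> 3 * K"
  using sum_norm_le[of UNIV f "\<lambda>_. K"] assms by simp

text \<open>Put \<open>W = Z / r\<close>. If \<open>X\<close> exceeded the claimed multiple
  \<open>c * W\<close>, both terms on the right of \<open>le\<close> would be at most
  \<open>C * r * W * X\<close>, and \<open>2 * C < c * m\<close> would contradict
  \<open>le\<close>.\<close>

lemma absorb_bound:
  fixes X Z r C m :: real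
  assumes m: "m > 0" and C: "C > 0" and r: "r \<ge> 1" and Z: "Z \<ge> 1" and X: "X \<ge> 0"
    and le: "r * m * X\<^sup>2 \<le> C * (Z * X + Z / r)"
  shows "X \<le> (1 + 2 * C / m) * Z / r"
proof (rule ccontr)
  define c where "c = 1 + 2 * C / m"
  have c: "c \<ge> 1" "2 * C < c * m" using m C by (auto simp: c_def field_simps)
  assume "\<not> X \<le> (1 + 2 * C / m) * Z / r"
  then have lt: "c * Z / r < X" by (simp add: c_def)
  define W where "W = Z / r"
  have W: "W > 0" "c * W < X" using lt r Z by (auto simp: W_def)
  have W2: "Z / r \<le> r * (W * W)" unfolding W_def using r Z by (simp add: field_simps)
  have "r * m * X\<^sup>2 \<le> C * (r * W * X + r * (W * W))"
    using le W2 C r by (smt (verit) W_def mult_left_mono nonzero_mult_div_cancel_left times_divide_eq_right)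
  then have "r * (m * X\<^sup>2) \<le> r * (C * (W * X + W * W))" by (simp add: algebra_simps)
  then have 1: "m * X\<^sup>2 \<le> C * (W * X + W * W)" using r by (simp add: mult_le_cancel_left)
  have "W \<le> c * W" using c(1) W(1) by simp
  then have "W \<le> X" using W(2) by linarith
  then have "W * W \<le> W * X" using W(1) by simp
  then have "C * (W * X + W * W) \<le> C * (2 * (W * X))" using C by (intro mult_left_mono) auto
  then have "m * X\<^sup>2 \<le> (2 * C) * W * X" using 1 by (simp add: algebra_simps)
  also have "\<dots> \<le> (c * m) * W * X" using c(2) W X by (intro mult_right_mono) auto
  also have "\<dots> = m * ((c * W) * X)" by (simp add: algebra_simps)
  also have "\<dots> < m * (X * X)" using W m by (intro mult_strict_left_mono mult_strict_right_mono) (auto intro: less_trans[OF _ W(2)] mult_pos_pos simp: c_def add_pos_pos C)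
  finally show False by (simp add: power2_eq_square)
qed

text \<open>\<open>X\<close> stands for the norm of the transformed velocity and strain, \<open>Y\<close> for that of the gradients
  of the transformed thermal rates.\<close>

lemma resolvent_scalar_bound:
  fixes C q m0 :: real
  assumes C: "C > 0" and q: "q > 0" and m0: "m0 > 0"
  obtains k L N where "k > 0" "L \<ge> 1" "N > 0"
    "\<And>\<mu> X Y \<alpha> \<beta> mm U Q V G. \<bar>Re \<mu>\<bar> = k * \<bar>Im \<mu>\<bar> \<Longrightarrow> cmod \<mu> \<ge> L \<Longrightarrow> X \<ge> 0 \<Longrightarrow> Y \<ge> 0 \<Longrightarrow>
       \<mu> * of_real \<alpha> + cnj \<mu> * of_real \<beta> = U \<Longrightarrow> m0 * X\<^sup>2 \<le> \<alpha> + \<beta> \<Longrightarrow>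
       cmod U \<le> C * ((Y + 1) * X + (Y + 1) / cmod \<mu>) \<Longrightarrow>
       \<mu> * of_real mm + Q = V + G \<Longrightarrow> Re G = 0 \<Longrightarrow> cmod G \<le> C * Y\<^sup>2 \<Longrightarrow> cmod Q \<le> C * Y\<^sup>2 \<Longrightarrow>
       q * Y\<^sup>2 \<le> Re Q \<Longrightarrow> cmod V \<le> C * Y * (1 + X + (Y + 1) / cmod \<mu>) \<Longrightarrow> X \<le> N \<and> Y \<le> N"
proof -
  \<comment> \<open>Turning \<open>Q\<close> and \<open>G\<close> by the factor
    \<open>1 + \<i> * of_real (s * k)\<close> costs at most \<open>2 * k * C\<close> times the
    square of \<open>Y\<close>, which for this \<open>k\<close> is half of the lower bound for the
    dissipation.\<close>
  define k where "k = q / (4 * C)"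
  have k: "k > 0" using C q by (simp add: k_def)
  \<comment> \<open>On the rays \<open>\<bar>Re \<mu>\<bar>\<close> equals
    \<open>\<kappa> * cmod \<mu>\<close>.\<close>
  define \<kappa> where "\<kappa> = k / sqrt (1 + k\<^sup>2)"
  have s0: "sqrt (1 + k\<^sup>2) > 0" by (simp add: add_pos_nonneg)
  have \<kappa>: "\<kappa> > 0" using k s0 by (simp add: \<kappa>_def)
  define c1 where "c1 = 1 + 2 * C / (\<kappa> * m0)"
  have c1: "c1 > 0" using C \<kappa> m0 by (simp add: c1_def add_pos_pos)
  define D where "D = (1 + k) * C"
  have D: "D > 0" using k C by (simp add: D_def)
  \<comment> \<open>From this modulus on, the terms of order \<open>(Y + 1) / cmod \<mu>\<close>
    cost at most \<open>q / 4 * (Y + 1)\<close>, so that half of the remaining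
    \<open>q / 2 * Y\<close> survives.\<close>
  define L where "L = 1 + 4 * D * (c1 + 1) / q"
  have L: "L \<ge> 1" using D c1 q by (simp add: L_def)
  define NY where "NY = 4 * D / q + 1"
  have NY: "NY > 0" using D q by (simp add: NY_def add_pos_pos)
  define N where "N = NY + c1 * (NY + 1)"
  have N: "N > 0" using NY c1 by (simp add: N_def add_pos_pos)
  show thesis
  proof (rule that[OF k L N])
    fix \<mu> U Q V G :: complex and X Y \<alpha> \<beta> mm :: real
    assume ray: "\<bar>Re \<mu>\<bar> = k * \<bar>Im \<mu>\<bar>" and r: "cmod \<mu> \<ge> L" and XY: "X \<ge> 0" "Y \<ge> 0"
      and eU: "\<mu> * of_real \<alpha> + cnj \<mu> * of_real \<beta> = U" and ab: "m0 * X\<^sup>2 \<le> \<alpha> + \<beta>"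
      and bU: "cmod U \<le> C * ((Y + 1) * X + (Y + 1) / cmod \<mu>)"
      and eQ: "\<mu> * of_real mm + Q = V + G" and G: "Re G = 0" "cmod G \<le> C * Y\<^sup>2" and Q: "cmod Q \<le> C * Y\<^sup>2" "q * Y\<^sup>2 \<le> Re Q"
      and V: "cmod V \<le> C * Y * (1 + X + (Y + 1) / cmod \<mu>)"
    define \<rho> where "\<rho> = cmod \<mu>"
    have \<rho>: "\<rho> \<ge> 1" "\<rho> \<ge> L" using r L by (auto simp: \<rho>_def)
    have Re\<mu>: "\<bar>Re \<mu>\<bar> = \<kappa> * \<rho>"
    proof -
      have "(cmod \<mu>)\<^sup>2 = (1 + k\<^sup>2) * (Im \<mu>)\<^sup>2"
        unfolding cmod_power2 using arg_cong[OF ray, of "\<lambda>x. x\<^sup>2"] by (simp add: power_mult_distrib algebra_simps)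
      then have "cmod \<mu> = sqrt (1 + k\<^sup>2) * \<bar>Im \<mu>\<bar>"
        by (metis norm_ge_zero real_sqrt_abs real_sqrt_mult real_sqrt_unique)
      then show ?thesis using ray s0 by (simp add: \<kappa>_def \<rho>_def)
    qed
    \<comment> \<open>Taking real parts in the mechanical identity, \<mu> and its conjugate
      contribute the same factor \<open>Re \<mu>\<close>, and the two forms add up.\<close>
    have X1: "X \<le> c1 * (Y + 1) / \<rho>"
      unfolding c1_def
    proof (rule absorb_bound)
      have "\<rho> * (\<kappa> * m0) * X\<^sup>2 = \<bar>Re \<mu>\<bar> * (m0 * X\<^sup>2)" by (simp add: Re\<mu>)
      also have "\<dots> \<le> \<bar>Re \<mu>\<bar> * (\<alpha> + \<beta>)" using ab by (intro mult_left_mono) auto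
      also have "\<dots> \<le> \<bar>Re \<mu> * (\<alpha> + \<beta>)\<bar>" by (simp add: abs_mult mult_left_mono)
      also have "Re \<mu> * (\<alpha> + \<beta>) = Re U" unfolding eU[symmetric] by (simp add: algebra_simps)
      also have "\<bar>Re U\<bar> \<le> cmod U" by (rule abs_Re_le_cmod)
      finally show "\<rho> * (\<kappa> * m0) * X\<^sup>2 \<le> C * ((Y + 1) * X + (Y + 1) / \<rho>)" using bU by (simp add: \<rho>_def)
    qed (use \<kappa> m0 C \<rho> XY in auto)
    \<comment> \<open>\<open>s\<close> is the sign that tells the rays apart. With it
      \<open>1 + \<i> * of_real (s * k)\<close> turns \<mu> into a purely imaginary number, and the
      term with \<open>mm\<close> drops out of the real part.\<close>
    obtain s :: real where s: "\<bar>s\<bar> = 1" "Re \<mu> = s * k * Im \<mu>"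
    proof -
      have "Re \<mu> = k * Im \<mu> \<or> Re \<mu> = - (k * Im \<mu>)" using ray k by (auto simp: abs_if split: if_splits)
      then show thesis using that[of 1] that[of "-1"] by auto
    qed
    have Y1: "Y \<le> NY"
    proof (cases "Y = 0")
      case True then show ?thesis using NY by simp
    next
      case False
      then have Yp: "Y > 0" using XY by simp
      have e: "Re ((1 + \<i> * of_real (s * k)) * Q) = Re ((1 + \<i> * of_real (s * k)) * V) + Re ((1 + \<i> * of_real (s * k)) * G)"
      proof -
        have "Re ((1 + \<i> * of_real (s * k)) * (\<mu> * of_real mm)) = 0" using s(2) by (simp add: algebra_simps)
        moreover have "Re ((1 + \<i> * of_real (s * k)) * (\<mu> * of_real mm)) + Re ((1 + \<i> * of_real (s * k)) * Q)
            = Re ((1 + \<i> * of_real (s * k)) * V) + Re ((1 + \<i> * of_real (s * k)) * G)"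
          using arg_cong[OF eQ, of "\<lambda>z. Re ((1 + \<i> * of_real (s * k)) * z)"]
          by (simp only: distrib_left plus_complex.sel)
        ultimately show ?thesis by linarith
      qed
      have sk: "\<bar>s * k\<bar> = k" using s(1) k by (simp add: abs_mult)
      have "Re Q - s * k * Im Q = Re ((1 + \<i> * of_real (s * k)) * V) - s * k * Im G" using e G(1) by simp
      moreover have "\<bar>s * k * Im Q\<bar> \<le> k * (C * Y\<^sup>2)"
        using abs_Im_le_cmod[of Q] Q(1) k unfolding abs_mult[of "s*k"] sk by (intro mult_left_mono) auto
      moreover have "\<bar>s * k * Im G\<bar> \<le> k * (C * Y\<^sup>2)"
        using abs_Im_le_cmod[of G] G(2) k unfolding abs_mult[of "s*k"] sk by (intro mult_left_mono) auto
      moreover have "Re ((1 + \<i> * of_real (s * k)) * V) \<le> (1 + k) * cmod V"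
      proof -
        have "Re ((1 + \<i> * of_real (s * k)) * V) \<le> cmod ((1 + \<i> * of_real (s * k)) * V)" by (rule complex_Re_le_cmod)
        also have "\<dots> \<le> (1 + k) * cmod V"
          unfolding norm_mult using norm_triangle_ineq[of 1 "\<i> * of_real (s * k)"] sk
          by (intro mult_right_mono) (auto simp: norm_mult)
        finally show ?thesis .
      qed
      ultimately have "q * Y\<^sup>2 \<le> (1 + k) * cmod V + 2 * (k * (C * Y\<^sup>2))" using Q(2) by linarith
      also have "2 * (k * (C * Y\<^sup>2)) = q / 2 * Y\<^sup>2" using C by (simp add: k_def)
      finally have "q / 2 * Y\<^sup>2 \<le> (1 + k) * cmod V" by simp
      also have "\<dots> \<le> (1 + k) * (C * Y * (1 + X + (Y + 1) / \<rho>))" using V k by (intro mult_left_mono) (auto simp: \<rho>_def)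
      also have "\<dots> = (D * (1 + X + (Y + 1) / \<rho>)) * Y" by (simp add: D_def)
      finally have "(q / 2 * Y) * Y \<le> (D * (1 + X + (Y + 1) / \<rho>)) * Y" by (simp add: power2_eq_square)
      then have "q / 2 * Y \<le> D * (1 + X + (Y + 1) / \<rho>)" by (rule mult_right_le_imp_le[OF _ Yp])
      also have "\<dots> \<le> D * (1 + c1 * (Y + 1) / \<rho> + (Y + 1) / \<rho>)" using X1 D by (intro mult_left_mono) auto
      also have "\<dots> = D + D * (c1 + 1) * ((Y + 1) / \<rho>)" by (simp add: algebra_simps add_divide_distrib)
      also have "D * (c1 + 1) * ((Y + 1) / \<rho>) \<le> q / 4 * (Y + 1)"
      proof -
        have "4 * D * (c1 + 1) / q \<le> \<rho>" using \<rho>(2) by (simp add: L_def)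
        then have "D * (c1 + 1) \<le> q / 4 * \<rho>" using q by (simp add: field_simps)
        then have "D * (c1 + 1) * (Y + 1) \<le> q / 4 * \<rho> * (Y + 1)" using XY by (intro mult_right_mono) auto
        then show ?thesis using \<rho>(1) by (simp add: field_simps)
      qed
      finally have "q / 2 * Y \<le> D + q / 4 * (Y + 1)" by simp
      moreover have "q / 2 * Y = q / 4 * Y + q / 4 * Y" "q / 4 * (Y + 1) = q / 4 * Y + q / 4"
        by (simp_all add: distrib_left)
      ultimately have "q / 4 * Y \<le> D + q / 4" by linarith
      then show ?thesis using q by (simp add: NY_def field_simps)
    qed
    have "c1 * (Y + 1) / \<rho> \<le> c1 * (NY + 1)"
    proof -
      have "c1 * (Y + 1) / \<rho> \<le> c1 * (Y + 1) / 1" using \<rho> c1 XY by (intro divide_left_mono) auto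
      also have "\<dots> \<le> c1 * (NY + 1)" using Y1 c1 by simp
      finally show ?thesis .
    qed
    then show "X \<le> N \<and> Y \<le> N" using X1 Y1 NY c1 by (auto simp: N_def intro: order_trans add_increasing2)
  qed
qed

section \<open>Coercivity and dissipation\<close>

lemma C1_closure_hpd: "C1_closure \<Omega> f \<Longrightarrow> x \<in> \<Omega> \<Longrightarrow> hpd j f (pd j f x) x"
  unfolding C1_closure_def by (intro pdiff_imp_hpd) auto

lemma C1_closure_bc: "bounded \<Omega> \<Longrightarrow> C1_closure \<Omega> f \<Longrightarrow> bc \<Omega> f"
  unfolding C1_closure_def by (intro bc_closure) auto

lemma C1_closure_bc_pd:
  assumes "bounded \<Omega>" "C1_closure \<Omega> f" shows "bc \<Omega> (pd j f)"
proof -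
  obtain F where F: "continuous_on (closure \<Omega>) F" "\<And>x. x \<in> \<Omega> \<Longrightarrow> F x = pd j f x"
    using assms(2)[unfolded C1_closure_def] by blast
  show ?thesis by (rule bc_cong[OF bc_closure[OF assms(1) F(1)] F(2)])
qed

lemma uniform_bound:
  fixes f :: "'i::finite \<Rightarrow> real^3 \<Rightarrow> real"
  assumes "\<And>i. bc \<Omega> (f i)"
  shows "\<exists>B>0. \<forall>i. \<forall>x\<in>\<Omega>. \<bar>f i x\<bar> \<le> B"
proof -
  have "\<exists>b. b > 0 \<and> (\<forall>x\<in>\<Omega>. \<bar>f i x\<bar> \<le> b)" for i
    using assms[of i] unfolding bc_def bounded_pos by auto
  then obtain b where b: "\<And>i. b i > 0" "\<And>i x. x \<in> \<Omega> \<Longrightarrow> \<bar>f i x\<bar> \<le> b i" by metis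
  show ?thesis
  proof (intro exI[of _ "sum b UNIV"] conjI allI ballI)
    show "sum b UNIV > 0" by (rule sum_pos) (auto simp: b)
    fix i x assume "x \<in> \<Omega>"
    then have "\<bar>f i x\<bar> \<le> b i" by (rule b)
    also have "b i \<le> sum b UNIV" by (rule member_le_sum) (auto intro: less_imp_le b)
    finally show "\<bar>f i x\<bar> \<le> sum b UNIV" .
  qed
qed

lemma sum_norm2_le:
  fixes f :: "3 \<Rightarrow> 3 \<Rightarrow> 'a::real_normed_vector"
  assumes "\<And>i j. norm (f i j) \<le> K" shows "norm (\<Sum>i\<in>UNIV. \<Sum>j\<in>UNIV. f i j) \<le> 9 * K"
  using norm_sum3_le[OF norm_sum3_le[OF assms], of "\<lambda>i j. i"] by simp

lemma sum_norm4_le: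
  fixes f :: "3 \<Rightarrow> 3 \<Rightarrow> 3 \<Rightarrow> 3 \<Rightarrow> 'a::real_normed_vector"
  assumes "\<And>i j k l. norm (f i j k l) \<le> K"
  shows "norm (\<Sum>i\<in>UNIV. \<Sum>j\<in>UNIV. \<Sum>k\<in>UNIV. \<Sum>l\<in>UNIV. f i j k l) \<le> 81 * K"
proof -
  have "norm (\<Sum>i\<in>UNIV. \<Sum>j\<in>UNIV. \<Sum>k\<in>UNIV. \<Sum>l\<in>UNIV. f i j k l) \<le> 9 * (9 * K)"
    by (intro sum_norm2_le assms)
  then show ?thesis by simp
qed

lemma set_integral_sum:
  fixes f :: "'i \<Rightarrow> 'a \<Rightarrow> 'b::{banach,second_countable_topology}"
  assumes "\<And>i. i \<in> I \<Longrightarrow> set_integrable M A (f i)"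
  shows "(LINT x:A|M. (\<Sum>i\<in>I. f i x)) = (\<Sum>i\<in>I. (LINT x:A|M. f i x))"
  unfolding set_lebesgue_integral_def scaleR_sum_right
  by (rule Bochner_Integration.integral_sum) (use assms in \<open>simp add: set_integrable_def\<close>)

lemma Re_ip:
  assumes "open \<Omega>" "bounded \<Omega>" "bc \<Omega> a" "bc \<Omega> f" "bc \<Omega> g"
  shows "Re (ip \<Omega> a f g) = (LINT x:\<Omega>|lborel. a x * Re (f x) * Re (g x)) + (LINT x:\<Omega>|lborel. a x * Im (f x) * Im (g x))"
proof -
  have "Re (ip \<Omega> a f g) = (LINT x:\<Omega>|lborel. Re (of_real (a x) * f x * cnj (g x)))"
    unfolding ip_def by (rule set_integral_linear[OF bounded_linear_Re, symmetric]) (intro bc_set_integrable bc_intros assms)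
  also have "\<dots> = (LINT x:\<Omega>|lborel. a x * Re (f x) * Re (g x) + a x * Im (f x) * Im (g x))"
    by (intro arg_cong[where f="set_lebesgue_integral lborel \<Omega>"] ext) simp
  also have "\<dots> = (LINT x:\<Omega>|lborel. a x * Re (f x) * Re (g x)) + (LINT x:\<Omega>|lborel. a x * Im (f x) * Im (g x))"
    by (rule set_integral_add(2)) (intro bc_set_integrable bc_intros assms)+
  finally show ?thesis .
qed

lemma nn2_square_Re_Im:
  assumes "open \<Omega>" "bounded \<Omega>" "bc \<Omega> f"
  shows "(nn2 \<Omega> f)\<^sup>2 = (LINT x:\<Omega>|lborel. (Re (f x))\<^sup>2) + (LINT x:\<Omega>|lborel. (Im (f x))\<^sup>2)"
  unfolding nn2_square cmod_power2
  by (rule set_integral_add(2)) (intro bc_set_integrable bc_intros assms)+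

lemma continuous_compact_pos_lower_bound:
  fixes f :: "'a::topological_space \<Rightarrow> real"
  assumes "compact S" "continuous_on S f" "\<And>x. x \<in> S \<Longrightarrow> f x > 0"
  shows "\<exists>c>0. \<forall>x\<in>S. c \<le> f x"
proof (cases "S = {}")
  case False
  then obtain y where "y \<in> S" "\<forall>x\<in>S. f y \<le> f x" using continuous_attains_inf[OF assms(1) _ assms(2)] by auto
  then show ?thesis using assms(3) by (intro exI[of _ "f y"]) auto
qed (auto intro: exI[of _ 1])

lemma trace0_bc: "bounded \<Omega> \<Longrightarrow> trace0 \<Omega> w dw \<Longrightarrow> bc \<Omega> w"
  unfolding trace0_def by (intro bc_closure) auto

lemma trace0_bc_grad: "trace0 \<Omega> w dw \<Longrightarrow> bc \<Omega> (dw j)"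
  unfolding trace0_def by auto

lemma trace0_lin:
  assumes "trace0 \<Omega> w dw" "trace0 \<Omega> p dp"
  shows "trace0 \<Omega> (\<lambda>x. c * w x - p x) (\<lambda>j x. c * dw j x - dp j x)"
  using assms unfolding trace0_def
  by (auto intro!: continuous_intros bc_diff bc_mult hpd_diff hpd_cmult)

section \<open>Bounds, symmetries and positivity of the coefficients\<close>

locale thermo =
  fixes \<Omega> :: "(real^3) set" and m :: material
  assumes op: "open \<Omega>" and bd: "bounded \<Omega>"
    and reg: "regular_coefficients \<Omega> m" and sym: "symmetric_coefficients \<Omega> m"
    and dens: "positive_density \<Omega> m" and coer: "coercive_energy \<Omega> m" and posdef: "dissipation_posdef \<Omega> m"
begin

lemma C1c: "C1_closure \<Omega> (rho m)" "C1_closure \<Omega> (cE m)"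
  "C1_closure \<Omega> (\<lambda>x. cM m x i j)" "C1_closure \<Omega> (\<lambda>x. a_co m x i j)" "C1_closure \<Omega> (\<lambda>x. b_co m x i j)"
  "C1_closure \<Omega> (\<lambda>x. d_co m x i j)" "C1_closure \<Omega> (\<lambda>x. K_co m x i j)" "C1_closure \<Omega> (\<lambda>x. Kt_co m x i j)"
  "C1_closure \<Omega> (\<lambda>x. A_co m x i j k l)" "C1_closure \<Omega> (\<lambda>x. B_co m x i j k l)"
  "C1_closure \<Omega> (\<lambda>x. C_co m x i j k l)" "C1_closure \<Omega> (\<lambda>x. Ct_co m x i j k l)"
  using reg unfolding regular_coefficients_def by auto

lemmas bcc = C1c[THEN C1_closure_bc[OF bd]]

lemma bc_heat: "bc \<Omega> (c_heat m)"
  unfolding c_heat_def[abs_def] divide_inverse by (intro bc_intros bcc)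

text \<open>The gradient of \<open>a_co\<close> appears when the coupling through
  \<open>a_co\<close> is integrated by parts in the resolvent estimate.\<close>

lemmas bc_da = C1_closure_bc_pd[OF bd C1c(4)]

lemma symc:
  assumes "x \<in> \<Omega>"
  shows "A_co m x i j k l = A_co m x j i k l" "A_co m x i j k l = A_co m x k l i j"
    "B_co m x i j k l = B_co m x j i k l"
    "a_co m x i j = a_co m x j i" "b_co m x i j = b_co m x j i" "cM m x i j = cM m x j i" "d_co m x i j = d_co m x j i"
    "Ct_co m x i j k l = Ct_co m x k l i j"
proof -
  have "x \<in> closure \<Omega>" using assms closure_subset by auto
  note s = sym[unfolded symmetric_coefficients_def, rule_format, OF this]
  show "A_co m x i j k l = A_co m x j i k l" using s by blast
  show "A_co m x i j k l = A_co m x k l i j" using s by blast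
  show "B_co m x i j k l = B_co m x j i k l" using s by blast
  show "a_co m x i j = a_co m x j i" using s by blast
  show "b_co m x i j = b_co m x j i" using s by blast
  show "cM m x i j = cM m x j i" using s by blast
  show "d_co m x i j = d_co m x j i" using s by blast
  show "Ct_co m x i j k l = Ct_co m x k l i j" using s by blast
qed

lemma coefficient_bound:
  obtains B where "B > 0" "\<And>x. x \<in> \<Omega> \<Longrightarrow> \<bar>rho m x\<bar> \<le> B" "\<And>x. x \<in> \<Omega> \<Longrightarrow> \<bar>c_heat m x\<bar> \<le> B"
    "\<And>x i j. x \<in> \<Omega> \<Longrightarrow> \<bar>cM m x i j\<bar> \<le> B" "\<And>x i j. x \<in> \<Omega> \<Longrightarrow> \<bar>a_co m x i j\<bar> \<le> B"
    "\<And>x i j. x \<in> \<Omega> \<Longrightarrow> \<bar>b_co m x i j\<bar> \<le> B" "\<And>x i j. x \<in> \<Omega> \<Longrightarrow> \<bar>d_co m x i j\<bar> \<le> B"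
    "\<And>x i j. x \<in> \<Omega> \<Longrightarrow> \<bar>K_co m x i j\<bar> \<le> B" "\<And>x i j. x \<in> \<Omega> \<Longrightarrow> \<bar>Kt_co m x i j\<bar> \<le> B"
    "\<And>x i j k l. x \<in> \<Omega> \<Longrightarrow> \<bar>A_co m x i j k l\<bar> \<le> B" "\<And>x i j k l. x \<in> \<Omega> \<Longrightarrow> \<bar>B_co m x i j k l\<bar> \<le> B"
    "\<And>x i j k l. x \<in> \<Omega> \<Longrightarrow> \<bar>C_co m x i j k l\<bar> \<le> B" "\<And>x i j k l. x \<in> \<Omega> \<Longrightarrow> \<bar>Ct_co m x i j k l\<bar> \<le> B"
    "\<And>x i j k. x \<in> \<Omega> \<Longrightarrow> \<bar>pd k (\<lambda>x. a_co m x i j) x\<bar> \<le> B"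
proof -
  have 2: "\<exists>B>0. \<forall>i j. \<forall>x\<in>\<Omega>. \<bar>f x i j\<bar> \<le> B" if "\<And>i j. bc \<Omega> (\<lambda>x. f x i j)" for f :: "real^3 \<Rightarrow> 3 \<Rightarrow> 3 \<Rightarrow> real"
    using uniform_bound[of \<Omega> "\<lambda>(i,j) x. f x i j"] that by (auto simp: split_beta)
  have 4: "\<exists>B>0. \<forall>i j k l. \<forall>x\<in>\<Omega>. \<bar>f x i j k l\<bar> \<le> B" if "\<And>i j k l. bc \<Omega> (\<lambda>x. f x i j k l)" for f :: "real^3 \<Rightarrow> 3 \<Rightarrow> 3 \<Rightarrow> 3 \<Rightarrow> 3 \<Rightarrow> real"
    using uniform_bound[of \<Omega> "\<lambda>(i,j,k,l) x. f x i j k l"] that by (auto simp: split_beta)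
  obtain B1 where B1: "B1 > 0" "\<And>x. x \<in> \<Omega> \<Longrightarrow> \<bar>rho m x\<bar> \<le> B1" using uniform_bound[of \<Omega> "\<lambda>_::unit. rho m"] bcc(1) by auto
  obtain B2 where B2: "B2 > 0" "\<And>x. x \<in> \<Omega> \<Longrightarrow> \<bar>c_heat m x\<bar> \<le> B2" using uniform_bound[of \<Omega> "\<lambda>_::unit. c_heat m"] bc_heat by auto
  obtain B3 where B3: "B3 > 0" "\<And>x i j. x \<in> \<Omega> \<Longrightarrow> \<bar>cM m x i j\<bar> \<le> B3" using 2[of "cM m"] bcc(3) by meson
  obtain B4 where B4: "B4 > 0" "\<And>x i j. x \<in> \<Omega> \<Longrightarrow> \<bar>a_co m x i j\<bar> \<le> B4" using 2[of "a_co m"] bcc(4) by meson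
  obtain B5 where B5: "B5 > 0" "\<And>x i j. x \<in> \<Omega> \<Longrightarrow> \<bar>b_co m x i j\<bar> \<le> B5" using 2[of "b_co m"] bcc(5) by meson
  obtain B6 where B6: "B6 > 0" "\<And>x i j. x \<in> \<Omega> \<Longrightarrow> \<bar>d_co m x i j\<bar> \<le> B6" using 2[of "d_co m"] bcc(6) by meson
  obtain B7 where B7: "B7 > 0" "\<And>x i j. x \<in> \<Omega> \<Longrightarrow> \<bar>K_co m x i j\<bar> \<le> B7" using 2[of "K_co m"] bcc(7) by meson
  obtain B8 where B8: "B8 > 0" "\<And>x i j. x \<in> \<Omega> \<Longrightarrow> \<bar>Kt_co m x i j\<bar> \<le> B8" using 2[of "Kt_co m"] bcc(8) by meson
  obtain B9 where B9: "B9 > 0" "\<And>x i j k l. x \<in> \<Omega> \<Longrightarrow> \<bar>A_co m x i j k l\<bar> \<le> B9" using 4[of "A_co m"] bcc(9) by meson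
  obtain B10 where B10: "B10 > 0" "\<And>x i j k l. x \<in> \<Omega> \<Longrightarrow> \<bar>B_co m x i j k l\<bar> \<le> B10" using 4[of "B_co m"] bcc(10) by meson
  obtain B11 where B11: "B11 > 0" "\<And>x i j k l. x \<in> \<Omega> \<Longrightarrow> \<bar>C_co m x i j k l\<bar> \<le> B11" using 4[of "C_co m"] bcc(11) by meson
  obtain B12 where B12: "B12 > 0" "\<And>x i j k l. x \<in> \<Omega> \<Longrightarrow> \<bar>Ct_co m x i j k l\<bar> \<le> B12" using 4[of "Ct_co m"] bcc(12) by meson
  have "\<exists>B>0. \<forall>i j k l::3. \<forall>x\<in>\<Omega>. \<bar>pd k (\<lambda>x. a_co m x i j) x\<bar> \<le> B"
    using 4[of "\<lambda>x i j k _. pd k (\<lambda>x. a_co m x i j) x"] bc_da by blast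
  then obtain B13 where B13: "B13 > 0" "\<And>x i j k. x \<in> \<Omega> \<Longrightarrow> \<bar>pd k (\<lambda>x. a_co m x i j) x\<bar> \<le> B13" by meson
  define B where "B = B1+B2+B3+B4+B5+B6+B7+B8+B9+B10+B11+B12+B13"
  note p = B1(1) B2(1) B3(1) B4(1) B5(1) B6(1) B7(1) B8(1) B9(1) B10(1) B11(1) B12(1) B13(1)
  have le: "B1 \<le> B" "B2 \<le> B" "B3 \<le> B" "B4 \<le> B" "B5 \<le> B" "B6 \<le> B" "B7 \<le> B" "B8 \<le> B" "B9 \<le> B"
    "B10 \<le> B" "B11 \<le> B" "B12 \<le> B" "B13 \<le> B" "B > 0"
    unfolding B_def using p by linarith+
  show thesis
    by (rule that[of B, OF le(14) order_trans[OF B1(2) le(1)] order_trans[OF B2(2) le(2)] order_trans[OF B3(2) le(3)]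
        order_trans[OF B4(2) le(4)] order_trans[OF B5(2) le(5)] order_trans[OF B6(2) le(6)] order_trans[OF B7(2) le(7)]
        order_trans[OF B8(2) le(8)] order_trans[OF B9(2) le(9)] order_trans[OF B10(2) le(10)] order_trans[OF B11(2) le(11)]
        order_trans[OF B12(2) le(12)] order_trans[OF B13(2) le(13)]])
qed

lemma density_lower_bound: "\<exists>c>0. \<forall>x\<in>\<Omega>. c \<le> rho m x"
proof -
  have "compact (closure \<Omega>)" using bd by (simp add: compact_closure)
  moreover have "continuous_on (closure \<Omega>) (rho m)" using C1c(1) by (simp add: C1_closure_def)
  ultimately have "\<exists>c>0. \<forall>x\<in>closure \<Omega>. c \<le> rho m x"
    by (rule continuous_compact_pos_lower_bound) (use dens in \<open>simp add: positive_density_def\<close>)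
  then show ?thesis using closure_subset by blast
qed

text \<open>The form is continuous and positive on the compact product of the closure of \<Omega>
  with the unit sphere, hence bounded below there; homogeneity of degree two does the rest.\<close>

lemma dissipation_lower_bound:
  "\<exists>q>0. \<forall>x\<in>\<Omega>. \<forall>\<xi> \<eta>. q * ((\<Sum>i\<in>UNIV. (\<xi> i)\<^sup>2) + (\<Sum>i\<in>UNIV. \<Sum>j\<in>UNIV. (\<eta> i j)\<^sup>2)) \<le> dissipation m x \<xi> \<eta>"
proof -
  define F where "F = (\<lambda>z :: (real^3) \<times> (real^3) \<times> (real^3^3). dissipation m (fst z) (\<lambda>i. fst (snd z) $ i) (\<lambda>i j. snd (snd z) $ i $ j))"
  define S where "S = closure \<Omega> \<times> sphere (0 :: (real^3) \<times> (real^3^3)) 1"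
  have "compact S" unfolding S_def using bd by (intro compact_Times) (auto simp: compact_closure)
  moreover have "continuous_on S F"
  proof -
    have "continuous_on S (\<lambda>z. Kt_co m (fst z) i j)" for i j
      by (rule continuous_on_compose2[of "closure \<Omega>" "\<lambda>x. Kt_co m x i j"])
        (use C1c(8) in \<open>auto simp: C1_closure_def S_def intro!: continuous_intros\<close>)
    moreover have "continuous_on S (\<lambda>z. Ct_co m (fst z) i j k l)" for i j k l
      by (rule continuous_on_compose2[of "closure \<Omega>" "\<lambda>x. Ct_co m x i j k l"])
        (use C1c(12) in \<open>auto simp: C1_closure_def S_def intro!: continuous_intros\<close>)
    ultimately show ?thesis unfolding F_def dissipation_def
      by (intro continuous_intros)
  qed
  moreover have "F z > 0" if "z \<in> S" for z
  proof -
    have "fst z \<in> closure \<Omega>" "snd z \<noteq> 0" using that by (auto simp: S_def)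
    then have "(\<exists>i. fst (snd z) $ i \<noteq> 0) \<or> (\<exists>i j. snd (snd z) $ i $ j \<noteq> 0)"
      by (auto simp: prod_eq_iff vec_eq_iff)
    then show ?thesis unfolding F_def
      by (rule posdef[unfolded dissipation_posdef_def, rule_format, OF \<open>fst z \<in> closure \<Omega>\<close>])
  qed
  ultimately obtain q where q: "q > 0" "\<And>z. z \<in> S \<Longrightarrow> q \<le> F z"
    using continuous_compact_pos_lower_bound by metis
  show ?thesis
  proof (intro exI[of _ q] conjI q(1) ballI allI)
    fix x \<xi> \<eta> assume x: "x \<in> \<Omega>"
    define w :: "(real^3) \<times> (real^3^3)" where "w = ((\<chi> i. \<xi> i), (\<chi> i j. \<eta> i j))"
    have n: "(norm w)\<^sup>2 = (\<Sum>i\<in>UNIV. (\<xi> i)\<^sup>2) + (\<Sum>i\<in>UNIV. \<Sum>j\<in>UNIV. (\<eta> i j)\<^sup>2)"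
      unfolding power2_norm_eq_inner w_def inner_Pair inner_vec_def by (simp add: power2_eq_square)
    show "q * ((\<Sum>i\<in>UNIV. (\<xi> i)\<^sup>2) + (\<Sum>i\<in>UNIV. \<Sum>j\<in>UNIV. (\<eta> i j)\<^sup>2)) \<le> dissipation m x \<xi> \<eta>"
    proof (cases "w = 0")
      case True
      then have "\<And>i. \<xi> i = 0" "\<And>i j. \<eta> i j = 0" by (auto simp: w_def prod_eq_iff vec_eq_iff)
      then show ?thesis by (simp add: dissipation_def)
    next
      case False
      define t where "t = norm w"
      have t: "t > 0" using False by (simp add: t_def)
      have "(x, (1/t) *\<^sub>R w) \<in> S" using x closure_subset t by (auto simp: S_def t_def)
      then have "q \<le> F (x, (1/t) *\<^sub>R w)" by (rule q(2))
      also have "F (x, (1/t) *\<^sub>R w) = (1/t)\<^sup>2 * dissipation m x \<xi> \<eta>"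
        unfolding F_def dissipation_def w_def
        by (simp add: sum_distrib_left distrib_left power2_eq_square mult_ac)
      finally have "q * t\<^sup>2 \<le> dissipation m x \<xi> \<eta>" using t by (simp add: power_divide field_simps)
      then show ?thesis by (simp add: t_def n)
    qed
  qed
qed

end

context thermo begin

abbreviation ipc where "ipc \<equiv> ip \<Omega>"
abbreviation L2 where "L2 \<equiv> nn2 \<Omega>"

lemma integral_sum2:
  fixes f :: "3 \<Rightarrow> 3 \<Rightarrow> real^3 \<Rightarrow> real"
  assumes "\<And>i j. bc \<Omega> (f i j)"
  shows "(LINT x:\<Omega>|lborel. \<Sum>i\<in>UNIV. \<Sum>j\<in>UNIV. f i j x) = (\<Sum>i\<in>UNIV. \<Sum>j\<in>UNIV. LINT x:\<Omega>|lborel. f i j x)"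
proof -
  have "(LINT x:\<Omega>|lborel. \<Sum>i\<in>UNIV. \<Sum>j\<in>UNIV. f i j x) = (\<Sum>i\<in>UNIV. LINT x:\<Omega>|lborel. \<Sum>j\<in>UNIV. f i j x)"
    by (rule set_integral_sum) (intro bc_set_integrable[OF op bd] bc_sum assms)
  also have "\<dots> = (\<Sum>i\<in>UNIV. \<Sum>j\<in>UNIV. LINT x:\<Omega>|lborel. f i j x)"
    by (intro sum.cong refl set_integral_sum bc_set_integrable[OF op bd] assms)
  finally show ?thesis .
qed

lemma integral_sum4:
  fixes f :: "3 \<Rightarrow> 3 \<Rightarrow> 3 \<Rightarrow> 3 \<Rightarrow> real^3 \<Rightarrow> real"
  assumes "\<And>i j k l. bc \<Omega> (f i j k l)"
  shows "(LINT x:\<Omega>|lborel. \<Sum>i\<in>UNIV. \<Sum>j\<in>UNIV. \<Sum>k\<in>UNIV. \<Sum>l\<in>UNIV. f i j k l x)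
    = (\<Sum>i\<in>UNIV. \<Sum>j\<in>UNIV. \<Sum>k\<in>UNIV. \<Sum>l\<in>UNIV. LINT x:\<Omega>|lborel. f i j k l x)"
proof -
  have "(LINT x:\<Omega>|lborel. \<Sum>i\<in>UNIV. \<Sum>j\<in>UNIV. \<Sum>k\<in>UNIV. \<Sum>l\<in>UNIV. f i j k l x)
      = (\<Sum>i\<in>UNIV. \<Sum>j\<in>UNIV. LINT x:\<Omega>|lborel. \<Sum>k\<in>UNIV. \<Sum>l\<in>UNIV. f i j k l x)"
    by (rule integral_sum2) (intro bc_sum assms)
  also have "\<dots> = (\<Sum>i\<in>UNIV. \<Sum>j\<in>UNIV. \<Sum>k\<in>UNIV. \<Sum>l\<in>UNIV. LINT x:\<Omega>|lborel. f i j k l x)"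
    by (intro sum.cong refl integral_sum2 assms)
  finally show ?thesis .
qed

text \<open>The energy inequality with \<tau> and \<open>R\<close> equal to 0.\<close>

lemma displacement_coercive:
  obtains c0 where "c0 > 0" "\<And>u Du. (\<And>i. W0_12 \<Omega> (u i)) \<Longrightarrow> (\<And>i. weak_gradient \<Omega> (u i) (Du i)) \<Longrightarrow>
     c0 * (LINT x:\<Omega>|lborel. (\<Sum>i\<in>UNIV. \<Sum>j\<in>UNIV. (sym_part Du i j x)\<^sup>2))
     \<le> (LINT x:\<Omega>|lborel. (\<Sum>i\<in>UNIV. \<Sum>j\<in>UNIV. \<Sum>k\<in>UNIV. \<Sum>l\<in>UNIV.
              A_co m x i j k l * sym_part Du k l x * sym_part Du i j x))"
proof -
  obtain c0 where c0: "c0 > 0" and *: "\<forall>u \<tau> R Du D\<tau> DR.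
        (\<forall>i. W0_12 \<Omega> (u i) \<and> weak_gradient \<Omega> (u i) (Du i)) \<and>
        W0_12 \<Omega> \<tau> \<and> weak_gradient \<Omega> \<tau> D\<tau> \<and>
        (\<forall>i. W0_12 \<Omega> (R i) \<and> weak_gradient \<Omega> (R i) (DR i)) \<longrightarrow>
        (LINT x:\<Omega>|lborel.
           (\<Sum>i\<in>UNIV. \<Sum>j\<in>UNIV. \<Sum>k\<in>UNIV. \<Sum>l\<in>UNIV.
              A_co m x i j k l * sym_part Du k l x * sym_part Du i j x
              + 2 * B_co m x i j k l * sym_part Du i j x * DR k l x
              + C_co m x i j k l * DR i j x * DR k l x)
           + (\<Sum>i\<in>UNIV. \<Sum>j\<in>UNIV. K_co m x i j * D\<tau> i x * D\<tau> j x))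
        \<ge> c0 * (LINT x:\<Omega>|lborel.
           (\<Sum>i\<in>UNIV. \<Sum>j\<in>UNIV. (sym_part Du i j x)\<^sup>2)
           + (\<Sum>i\<in>UNIV. (D\<tau> i x)\<^sup>2)
           + (\<Sum>i\<in>UNIV. \<Sum>j\<in>UNIV. (DR i j x)\<^sup>2))"
    using coer[unfolded coercive_energy_def] by (elim exE conjE) (rule that)
  have z: "W0_12 \<Omega> (\<lambda>_. 0)" "weak_gradient \<Omega> (\<lambda>_. 0) (\<lambda>_ _. 0)"
    by (rule vanishing_trace_W0_12[OF op bd, of _ "\<lambda>_ _. 0"] vanishing_trace_weak_gradient[OF op bd]; simp)+
  show thesis
  proof (rule that[OF c0])
    fix u :: "3 \<Rightarrow> real^3 \<Rightarrow> real" and Du :: "3 \<Rightarrow> 3 \<Rightarrow> real^3 \<Rightarrow> real"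
    assume "\<And>i. W0_12 \<Omega> (u i)" "\<And>i. weak_gradient \<Omega> (u i) (Du i)"
    then show "c0 * (LINT x:\<Omega>|lborel. (\<Sum>i\<in>UNIV. \<Sum>j\<in>UNIV. (sym_part Du i j x)\<^sup>2))
     \<le> (LINT x:\<Omega>|lborel. (\<Sum>i\<in>UNIV. \<Sum>j\<in>UNIV. \<Sum>k\<in>UNIV. \<Sum>l\<in>UNIV.
              A_co m x i j k l * sym_part Du k l x * sym_part Du i j x))"
      using *[THEN spec, THEN spec, THEN spec, THEN spec, THEN spec, THEN spec,
          of u Du "\<lambda>_. 0" "\<lambda>_ _. 0" "\<lambda>_ _. 0" "\<lambda>_ _ _. 0"] z by simp
  qed
qed

text \<open>The weights are real, so the real part of a pairing is the pairing of the real parts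
  plus that of the imaginary parts. The real inequality is applied to each.\<close>

lemma coercive_complex:
  "\<exists>c0>0. \<forall>uh du E. (\<forall>i. trace0 \<Omega> (uh i) (du i)) \<longrightarrow> (\<forall>i j x. E i j x = (du i j x + du j i x) / 2) \<longrightarrow>
     c0 * (\<Sum>i\<in>UNIV. \<Sum>j\<in>UNIV. (L2 (E i j))\<^sup>2)
      \<le> Re (\<Sum>i\<in>UNIV. \<Sum>j\<in>UNIV. \<Sum>k\<in>UNIV. \<Sum>l\<in>UNIV. ipc (\<lambda>x. A_co m x i j k l) (E k l) (E i j))"
proof (rule displacement_coercive)
  fix c0 :: real
  assume c0: "c0 > 0" and coer: "\<And>u Du. (\<And>i. W0_12 \<Omega> (u i)) \<Longrightarrow> (\<And>i. weak_gradient \<Omega> (u i) (Du i)) \<Longrightarrow>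
     c0 * (LINT x:\<Omega>|lborel. (\<Sum>i\<in>UNIV. \<Sum>j\<in>UNIV. (sym_part Du i j x)\<^sup>2))
     \<le> (LINT x:\<Omega>|lborel. (\<Sum>i\<in>UNIV. \<Sum>j\<in>UNIV. \<Sum>k\<in>UNIV. \<Sum>l\<in>UNIV.
              A_co m x i j k l * sym_part Du k l x * sym_part Du i j x))"
  show ?thesis
  proof (intro exI[of _ c0] conjI c0 allI impI)
    fix uh :: "3 \<Rightarrow> real^3 \<Rightarrow> complex" and du E :: "3 \<Rightarrow> 3 \<Rightarrow> real^3 \<Rightarrow> complex"
    assume t: "\<forall>i. trace0 \<Omega> (uh i) (du i)" and E: "\<forall>i j x. E i j x = (du i j x + du j i x) / 2"
    have bdu: "bc \<Omega> (du i j)" for i j using t by (simp add: trace0_def)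
    have bE: "bc \<Omega> (E i j)" for i j
      by (rule bc_cong[of _ "\<lambda>x. (1/2) * (du i j x + du j i x)"]) (intro bc_intros bdu, simp add: E)
    have part: "c0 * (\<Sum>i\<in>UNIV. \<Sum>j\<in>UNIV. (LINT x:\<Omega>|lborel. (P (E i j x))\<^sup>2))
      \<le> (\<Sum>i\<in>UNIV. \<Sum>j\<in>UNIV. \<Sum>k\<in>UNIV. \<Sum>l\<in>UNIV. (LINT x:\<Omega>|lborel. A_co m x i j k l * P (E k l x) * P (E i j x)))"
      if P: "bounded_linear P" for P :: "complex \<Rightarrow> real"
    proof -
      have bP: "bc \<Omega> (\<lambda>x. P (E i j x))" for i j by (rule bc_linear[OF P bE])
      have s: "sym_part (\<lambda>i j x. P (du i j x)) i j x = P (E i j x)" for i j x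
      proof -
        have "P (E i j x) = P ((1/2) *\<^sub>R (du i j x + du j i x))" by (simp add: E scaleR_conv_of_real)
        also have "\<dots> = (1/2) * (P (du i j x) + P (du j i x))"
          by (simp only: linear_simps(5)[OF P] linear_simps(1)[OF P] real_scaleR_def)
        finally show ?thesis by (simp add: sym_part_def)
      qed
      have vt: "continuous_on (closure \<Omega>) (\<lambda>x. P (uh i x))" "\<And>x. x \<in> frontier \<Omega> \<Longrightarrow> P (uh i x) = 0"
        "\<And>j x. x \<in> \<Omega> \<Longrightarrow> hpd j (\<lambda>x. P (uh i x)) (P (du i j x)) x" "\<And>j. bc \<Omega> (\<lambda>x. P (du i j x))" for i
        using t bdu linear_simps(3)[OF P]
        by (auto simp: trace0_def intro!: bounded_linear.continuous_on[OF P] hpd_linear[OF P] bc_linear[OF P])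
      have "c0 * (LINT x:\<Omega>|lborel. (\<Sum>i\<in>UNIV. \<Sum>j\<in>UNIV. (sym_part (\<lambda>i j x. P (du i j x)) i j x)\<^sup>2))
       \<le> (LINT x:\<Omega>|lborel. (\<Sum>i\<in>UNIV. \<Sum>j\<in>UNIV. \<Sum>k\<in>UNIV. \<Sum>l\<in>UNIV.
              A_co m x i j k l * sym_part (\<lambda>i j x. P (du i j x)) k l x * sym_part (\<lambda>i j x. P (du i j x)) i j x))"
        by (rule coer[where u="\<lambda>i x. P (uh i x)"])
          (rule vanishing_trace_W0_12[OF op bd vt] vanishing_trace_weak_gradient[OF op bd vt]; assumption)+
      then show ?thesis unfolding s
        by (simp only: integral_sum2[OF bc_power[OF bP]] integral_sum4[OF bc_mult[OF bc_mult[OF bcc(9) bP] bP]])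
    qed
    have "c0 * (\<Sum>i\<in>UNIV. \<Sum>j\<in>UNIV. (L2 (E i j))\<^sup>2)
      = c0 * (\<Sum>i\<in>UNIV. \<Sum>j\<in>UNIV. (LINT x:\<Omega>|lborel. (Re (E i j x))\<^sup>2))
       + c0 * (\<Sum>i\<in>UNIV. \<Sum>j\<in>UNIV. (LINT x:\<Omega>|lborel. (Im (E i j x))\<^sup>2))"
      by (simp add: nn2_square_Re_Im[OF op bd bE] sum.distrib distrib_left)
    also have "\<dots> \<le> (\<Sum>i\<in>UNIV. \<Sum>j\<in>UNIV. \<Sum>k\<in>UNIV. \<Sum>l\<in>UNIV. (LINT x:\<Omega>|lborel. A_co m x i j k l * Re (E k l x) * Re (E i j x)))
       + (\<Sum>i\<in>UNIV. \<Sum>j\<in>UNIV. \<Sum>k\<in>UNIV. \<Sum>l\<in>UNIV. (LINT x:\<Omega>|lborel. A_co m x i j k l * Im (E k l x) * Im (E i j x)))"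
      by (rule add_mono[OF part[OF bounded_linear_Re] part[OF bounded_linear_Im]])
    also have "\<dots> = Re (\<Sum>i\<in>UNIV. \<Sum>j\<in>UNIV. \<Sum>k\<in>UNIV. \<Sum>l\<in>UNIV. ipc (\<lambda>x. A_co m x i j k l) (E k l) (E i j))"
      by (simp add: Re_ip[OF op bd bcc(9) bE bE] sum.distrib)
    finally show "c0 * (\<Sum>i\<in>UNIV. \<Sum>j\<in>UNIV. (L2 (E i j))\<^sup>2)
      \<le> Re (\<Sum>i\<in>UNIV. \<Sum>j\<in>UNIV. \<Sum>k\<in>UNIV. \<Sum>l\<in>UNIV. ipc (\<lambda>x. A_co m x i j k l) (E k l) (E i j))" .
  qed
qed

text \<open>Real and imaginary parts are treated as in \<open>coercive_complex\<close>. The indices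
  differ, however: the equation contracts \<open>Ct_co m x j i k l\<close> with
  \<open>dM k l\<close> and \<open>dM i j\<close>, while \<open>dissipation\<close> contracts
  \<open>Ct_co m x i j k l\<close> with \<open>\<eta> l k\<close> and \<open>\<eta> i j\<close>. The
  exchange of the two index pairs, followed by a renaming, matches them.\<close>

lemma dissipation_complex:
  assumes q: "\<And>x \<xi> \<eta>. x \<in> \<Omega> \<Longrightarrow> q * ((\<Sum>i\<in>UNIV. (\<xi> i)\<^sup>2) + (\<Sum>i\<in>UNIV. \<Sum>j\<in>UNIV. (\<eta> i j)\<^sup>2)) \<le> dissipation m x \<xi> \<eta>"
    and b\<theta>: "\<And>j. bc \<Omega> (d\<theta> j)" and bM: "\<And>i j. bc \<Omega> (dM i j)"
  shows "q * ((\<Sum>j\<in>UNIV. (L2 (d\<theta> j))\<^sup>2) + (\<Sum>i\<in>UNIV. \<Sum>j\<in>UNIV. (L2 (dM i j))\<^sup>2))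
     \<le> Re ((\<Sum>i\<in>UNIV. \<Sum>j\<in>UNIV. ipc (\<lambda>x. Kt_co m x i j) (d\<theta> j) (d\<theta> i))
        + (\<Sum>i\<in>UNIV. \<Sum>j\<in>UNIV. \<Sum>k\<in>UNIV. \<Sum>l\<in>UNIV. ipc (\<lambda>x. Ct_co m x j i k l) (dM k l) (dM i j)))"
proof -
  have part: "q * ((\<Sum>j\<in>UNIV. (LINT x:\<Omega>|lborel. (P (d\<theta> j x))\<^sup>2)) + (\<Sum>i\<in>UNIV. \<Sum>j\<in>UNIV. (LINT x:\<Omega>|lborel. (P (dM i j x))\<^sup>2)))
     \<le> (\<Sum>i\<in>UNIV. \<Sum>j\<in>UNIV. (LINT x:\<Omega>|lborel. Kt_co m x i j * P (d\<theta> j x) * P (d\<theta> i x)))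
      + (\<Sum>i\<in>UNIV. \<Sum>j\<in>UNIV. \<Sum>k\<in>UNIV. \<Sum>l\<in>UNIV. (LINT x:\<Omega>|lborel. Ct_co m x j i k l * P (dM k l x) * P (dM i j x)))"
    if P: "bounded_linear P" for P :: "complex \<Rightarrow> real"
  proof -
    have b1: "bc \<Omega> (\<lambda>x. P (d\<theta> j x))" for j by (rule bc_linear[OF P b\<theta>])
    have b2: "bc \<Omega> (\<lambda>x. P (dM i j x))" for i j by (rule bc_linear[OF P bM])
    note int = bc_set_integrable[OF op bd]
    note bcs = bc_intros b1 b2 bcc
    define f where "f = (\<lambda>x. (\<Sum>j\<in>UNIV. (P (d\<theta> j x))\<^sup>2) + (\<Sum>i\<in>UNIV. \<Sum>j\<in>UNIV. (P (dM i j x))\<^sup>2))"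
    define g where "g = (\<lambda>x. (\<Sum>i\<in>UNIV. \<Sum>j\<in>UNIV. Kt_co m x i j * P (d\<theta> j x) * P (d\<theta> i x))
      + (\<Sum>i\<in>UNIV. \<Sum>j\<in>UNIV. \<Sum>k\<in>UNIV. \<Sum>l\<in>UNIV. Ct_co m x j i k l * P (dM k l x) * P (dM i j x)))"
    have le: "q * f x \<le> g x" if x: "x \<in> \<Omega>" for x
    proof -
      have "(\<Sum>i\<in>UNIV. \<Sum>j\<in>UNIV. \<Sum>k\<in>UNIV. \<Sum>l\<in>UNIV. Ct_co m x j i k l * P (dM k l x) * P (dM i j x))
          = (\<Sum>j\<in>UNIV. \<Sum>i\<in>UNIV. \<Sum>k\<in>UNIV. \<Sum>l\<in>UNIV. Ct_co m x k l j i * P (dM i j x) * P (dM k l x))"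
        by (subst sum.swap) (intro sum.cong refl, subst symc(8)[OF x], simp)
      also have "\<dots> = (\<Sum>i\<in>UNIV. \<Sum>j\<in>UNIV. \<Sum>k\<in>UNIV. \<Sum>l\<in>UNIV. Ct_co m x i j k l * P (dM l k x) * P (dM i j x))"
      proof -
        have "(\<Sum>j\<in>UNIV. \<Sum>i\<in>UNIV. \<Sum>k\<in>UNIV. \<Sum>l\<in>UNIV. F j i k l) = (\<Sum>k\<in>UNIV. \<Sum>l\<in>UNIV. \<Sum>j\<in>UNIV. \<Sum>i\<in>UNIV. F j i k l)"
          for F :: "3 \<Rightarrow> 3 \<Rightarrow> 3 \<Rightarrow> 3 \<Rightarrow> real"
          unfolding sum.cartesian_product split_beta
          by (rule sum.reindex_bij_witness[of _ "\<lambda>(k,l,j,i). (j,i,k,l)" "\<lambda>(j,i,k,l). (k,l,j,i)"]) (auto simp: UNIV_Times_UNIV)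
        then show ?thesis by simp
      qed
      finally have "g x = dissipation m x (\<lambda>i. P (d\<theta> i x)) (\<lambda>i j. P (dM i j x))"
        unfolding g_def dissipation_def by (simp add: mult_ac)
      then show ?thesis using q[OF x, of "\<lambda>i. P (d\<theta> i x)" "\<lambda>i j. P (dM i j x)"] by (simp add: f_def)
    qed
    have bf: "bc \<Omega> f" "bc \<Omega> g" unfolding f_def g_def by (intro bcs)+
    have "(LINT x:\<Omega>|lborel. q * f x) \<le> (LINT x:\<Omega>|lborel. g x)"
      by (rule set_integral_mono) (intro int bcs bf le | assumption)+
    moreover have "(LINT x:\<Omega>|lborel. q * f x) = q * (LINT x:\<Omega>|lborel. f x)" by simp
    moreover have "(LINT x:\<Omega>|lborel. f x) = (\<Sum>j\<in>UNIV. (LINT x:\<Omega>|lborel. (P (d\<theta> j x))\<^sup>2)) + (\<Sum>i\<in>UNIV. \<Sum>j\<in>UNIV. (LINT x:\<Omega>|lborel. (P (dM i j x))\<^sup>2))"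
      unfolding f_def
      by (subst set_integral_add(2); (intro int bcs)?) (simp only: integral_sum2[OF bc_power[OF b2]] set_integral_sum[OF int[OF bc_power[OF b1]]])
    moreover have "(LINT x:\<Omega>|lborel. g x) = (\<Sum>i\<in>UNIV. \<Sum>j\<in>UNIV. (LINT x:\<Omega>|lborel. Kt_co m x i j * P (d\<theta> j x) * P (d\<theta> i x)))
      + (\<Sum>i\<in>UNIV. \<Sum>j\<in>UNIV. \<Sum>k\<in>UNIV. \<Sum>l\<in>UNIV. (LINT x:\<Omega>|lborel. Ct_co m x j i k l * P (dM k l x) * P (dM i j x)))"
      unfolding g_def
      by (subst set_integral_add(2); (intro int bcs)?)
        (simp only: integral_sum2[OF bc_mult[OF bc_mult[OF bcc(8) b1] b1]] integral_sum4[OF bc_mult[OF bc_mult[OF bcc(12) b2] b2]])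
    ultimately show ?thesis by simp
  qed
  show ?thesis
    using add_mono[OF part[OF bounded_linear_Re] part[OF bounded_linear_Im]]
    by (simp add: Re_ip[OF op bd bcc(8) b\<theta> b\<theta>] Re_ip[OF op bd bcc(12) bM bM]
        nn2_square_Re_Im[OF op bd b\<theta>] nn2_square_Re_Im[OF op bd bM] sum.distrib distrib_left add_ac)
qed

end

section \<open>The resolvent estimate\<close>

text \<open>Transform of the time derivative of a field with transform \<open>f\<close> and initial value \<open>f0\<close>.\<close>

definition rate :: "complex \<Rightarrow> (real^3 \<Rightarrow> complex) \<Rightarrow> (real^3 \<Rightarrow> complex) \<Rightarrow> real^3 \<Rightarrow> complex" where
  "rate \<mu> f f0 x = \<mu> * f x - f0 x"

definition symg :: "(3 \<Rightarrow> 3 \<Rightarrow> real^3 \<Rightarrow> complex) \<Rightarrow> 3 \<Rightarrow> 3 \<Rightarrow> real^3 \<Rightarrow> complex" where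
  "symg G i j x = (G i j x + G j i x) / 2"

lemma bc_rate: "bc \<Omega> f \<Longrightarrow> bc \<Omega> g \<Longrightarrow> bc \<Omega> (rate \<mu> f g)"
  unfolding rate_def[abs_def] by (intro bc_intros)

lemma bc_symg: "(\<And>i j. bc \<Omega> (G i j)) \<Longrightarrow> bc \<Omega> (symg G i j)"
proof -
  assume G: "\<And>i j. bc \<Omega> (G i j)"
  show ?thesis by (rule bc_cong[of _ "\<lambda>x. (1/2) * (G i j x + G j i x)"]) (intro bc_intros G, simp add: symg_def)
qed

lemma trace0_rate: "trace0 \<Omega> w dw \<Longrightarrow> trace0 \<Omega> p dp \<Longrightarrow> trace0 \<Omega> (rate \<mu> w p) (\<lambda>j. rate \<mu> (dw j) (dp j))"
  unfolding rate_def[abs_def] by (rule trace0_lin)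

lemma le_sum1: "(\<And>i. f i \<ge> 0) \<Longrightarrow> f i \<le> (\<Sum>i\<in>UNIV. f i)" for f :: "3 \<Rightarrow> real"
  by (rule member_le_sum) auto

lemma le_sum2: "(\<And>i j. f i j \<ge> 0) \<Longrightarrow> f i j \<le> (\<Sum>i\<in>UNIV. \<Sum>j\<in>UNIV. f i j)" for f :: "3 \<Rightarrow> 3 \<Rightarrow> real"
  by (rule order_trans[OF le_sum1[of "f i" j] le_sum1[of "\<lambda>i. \<Sum>j\<in>UNIV. f i j" i]]) (auto intro: sum_nonneg)

lemma sum_swap_pairs:
  "(\<Sum>i\<in>UNIV. \<Sum>j\<in>UNIV. \<Sum>k\<in>UNIV. \<Sum>l\<in>UNIV. F i j k l) = (\<Sum>k\<in>UNIV. \<Sum>l\<in>UNIV. \<Sum>i\<in>UNIV. \<Sum>j\<in>UNIV. F i j k l)"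
  for F :: "3 \<Rightarrow> 3 \<Rightarrow> 3 \<Rightarrow> 3 \<Rightarrow> 'a::comm_monoid_add"
  unfolding sum.cartesian_product split_beta
  by (rule sum.reindex_bij_witness[of _ "\<lambda>(k,l,i,j). (i,j,k,l)" "\<lambda>(i,j,k,l). (k,l,i,j)"]) (auto simp: UNIV_Times_UNIV)

lemma cnj_eq_imp_of_real: "cnj z = z \<Longrightarrow> of_real (Re z) = z"
  by (auto simp: complex_eq_iff)

text \<open>The factors 3, 9 and 81 count the index tuples of a sum; 300 is a round number above all
  their totals, here and in \<open>collect_thermal_bounds\<close>.\<close>

lemma collect_momentum_bounds:
  fixes u :: real
  assumes "u \<le> a1 + a2 + a3 + a4 + a5" "a1 \<le> 3 * t1" "a2 \<le> 81 * t2" "a3 \<le> 9 * t3" "a4 \<le> 81 * t4" "a5 \<le> 81 * t5"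
    "t1 \<le> w" "t2 \<le> w" "t3 \<le> w" "t4 \<le> w" "t5 \<le> z" "0 \<le> w" "0 \<le> z"
  shows "u \<le> 300 * w + 300 * z"
  using assms by linarith

lemma collect_thermal_bounds:
  fixes u :: real
  assumes "u \<le> a1 + a2 + a3 + a4 + a5 + a6" "a1 \<le> t1" "a2 \<le> 9 * t1" "a3 \<le> 9 * t3" "a4 \<le> 9 * t4" "a5 \<le> 81 * t5" "a6 \<le> 81 * t4"
    "t1 \<le> w1" "t3 \<le> w2" "t5 \<le> w2" "t4 \<le> w3" "0 \<le> w1" "0 \<le> w2" "0 \<le> w3"
  shows "u \<le> 300 * w1 + 300 * w2 + 300 * w3"
  using assms by linarith

context thermo begin

lemma ip_rate_left:
  "bc \<Omega> a \<Longrightarrow> bc \<Omega> f \<Longrightarrow> bc \<Omega> p \<Longrightarrow> bc \<Omega> g \<Longrightarrow> ipc a (rate c f p) g = c * ipc a f g - ipc a p g"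
  unfolding rate_def[abs_def] by (rule ip_lin_left[OF op bd])

lemma ip_rate_right:
  "bc \<Omega> a \<Longrightarrow> bc \<Omega> f \<Longrightarrow> bc \<Omega> p \<Longrightarrow> bc \<Omega> g \<Longrightarrow> ipc a g (rate c f p) = cnj c * ipc a g f - ipc a g p"
  unfolding rate_def[abs_def] by (rule ip_lin_right[OF op bd])

text \<open>A weight symmetric in \<open>i\<close> and \<open>j\<close> sees only the symmetric
  part, so a velocity gradient may be replaced by the strain of the velocity.\<close>

lemma symmetric_contraction:
  assumes b: "bc \<Omega> f" "\<And>i j. bc \<Omega> (G i j)" "\<And>i j. bc \<Omega> (a i j)" and s: "\<And>x i j. x \<in> \<Omega> \<Longrightarrow> a i j x = a j i x"
  shows "(\<Sum>i\<in>UNIV. \<Sum>j\<in>UNIV. ipc (a i j) f (G i j)) = (\<Sum>i\<in>UNIV. \<Sum>j\<in>UNIV. ipc (a i j) f (symg G i j))"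
proof -
  have "ipc (a i j) f (symg G i j) = (1/2) * ipc (a i j) f (G i j) + (1/2) * ipc (a i j) f (G j i)" for i j
  proof -
    have "ipc (a i j) f (symg G i j) = ipc (a i j) f (\<lambda>x. (1/2) * G i j x - (- (1/2)) * G j i x)"
      by (rule ip_cong) (auto simp: symg_def field_simps)
    also have "\<dots> = cnj (1/2) * ipc (a i j) f (G i j) - ipc (a i j) f (\<lambda>x. (- (1/2)) * G j i x - 0)"
      by (subst ip_lin_right[OF op bd]) (intro b bc_intros | simp)+
    also have "ipc (a i j) f (\<lambda>x. (- (1/2)) * G j i x - 0) = cnj (- (1/2)) * ipc (a i j) f (G j i) - ipc (a i j) f (\<lambda>_. 0)"
      by (rule ip_lin_right[OF op bd]) (intro b bc_intros)+
    also have "ipc (a i j) f (\<lambda>_. 0) = 0" by (simp add: ip_def)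
    finally show ?thesis by simp
  qed
  then have "(\<Sum>i\<in>UNIV. \<Sum>j\<in>UNIV. ipc (a i j) f (symg G i j))
    = (1/2) * (\<Sum>i\<in>UNIV. \<Sum>j\<in>UNIV. ipc (a i j) f (G i j)) + (1/2) * (\<Sum>i\<in>UNIV. \<Sum>j\<in>UNIV. ipc (a i j) f (G j i))"
    by (simp only: sum.distrib sum_distrib_left)
  also have "(\<Sum>i\<in>UNIV. \<Sum>j\<in>UNIV. ipc (a i j) f (G j i)) = (\<Sum>i\<in>UNIV. \<Sum>j\<in>UNIV. ipc (a i j) f (G i j))"
    by (subst sum.swap) (intro sum.cong refl ip_cong, auto simp: s)
  finally show ?thesis by simp
qed

text \<open>The transformed equations, tested with the transformed rates of \<open>u\<close>, \<open>\<tau>\<close> and \<open>R\<close>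
  themselves; \<open>p\<close> is the initial value of the rate concerned.\<close>

definition weak_momentum where
  "weak_momentum \<mu> u0 du0 p uh du \<theta> dR \<longleftrightarrow>
     (\<Sum>i\<in>UNIV. ipc (rho m) (rate \<mu> (rate \<mu> (uh i) (u0 i)) (p i)) (rate \<mu> (uh i) (u0 i)))
     + (\<Sum>i\<in>UNIV. \<Sum>j\<in>UNIV. \<Sum>k\<in>UNIV. \<Sum>l\<in>UNIV. ipc (\<lambda>x. A_co m x j i k l) (symg du k l) (rate \<mu> (du i j) (du0 i j)))
     - (\<Sum>i\<in>UNIV. \<Sum>j\<in>UNIV. ipc (\<lambda>x. a_co m x j i) \<theta> (rate \<mu> (du i j) (du0 i j)))
     + (\<Sum>i\<in>UNIV. \<Sum>j\<in>UNIV. \<Sum>k\<in>UNIV. \<Sum>l\<in>UNIV. ipc (\<lambda>x. B_co m x j i k l) (dR l k) (rate \<mu> (du i j) (du0 i j))) = 0"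

definition weak_energy where
  "weak_energy \<mu> p Ev \<theta> d\<tau> d\<theta> M dM \<longleftrightarrow>
     ipc (c_heat m) (rate \<mu> \<theta> p) \<theta> + (\<Sum>i\<in>UNIV. \<Sum>j\<in>UNIV. ipc (\<lambda>x. a_co m x i j) (Ev i j) \<theta>)
     - (\<Sum>i\<in>UNIV. \<Sum>j\<in>UNIV. ipc (\<lambda>x. d_co m x i j) (M j) (d\<theta> i))
     + (\<Sum>i\<in>UNIV. \<Sum>j\<in>UNIV. ipc (\<lambda>x. K_co m x i j) (d\<tau> j) (d\<theta> i))
     + (\<Sum>i\<in>UNIV. \<Sum>j\<in>UNIV. ipc (\<lambda>x. Kt_co m x i j) (d\<theta> j) (d\<theta> i))
     + (\<Sum>i\<in>UNIV. \<Sum>j\<in>UNIV. ipc (\<lambda>x. b_co m x i j) (dM i j) \<theta>) = 0"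

definition weak_moment where
  "weak_moment \<mu> p E \<theta> d\<theta> dR M dM \<longleftrightarrow>
     (\<Sum>i\<in>UNIV. \<Sum>j\<in>UNIV. ipc (\<lambda>x. cM m x i j) (rate \<mu> (M j) (p j)) (M i))
     + (\<Sum>i\<in>UNIV. \<Sum>j\<in>UNIV. \<Sum>k\<in>UNIV. \<Sum>l\<in>UNIV. ipc (\<lambda>x. B_co m x k l j i) (E k l) (dM i j))
     - (\<Sum>i\<in>UNIV. \<Sum>j\<in>UNIV. ipc (\<lambda>x. b_co m x j i) \<theta> (dM i j))
     + (\<Sum>i\<in>UNIV. \<Sum>j\<in>UNIV. \<Sum>k\<in>UNIV. \<Sum>l\<in>UNIV. ipc (\<lambda>x. C_co m x j i k l) (dR k l) (dM i j))
     + (\<Sum>i\<in>UNIV. \<Sum>j\<in>UNIV. \<Sum>k\<in>UNIV. \<Sum>l\<in>UNIV. ipc (\<lambda>x. Ct_co m x j i k l) (dM k l) (dM i j))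
     + (\<Sum>i\<in>UNIV. \<Sum>j\<in>UNIV. ipc (\<lambda>x. d_co m x i j) (d\<theta> j) (M i)) = 0"

text \<open>\<open>u0\<close>, \<open>p\<close> and their analogues stand for the data at the left
  end of the time window; the constants may depend on them but not on \<mu>. All pairings are
  bounded in terms of \<open>X\<close> and \<open>Y\<close>, and
  \<open>resolvent_scalar_bound\<close> draws the conclusion.\<close>

lemma resolvent_estimate:
  assumes u0: "\<And>i. trace0 \<Omega> (u0 i) (du0 i)" and \<tau>0: "trace0 \<Omega> \<tau>0 d\<tau>0" and R0: "\<And>i. trace0 \<Omega> (R0 i) (dR0 i)"
    and p: "\<And>i. bc \<Omega> (p i)" and p\<theta>: "bc \<Omega> p\<theta>" and pM: "\<And>i. bc \<Omega> (pM i)"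
  shows "\<exists>k L N. k > 0 \<and> (\<forall>\<mu> uh du \<tau>h d\<tau> Rh dR. \<bar>Re \<mu>\<bar> = k * \<bar>Im \<mu>\<bar> \<longrightarrow> cmod \<mu> \<ge> L \<longrightarrow>
      (\<forall>i. trace0 \<Omega> (uh i) (du i)) \<longrightarrow> trace0 \<Omega> \<tau>h d\<tau> \<longrightarrow> (\<forall>i. trace0 \<Omega> (Rh i) (dR i)) \<longrightarrow>
      weak_momentum \<mu> u0 du0 p uh du (rate \<mu> \<tau>h \<tau>0) dR \<longrightarrow>
      weak_energy \<mu> p\<theta> (\<lambda>i j. rate \<mu> (symg du i j) (symg du0 i j)) (rate \<mu> \<tau>h \<tau>0) d\<tau> (\<lambda>j. rate \<mu> (d\<tau> j) (d\<tau>0 j))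
        (\<lambda>i. rate \<mu> (Rh i) (R0 i)) (\<lambda>i j. rate \<mu> (dR i j) (dR0 i j)) \<longrightarrow>
      weak_moment \<mu> pM (symg du) (rate \<mu> \<tau>h \<tau>0) (\<lambda>j. rate \<mu> (d\<tau> j) (d\<tau>0 j)) dR
        (\<lambda>i. rate \<mu> (Rh i) (R0 i)) (\<lambda>i j. rate \<mu> (dR i j) (dR0 i j)) \<longrightarrow>
      (\<forall>i. L2 (uh i) \<le> N) \<and> L2 \<tau>h \<le> N \<and> (\<forall>i. L2 (Rh i) \<le> N))"
proof -
  obtain B where B0: "B > 0" and B: "\<And>x. x \<in> \<Omega> \<Longrightarrow> \<bar>rho m x\<bar> \<le> B" "\<And>x. x \<in> \<Omega> \<Longrightarrow> \<bar>c_heat m x\<bar> \<le> B"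
    "\<And>x i j. x \<in> \<Omega> \<Longrightarrow> \<bar>cM m x i j\<bar> \<le> B" "\<And>x i j. x \<in> \<Omega> \<Longrightarrow> \<bar>a_co m x i j\<bar> \<le> B"
    "\<And>x i j. x \<in> \<Omega> \<Longrightarrow> \<bar>b_co m x i j\<bar> \<le> B" "\<And>x i j. x \<in> \<Omega> \<Longrightarrow> \<bar>d_co m x i j\<bar> \<le> B"
    "\<And>x i j. x \<in> \<Omega> \<Longrightarrow> \<bar>K_co m x i j\<bar> \<le> B" "\<And>x i j. x \<in> \<Omega> \<Longrightarrow> \<bar>Kt_co m x i j\<bar> \<le> B"
    "\<And>x i j k l. x \<in> \<Omega> \<Longrightarrow> \<bar>A_co m x i j k l\<bar> \<le> B" "\<And>x i j k l. x \<in> \<Omega> \<Longrightarrow> \<bar>B_co m x i j k l\<bar> \<le> B"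
    "\<And>x i j k l. x \<in> \<Omega> \<Longrightarrow> \<bar>C_co m x i j k l\<bar> \<le> B" "\<And>x i j k l. x \<in> \<Omega> \<Longrightarrow> \<bar>Ct_co m x i j k l\<bar> \<le> B"
    "\<And>x i j k. x \<in> \<Omega> \<Longrightarrow> \<bar>pd k (\<lambda>x. a_co m x i j) x\<bar> \<le> B"
    by (rule coefficient_bound, rule that)
  obtain \<rho>0 where \<rho>0: "\<rho>0 > 0" "\<forall>x\<in>\<Omega>. \<rho>0 \<le> rho m x" using density_lower_bound by auto
  obtain q where q: "q > 0" and q': "\<forall>x\<in>\<Omega>. \<forall>\<xi> \<eta>. q * ((\<Sum>i\<in>UNIV. (\<xi> i)\<^sup>2) + (\<Sum>i\<in>UNIV. \<Sum>j\<in>UNIV. (\<eta> i j)\<^sup>2)) \<le> dissipation m x \<xi> \<eta>"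
    using dissipation_lower_bound by (elim exE conjE) (rule that)
  obtain c0 where c0: "c0 > 0" and c0': "\<forall>uh du E. (\<forall>i. trace0 \<Omega> (uh i) (du i)) \<longrightarrow> (\<forall>i j x. E i j x = (du i j x + du j i x) / 2) \<longrightarrow>
     c0 * (\<Sum>i\<in>UNIV. \<Sum>j\<in>UNIV. (L2 (E i j))\<^sup>2)
      \<le> Re (\<Sum>i\<in>UNIV. \<Sum>j\<in>UNIV. \<Sum>k\<in>UNIV. \<Sum>l\<in>UNIV. ipc (\<lambda>x. A_co m x i j k l) (E k l) (E i j))"
    using coercive_complex by (elim exE conjE) (rule that)
  obtain D where D: "\<And>x. x \<in> \<Omega> \<Longrightarrow> \<bar>x$1\<bar> \<le> D"
    using bd unfolding bounded_iff by (metis component_le_norm_cart order_trans)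
  define P where "P = 2 * \<bar>D\<bar>"
  have P: "P \<ge> 0" by (simp add: P_def)
  have bdu0: "bc \<Omega> (du0 i j)" and bd\<tau>0: "bc \<Omega> (d\<tau>0 j)" and bdR0: "bc \<Omega> (dR0 i j)" for i j
    using u0 \<tau>0 R0 by (auto intro: trace0_bc_grad)
  have bu0: "bc \<Omega> (u0 i)" and b\<tau>0: "bc \<Omega> \<tau>0" and bR0: "bc \<Omega> (R0 i)" for i
    using u0 \<tau>0 R0 by (auto intro: trace0_bc[OF bd])
  define N0 where "N0 = (\<Sum>i\<in>UNIV. L2 (p i)) + (\<Sum>i\<in>UNIV. \<Sum>j\<in>UNIV. L2 (symg du0 i j)) + L2 p\<theta> + (\<Sum>i\<in>UNIV. L2 (pM i))
     + (\<Sum>j\<in>UNIV. L2 (d\<tau>0 j)) + (\<Sum>i\<in>UNIV. \<Sum>j\<in>UNIV. L2 (dR0 i j)) + (\<Sum>i\<in>UNIV. L2 (u0 i))"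
  note nn = nn2_nonneg[of \<Omega>]
  have s0: "(\<Sum>i\<in>UNIV. L2 (p i)) \<ge> 0" "(\<Sum>i\<in>UNIV. \<Sum>j\<in>UNIV. L2 (symg du0 i j)) \<ge> 0" "L2 p\<theta> \<ge> 0" "(\<Sum>i\<in>UNIV. L2 (pM i)) \<ge> 0"
    "(\<Sum>j\<in>UNIV. L2 (d\<tau>0 j)) \<ge> 0" "(\<Sum>i\<in>UNIV. \<Sum>j\<in>UNIV. L2 (dR0 i j)) \<ge> 0" "(\<Sum>i\<in>UNIV. L2 (u0 i)) \<ge> 0"
    by (intro sum_nonneg nn)+
  have N0: "N0 \<ge> 0" unfolding N0_def using s0 by linarith
  have dat: "L2 (p i) \<le> N0" "L2 (symg du0 i j) \<le> N0" "L2 p\<theta> \<le> N0" "L2 (pM i) \<le> N0" "L2 (d\<tau>0 i) \<le> N0" "L2 (dR0 i j) \<le> N0" "L2 (u0 i) \<le> N0" for i j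
    unfolding N0_def
    using s0 le_sum1[of "\<lambda>i. L2 (p i)" i, OF nn] le_sum2[of "\<lambda>i j. L2 (symg du0 i j)" i j, OF nn]
      le_sum1[of "\<lambda>i. L2 (pM i)" i, OF nn] le_sum1[of "\<lambda>i. L2 (d\<tau>0 i)" i, OF nn]
      le_sum2[of "\<lambda>i j. L2 (dR0 i j)" i j, OF nn] le_sum1[of "\<lambda>i. L2 (u0 i)" i, OF nn]
    by linarith+
  define N1 where "N1 = 1 + N0"
  have N1: "N1 \<ge> 1" "N0 \<le> N1" using N0 by (auto simp: N1_def)
  \<comment> \<open>One constant that dominates \<open>B\<close> times every product of data bounds
    and Poincare constants met below; \<open>b1\<close> to \<open>b7\<close> record the
    instances.\<close>
  define b where "b = B * N1 * N1 * (1 + P)"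
  have b: "b > 0" using B0 N1 P by (simp add: b_def)
  have N11: "1 \<le> N1 * N1" "N0 \<le> N1 * N1" "N1 \<le> N1 * N1" "N1 * N0 \<le> N1 * N1"
    using N1 N0 mult_mono[of 1 N1 1 N1] mult_mono[of N0 N1 1 N1] mult_mono[of N1 N1 1 N1] mult_left_mono[of N0 N1 N1] by auto
  have bb: "B * s \<le> b" if "s \<le> t * (1 + P)" "t \<le> N1 * N1" for s t
  proof -
    have "s \<le> (N1 * N1) * (1 + P)" using that P by (meson add_nonneg_nonneg mult_right_mono order_trans zero_le_one)
    then have "B * s \<le> B * ((N1 * N1) * (1 + P))" using B0 by simp
    then show ?thesis by (simp add: b_def mult.assoc)
  qed
  have b1: "B * 1 \<le> b" by (rule bb[of _ 1]) (use P N11 in auto)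
  have b2: "B * N0 \<le> b" by (rule bb[of _ N0]) (use P N0 N11 in \<open>auto simp: algebra_simps\<close>)
  have b3: "B * (1 + P) \<le> b" by (rule bb[of _ 1]) (use P N11 in auto)
  have b4: "B * N1 \<le> b" by (rule bb[of _ N1]) (use P N1 N11 in \<open>auto simp: algebra_simps\<close>)
  have b5: "B * (N1 * N0) \<le> b" by (rule bb[of _ "N1 * N0"]) (use P N1 N0 N11 in \<open>auto simp: algebra_simps\<close>)
  have b6: "B * (N0 * P) \<le> b" by (rule bb[of _ N0]) (use P N0 N11 in \<open>auto simp: algebra_simps\<close>)
  have b7: "B * P \<le> b" by (rule bb[of _ 1]) (use P N11 in auto)
  have m0: "min \<rho>0 c0 > 0" using \<rho>0 c0 by simp
  have C: "300 * b > 0" using b by simp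
  show ?thesis
  proof (rule resolvent_scalar_bound[OF C q m0])
    fix k L N :: real
    assume k: "k > 0" and L: "L \<ge> 1" and N: "N > 0" and scalar:
      "\<And>\<mu> X Y \<alpha> \<beta> mm U Q V G. \<bar>Re \<mu>\<bar> = k * \<bar>Im \<mu>\<bar> \<Longrightarrow> cmod \<mu> \<ge> L \<Longrightarrow> X \<ge> 0 \<Longrightarrow> Y \<ge> 0 \<Longrightarrow>
       \<mu> * of_real \<alpha> + cnj \<mu> * of_real \<beta> = U \<Longrightarrow> min \<rho>0 c0 * X\<^sup>2 \<le> \<alpha> + \<beta> \<Longrightarrow>
       cmod U \<le> 300 * b * ((Y + 1) * X + (Y + 1) / cmod \<mu>) \<Longrightarrow>
       \<mu> * of_real mm + Q = V + G \<Longrightarrow> Re G = 0 \<Longrightarrow> cmod G \<le> 300 * b * Y\<^sup>2 \<Longrightarrow> cmod Q \<le> 300 * b * Y\<^sup>2 \<Longrightarrow>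
       q * Y\<^sup>2 \<le> Re Q \<Longrightarrow> cmod V \<le> 300 * b * Y * (1 + X + (Y + 1) / cmod \<mu>) \<Longrightarrow> X \<le> N \<and> Y \<le> N"
    show ?thesis
    \<comment> \<open>The first summand of the bound serves for \<open>u\<close>, recovered from its
      rate by dividing by \<mu>; the second serves for \<tau> and \<open>R\<close>, estimated
      through their gradients.\<close>
    proof (rule exI[of _ k], rule exI[of _ L], rule exI[of _ "(N + N0) + P * (N + N0)"], rule conjI[OF k], intro allI impI)
      fix \<mu> uh du \<tau>h d\<tau> Rh dR
      assume ray: "\<bar>Re \<mu>\<bar> = k * \<bar>Im \<mu>\<bar>" and r\<mu>: "cmod \<mu> \<ge> L"
        and tu: "\<forall>i. trace0 \<Omega> (uh i) (du i)" and t\<tau>: "trace0 \<Omega> \<tau>h d\<tau>" and tR: "\<forall>i. trace0 \<Omega> (Rh i) (dR i)"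
        and eqU: "weak_momentum \<mu> u0 du0 p uh du (rate \<mu> \<tau>h \<tau>0) dR"
        and eqT: "weak_energy \<mu> p\<theta> (\<lambda>i j. rate \<mu> (symg du i j) (symg du0 i j)) (rate \<mu> \<tau>h \<tau>0) d\<tau> (\<lambda>j. rate \<mu> (d\<tau> j) (d\<tau>0 j))
        (\<lambda>i. rate \<mu> (Rh i) (R0 i)) (\<lambda>i j. rate \<mu> (dR i j) (dR0 i j))"
        and eqR: "weak_moment \<mu> pM (symg du) (rate \<mu> \<tau>h \<tau>0) (\<lambda>j. rate \<mu> (d\<tau> j) (d\<tau>0 j)) dR
        (\<lambda>i. rate \<mu> (Rh i) (R0 i)) (\<lambda>i j. rate \<mu> (dR i j) (dR0 i j))"
      define v dv E E0 Ev \<theta> d\<theta> M dM where "v = (\<lambda>i. rate \<mu> (uh i) (u0 i))" and "dv = (\<lambda>i j. rate \<mu> (du i j) (du0 i j))"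
        and "E = symg du" and "E0 = symg du0" and "Ev = (\<lambda>i j. rate \<mu> (E i j) (E0 i j))"
        and "\<theta> = rate \<mu> \<tau>h \<tau>0" and "d\<theta> = (\<lambda>j. rate \<mu> (d\<tau> j) (d\<tau>0 j))"
        and "M = (\<lambda>i. rate \<mu> (Rh i) (R0 i))" and "dM = (\<lambda>i j. rate \<mu> (dR i j) (dR0 i j))"
      note defs = v_def dv_def E_def E0_def Ev_def \<theta>_def d\<theta>_def M_def dM_def
      have tv: "trace0 \<Omega> (v i) (dv i)" for i unfolding v_def dv_def using trace0_rate[of \<Omega> "uh i" "du i" "u0 i" "du0 i"] tu u0 by simp
      have t\<theta>: "trace0 \<Omega> \<theta> d\<theta>" unfolding \<theta>_def d\<theta>_def by (rule trace0_rate[OF t\<tau> \<tau>0])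
      have tM: "trace0 \<Omega> (M i) (dM i)" for i unfolding M_def dM_def using trace0_rate[of \<Omega> "Rh i" "dR i" "R0 i" "dR0 i"] tR R0 by simp
      have bv: "bc \<Omega> (v i)" "bc \<Omega> (dv i j)" and b\<theta>: "bc \<Omega> \<theta>" "bc \<Omega> (d\<theta> j)" and bM: "bc \<Omega> (M i)" "bc \<Omega> (dM i j)" for i j
        using tv t\<theta> tM by (auto intro: trace0_bc[OF bd] trace0_bc_grad)
      have bdu: "bc \<Omega> (du i j)" and bd\<tau>: "bc \<Omega> (d\<tau> j)" and bdR: "bc \<Omega> (dR i j)" for i j
        using tu t\<tau> tR by (auto intro: trace0_bc_grad)
      have bu: "bc \<Omega> (uh i)" and b\<tau>: "bc \<Omega> \<tau>h" and bR: "bc \<Omega> (Rh i)" for i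
        using tu t\<tau> tR by (auto intro: trace0_bc[OF bd])
      have bE: "bc \<Omega> (E i j)" "bc \<Omega> (E0 i j)" for i j unfolding E_def E0_def by (intro bc_symg bdu bdu0)+
      have sdv: "symg dv = Ev" unfolding Ev_def dv_def E_def E0_def by (intro ext) (simp add: symg_def rate_def field_simps)
      have bEv: "bc \<Omega> (Ev i j)" for i j unfolding Ev_def by (intro bc_rate bE)
      have r1: "cmod \<mu> \<ge> 1" using r\<mu> L by simp
      have \<mu>0: "\<mu> \<noteq> 0" using r1 by auto
      \<comment> \<open>\<open>X\<close> pairs the velocity with the strain of the displacement, not
        of the velocity: the forms in these two carry \<mu> and \<open>cnj \<mu>\<close> in the
        momentum identity.\<close>
      define X where "X = sqrt ((\<Sum>i\<in>UNIV. (L2 (v i))\<^sup>2) + (\<Sum>i\<in>UNIV. \<Sum>j\<in>UNIV. (L2 (E i j))\<^sup>2))"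
      define Y where "Y = sqrt ((\<Sum>j\<in>UNIV. (L2 (d\<theta> j))\<^sup>2) + (\<Sum>i\<in>UNIV. \<Sum>j\<in>UNIV. (L2 (dM i j))\<^sup>2))"
      have sq: "(\<Sum>i\<in>UNIV. (L2 (v i))\<^sup>2) \<ge> 0" "(\<Sum>i\<in>UNIV. \<Sum>j\<in>UNIV. (L2 (E i j))\<^sup>2) \<ge> 0"
        "(\<Sum>j\<in>UNIV. (L2 (d\<theta> j))\<^sup>2) \<ge> 0" "(\<Sum>i\<in>UNIV. \<Sum>j\<in>UNIV. (L2 (dM i j))\<^sup>2) \<ge> 0"
        by (intro sum_nonneg zero_le_power2)+
      have X0: "X \<ge> 0" and Y0: "Y \<ge> 0" using sq by (auto simp: X_def Y_def)
      have X2: "X\<^sup>2 = (\<Sum>i\<in>UNIV. (L2 (v i))\<^sup>2) + (\<Sum>i\<in>UNIV. \<Sum>j\<in>UNIV. (L2 (E i j))\<^sup>2)"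
        and Y2: "Y\<^sup>2 = (\<Sum>j\<in>UNIV. (L2 (d\<theta> j))\<^sup>2) + (\<Sum>i\<in>UNIV. \<Sum>j\<in>UNIV. (L2 (dM i j))\<^sup>2)"
        using sq by (auto simp: X_def Y_def)
      have nX: "L2 (v i) \<le> X" "L2 (E i j) \<le> X" for i j
        unfolding X_def using sq le_sum1[of "\<lambda>i. (L2 (v i))\<^sup>2" i, OF zero_le_power2] le_sum2[of "\<lambda>i j. (L2 (E i j))\<^sup>2" i j, OF zero_le_power2]
        by (auto intro!: real_le_rsqrt)
      have nY: "L2 (d\<theta> j) \<le> Y" "L2 (dM i j) \<le> Y" for i j
        unfolding Y_def using sq le_sum1[of "\<lambda>j. (L2 (d\<theta> j))\<^sup>2" j, OF zero_le_power2] le_sum2[of "\<lambda>i j. (L2 (dM i j))\<^sup>2" i j, OF zero_le_power2]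
        by (auto intro!: real_le_rsqrt)
      have PY: "P * L2 (d\<theta> 1) \<le> P * Y" "P * L2 (dM i 1) \<le> P * Y" for i using nY P by (auto intro!: mult_left_mono)
      have n\<theta>: "L2 \<theta> \<le> P * Y" using poincare[OF op bd t\<theta> D] PY(1) unfolding P_def by linarith
      have nM: "L2 (M i) \<le> P * Y" for i using poincare[OF op bd tM D, of i] PY(2)[of i] unfolding P_def by linarith
      \<comment> \<open>The transformed gradient is its rate plus data, divided by \<mu>. This gain
        makes the terms with \<open>K_co\<close> and \<open>C_co\<close> small and pays for the
        factor \<mu> in the \<open>B_co\<close> term.\<close>
      have nd\<tau>: "L2 (d\<tau> j) \<le> (Y + N0) / cmod \<mu>" for j
      proof -
        have "L2 (d\<tau> j) \<le> (L2 (d\<theta> j) + L2 (d\<tau>0 j)) / cmod \<mu>"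
          by (rule nn2_div[OF op bd bd\<tau> b\<theta>(2) bd\<tau>0 \<mu>0]) (simp add: d\<theta>_def rate_def)
        also have "\<dots> \<le> (Y + N0) / cmod \<mu>" using nY(1)[of j] dat(5)[of j] by (intro divide_right_mono) auto
        finally show ?thesis .
      qed
      have ndR: "L2 (dR i j) \<le> (Y + N0) / cmod \<mu>" for i j
      proof -
        have "L2 (dR i j) \<le> (L2 (dM i j) + L2 (dR0 i j)) / cmod \<mu>"
          by (rule nn2_div[OF op bd bdR bM(2) bdR0 \<mu>0]) (simp add: dM_def rate_def)
        also have "\<dots> \<le> (Y + N0) / cmod \<mu>" using nY(2)[of i j] dat(6)[of i j] by (intro divide_right_mono) auto
        finally show ?thesis .
      qed
      have ipb: "cmod (ipc a f g) \<le> B * F * G"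
        if "bc \<Omega> a" "\<And>x. x \<in> \<Omega> \<Longrightarrow> \<bar>a x\<bar> \<le> B" "bc \<Omega> f" "bc \<Omega> g" "L2 f \<le> F" "L2 g \<le> G" for a f g F G
      proof -
        have "cmod (ipc a f g) \<le> \<bar>B\<bar> * L2 f * L2 g" by (rule ip_bound[OF op bd that(1,3,4,2)])
        also have "\<dots> \<le> B * F * G" using that(5,6) nn[of f] nn[of g] B0 by (intro mult_mono) auto
        finally show ?thesis .
      qed

      \<comment> \<open>\<open>dv\<close> behaves like \<mu> times a displacement gradient and is
        not controlled by \<open>X\<close>. Integration by parts moves the derivative to \<theta>
        and \<open>a_co\<close>, which leaves \<open>v\<close>, \<open>d\<theta>\<close> and, by the
        Poincare inequality, \<theta>.\<close>
      define H where "H = (\<Sum>i\<in>UNIV. \<Sum>j\<in>UNIV. ipc (\<lambda>x. a_co m x j i) \<theta> (dv i j))"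
      have H: "cmod H \<le> 9 * (B * Y * X + B * (P * Y) * X)"
        unfolding H_def
      proof (rule sum_norm2_le)
        fix i j
        have "(LINT x:\<Omega>|lborel. (of_real (a_co m x j i) * d\<theta> j x + of_real (pd j (\<lambda>x. a_co m x j i) x) * \<theta> x) * cnj (v i x))
           = - (LINT x:\<Omega>|lborel. (of_real (a_co m x j i) * \<theta> x) * cnj (dv i j x))"
        proof (rule integration_by_parts[OF op bd tv])
          show "hpd j (\<lambda>x. of_real (a_co m x j i) * \<theta> x) (of_real (a_co m x j i) * d\<theta> j x + of_real (pd j (\<lambda>x. a_co m x j i) x) * \<theta> x) x"
            if "x \<in> \<Omega>" for x
            using t\<theta> that by (intro hpd_mult hpd_linear[OF bounded_linear_of_real] C1_closure_hpd[OF C1c(4)]) (auto simp: trace0_def)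
        qed (intro bc_intros bcc b\<theta> bc_da)+
        moreover have "(LINT x:\<Omega>|lborel. (of_real (a_co m x j i) * d\<theta> j x + of_real (pd j (\<lambda>x. a_co m x j i) x) * \<theta> x) * cnj (v i x))
          = ipc (\<lambda>x. a_co m x j i) (d\<theta> j) (v i) + ipc (pd j (\<lambda>x. a_co m x j i)) \<theta> (v i)"
          unfolding ip_def distrib_right
          by (rule set_integral_add(2)) (intro bc_set_integrable[OF op bd] bc_intros bcc b\<theta> bc_da bv)+
        ultimately have "ipc (\<lambda>x. a_co m x j i) \<theta> (dv i j) = - (ipc (\<lambda>x. a_co m x j i) (d\<theta> j) (v i) + ipc (pd j (\<lambda>x. a_co m x j i)) \<theta> (v i))"
          unfolding ip_def[of _ _ \<theta> "dv i j"] by simp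
        then have "cmod (ipc (\<lambda>x. a_co m x j i) \<theta> (dv i j)) \<le> cmod (ipc (\<lambda>x. a_co m x j i) (d\<theta> j) (v i)) + cmod (ipc (pd j (\<lambda>x. a_co m x j i)) \<theta> (v i))"
          using norm_triangle_ineq by (simp only: norm_minus_cancel)
        also have "\<dots> \<le> B * Y * X + B * (P * Y) * X"
          by (intro add_mono ipb bcc b\<theta> bc_da bv nX nY n\<theta>) (rule B(4) B(13); assumption)+
        finally show "cmod (ipc (\<lambda>x. a_co m x j i) \<theta> (dv i j)) \<le> B * Y * X + B * (P * Y) * X" .
      qed
      \<comment> \<open>Symmetry in the first index pair reduces \<open>dv\<close> to its strain
        \<open>Ev\<close>, which is the rate of \<open>E\<close>; in the second slot of the pairing
        \<mu> comes out conjugated.\<close>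
      have contr: "(\<Sum>i\<in>UNIV. \<Sum>j\<in>UNIV. \<Sum>k\<in>UNIV. \<Sum>l\<in>UNIV. ipc (a i j k l) (F k l) (dv i j)) = cnj \<mu> * (\<Sum>i\<in>UNIV. \<Sum>j\<in>UNIV. \<Sum>k\<in>UNIV. \<Sum>l\<in>UNIV. ipc (a i j k l) (F k l) (E i j)) - (\<Sum>i\<in>UNIV. \<Sum>j\<in>UNIV. \<Sum>k\<in>UNIV. \<Sum>l\<in>UNIV. ipc (a i j k l) (F k l) (E0 i j))"
        if a: "\<And>i j k l. bc \<Omega> (a i j k l)" and F: "\<And>k l. bc \<Omega> (F k l)" and sa: "\<And>x i j k l. x \<in> \<Omega> \<Longrightarrow> a i j k l x = a j i k l x"
        for a :: "3 \<Rightarrow> 3 \<Rightarrow> 3 \<Rightarrow> 3 \<Rightarrow> real^3 \<Rightarrow> real" and F :: "3 \<Rightarrow> 3 \<Rightarrow> real^3 \<Rightarrow> complex"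
      proof -
        have "(\<Sum>i\<in>UNIV. \<Sum>j\<in>UNIV. \<Sum>k\<in>UNIV. \<Sum>l\<in>UNIV. ipc (a i j k l) (F k l) (dv i j)) = (\<Sum>k\<in>UNIV. \<Sum>l\<in>UNIV. \<Sum>i\<in>UNIV. \<Sum>j\<in>UNIV. ipc (a i j k l) (F k l) (dv i j))"
          by (rule sum_swap_pairs)
        also have "\<dots> = (\<Sum>k\<in>UNIV. \<Sum>l\<in>UNIV. \<Sum>i\<in>UNIV. \<Sum>j\<in>UNIV. ipc (a i j k l) (F k l) (Ev i j))"
        proof (rule sum.cong[OF refl], rule sum.cong[OF refl])
          fix k l :: 3
          show "(\<Sum>i\<in>UNIV. \<Sum>j\<in>UNIV. ipc (a i j k l) (F k l) (dv i j)) = (\<Sum>i\<in>UNIV. \<Sum>j\<in>UNIV. ipc (a i j k l) (F k l) (Ev i j))"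
            unfolding sdv[symmetric] by (rule symmetric_contraction[OF F bv(2) a sa])
        qed
        also have "\<dots> = (\<Sum>i\<in>UNIV. \<Sum>j\<in>UNIV. \<Sum>k\<in>UNIV. \<Sum>l\<in>UNIV. ipc (a i j k l) (F k l) (Ev i j))" by (rule sum_swap_pairs[symmetric])
        also have "\<dots> = cnj \<mu> * (\<Sum>i\<in>UNIV. \<Sum>j\<in>UNIV. \<Sum>k\<in>UNIV. \<Sum>l\<in>UNIV. ipc (a i j k l) (F k l) (E i j)) - (\<Sum>i\<in>UNIV. \<Sum>j\<in>UNIV. \<Sum>k\<in>UNIV. \<Sum>l\<in>UNIV. ipc (a i j k l) (F k l) (E0 i j))"
          unfolding Ev_def by (simp only: ip_rate_right[OF a bE(1) bE(2) F] sum_subtractf sum_distrib_left)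
        finally show ?thesis .
      qed
      define SA SA0 SB SB0 S\<rho> Sp where "SA = (\<Sum>i\<in>UNIV. \<Sum>j\<in>UNIV. \<Sum>k\<in>UNIV. \<Sum>l\<in>UNIV. ipc (\<lambda>x. A_co m x j i k l) (E k l) (E i j))"
        and "SA0 = (\<Sum>i\<in>UNIV. \<Sum>j\<in>UNIV. \<Sum>k\<in>UNIV. \<Sum>l\<in>UNIV. ipc (\<lambda>x. A_co m x j i k l) (E k l) (E0 i j))"
        and "SB = (\<Sum>i\<in>UNIV. \<Sum>j\<in>UNIV. \<Sum>k\<in>UNIV. \<Sum>l\<in>UNIV. ipc (\<lambda>x. B_co m x j i k l) (dR l k) (E i j))"
        and "SB0 = (\<Sum>i\<in>UNIV. \<Sum>j\<in>UNIV. \<Sum>k\<in>UNIV. \<Sum>l\<in>UNIV. ipc (\<lambda>x. B_co m x j i k l) (dR l k) (E0 i j))"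
        and "S\<rho> = (\<Sum>i\<in>UNIV. ipc (rho m) (v i) (v i))" and "Sp = (\<Sum>i\<in>UNIV. ipc (rho m) (p i) (v i))"
      have eA: "(\<Sum>i\<in>UNIV. \<Sum>j\<in>UNIV. \<Sum>k\<in>UNIV. \<Sum>l\<in>UNIV. ipc (\<lambda>x. A_co m x j i k l) (E k l) (dv i j)) = cnj \<mu> * SA - SA0"
        unfolding SA_def SA0_def by (rule contr) (intro bcc bE symc(1) | assumption)+
      have eB: "(\<Sum>i\<in>UNIV. \<Sum>j\<in>UNIV. \<Sum>k\<in>UNIV. \<Sum>l\<in>UNIV. ipc (\<lambda>x. B_co m x j i k l) (dR l k) (dv i j)) = cnj \<mu> * SB - SB0"
        unfolding SB_def SB0_def by (rule contr) (intro bcc bdR symc(3) | assumption)+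
      have e\<rho>: "(\<Sum>i\<in>UNIV. ipc (rho m) (rate \<mu> (v i) (p i)) (v i)) = \<mu> * S\<rho> - Sp"
        unfolding S\<rho>_def Sp_def by (simp only: ip_rate_left[OF bcc(1) bv(1) p bv(1)] sum_subtractf sum_distrib_left)
      have "(\<Sum>i\<in>UNIV. ipc (rho m) (rate \<mu> (v i) (p i)) (v i)) + (\<Sum>i\<in>UNIV. \<Sum>j\<in>UNIV. \<Sum>k\<in>UNIV. \<Sum>l\<in>UNIV. ipc (\<lambda>x. A_co m x j i k l) (E k l) (dv i j)) - H + (\<Sum>i\<in>UNIV. \<Sum>j\<in>UNIV. \<Sum>k\<in>UNIV. \<Sum>l\<in>UNIV. ipc (\<lambda>x. B_co m x j i k l) (dR l k) (dv i j)) = 0"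
        using eqU unfolding weak_momentum_def H_def defs .
      then have "(\<mu> * S\<rho> - Sp) + (cnj \<mu> * SA - SA0) - H + (cnj \<mu> * SB - SB0) = 0" unfolding eA eB e\<rho> .
      then have mom: "\<mu> * S\<rho> + cnj \<mu> * SA = Sp + SA0 + H - cnj \<mu> * SB + SB0" by algebra
      \<comment> \<open>Symmetry of the two forms makes their values real, as
        \<open>resolvent_scalar_bound\<close> demands of \<open>\<alpha>\<close> and
        \<open>\<beta>\<close>.\<close>
      have S\<rho>r: "of_real (Re S\<rho>) = S\<rho>"
        by (rule cnj_eq_imp_of_real) (simp add: S\<rho>_def ip_cnj[OF op bd bcc(1) bv(1) bv(1)])
      have SA': "SA = (\<Sum>i\<in>UNIV. \<Sum>j\<in>UNIV. \<Sum>k\<in>UNIV. \<Sum>l\<in>UNIV. ipc (\<lambda>x. A_co m x i j k l) (E k l) (E i j))"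
        unfolding SA_def by (intro sum.cong refl ip_cong symc(1))
      have SAr: "of_real (Re SA) = SA"
      proof (rule cnj_eq_imp_of_real)
        have "cnj SA = (\<Sum>i\<in>UNIV. \<Sum>j\<in>UNIV. \<Sum>k\<in>UNIV. \<Sum>l\<in>UNIV. ipc (\<lambda>x. A_co m x i j k l) (E i j) (E k l))"
          unfolding SA' by (simp add: ip_cnj[OF op bd bcc(9) bE(1) bE(1)])
        also have "\<dots> = (\<Sum>k\<in>UNIV. \<Sum>l\<in>UNIV. \<Sum>i\<in>UNIV. \<Sum>j\<in>UNIV. ipc (\<lambda>x. A_co m x i j k l) (E i j) (E k l))" by (rule sum_swap_pairs)
        also have "\<dots> = SA" unfolding SA' by (intro sum.cong refl ip_cong symc(2))
        finally show "cnj SA = SA" .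
      qed
      have low: "min \<rho>0 c0 * X\<^sup>2 \<le> Re S\<rho> + Re SA"
      proof -
        have "\<rho>0 * (L2 (v i))\<^sup>2 \<le> Re (ipc (rho m) (v i) (v i))" for i
        proof -
          have "\<rho>0 * (LINT x:\<Omega>|lborel. (f x)\<^sup>2) \<le> (LINT x:\<Omega>|lborel. rho m x * f x * f x)" if "bc \<Omega> f" for f
          proof -
            have "(LINT x:\<Omega>|lborel. \<rho>0 * (f x)\<^sup>2) \<le> (LINT x:\<Omega>|lborel. rho m x * f x * f x)"
            proof (rule set_integral_mono)
              fix x assume "x \<in> \<Omega>"
              then have "\<rho>0 * (f x)\<^sup>2 \<le> rho m x * (f x)\<^sup>2" using \<rho>0(2) by (intro mult_right_mono) auto
              then show "\<rho>0 * (f x)\<^sup>2 \<le> rho m x * f x * f x" by (simp add: power2_eq_square mult.assoc)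
            qed (intro bc_set_integrable[OF op bd] bc_intros bcc that)+
            then show ?thesis by simp
          qed
          from add_mono[OF this[OF bc_Re[OF bv(1)[of i]]] this[OF bc_Im[OF bv(1)[of i]]]] show ?thesis
            by (simp add: Re_ip[OF op bd bcc(1) bv(1) bv(1)] nn2_square_Re_Im[OF op bd bv(1)] distrib_left)
        qed
        then have "(\<Sum>i\<in>UNIV. \<rho>0 * (L2 (v i))\<^sup>2) \<le> (\<Sum>i\<in>UNIV. Re (ipc (rho m) (v i) (v i)))" by (intro sum_mono)
        then have 1: "\<rho>0 * (\<Sum>i\<in>UNIV. (L2 (v i))\<^sup>2) \<le> Re S\<rho>" unfolding S\<rho>_def Re_sum sum_distrib_left .
        have 2: "c0 * (\<Sum>i\<in>UNIV. \<Sum>j\<in>UNIV. (L2 (E i j))\<^sup>2) \<le> Re SA"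
          unfolding SA' using c0'[rule_format, of uh du E] tu by (simp add: E_def symg_def)
        have "min \<rho>0 c0 * (\<Sum>i\<in>UNIV. (L2 (v i))\<^sup>2) \<le> \<rho>0 * (\<Sum>i\<in>UNIV. (L2 (v i))\<^sup>2)"
          "min \<rho>0 c0 * (\<Sum>i\<in>UNIV. \<Sum>j\<in>UNIV. (L2 (E i j))\<^sup>2) \<le> c0 * (\<Sum>i\<in>UNIV. \<Sum>j\<in>UNIV. (L2 (E i j))\<^sup>2)"
          using sq by (intro mult_right_mono; simp)+
        then show ?thesis unfolding X2 distrib_left using 1 2 by linarith
      qed
      \<comment> \<open>\<open>Z\<close> absorbs the data:
        \<open>Y + N0 \<le> N1 * Z\<close>.\<close>
      define Z r where "Z = Y + 1" and "r = cmod \<mu>"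
      have r: "r \<ge> 1" using r1 by (simp add: r_def)
      have Z: "Z \<ge> 1" "Y \<le> Z" using Y0 by (auto simp: Z_def)
      have YN: "Y + N0 \<le> N1 * Z" using Y0 N0 by (simp add: Z_def N1_def algebra_simps)
      have at: "0 \<le> b * (Z * X)" "0 \<le> b * (Z / r)" "0 \<le> b * Y" "0 \<le> b * (X * Y)" "0 \<le> b * (Z / r * Y)" "0 \<le> b * (Y * Y)"
        using b Z X0 Y0 r by auto
      have up: "s * t \<le> b * t'" if "s \<le> b" "0 \<le> t" "t \<le> t'" for s t t'
        using that b by (intro mult_mono) auto
      have XZ: "X \<le> Z * X" using Z X0 by (simp add: mult_le_cancel_right1)
      have YX: "Y * X \<le> Z * X" using Z X0 by (simp add: mult_right_mono)
      have f1: "B * N0 * X \<le> b * (Z * X)" by (rule up[OF b2 X0 XZ])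
      have f2: "B * X * N0 \<le> b * (Z * X)" using f1 by (simp add: mult_ac)
      have f3: "B * Y * X + B * (P * Y) * X \<le> b * (Z * X)"
        using up[OF b3 _ YX] X0 Y0 by (simp add: algebra_simps)
      have f4: "B * (Y + N0) * X \<le> b * (Z * X)"
      proof -
        have "B * (Y + N0) * X \<le> B * (N1 * Z) * X" using YN B0 X0 by (intro mult_right_mono mult_left_mono) auto
        also have "\<dots> = (B * N1) * (Z * X)" by (simp add: mult_ac)
        also have "\<dots> \<le> b * (Z * X)" by (rule up[OF b4]) (use Z X0 in auto)
        finally show ?thesis .
      qed
      have YNr: "(Y + N0) / r \<le> N1 * (Z / r)" using YN r by (simp add: divide_right_mono)
      have f5: "B * ((Y + N0) / r) * N0 \<le> b * (Z / r)"
      proof -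
        have "B * ((Y + N0) / r) * N0 \<le> B * (N1 * (Z / r)) * N0" using YNr B0 N0 by (intro mult_right_mono mult_left_mono) auto
        also have "\<dots> = (B * (N1 * N0)) * (Z / r)" by (simp add: mult_ac)
        also have "\<dots> \<le> b * (Z / r)" by (rule up[OF b5]) (use Z r in auto)
        finally show ?thesis .
      qed
      have f6: "B * ((Y + N0) / r) * Y \<le> b * (Z / r * Y)"
      proof -
        have "B * ((Y + N0) / r) * Y \<le> B * (N1 * (Z / r)) * Y" using YNr B0 Y0 by (intro mult_right_mono mult_left_mono) auto
        also have "\<dots> = (B * N1) * (Z / r * Y)" by (simp add: mult_ac)
        also have "\<dots> \<le> b * (Z / r * Y)" by (rule up[OF b4]) (use Z r Y0 in auto)
        finally show ?thesis .
      qed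
      have f7: "B * N0 * (P * Y) \<le> b * Y" using up[OF b6 Y0 order_refl] by (simp add: mult_ac)
      have f8: "B * Y * X + B * (P * Y) * X \<le> b * (X * Y)"
        using up[OF b3, of "X * Y" "X * Y"] X0 Y0 by (simp add: algebra_simps)
      have f9: "B * X * Y \<le> b * (X * Y)" using up[OF b1, of "X * Y" "X * Y"] X0 Y0 by (simp add: mult_ac)
      have f10: "B * (P * Y) * Y \<le> b * (Y * Y)" using up[OF b7, of "Y * Y" "Y * Y"] Y0 by (simp add: mult_ac)
      have f11: "B * Y * Y \<le> b * (Y * Y)" using up[OF b1, of "Y * Y" "Y * Y"] Y0 by (simp add: mult_ac)
      have nd\<tau>': "L2 (d\<tau> j) \<le> (Y + N0) / r" and ndR': "L2 (dR i j) \<le> (Y + N0) / r" for i j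
        using nd\<tau> ndR by (auto simp: r_def)
      have bU: "cmod (Sp + SA0 + H - cnj \<mu> * SB + SB0) \<le> 300 * b * ((Y + 1) * X + (Y + 1) / cmod \<mu>)"
      proof -
        have g1: "cmod Sp \<le> 3 * (B * N0 * X)" unfolding Sp_def
          by (rule norm_sum3_le) (intro ipb bcc p bv dat nX B; assumption)
        have g2: "cmod SA0 \<le> 81 * (B * X * N0)" unfolding SA0_def
          by (rule sum_norm4_le) (rule ipb[OF bcc(9) B(9) bE(1) bE(2) nX(2) dat(2)[folded E0_def]]; assumption)
        \<comment> \<open>Here the factor \<mu> meets the gain \<open>1 / r\<close> in the bound for
          \<open>dR\<close>.\<close>
        have g4: "cmod (cnj \<mu> * SB) \<le> 81 * (B * (Y + N0) * X)"
        proof -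
          have "cmod SB \<le> 81 * (B * ((Y + N0) / r) * X)" unfolding SB_def
            by (rule sum_norm4_le) (rule ipb[OF bcc(10) B(10) bdR bE(1) ndR' nX(2)]; assumption)
          then have "r * cmod SB \<le> r * (81 * (B * ((Y + N0) / r) * X))" using r by (intro mult_left_mono) auto
          also have "\<dots> = 81 * (B * (Y + N0) * X)" using r by simp
          finally show ?thesis by (simp add: norm_mult r_def)
        qed
        have g5: "cmod SB0 \<le> 81 * (B * ((Y + N0) / r) * N0)" unfolding SB0_def
          by (rule sum_norm4_le) (rule ipb[OF bcc(10) B(10) bdR bE(2) ndR' dat(2)[folded E0_def]]; assumption)
        have g0: "cmod (Sp + SA0 + H - cnj \<mu> * SB + SB0) \<le> cmod Sp + cmod SA0 + cmod H + cmod (cnj \<mu> * SB) + cmod SB0"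
          by (intro norm_triangle_le norm_triangle_le_diff add_mono order_refl)
        have ge: "300 * b * ((Y + 1) * X + (Y + 1) / cmod \<mu>) = 300 * (b * (Z * X)) + 300 * (b * (Z / r))"
          by (simp add: Z_def r_def algebra_simps)
        show ?thesis unfolding ge by (rule collect_momentum_bounds[OF g0 g1 g2 H g4 g5 f1 f2 f3 f4 f5 at(1,2)])
      qed

      define Q1 Q2 Dd R6 bb R3 KK R2 R4 cc cM' pc pcM where "Q1 = (\<Sum>i\<in>UNIV. \<Sum>j\<in>UNIV. ipc (\<lambda>x. Kt_co m x i j) (d\<theta> j) (d\<theta> i))"
        and "Q2 = (\<Sum>i\<in>UNIV. \<Sum>j\<in>UNIV. \<Sum>k\<in>UNIV. \<Sum>l\<in>UNIV. ipc (\<lambda>x. Ct_co m x j i k l) (dM k l) (dM i j))"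
        and "Dd = (\<Sum>i\<in>UNIV. \<Sum>j\<in>UNIV. ipc (\<lambda>x. d_co m x i j) (M j) (d\<theta> i))" and "R6 = (\<Sum>i\<in>UNIV. \<Sum>j\<in>UNIV. ipc (\<lambda>x. d_co m x i j) (d\<theta> j) (M i))"
        and "bb = (\<Sum>i\<in>UNIV. \<Sum>j\<in>UNIV. ipc (\<lambda>x. b_co m x i j) (dM i j) (\<theta>))" and "R3 = (\<Sum>i\<in>UNIV. \<Sum>j\<in>UNIV. ipc (\<lambda>x. b_co m x j i) (\<theta>) (dM i j))"
        and "KK = (\<Sum>i\<in>UNIV. \<Sum>j\<in>UNIV. ipc (\<lambda>x. K_co m x i j) (d\<tau> j) (d\<theta> i))"
        and "R2 = (\<Sum>i\<in>UNIV. \<Sum>j\<in>UNIV. \<Sum>k\<in>UNIV. \<Sum>l\<in>UNIV. ipc (\<lambda>x. B_co m x k l j i) (E k l) (dM i j))" and "R4 = (\<Sum>i\<in>UNIV. \<Sum>j\<in>UNIV. \<Sum>k\<in>UNIV. \<Sum>l\<in>UNIV. ipc (\<lambda>x. C_co m x j i k l) (dR k l) (dM i j))"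
        and "cc = ipc (c_heat m) \<theta> \<theta>" and "cM' = (\<Sum>i\<in>UNIV. \<Sum>j\<in>UNIV. ipc (\<lambda>x. cM m x i j) (M j) (M i))"
        and "pc = ipc (c_heat m) p\<theta> \<theta>" and "pcM = (\<Sum>i\<in>UNIV. \<Sum>j\<in>UNIV. ipc (\<lambda>x. cM m x i j) (pM j) (M i))"
      \<comment> \<open>By symmetry of \<open>a_co\<close> the coupling in the energy equation is
        the conjugate of the one in the momentum equation, so the bound for \<open>H\<close> serves
        twice.\<close>
      have eH: "(\<Sum>i\<in>UNIV. \<Sum>j\<in>UNIV. ipc (\<lambda>x. a_co m x i j) (Ev i j) (\<theta>)) = cnj H"
      proof -
        have "cnj H = (\<Sum>i\<in>UNIV. \<Sum>j\<in>UNIV. ipc (\<lambda>x. a_co m x j i) (dv i j) (\<theta>))" unfolding H_def by (simp add: ip_cnj[OF op bd bcc(4) b\<theta>(1) bv(2)])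
        also have "\<dots> = (\<Sum>i\<in>UNIV. \<Sum>j\<in>UNIV. ipc (\<lambda>x. a_co m x i j) (dv i j) (\<theta>))" by (intro sum.cong refl ip_cong symc(4))
        also have "\<dots> = cnj (\<Sum>i\<in>UNIV. \<Sum>j\<in>UNIV. ipc (\<lambda>x. a_co m x i j) (\<theta>) (dv i j))" by (simp add: ip_cnj[OF op bd bcc(4) b\<theta>(1) bv(2)])
        also have "(\<Sum>i\<in>UNIV. \<Sum>j\<in>UNIV. ipc (\<lambda>x. a_co m x i j) (\<theta>) (dv i j)) = (\<Sum>i\<in>UNIV. \<Sum>j\<in>UNIV. ipc (\<lambda>x. a_co m x i j) (\<theta>) (symg dv i j))"
          by (rule symmetric_contraction) (intro b\<theta> bv bcc symc(4) | assumption)+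
        also have "cnj \<dots> = (\<Sum>i\<in>UNIV. \<Sum>j\<in>UNIV. ipc (\<lambda>x. a_co m x i j) (Ev i j) (\<theta>))" unfolding sdv by (simp add: ip_cnj[OF op bd bcc(4) b\<theta>(1) bEv])
        finally show ?thesis by simp
      qed
      have "ipc (c_heat m) (rate \<mu> \<theta> p\<theta>) \<theta> + (\<Sum>i\<in>UNIV. \<Sum>j\<in>UNIV. ipc (\<lambda>x. a_co m x i j) (Ev i j) (\<theta>)) - Dd + KK + Q1 + bb = 0"
        using eqT unfolding weak_energy_def Dd_def KK_def Q1_def bb_def defs .
      then have en: "(\<mu> * cc - pc) + cnj H - Dd + KK + Q1 + bb = 0"
        unfolding eH ip_rate_left[OF bc_heat b\<theta>(1) p\<theta> b\<theta>(1)] cc_def pc_def .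
      have eM: "(\<Sum>i\<in>UNIV. \<Sum>j\<in>UNIV. ipc (\<lambda>x. cM m x i j) (rate \<mu> (M j) (pM j)) (M i)) = \<mu> * cM' - pcM"
        unfolding cM'_def pcM_def by (simp only: ip_rate_left[OF bcc(3) bM(1) pM bM(1)] sum_subtractf sum_distrib_left)
      have "(\<Sum>i\<in>UNIV. \<Sum>j\<in>UNIV. ipc (\<lambda>x. cM m x i j) (rate \<mu> (M j) (pM j)) (M i)) + R2 - R3 + R4 + Q2 + R6 = 0"
        using eqR unfolding weak_moment_def R2_def R3_def R4_def Q2_def R6_def defs .
      then have mo: "(\<mu> * cM' - pcM) + R2 - R3 + R4 + Q2 + R6 = 0" unfolding eM .
      have ccr: "of_real (Re (cc + cM')) = cc + cM'"
      proof (rule cnj_eq_imp_of_real)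
        have "cnj cM' = (\<Sum>i\<in>UNIV. \<Sum>j\<in>UNIV. ipc (\<lambda>x. cM m x i j) (M i) (M j))"
          unfolding cM'_def by (simp add: ip_cnj[OF op bd bcc(3) bM(1) bM(1)])
        also have "\<dots> = cM'" unfolding cM'_def by (subst sum.swap) (intro sum.cong refl ip_cong symc(6))
        finally show "cnj (cc + cM') = cc + cM'" by (simp add: cc_def ip_cnj[OF op bd bc_heat b\<theta>(1) b\<theta>(1)])
      qed
      have cD: "cnj Dd = R6"
      proof -
        have "cnj Dd = (\<Sum>i\<in>UNIV. \<Sum>j\<in>UNIV. ipc (\<lambda>x. d_co m x i j) (d\<theta> i) (M j))" unfolding Dd_def by (simp add: ip_cnj[OF op bd bcc(6) bM(1) b\<theta>(2)])
        also have "\<dots> = R6" unfolding R6_def by (subst sum.swap) (intro sum.cong refl ip_cong symc(7))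
        finally show ?thesis .
      qed
      have cb: "cnj bb = R3"
      proof -
        have "cnj bb = (\<Sum>i\<in>UNIV. \<Sum>j\<in>UNIV. ipc (\<lambda>x. b_co m x i j) (\<theta>) (dM i j))" unfolding bb_def by (simp add: ip_cnj[OF op bd bcc(5) bM(2) b\<theta>(1)])
        also have "\<dots> = R3" unfolding R3_def by (intro sum.cong refl ip_cong symc(5))
        finally show ?thesis .
      qed
      \<comment> \<open>The sum of the two thermal identities. The couplings through
        \<open>d_co\<close> and \<open>b_co\<close> occur in it as differences of a number and its
        conjugate, hence without real part; in size they are only comparable to the
        dissipation.\<close>
      have th: "\<mu> * of_real (Re (cc + cM')) + (Q1 + Q2) = (pc + pcM - cnj H - KK - R2 - R4) + (Dd - R6 + (R3 - bb))"
        unfolding ccr using en mo by algebra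
      have G0: "Re (Dd - R6 + (R3 - bb)) = 0" unfolding cD[symmetric] cb[symmetric] by simp
      have bDd: "cmod Dd \<le> 9 * (B * (P * Y) * Y)" unfolding Dd_def
        by (rule sum_norm2_le) (rule ipb[OF bcc(6) B(6) bM(1) b\<theta>(2) nM nY(1)]; assumption)
      have bbb: "cmod bb \<le> 9 * (B * Y * (P * Y))" unfolding bb_def
        by (rule sum_norm2_le) (rule ipb[OF bcc(5) B(5) bM(2) b\<theta>(1) nY(2) n\<theta>]; assumption)
      have e10: "B * Y * (P * Y) = B * (P * Y) * Y" by (simp add: mult_ac)
      have bR6: "cmod R6 = cmod Dd" "cmod R3 = cmod bb" unfolding cD[symmetric] cb[symmetric] by simp_all
      have e300: "300 * b * Y\<^sup>2 = 300 * (b * (Y * Y))" by (simp add: power2_eq_square)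
      have bG: "cmod (Dd - R6 + (R3 - bb)) \<le> 300 * b * Y\<^sup>2"
      proof -
        have "cmod (Dd - R6 + (R3 - bb)) \<le> (cmod Dd + cmod R6) + (cmod R3 + cmod bb)"
          by (intro norm_triangle_le add_mono norm_triangle_ineq4)
        then show ?thesis unfolding e300 using bDd bbb bR6 f10 e10 at by linarith
      qed
      have bQ: "cmod (Q1 + Q2) \<le> 300 * b * Y\<^sup>2"
      proof -
        have "cmod Q1 \<le> 9 * (B * Y * Y)" unfolding Q1_def
          by (rule sum_norm2_le) (rule ipb[OF bcc(8) B(8) b\<theta>(2) b\<theta>(2) nY(1) nY(1)]; assumption)
        moreover have "cmod Q2 \<le> 81 * (B * Y * Y)" unfolding Q2_def
          by (rule sum_norm4_le) (rule ipb[OF bcc(12) B(12) bM(2) bM(2) nY(2) nY(2)]; assumption)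
        ultimately show ?thesis unfolding e300 using norm_triangle_ineq[of Q1 Q2] f11 at by linarith
      qed
      have lQ: "q * Y\<^sup>2 \<le> Re (Q1 + Q2)"
        unfolding Y2 Q1_def Q2_def by (rule dissipation_complex[OF _ b\<theta>(2) bM(2)]) (use q' in blast)
      have bV: "cmod (pc + pcM - cnj H - KK - R2 - R4) \<le> 300 * b * Y * (1 + X + (Y + 1) / cmod \<mu>)"
      proof -
        have g1: "cmod pc \<le> B * N0 * (P * Y)" unfolding pc_def
          by (rule ipb[OF bc_heat B(2) p\<theta> b\<theta>(1) dat(3) n\<theta>])
        have g2: "cmod pcM \<le> 9 * (B * N0 * (P * Y))" unfolding pcM_def
          by (rule sum_norm2_le) (rule ipb[OF bcc(3) B(3) pM bM(1) dat(4) nM]; assumption)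
        have g4: "cmod KK \<le> 9 * (B * ((Y + N0) / r) * Y)" unfolding KK_def
          by (rule sum_norm2_le) (rule ipb[OF bcc(7) B(7) bd\<tau> b\<theta>(2) nd\<tau>' nY(1)]; assumption)
        have g5: "cmod R2 \<le> 81 * (B * X * Y)" unfolding R2_def
          by (rule sum_norm4_le) (rule ipb[OF bcc(10) B(10) bE(1) bM(2) nX(2) nY(2)]; assumption)
        have g6: "cmod R4 \<le> 81 * (B * ((Y + N0) / r) * Y)" unfolding R4_def
          by (rule sum_norm4_le) (rule ipb[OF bcc(11) B(11) bdR bM(2) ndR' nY(2)]; assumption)
        have g0: "cmod (pc + pcM - cnj H - KK - R2 - R4) \<le> cmod pc + cmod pcM + cmod (cnj H) + cmod KK + cmod R2 + cmod R4"
          by (intro norm_triangle_le norm_triangle_le_diff add_mono order_refl)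
        have g3: "cmod (cnj H) \<le> 9 * (B * Y * X + B * (P * Y) * X)" using H by simp
        have ge: "300 * b * Y * (1 + X + (Y + 1) / cmod \<mu>) = 300 * (b * Y) + 300 * (b * (X * Y)) + 300 * (b * (Z / r * Y))"
          by (simp add: Z_def r_def algebra_simps)
        show ?thesis unfolding ge by (rule collect_thermal_bounds[OF g0 g1 g2 g3 g4 g5 g6 f7 f8 f9 f6 at(3,4,5)])
      qed
      have mom': "\<mu> * of_real (Re S\<rho>) + cnj \<mu> * of_real (Re SA) = Sp + SA0 + H - cnj \<mu> * SB + SB0"
        unfolding S\<rho>r SAr by (rule mom)
      have XN: "X \<le> N" "Y \<le> N"
        using scalar[OF ray r\<mu> X0 Y0 mom' low bU th G0 bG bQ lQ bV] by auto
      have N00: "N + N0 \<ge> 0" using N N0 by simp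
      have PN: "P * (N + N0) \<ge> 0" using P N00 by simp
      have div: "t / r \<le> t" if "t \<ge> 0" for t using that r by (simp add: divide_le_eq mult_le_cancel_left1)
      have fu: "L2 (uh i) \<le> (N + N0) + P * (N + N0)" for i
      proof -
        have "L2 (uh i) \<le> (L2 (v i) + L2 (u0 i)) / cmod \<mu>"
          by (rule nn2_div[OF op bd bu bv(1) bu0 \<mu>0]) (simp add: v_def rate_def)
        also have "\<dots> \<le> L2 (v i) + L2 (u0 i)" using div[of "L2 (v i) + L2 (u0 i)"] nn[of "v i"] nn[of "u0 i"] by (simp add: r_def)
        also have "\<dots> \<le> N + N0" using nX(1)[of i] XN dat(7)[of i] by linarith
        finally show ?thesis using PN by linarith
      qed
      have YNN: "(Y + N0) / r \<le> N + N0" using div[of "Y + N0"] XN Y0 N0 by linarith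
      have f\<tau>: "L2 \<tau>h \<le> (N + N0) + P * (N + N0)"
      proof -
        have "L2 \<tau>h \<le> P * L2 (d\<tau> 1)" using poincare[OF op bd t\<tau> D] by (simp add: P_def)
        also have "\<dots> \<le> P * (N + N0)" using nd\<tau>'[of 1] YNN P by (intro mult_left_mono) auto
        finally show ?thesis using N00 by linarith
      qed
      have fR: "L2 (Rh i) \<le> (N + N0) + P * (N + N0)" for i
      proof -
        have "L2 (Rh i) \<le> P * L2 (dR i 1)" using poincare[OF op bd tR[rule_format] D, of i] by (simp add: P_def)
        also have "\<dots> \<le> P * (N + N0)" using ndR'[of i 1] YNN P by (intro mult_left_mono) auto
        finally show ?thesis using N00 by linarith
      qed
      show "(\<forall>i. L2 (uh i) \<le> (N + N0) + P * (N + N0)) \<and> L2 \<tau>h \<le> (N + N0) + P * (N + N0) \<and> (\<forall>i. L2 (Rh i) \<le> (N + N0) + P * (N + N0))"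
        using fu f\<tau> fR by blast
    qed
  qed
qed

end

section \<open>Transforms of solutions\<close>

lemma cont_extE:
  assumes "cont_ext \<Omega> f"
  obtains F where "continuous_on (closure \<Omega> \<times> {0<..}) F" "\<And>x t. x \<in> \<Omega> \<Longrightarrow> t > 0 \<Longrightarrow> F (x, t) = f x t"
  using assms unfolding cont_ext_def by blast

lemma cont_ext_cong:
  assumes "cont_ext \<Omega> f" "\<And>x t. x \<in> \<Omega> \<Longrightarrow> t > 0 \<Longrightarrow> f x t = g x t"
  shows "cont_ext \<Omega> g"
  using assms unfolding cont_ext_def by metis

lemma cont_ext_add:
  assumes "cont_ext \<Omega> f" "cont_ext \<Omega> g" shows "cont_ext \<Omega> (\<lambda>x t. f x t + g x t)"
proof (rule cont_extE[OF assms(1)], rule cont_extE[OF assms(2)])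
  fix F G :: "(real^3) \<times> real \<Rightarrow> real"
  assume "continuous_on (closure \<Omega> \<times> {0<..}) F" "\<And>x t. x \<in> \<Omega> \<Longrightarrow> t > 0 \<Longrightarrow> F (x, t) = f x t"
    "continuous_on (closure \<Omega> \<times> {0<..}) G" "\<And>x t. x \<in> \<Omega> \<Longrightarrow> t > 0 \<Longrightarrow> G (x, t) = g x t"
  then show ?thesis unfolding cont_ext_def
    by (intro exI[of _ "\<lambda>z. F z + G z"]) (auto intro: continuous_on_add)
qed

lemma cont_ext_cmult:
  assumes "continuous_on (closure \<Omega>) a" "cont_ext \<Omega> f" shows "cont_ext \<Omega> (\<lambda>x t. a x * f x t)"
proof (rule cont_extE[OF assms(2)])
  fix F :: "(real^3) \<times> real \<Rightarrow> real"
  assume F: "continuous_on (closure \<Omega> \<times> {0<..}) F" "\<And>x t. x \<in> \<Omega> \<Longrightarrow> t > 0 \<Longrightarrow> F (x, t) = f x t"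
  have "continuous_on (closure \<Omega> \<times> {0<..}) (\<lambda>z::(real^3) \<times> real. a (fst z))"
    by (rule continuous_on_compose2[OF assms(1)]) (auto intro!: continuous_intros)
  then show ?thesis unfolding cont_ext_def using F
    by (intro exI[of _ "\<lambda>z. a (fst z) * F z"]) (auto intro: continuous_on_mult)
qed

text \<open>The regularity a flux needs in order to be transformed, differentiated in direction
  \<open>j\<close> under the integral and integrated by parts; it is stable under products with
  \<open>C1_closure\<close> coefficients.\<close>

definition XC :: "(real^3) set \<Rightarrow> 3 \<Rightarrow> (real^3 \<Rightarrow> real \<Rightarrow> real) \<Rightarrow> bool" where
  "XC \<Omega> j f \<longleftrightarrow> cont_ext \<Omega> f \<and> has_dx \<Omega> j f \<and> cont_ext \<Omega> (dx j f)"

lemma XC_hpd: "XC \<Omega> j f \<Longrightarrow> x \<in> \<Omega> \<Longrightarrow> t > 0 \<Longrightarrow> hpd j (\<lambda>y. f y t) (dx j f x t) x"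
  unfolding XC_def has_dx_def dx_def by (intro pdiff_imp_hpd) auto

lemma XC_I:
  assumes "cont_ext \<Omega> f" "cont_ext \<Omega> f'" "\<And>x t. x \<in> \<Omega> \<Longrightarrow> t > 0 \<Longrightarrow> hpd j (\<lambda>y. f y t) (f' x t) x"
  shows "XC \<Omega> j f"
  unfolding XC_def
proof (intro conjI assms(1))
  have h: "pdiff j (\<lambda>y. f y t) x \<and> pd j (\<lambda>y. f y t) x = f' x t" if "x \<in> \<Omega>" "t > 0" for x t
    by (rule hpd_imp_pd[OF assms(3)[OF that]])
  then show "has_dx \<Omega> j f" by (simp add: has_dx_def)
  show "cont_ext \<Omega> (dx j f)" by (rule cont_ext_cong[OF assms(2)]) (simp add: h dx_def)
qed

lemma XC_add: "XC \<Omega> j f \<Longrightarrow> XC \<Omega> j g \<Longrightarrow> XC \<Omega> j (\<lambda>x t. f x t + g x t)"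
  by (rule XC_I[where f'="\<lambda>x t. dx j f x t + dx j g x t"])
    (auto intro!: cont_ext_add hpd_add XC_hpd simp: XC_def)

lemma XC_cmult:
  assumes a: "C1_closure \<Omega> a" and f: "XC \<Omega> j f" shows "XC \<Omega> j (\<lambda>x t. a x * f x t)"
proof -
  obtain A' where A': "continuous_on (closure \<Omega>) A'" "\<And>x. x \<in> \<Omega> \<Longrightarrow> A' x = pd j a x"
    using a unfolding C1_closure_def by blast
  have ca: "continuous_on (closure \<Omega>) a" using a unfolding C1_closure_def by blast
  show ?thesis
  proof (rule XC_I[where f'="\<lambda>x t. a x * dx j f x t + A' x * f x t"])
    show "cont_ext \<Omega> (\<lambda>x t. a x * f x t)" "cont_ext \<Omega> (\<lambda>x t. a x * dx j f x t + A' x * f x t)"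
      using f by (auto intro!: cont_ext_add cont_ext_cmult ca A' simp: XC_def)
    show "hpd j (\<lambda>y. a y * f y t) (a x * dx j f x t + A' x * f x t) x" if "x \<in> \<Omega>" "t > 0" for x t
      unfolding A'(2)[OF that(1)] by (rule hpd_mult[OF C1_closure_hpd[OF a that(1)] XC_hpd[OF f that]])
  qed
qed

lemma C1_closure_const: "C1_closure \<Omega> (\<lambda>_. c)"
  unfolding C1_closure_def
proof (intro conjI allI ballI)
  show "pdiff j (\<lambda>_. c) x" for j x using hpd_imp_pd[OF hpd_const] by blast
  show "\<exists>F. continuous_on (closure \<Omega>) F \<and> (\<forall>x\<in>\<Omega>. F x = pd j (\<lambda>_. c) x)" for j
    using hpd_imp_pd[OF hpd_const[of j c]] by (intro exI[of _ "\<lambda>_. 0"]) auto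
qed simp

lemma XC_minus: "XC \<Omega> j f \<Longrightarrow> XC \<Omega> j (\<lambda>x t. - f x t)"
  using XC_cmult[OF C1_closure_const[of \<Omega> "-1"]] by simp

lemma XC_diff: "XC \<Omega> j f \<Longrightarrow> XC \<Omega> j g \<Longrightarrow> XC \<Omega> j (\<lambda>x t. f x t - g x t)"
  using XC_add[OF _ XC_minus, of \<Omega> j f g] by simp

lemma XC_zero: "XC \<Omega> j (\<lambda>x t. 0)"
  by (rule XC_I[where f'="\<lambda>_ _. 0"]) (auto simp: cont_ext_def intro!: exI[of _ "\<lambda>_. 0"])

lemma XC_sum: "(\<And>i. i \<in> I \<Longrightarrow> XC \<Omega> j (f i)) \<Longrightarrow> XC \<Omega> j (\<lambda>x t. \<Sum>i\<in>I. f i x t)"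
  by (induction I rule: infinite_finite_induct) (auto intro: XC_add XC_zero)

text \<open>The kernel is 1 at \<open>t = d\<close>, so the values at time \<open>d\<close> enter
  the derivative rule without a factor. The finite window makes the transform of a continuous
  function entire in \<mu>.\<close>

definition tr :: "real \<Rightarrow> real \<Rightarrow> complex \<Rightarrow> (real^3 \<Rightarrow> real \<Rightarrow> real) \<Rightarrow> real^3 \<Rightarrow> complex" where
  "tr d T \<mu> f x = integral {d..T} (\<lambda>t. exp (- \<mu> * of_real (t - d)) * of_real (f x t))"

lemma cont_ext_slice_t:
  assumes "cont_ext \<Omega> f" "x \<in> \<Omega>" shows "continuous_on {0<..} (f x)"
proof (rule cont_extE[OF assms(1)])
  fix F :: "(real^3) \<times> real \<Rightarrow> real"
  assume F: "continuous_on (closure \<Omega> \<times> {0<..}) F" "\<And>x t. x \<in> \<Omega> \<Longrightarrow> t > 0 \<Longrightarrow> F (x, t) = f x t"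
  have "continuous_on {0<..} (\<lambda>t. F (x, t))"
    by (rule continuous_on_compose2[OF F(1)]) (use assms(2) closure_subset in \<open>auto intro!: continuous_intros\<close>)
  then show ?thesis by (rule continuous_on_eq) (use F(2) assms(2) in auto)
qed

lemma cont_ext_slice_bc:
  assumes "bounded \<Omega>" "cont_ext \<Omega> f" "t > 0" shows "bc \<Omega> (\<lambda>x. f x t)"
proof (rule cont_extE[OF assms(2)])
  fix F :: "(real^3) \<times> real \<Rightarrow> real"
  assume F: "continuous_on (closure \<Omega> \<times> {0<..}) F" "\<And>x t. x \<in> \<Omega> \<Longrightarrow> t > 0 \<Longrightarrow> F (x, t) = f x t"
  have "continuous_on (closure \<Omega>) (\<lambda>x. F (x, t))"
    by (rule continuous_on_compose2[OF F(1)]) (use assms(3) in \<open>auto intro!: continuous_intros\<close>)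
  then show ?thesis by (rule bc_cong[OF bc_closure[OF assms(1)]]) (use F(2) assms(3) in auto)
qed

context
  fixes \<Omega> :: "(real^3) set" and d T :: real
  assumes op: "open \<Omega>" and bd: "bounded \<Omega>" and d: "d > 0" and dT: "d < T"
begin

lemma tr_integrand:
  assumes "cont_ext \<Omega> f" "x \<in> \<Omega>"
  shows "continuous_on {d..T} (\<lambda>t. exp (- \<mu> * of_real (t - d)) * (of_real (f x t) :: complex))"
  by (intro continuous_intros continuous_on_subset[OF cont_ext_slice_t[OF assms]]) (use d in auto)

lemma tr_continuous:
  assumes "continuous_on (closure \<Omega> \<times> {0<..}) F"
  shows "continuous_on (closure \<Omega>) (\<lambda>x. integral {d..T} (\<lambda>t. exp (- \<mu> * of_real (t - d)) * (of_real (F (x, t)) :: complex)))"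
proof -
  have F': "continuous_on (closure \<Omega> \<times> {d..T}) (\<lambda>z. F (fst z, snd z))"
    by (rule continuous_on_compose2[OF assms]) (use d in \<open>auto intro!: continuous_intros\<close>)
  show ?thesis unfolding interval_cbox
    by (rule integral_continuous_on_param, unfold split_beta cbox_interval)
      (intro continuous_intros F')
qed

lemma tr_bc: assumes "cont_ext \<Omega> f" shows "bc \<Omega> (tr d T \<mu> f)"
proof (rule cont_extE[OF assms])
  fix F :: "(real^3) \<times> real \<Rightarrow> real"
  assume F: "continuous_on (closure \<Omega> \<times> {0<..}) F" "\<And>x t. x \<in> \<Omega> \<Longrightarrow> t > 0 \<Longrightarrow> F (x, t) = f x t"
  show ?thesis
    by (rule bc_cong[OF bc_closure[OF bd tr_continuous[OF F(1)]]])
      (use F(2) d in \<open>auto simp: tr_def intro!: Henstock_Kurzweil_Integration.integral_cong\<close>)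
qed

text \<open>Differentiation under the integral, with shifts \<open>h\<close> so small that the
  shifted point stays in \<Omega>; there the derivative is jointly continuous in shift and
  time.\<close>

lemma tr_hpd:
  assumes f: "XC \<Omega> j f" and x: "x \<in> \<Omega>"
  shows "hpd j (tr d T \<mu> f) (tr d T \<mu> (dx j f) x) x"
proof -
  let ?e = "axis j 1 :: real^3"
  define U where "U = (\<lambda>h. x + h *\<^sub>R ?e) -` \<Omega>"
  have "open U" unfolding U_def by (intro open_vimage op continuous_intros)
  moreover have "0 \<in> U" using x by (simp add: U_def)
  ultimately obtain r where r: "r > 0" "ball 0 r \<subseteq> U" using open_contains_ball by blast
  have f2: "cont_ext \<Omega> f" "cont_ext \<Omega> (dx j f)" using f by (auto simp: XC_def)
  have inU: "x + h *\<^sub>R ?e \<in> \<Omega>" if "h \<in> ball 0 r" for h using that r(2) unfolding U_def by blast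
  have "((\<lambda>h. integral (cbox d T) (\<lambda>t. exp (- \<mu> * of_real (t - d)) * of_real (f (x + h *\<^sub>R ?e) t))) has_vector_derivative
      integral (cbox d T) (\<lambda>t. exp (- \<mu> * of_real (t - d)) * of_real (dx j f (x + 0 *\<^sub>R ?e) t))) (at 0 within ball 0 r)"
  proof (rule leibniz_rule_vector_derivative)
    fix h t :: real assume h: "h \<in> ball 0 r" and t: "t \<in> cbox d T"
    have "((\<lambda>h. f (x + h *\<^sub>R ?e) t) has_vector_derivative dx j f (x + h *\<^sub>R ?e) t) (at h)"
      by (rule hpd_shift, rule XC_hpd[OF f inU[OF h]]) (use t d in auto)
    then have "((\<lambda>h. of_real (f (x + h *\<^sub>R ?e) t) :: complex) has_vector_derivative of_real (dx j f (x + h *\<^sub>R ?e) t)) (at h)"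
      by (rule bounded_linear.has_vector_derivative[OF bounded_linear_of_real])
    then show "((\<lambda>h. exp (- \<mu> * of_real (t - d)) * of_real (f (x + h *\<^sub>R ?e) t)) has_vector_derivative
        exp (- \<mu> * of_real (t - d)) * of_real (dx j f (x + h *\<^sub>R ?e) t)) (at h within ball 0 r)"
      by (rule has_vector_derivative_at_within[OF has_vector_derivative_mult_right])
  next
    fix h :: real assume "h \<in> ball 0 r"
    then show "(\<lambda>t. exp (- \<mu> * of_real (t - d)) * (of_real (f (x + h *\<^sub>R ?e) t) :: complex)) integrable_on cbox d T"
      unfolding cbox_interval by (intro integrable_continuous_interval tr_integrand[OF f2(1)] inU)
  next
    show "continuous_on (ball 0 r \<times> cbox d T) (\<lambda>(h, t). exp (- \<mu> * of_real (t - d)) * (of_real (dx j f (x + h *\<^sub>R ?e) t) :: complex))"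
    proof (rule cont_extE[OF f2(2)])
      fix F :: "(real^3) \<times> real \<Rightarrow> real"
      assume F: "continuous_on (closure \<Omega> \<times> {0<..}) F" "\<And>x t. x \<in> \<Omega> \<Longrightarrow> t > 0 \<Longrightarrow> F (x, t) = dx j f x t"
      have "continuous_on (ball 0 r \<times> cbox d T) (\<lambda>z. F (x + fst z *\<^sub>R ?e, snd z))"
        by (rule continuous_on_compose2[OF F(1)])
          (use inU closure_subset[of \<Omega>] d in \<open>auto intro!: continuous_intros\<close>)
      then have "continuous_on (ball 0 r \<times> cbox d T) (\<lambda>z. exp (- \<mu> * of_real (snd z - d)) * (of_real (F (x + fst z *\<^sub>R ?e, snd z)) :: complex))"
        by (intro continuous_intros)
      then show ?thesis
        by (rule continuous_on_eq) (use F(2) inU d in auto)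
    qed
  qed (use r in auto)
  then have "((\<lambda>h. tr d T \<mu> f (x + h *\<^sub>R ?e)) has_vector_derivative tr d T \<mu> (dx j f) x) (at 0 within ball 0 r)"
    by (simp add: tr_def cbox_interval)
  then show ?thesis unfolding hpd_def using r(1) by (simp add: at_within_open[of _ "ball 0 r"])
qed

text \<open>Integration by parts in time. With \<open>f x T = 0\<close> the end of the window
  contributes nothing, and its beginning gives the value at time \<open>d\<close>.\<close>

lemma tr_dt:
  assumes f: "cont_ext \<Omega> f" "has_dt \<Omega> f" "cont_ext \<Omega> (dt f)" and x: "x \<in> \<Omega>" and fT: "f x T = 0"
  shows "tr d T \<mu> (dt f) x = rate \<mu> (tr d T \<mu> f) (\<lambda>x. of_real (f x d)) x"
proof -
  let ?E = "\<lambda>t. exp (- \<mu> * of_real (t - d))"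
  have "((\<lambda>t. ?E t * of_real (dt f x t) - \<mu> * (?E t * of_real (f x t))) has_integral
     ?E T * of_real (f x T) - ?E d * of_real (f x d)) {d..T}"
  proof (rule fundamental_theorem_of_calculus)
    fix t assume t: "t \<in> {d..T}"
    have "((\<lambda>s. f x s) has_real_derivative dt f x t) (at t)"
      using f(2) x t d unfolding has_dt_def dt_def by (auto simp: DERIV_deriv_iff_real_differentiable)
    then have 1: "((\<lambda>s. of_real (f x s) :: complex) has_vector_derivative of_real (dt f x t)) (at t)"
      unfolding has_real_derivative_iff_has_vector_derivative
      by (rule bounded_linear.has_vector_derivative[OF bounded_linear_of_real])
    have 2: "(?E has_vector_derivative - \<mu> * ?E t) (at t)"
    proof -
      have l: "((\<lambda>s. - \<mu> * of_real (s - d)) has_vector_derivative - \<mu>) (at t)"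
        by (auto intro!: derivative_eq_intros)
      have "(exp \<circ> (\<lambda>s. - \<mu> * of_real (s - d)) has_vector_derivative - \<mu> * exp (- \<mu> * of_real (t - d))) (at t)"
        by (rule field_vector_diff_chain_at[OF l DERIV_exp])
      then show ?thesis by (simp add: o_def)
    qed
    have e: "?E t * of_real (dt f x t) + - \<mu> * ?E t * of_real (f x t) = ?E t * of_real (dt f x t) - \<mu> * (?E t * of_real (f x t))"
      by simp
    show "((\<lambda>s. ?E s * of_real (f x s)) has_vector_derivative ?E t * of_real (dt f x t) - \<mu> * (?E t * of_real (f x t))) (at t within {d..T})"
      by (rule has_vector_derivative_at_within) (rule has_vector_derivative_mult[OF 2 1, unfolded e])
  qed (use dT in simp)
  then have "integral {d..T} (\<lambda>t. ?E t * of_real (dt f x t) - \<mu> * (?E t * of_real (f x t))) = - of_real (f x d)"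
    using fT by (simp add: integral_unique)
  moreover have "integral {d..T} (\<lambda>t. ?E t * of_real (dt f x t) - \<mu> * (?E t * of_real (f x t)))
     = integral {d..T} (\<lambda>t. ?E t * of_real (dt f x t)) - integral {d..T} (\<lambda>t. \<mu> * (?E t * of_real (f x t)))"
    by (intro Henstock_Kurzweil_Integration.integral_diff integrable_continuous_interval continuous_on_mult continuous_on_const
        tr_integrand[OF f(3) x] tr_integrand[OF f(1) x])
  ultimately have "tr d T \<mu> (dt f) x - \<mu> * tr d T \<mu> f x = - of_real (f x d)"
    unfolding tr_def integral_mult_right by simp
  then show ?thesis unfolding rate_def by (simp add: algebra_simps)
qed

lemma tr_cong:
  assumes "\<And>t. t > 0 \<Longrightarrow> f x t = g x t" shows "tr d T \<mu> f x = tr d T \<mu> g x"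
  unfolding tr_def by (rule Henstock_Kurzweil_Integration.integral_cong) (use assms d in auto)

lemma tr_add:
  assumes "cont_ext \<Omega> f" "cont_ext \<Omega> g" "x \<in> \<Omega>"
  shows "tr d T \<mu> (\<lambda>x t. f x t + g x t) x = tr d T \<mu> f x + tr d T \<mu> g x"
proof -
  have "tr d T \<mu> (\<lambda>x t. f x t + g x t) x = integral {d..T} (\<lambda>t. exp (- \<mu> * of_real (t - d)) * of_real (f x t) + exp (- \<mu> * of_real (t - d)) * of_real (g x t))"
    unfolding tr_def by (rule Henstock_Kurzweil_Integration.integral_cong) (simp only: of_real_add distrib_left)
  also have "\<dots> = tr d T \<mu> f x + tr d T \<mu> g x"
    unfolding tr_def by (intro Henstock_Kurzweil_Integration.integral_add integrable_continuous_interval tr_integrand assms)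
  finally show ?thesis .
qed

lemma tr_cmult: "tr d T \<mu> (\<lambda>x t. a x * f x t) x = of_real (a x) * tr d T \<mu> f x"
  unfolding tr_def by (simp only: of_real_mult mult.left_commute[of _ "of_real (a x)"] integral_mult_right)

lemma tr_minus: "tr d T \<mu> (\<lambda>x t. - f x t) x = - tr d T \<mu> f x"
  using tr_cmult[of \<mu> "\<lambda>_. -1" f x] by simp

lemma tr_diff:
  assumes f: "cont_ext \<Omega> f" and g: "cont_ext \<Omega> g" and x: "x \<in> \<Omega>"
  shows "tr d T \<mu> (\<lambda>x t. f x t - g x t) x = tr d T \<mu> f x - tr d T \<mu> g x"
proof -
  have "cont_ext \<Omega> (\<lambda>x t. - g x t)" using cont_ext_cmult[OF continuous_on_const[of _ "-1"] g] by simp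
  from tr_add[OF f this x, of \<mu>] show ?thesis by (simp add: tr_minus)
qed

lemma tr_sum:
  assumes f: "\<And>i. i \<in> I \<Longrightarrow> cont_ext \<Omega> (f i)" and x: "x \<in> \<Omega>" and I: "finite I"
  shows "tr d T \<mu> (\<lambda>x t. \<Sum>i\<in>I. f i x t) x = (\<Sum>i\<in>I. tr d T \<mu> (f i) x)"
proof -
  have "tr d T \<mu> (\<lambda>x t. \<Sum>i\<in>I. f i x t) x = integral {d..T} (\<lambda>t. \<Sum>i\<in>I. exp (- \<mu> * of_real (t - d)) * of_real (f i x t))"
    unfolding tr_def by (rule Henstock_Kurzweil_Integration.integral_cong) (simp only: of_real_sum sum_distrib_left)
  also have "\<dots> = (\<Sum>i\<in>I. tr d T \<mu> (f i) x)"
    unfolding tr_def by (intro Henstock_Kurzweil_Integration.integral_sum I integrable_continuous_interval tr_integrand f x)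
  finally show ?thesis .
qed

end

section \<open>Derivative rules for the transforms of a solution\<close>

lemma cont_ext_const0: "cont_ext \<Omega> (\<lambda>x t. 0)"
  unfolding cont_ext_def by (intro exI[of _ "\<lambda>_. 0"]) auto

lemma cont_ext_sum: "(\<And>i. i \<in> I \<Longrightarrow> cont_ext \<Omega> (f i)) \<Longrightarrow> cont_ext \<Omega> (\<lambda>x t. \<Sum>i\<in>I. f i x t)"
  by (induction I rule: infinite_finite_induct) (auto intro: cont_ext_add cont_ext_const0)

lemma XC_cont_ext: "XC \<Omega> j f \<Longrightarrow> cont_ext \<Omega> f"
  by (simp add: XC_def)

lemma XC_cont_ext_dx: "XC \<Omega> j f \<Longrightarrow> cont_ext \<Omega> (dx j f)"
  by (simp add: XC_def)

lemma C2_spacetime_XC: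
  assumes "C2_spacetime \<Omega> f"
  shows "XC \<Omega> j f" "XC \<Omega> j (dt f)" "XC \<Omega> k (dx j f)"
  using assms unfolding C2_spacetime_def C1_spacetime_def XC_def by auto

lemma C2_spacetime_dt:
  assumes "C2_spacetime \<Omega> f"
  shows "has_dt \<Omega> f" "has_dt \<Omega> (dt f)" "has_dt \<Omega> (dx j f)" "cont_ext \<Omega> (dt (dt f))" "cont_ext \<Omega> (dt (dx j f))"
  using assms unfolding C2_spacetime_def C1_spacetime_def by auto

definition snap :: "real \<Rightarrow> (real^3 \<Rightarrow> real \<Rightarrow> real) \<Rightarrow> real^3 \<Rightarrow> complex" where
  "snap d f x = of_real (f x d)"

lemma dt_zero_late:
  assumes "\<And>t. t > t0 \<Longrightarrow> f x t = 0" "T > t0" shows "dt f x T = 0"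
proof -
  have "((\<lambda>s. f x s) has_real_derivative 0) (at T)"
    by (rule has_field_derivative_transform_within_open[of "\<lambda>_. 0" 0 T "{t0<..}"]) (use assms in auto)
  then show ?thesis unfolding dt_def by (rule DERIV_imp_deriv)
qed

lemma dx_zero:
  assumes "open \<Omega>" "x \<in> \<Omega>" "\<And>y. y \<in> \<Omega> \<Longrightarrow> f y t = 0" shows "dx j f x t = 0"
  unfolding dx_def using hpd_imp_pd[OF hpd_cong[OF assms(1,2) _ hpd_const[of j 0]], of "\<lambda>y. f y t"] assms(3) by auto

lemma hpd_of_real: "hpd j f a x \<Longrightarrow> hpd j (\<lambda>x. of_real (f x) :: complex) (of_real a) x"
  by (rule hpd_linear[OF bounded_linear_of_real])

text \<open>\<open>T\<close> lies strictly beyond \<open>t0\<close>, so the fields vanish on a whole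
  time interval around \<open>T\<close> and their rates vanish at \<open>T\<close> as well.\<close>

locale solution = thermo +
  fixes u R :: "3 \<Rightarrow> real^3 \<Rightarrow> real \<Rightarrow> real" and \<tau> :: "real^3 \<Rightarrow> real \<Rightarrow> real" and d T t0 :: real
  assumes sol: "is_solution \<Omega> m u \<tau> R"
    and bu: "\<And>i. boundary_zero \<Omega> (u i)" and b\<tau>: "boundary_zero \<Omega> \<tau>" and bR: "\<And>i. boundary_zero \<Omega> (R i)"
    and d: "d > 0" and dT: "d < T" and t0T: "t0 < T"
    and late: "\<And>x t i. x \<in> \<Omega> \<Longrightarrow> t > t0 \<Longrightarrow> u i x t = 0" "\<And>x t. x \<in> \<Omega> \<Longrightarrow> t > t0 \<Longrightarrow> \<tau> x t = 0"
      "\<And>x t i. x \<in> \<Omega> \<Longrightarrow> t > t0 \<Longrightarrow> R i x t = 0"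
begin

abbreviation L where "L \<equiv> tr d T"
abbreviation S where "S \<equiv> snap d"

lemmas tr_rules = tr_bc[OF op bd d dT] tr_hpd[OF op bd d dT] tr_dt[OF op bd d dT]

lemma C2: "C2_spacetime \<Omega> (u i)" "C2_spacetime \<Omega> \<tau>" "C2_spacetime \<Omega> (R i)"
  and Cr: "XC \<Omega> k (dx j (dt \<tau>))" "XC \<Omega> k (dx j (dt (R i)))"
  using sol unfolding is_solution_def C2_rate_def XC_def C2_spacetime_def C1_spacetime_def by auto

lemma trace0_tr:
  assumes f: "C2_spacetime \<Omega> f" and b: "boundary_zero \<Omega> f"
  shows "trace0 \<Omega> (L \<mu> f) (\<lambda>j. L \<mu> (dx j f))"
  unfolding trace0_def
proof (intro conjI allI ballI)
  have "continuous_on (closure \<Omega> \<times> {0<..}) (\<lambda>(x, t). f x t)" using f unfolding C2_spacetime_def by blast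
  from tr_continuous[OF op bd d dT this] show "continuous_on (closure \<Omega>) (L \<mu> f)"
    by (simp add: tr_def[abs_def])
  show "L \<mu> f x = 0" if "x \<in> frontier \<Omega>" for x
  proof -
    have "L \<mu> f x = integral {d..T} (\<lambda>t. 0)" unfolding tr_def
      by (rule Henstock_Kurzweil_Integration.integral_cong) (use that b d in \<open>auto simp: boundary_zero_def\<close>)
    then show ?thesis by simp
  qed
  show "bc \<Omega> (L \<mu> (dx j f))" for j by (rule tr_rules(1)[OF XC_cont_ext_dx[OF C2_spacetime_XC(1)[OF f]]])
  show "hpd j (L \<mu> f) (L \<mu> (dx j f) x) x" if "x \<in> \<Omega>" for j x
    by (rule tr_rules(2)[OF C2_spacetime_XC(1)[OF f] that])
qed

lemma trace0_snap:
  assumes f: "C2_spacetime \<Omega> f" and b: "boundary_zero \<Omega> f"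
  shows "trace0 \<Omega> (S f) (\<lambda>j. S (dx j f))"
  unfolding trace0_def
proof (intro conjI allI ballI)
  have F: "continuous_on (closure \<Omega> \<times> {0<..}) (\<lambda>(x, t). f x t)" using f unfolding C2_spacetime_def by blast
  have "continuous_on (closure \<Omega>) (\<lambda>x. case (x, d) of (x, t) \<Rightarrow> f x t)"
    by (rule continuous_on_compose2[OF F]) (use d in \<open>auto intro!: continuous_intros\<close>)
  then show "continuous_on (closure \<Omega>) (S f)" unfolding snap_def[abs_def] by (intro continuous_intros) simp
  show "S f x = 0" if "x \<in> frontier \<Omega>" for x using that b d by (simp add: snap_def boundary_zero_def)
  show "bc \<Omega> (S (dx j f))" for j unfolding snap_def[abs_def]
    by (intro bc_of_real cont_ext_slice_bc[OF bd XC_cont_ext_dx[OF C2_spacetime_XC(1)[OF f]] d])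
  show "hpd j (S f) (S (dx j f) x) x" if "x \<in> \<Omega>" for j x
    unfolding snap_def[abs_def] by (rule hpd_of_real[OF XC_hpd[OF C2_spacetime_XC(1)[OF f] that d]])
qed

context
  fixes f :: "real^3 \<Rightarrow> real \<Rightarrow> real"
  assumes f: "C2_spacetime \<Omega> f" and z: "\<And>x t. x \<in> \<Omega> \<Longrightarrow> t > t0 \<Longrightarrow> f x t = 0"
begin

lemma tr_dt1: "x \<in> \<Omega> \<Longrightarrow> L \<mu> (dt f) x = rate \<mu> (L \<mu> f) (S f) x"
  unfolding snap_def[abs_def]
  by (rule tr_rules(3)[OF XC_cont_ext[OF C2_spacetime_XC(1)[OF f]] C2_spacetime_dt(1)[OF f] XC_cont_ext[OF C2_spacetime_XC(2)[OF f]]])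
    (use z t0T in auto)

lemma tr_dt2: "x \<in> \<Omega> \<Longrightarrow> L \<mu> (dt (dt f)) x = rate \<mu> (rate \<mu> (L \<mu> f) (S f)) (S (dt f)) x"
proof -
  assume x: "x \<in> \<Omega>"
  have "L \<mu> (dt (dt f)) x = rate \<mu> (L \<mu> (dt f)) (S (dt f)) x"
    unfolding snap_def[abs_def]
    by (rule tr_rules(3)[OF XC_cont_ext[OF C2_spacetime_XC(2)[OF f]] C2_spacetime_dt(2)[OF f] C2_spacetime_dt(4)[OF f] x])
      (rule dt_zero_late[of t0 f x T, OF z[OF x] t0T])
  then show ?thesis unfolding rate_def[of _ _ "S (dt f)"] tr_dt1[OF x] .
qed

lemma tr_dt_dx: "x \<in> \<Omega> \<Longrightarrow> L \<mu> (dt (dx j f)) x = rate \<mu> (L \<mu> (dx j f)) (S (dx j f)) x"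
  unfolding snap_def[abs_def]
  by (rule tr_rules(3)[OF XC_cont_ext_dx[OF C2_spacetime_XC(1)[OF f]] C2_spacetime_dt(3)[OF f] C2_spacetime_dt(5)[OF f]])
    (auto intro!: dx_zero[OF op] z t0T)

text \<open>The transform of a rate and its affine expression have the same gradient, so the order of
  \<^term>\<open>dt\<close> and \<^term>\<open>dx j\<close> need not be interchanged.\<close>

lemma tr_dx_dt: "x \<in> \<Omega> \<Longrightarrow> L \<mu> (dx j (dt f)) x = rate \<mu> (L \<mu> (dx j f)) (S (dx j f)) x"
proof -
  assume x: "x \<in> \<Omega>"
  have 1: "hpd j (L \<mu> (dt f)) (L \<mu> (dx j (dt f)) x) x" by (rule tr_rules(2)[OF C2_spacetime_XC(2)[OF f] x])
  have "hpd j (\<lambda>x. \<mu> * L \<mu> f x - S f x) (\<mu> * L \<mu> (dx j f) x - S (dx j f) x) x"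
    unfolding snap_def[abs_def]
    by (intro hpd_diff hpd_cmult tr_rules(2)[OF C2_spacetime_XC(1)[OF f] x] hpd_of_real[OF XC_hpd[OF C2_spacetime_XC(1)[OF f] x d]])
  then have "hpd j (L \<mu> (dt f)) (\<mu> * L \<mu> (dx j f) x - S (dx j f) x) x"
    by (rule hpd_cong[OF op x, rotated]) (simp add: tr_dt1 rate_def)
  from hpd_unique[OF 1 this] show ?thesis by (simp add: rate_def)
qed

end

lemma strain_half: "strain u i j = (\<lambda>x t. (1/2) * (dx j (u i) x t + dx i (u j) x t))"
  by (intro ext) (simp add: strain_def)

lemma XC_strain: "XC \<Omega> k (strain u i j)"
  unfolding strain_half by (intro XC_cmult[OF C1_closure_const] XC_add C2_spacetime_XC(3)[OF C2(1)])

lemma tr_strain: "x \<in> \<Omega> \<Longrightarrow> L \<mu> (strain u i j) x = symg (\<lambda>i j. L \<mu> (dx j (u i))) i j x"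
  unfolding strain_half tr_cmult[OF op bd d dT, of \<mu> "\<lambda>_. 1/2"]
  by (subst tr_add[OF op bd d dT]) (auto intro!: XC_cont_ext_dx[OF C2_spacetime_XC(1)[OF C2(1)]] simp: symg_def)

lemma dt_strain:
  assumes "x \<in> \<Omega>" "t > 0"
  shows "dt (strain u i j) x t = (1/2) * (dt (dx j (u i)) x t + dt (dx i (u j)) x t)"
proof -
  have D: "((\<lambda>s. dx k (u l) x s) has_real_derivative dt (dx k (u l)) x t) (at t)" for k l
    using C2_spacetime_dt(3)[OF C2(1), of k l] assms unfolding has_dt_def dt_def by (auto simp: DERIV_deriv_iff_real_differentiable)
  have "((\<lambda>s. (1/2) * (dx j (u i) x s + dx i (u j) x s)) has_real_derivative (1/2) * (dt (dx j (u i)) x t + dt (dx i (u j)) x t)) (at t)"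
    by (intro DERIV_cmult DERIV_add D)
  then show ?thesis unfolding dt_def[of "strain u i j"] unfolding strain_half by (rule DERIV_imp_deriv)
qed

lemma tr_dt_strain:
  assumes x: "x \<in> \<Omega>"
  shows "L \<mu> (dt (strain u i j)) x = rate \<mu> (symg (\<lambda>i j. L \<mu> (dx j (u i))) i j) (symg (\<lambda>i j. S (dx j (u i))) i j) x"
proof -
  have "L \<mu> (dt (strain u i j)) x = L \<mu> (\<lambda>x t. (1/2) * (dt (dx j (u i)) x t + dt (dx i (u j)) x t)) x"
    by (rule tr_cong[OF op bd d dT]) (rule dt_strain[OF x])
  also have "\<dots> = of_real (1/2) * (L \<mu> (dt (dx j (u i))) x + L \<mu> (dt (dx i (u j))) x)"
    unfolding tr_cmult[OF op bd d dT, of \<mu> "\<lambda>_. 1/2"]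
    by (subst tr_add[OF op bd d dT C2_spacetime_dt(5)[OF C2(1)] C2_spacetime_dt(5)[OF C2(1)] x]) (rule refl)
  also have "\<dots> = rate \<mu> (symg (\<lambda>i j. L \<mu> (dx j (u i))) i j) (symg (\<lambda>i j. S (dx j (u i))) i j) x"
    by (simp add: tr_dt_dx[OF C2(1) late(1) x] rate_def symg_def field_simps)
  finally show ?thesis .
qed

lemma cont_ext_dt_strain: "cont_ext \<Omega> (dt (strain u i j))"
proof (rule cont_ext_cong)
  show "cont_ext \<Omega> (\<lambda>x t. (1/2) * (dt (dx j (u i)) x t + dt (dx i (u j)) x t))"
    by (intro cont_ext_cmult continuous_on_const cont_ext_add C2_spacetime_dt(5)[OF C2(1)])
qed (simp add: dt_strain)

subsection \<open>Weak form of the transformed equations\<close>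

lemma pair_add:
  assumes "bc \<Omega> g" "bc \<Omega> h" "bc \<Omega> w"
  shows "(LINT x:\<Omega>|lborel. (g x + h x) * cnj (w x)) = (LINT x:\<Omega>|lborel. g x * cnj (w x)) + (LINT x:\<Omega>|lborel. h x * cnj (w x))"
  unfolding distrib_right by (intro set_integral_add(2) bc_set_integrable[OF op bd] bc_intros assms)

lemma pair_diff:
  assumes "bc \<Omega> g" "bc \<Omega> h" "bc \<Omega> w"
  shows "(LINT x:\<Omega>|lborel. (g x - h x) * cnj (w x)) = (LINT x:\<Omega>|lborel. g x * cnj (w x)) - (LINT x:\<Omega>|lborel. h x * cnj (w x))"
  unfolding left_diff_distrib by (intro set_integral_diff(2) bc_set_integrable[OF op bd] bc_intros assms)

lemma pair_sum:
  assumes "\<And>i. bc \<Omega> (g i)" "bc \<Omega> w"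
  shows "(LINT x:\<Omega>|lborel. (\<Sum>i\<in>UNIV. g i x) * cnj (w x)) = (\<Sum>i\<in>(UNIV::3 set). LINT x:\<Omega>|lborel. g i x * cnj (w x))"
  unfolding sum_distrib_right by (intro set_integral_sum bc_set_integrable[OF op bd] bc_intros assms)

lemma pair_sum2:
  assumes "\<And>k l. bc \<Omega> (a k l)" "\<And>k l. bc \<Omega> (g k l)" "bc \<Omega> w"
  shows "(LINT x:\<Omega>|lborel. (\<Sum>k\<in>UNIV. \<Sum>l\<in>UNIV. of_real (a k l x) * g k l x) * cnj (w x))
    = (\<Sum>k\<in>(UNIV::3 set). \<Sum>l\<in>(UNIV::3 set). ipc (a k l) (g k l) w)"
proof -
  have "(LINT x:\<Omega>|lborel. (\<Sum>k\<in>UNIV. \<Sum>l\<in>UNIV. of_real (a k l x) * g k l x) * cnj (w x))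
    = (\<Sum>k\<in>UNIV. LINT x:\<Omega>|lborel. (\<Sum>l\<in>UNIV. of_real (a k l x) * g k l x) * cnj (w x))"
    by (rule pair_sum) (intro bc_intros assms)+
  also have "\<dots> = (\<Sum>k\<in>UNIV. \<Sum>l\<in>UNIV. LINT x:\<Omega>|lborel. (of_real (a k l x) * g k l x) * cnj (w x))"
    by (intro sum.cong refl pair_sum) (intro bc_intros assms)+
  finally show ?thesis by (simp only: ip_def)
qed

lemma pair_cong:
  assumes "\<And>x. x \<in> \<Omega> \<Longrightarrow> g x = h x"
  shows "(LINT x:\<Omega>|lborel. g x * cnj (w x)) = (LINT x:\<Omega>|lborel. h x * cnj (w x))"
  by (rule set_lebesgue_integral_cong) (use assms op in auto)

lemma pair_divergence:
  assumes F: "\<And>j. XC \<Omega> j (F j)" and w: "trace0 \<Omega> w dw"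
  shows "(LINT x:\<Omega>|lborel. L \<mu> (\<lambda>x t. \<Sum>j\<in>UNIV. dx j (F j) x t) x * cnj (w x))
    = - (\<Sum>j\<in>UNIV. LINT x:\<Omega>|lborel. L \<mu> (F j) x * cnj (dw j x))"
proof -
  have "(LINT x:\<Omega>|lborel. L \<mu> (\<lambda>x t. \<Sum>j\<in>UNIV. dx j (F j) x t) x * cnj (w x))
    = (LINT x:\<Omega>|lborel. (\<Sum>j\<in>UNIV. L \<mu> (dx j (F j)) x) * cnj (w x))"
    by (rule pair_cong, rule tr_sum[OF op bd d dT XC_cont_ext_dx[OF F]]) auto
  also have "\<dots> = (\<Sum>j\<in>UNIV. LINT x:\<Omega>|lborel. L \<mu> (dx j (F j)) x * cnj (w x))"
    by (rule pair_sum[OF tr_rules(1)[OF XC_cont_ext_dx[OF F]] trace0_bc[OF bd w]])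
  also have "\<dots> = (\<Sum>j\<in>UNIV. - (LINT x:\<Omega>|lborel. L \<mu> (F j) x * cnj (dw j x)))"
    by (intro sum.cong refl integration_by_parts[OF op bd w] tr_rules(1) tr_rules(2) XC_cont_ext[OF F] XC_cont_ext_dx[OF F] F)
  finally show ?thesis by (simp add: sum_negf)
qed

end

context solution
begin

lemmas bcL = tr_rules(1)
lemmas ce = XC_cont_ext[OF C2_spacetime_XC(1)] XC_cont_ext[OF C2_spacetime_XC(2)] XC_cont_ext_dx[OF C2_spacetime_XC(1)]
  XC_cont_ext_dx[OF C2_spacetime_XC(2)] C2_spacetime_dt(4)

lemma bc_snap: "cont_ext \<Omega> f \<Longrightarrow> bc \<Omega> (S f)"
  unfolding snap_def[abs_def] by (intro bc_of_real cont_ext_slice_bc[OF bd _ d])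

lemma ce_sum2:
  assumes "\<And>k l. C1_closure \<Omega> (a k l)" "\<And>k l. cont_ext \<Omega> (f k l)"
  shows "cont_ext \<Omega> (\<lambda>x t. \<Sum>k\<in>(UNIV::3 set). \<Sum>l\<in>(UNIV::3 set). a k l x * f k l x t)"
  by (intro cont_ext_sum cont_ext_cmult assms(2)) (use assms(1) in \<open>auto simp: C1_closure_def\<close>)

lemma tr_sum2:
  assumes a: "\<And>k l. C1_closure \<Omega> (a k l)" and f: "\<And>k l. cont_ext \<Omega> (f k l)" and x: "x \<in> \<Omega>"
  shows "L \<mu> (\<lambda>x t. \<Sum>k\<in>(UNIV::3 set). \<Sum>l\<in>(UNIV::3 set). a k l x * f k l x t) x
    = (\<Sum>k\<in>UNIV. \<Sum>l\<in>UNIV. of_real (a k l x) * L \<mu> (f k l) x)"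
proof -
  have c: "cont_ext \<Omega> (\<lambda>x t. a k l x * f k l x t)" for k l
    using a f by (intro cont_ext_cmult) (auto simp: C1_closure_def)
  have "L \<mu> (\<lambda>x t. \<Sum>k\<in>(UNIV::3 set). \<Sum>l\<in>(UNIV::3 set). a k l x * f k l x t) x
      = (\<Sum>k\<in>UNIV. L \<mu> (\<lambda>x t. \<Sum>l\<in>(UNIV::3 set). a k l x * f k l x t) x)"
    by (rule tr_sum[OF op bd d dT _ x]) (auto intro: cont_ext_sum c)
  also have "\<dots> = (\<Sum>k\<in>UNIV. \<Sum>l\<in>UNIV. L \<mu> (\<lambda>x t. a k l x * f k l x t) x)"
    by (intro sum.cong refl tr_sum[OF op bd d dT c x]) auto
  finally show ?thesis unfolding tr_cmult[OF op bd d dT] .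
qed

abbreviation "u0 \<equiv> \<lambda>i. S (u i)"
abbreviation "du0 \<equiv> \<lambda>i j. S (dx j (u i))"
abbreviation "uh \<equiv> \<lambda>\<mu> i. L \<mu> (u i)"
abbreviation "du \<equiv> \<lambda>\<mu> i j. L \<mu> (dx j (u i))"
abbreviation "R0 \<equiv> \<lambda>i. S (R i)"
abbreviation "dR0 \<equiv> \<lambda>i j. S (dx j (R i))"
abbreviation "Rh \<equiv> \<lambda>\<mu> i. L \<mu> (R i)"
abbreviation "dR \<equiv> \<lambda>\<mu> i j. L \<mu> (dx j (R i))"
abbreviation "\<theta>h \<equiv> \<lambda>\<mu>. rate \<mu> (L \<mu> \<tau>) (S \<tau>)"
abbreviation "d\<theta>h \<equiv> \<lambda>\<mu> j. rate \<mu> (L \<mu> (dx j \<tau>)) (S (dx j \<tau>))"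
abbreviation "Mh \<equiv> \<lambda>\<mu> i. rate \<mu> (Rh \<mu> i) (R0 i)"
abbreviation "dMh \<equiv> \<lambda>\<mu> i j. rate \<mu> (dR \<mu> i j) (dR0 i j)"

lemma traces:
  "trace0 \<Omega> (uh \<mu> i) (du \<mu> i)" "trace0 \<Omega> (u0 i) (du0 i)" "trace0 \<Omega> (L \<mu> \<tau>) (\<lambda>j. L \<mu> (dx j \<tau>))" "trace0 \<Omega> (S \<tau>) (\<lambda>j. S (dx j \<tau>))"
  "trace0 \<Omega> (Rh \<mu> i) (dR \<mu> i)" "trace0 \<Omega> (R0 i) (dR0 i)"
  by (intro trace0_tr trace0_snap C2 bu b\<tau> bR)+

lemma bch: "bc \<Omega> (uh \<mu> i)" "bc \<Omega> (du \<mu> i j)" "bc \<Omega> (u0 i)" "bc \<Omega> (du0 i j)" "bc \<Omega> (\<theta>h \<mu>)" "bc \<Omega> (d\<theta>h \<mu> j)"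
  "bc \<Omega> (Mh \<mu> i)" "bc \<Omega> (dMh \<mu> i j)" "bc \<Omega> (Rh \<mu> i)" "bc \<Omega> (dR \<mu> i j)" "bc \<Omega> (L \<mu> (dx j \<tau>))"
  by (intro bc_rate bcL bc_snap ce C2)+

lemma bc_symg_du: "bc \<Omega> (symg (du \<mu>) k l)" by (intro bc_symg bch)

text \<open>Transform the equation at each point, pair it with the transformed velocity and move the
  divergence to the test field. \<open>energy_weak\<close> and \<open>moment_weak\<close> follow the
  same pattern with their own fluxes \<open>F\<close>.\<close>

lemma momentum_weak:
  "weak_momentum \<mu> u0 du0 (\<lambda>i. S (dt (u i))) (uh \<mu>) (du \<mu>) (\<theta>h \<mu>) (dR \<mu>)"
proof -
  define F where "F = (\<lambda>i j y s. (\<Sum>k\<in>UNIV. \<Sum>l\<in>UNIV. A_co m y j i k l * strain u k l y s) - a_co m y j i * dt \<tau> y s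
        + (\<Sum>k\<in>UNIV. \<Sum>l\<in>UNIV. B_co m y j i k l * dx k (R l) y s))"
  have XF: "XC \<Omega> j' (F i j)" for i j j'
    unfolding F_def by (intro XC_add XC_diff XC_sum XC_cmult C1c XC_strain C2_spacetime_XC C2)
  have tF: "L \<mu> (F i j) x = (\<Sum>k\<in>UNIV. \<Sum>l\<in>UNIV. of_real (A_co m x j i k l) * symg (du \<mu>) k l x) - of_real (a_co m x j i) * \<theta>h \<mu> x
        + (\<Sum>k\<in>UNIV. \<Sum>l\<in>UNIV. of_real (B_co m x j i k l) * dR \<mu> l k x)" if x: "x \<in> \<Omega>" for i j x
  proof -
    have c: "cont_ext \<Omega> (\<lambda>y s. \<Sum>k\<in>UNIV. \<Sum>l\<in>UNIV. A_co m y j i k l * strain u k l y s)"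
      "cont_ext \<Omega> (\<lambda>y s. a_co m y j i * dt \<tau> y s)" "cont_ext \<Omega> (\<lambda>y s. \<Sum>k\<in>UNIV. \<Sum>l\<in>UNIV. B_co m y j i k l * dx k (R l) y s)"
      by (rule XC_cont_ext[of _ j], intro XC_add XC_diff XC_sum XC_cmult C1c XC_strain C2_spacetime_XC C2)+
    have cd: "cont_ext \<Omega> (\<lambda>y s. (\<Sum>k\<in>UNIV. \<Sum>l\<in>UNIV. A_co m y j i k l * strain u k l y s) - a_co m y j i * dt \<tau> y s)"
      by (rule XC_cont_ext[of _ j], intro XC_add XC_diff XC_sum XC_cmult C1c XC_strain C2_spacetime_XC C2)
    show ?thesis unfolding F_def
      by (simp only: tr_add[OF op bd d dT cd c(3) x] tr_diff[OF op bd d dT c(1,2) x]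
          tr_sum2[OF C1c(9) XC_cont_ext[OF XC_strain] x] tr_sum2[OF C1c(10) ce(3)[OF C2(3)] x] tr_cmult[OF op bd d dT]
          tr_strain[OF x] tr_dt1[OF C2(2) late(2) x])
  qed
  have mi: "ipc (rho m) (rate \<mu> (rate \<mu> (uh \<mu> i) (u0 i)) (S (dt (u i)))) (rate \<mu> (uh \<mu> i) (u0 i))
     = - (\<Sum>j\<in>UNIV. (\<Sum>k\<in>UNIV. \<Sum>l\<in>UNIV. ipc (\<lambda>x. A_co m x j i k l) (symg (du \<mu>) k l) (rate \<mu> (du \<mu> i j) (du0 i j)))
        - ipc (\<lambda>x. a_co m x j i) (\<theta>h \<mu>) (rate \<mu> (du \<mu> i j) (du0 i j))
        + (\<Sum>k\<in>UNIV. \<Sum>l\<in>UNIV. ipc (\<lambda>x. B_co m x j i k l) (dR \<mu> l k) (rate \<mu> (du \<mu> i j) (du0 i j))))" (is "?lhs = ?rhs") for i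
  proof -
    let ?v = "rate \<mu> (uh \<mu> i) (u0 i)" and ?dv = "\<lambda>j. rate \<mu> (du \<mu> i j) (du0 i j)"
    have tv: "trace0 \<Omega> ?v ?dv" by (rule trace0_rate[OF traces(1,2)])
    have bdv: "bc \<Omega> (?dv j)" for j by (rule trace0_bc_grad[OF tv])
    have "?lhs = (LINT x:\<Omega>|lborel. L \<mu> (\<lambda>x t. \<Sum>j\<in>UNIV. dx j (F i j) x t) x * cnj (?v x))"
      unfolding ip_def
    proof (rule pair_cong)
      fix x assume x: "x \<in> \<Omega>"
      have "of_real (rho m x) * rate \<mu> ?v (S (dt (u i))) x = L \<mu> (\<lambda>x t. rho m x * dt (dt (u i)) x t) x"
        by (simp only: tr_cmult[OF op bd d dT] tr_dt2[OF C2(1) late(1) x])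
      also have "\<dots> = L \<mu> (\<lambda>x t. \<Sum>j\<in>UNIV. dx j (F i j) x t) x"
        by (rule tr_cong[OF op bd d dT]) (use sol x in \<open>auto simp: is_solution_def momentum_eq_def F_def\<close>)
      finally show "of_real (rho m x) * rate \<mu> ?v (S (dt (u i))) x = L \<mu> (\<lambda>x t. \<Sum>j\<in>UNIV. dx j (F i j) x t) x" .
    qed
    also have "\<dots> = - (\<Sum>j\<in>UNIV. LINT x:\<Omega>|lborel. L \<mu> (F i j) x * cnj (?dv j x))"
      by (rule pair_divergence[OF XF tv])
    also have "\<dots> = ?rhs"
    proof (intro arg_cong[where f=uminus] sum.cong refl)
      fix j :: 3
      have b: "bc \<Omega> (\<lambda>x. \<Sum>k\<in>UNIV. \<Sum>l\<in>UNIV. of_real (A_co m x j i k l) * symg (du \<mu>) k l x)" "bc \<Omega> (\<lambda>x. of_real (a_co m x j i) * \<theta>h \<mu> x)"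
        "bc \<Omega> (\<lambda>x. \<Sum>k\<in>UNIV. \<Sum>l\<in>UNIV. of_real (B_co m x j i k l) * dR \<mu> l k x)"
        by (intro bc_intros bcc bch bc_symg_du)+
      show "(LINT x:\<Omega>|lborel. L \<mu> (F i j) x * cnj (?dv j x)) =
         (\<Sum>k\<in>UNIV. \<Sum>l\<in>UNIV. ipc (\<lambda>x. A_co m x j i k l) (symg (du \<mu>) k l) (?dv j))
        - ipc (\<lambda>x. a_co m x j i) (\<theta>h \<mu>) (?dv j) + (\<Sum>k\<in>UNIV. \<Sum>l\<in>UNIV. ipc (\<lambda>x. B_co m x j i k l) (dR \<mu> l k) (?dv j))"
        by (simp only: pair_cong[OF tF] pair_add[OF bc_diff[OF b(1,2)] b(3) bdv] pair_diff[OF b(1,2) bdv]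
            pair_sum2[OF bcc(9) bc_symg_du bdv] pair_sum2[OF bcc(10) bch(10) bdv] ip_def[of _ _ "\<theta>h \<mu>"])
    qed
    finally show ?thesis .
  qed
  show ?thesis unfolding weak_momentum_def mi by (simp add: sum.distrib sum_subtractf sum_negf)
qed

lemma energy_weak:
  "weak_energy \<mu> (S (dt \<tau>)) (\<lambda>i j. rate \<mu> (symg (du \<mu>) i j) (symg du0 i j)) (\<theta>h \<mu>) (\<lambda>j. L \<mu> (dx j \<tau>)) (d\<theta>h \<mu>) (Mh \<mu>) (dMh \<mu>)"
proof -
  define F where "F = (\<lambda>i y s. \<Sum>j\<in>UNIV. - d_co m y i j * dt (R j) y s + K_co m y i j * dx j \<tau> y s + Kt_co m y i j * dx j (dt \<tau>) y s)"
  have XF1: "XC \<Omega> k (\<lambda>y s. - d_co m y i j * dt (R j) y s)" for i j k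
    using XC_minus[OF XC_cmult[OF C1c(6) C2_spacetime_XC(2)[OF C2(3)]]] by simp
  have XF: "XC \<Omega> k (F i)" for i k
    unfolding F_def by (intro XC_add XC_sum XF1 XC_cmult C1c C2_spacetime_XC C2 Cr)
  have tF: "L \<mu> (F i) x = (\<Sum>j\<in>UNIV. - (of_real (d_co m x i j) * Mh \<mu> j x) + of_real (K_co m x i j) * L \<mu> (dx j \<tau>) x + of_real (Kt_co m x i j) * d\<theta>h \<mu> j x)"
    if x: "x \<in> \<Omega>" for i x
  proof -
    have c: "cont_ext \<Omega> (\<lambda>y s. - d_co m y i j * dt (R j) y s)" "cont_ext \<Omega> (\<lambda>y s. K_co m y i j * dx j \<tau> y s)"
      "cont_ext \<Omega> (\<lambda>y s. Kt_co m y i j * dx j (dt \<tau>) y s)" for j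
      by (rule XC_cont_ext[of _ j], intro XF1 XC_cmult C1c C2_spacetime_XC C2 Cr)+
    have "L \<mu> (F i) x = (\<Sum>j\<in>UNIV. L \<mu> (\<lambda>y s. - d_co m y i j * dt (R j) y s + K_co m y i j * dx j \<tau> y s + Kt_co m y i j * dx j (dt \<tau>) y s) x)"
      unfolding F_def by (rule tr_sum[OF op bd d dT cont_ext_add[OF cont_ext_add[OF c(1,2)] c(3)] x finite])
    also have "\<dots> = (\<Sum>j\<in>UNIV. - (of_real (d_co m x i j) * Mh \<mu> j x) + of_real (K_co m x i j) * L \<mu> (dx j \<tau>) x + of_real (Kt_co m x i j) * d\<theta>h \<mu> j x)"
      by (intro sum.cong refl)
        (simp only: tr_add[OF op bd d dT cont_ext_add[OF c(1,2)] c(3) x] tr_add[OF op bd d dT c(1,2) x] tr_cmult[OF op bd d dT]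
          tr_dt1[OF C2(3) late(3) x] tr_dx_dt[OF C2(2) late(2) x], simp only: of_real_minus mult_minus_left)
    finally show ?thesis .
  qed
  let ?\<theta> = "\<theta>h \<mu>"
  have t\<theta>: "trace0 \<Omega> ?\<theta> (d\<theta>h \<mu>)" by (rule trace0_rate[OF traces(3,4)])
  have b\<theta>: "bc \<Omega> ?\<theta>" by (rule bch)
  have eq: "of_real (c_heat m x) * rate \<mu> ?\<theta> (S (dt \<tau>)) x
     = - (\<Sum>i\<in>UNIV. \<Sum>j\<in>UNIV. of_real (a_co m x i j) * rate \<mu> (symg (du \<mu>) i j) (symg du0 i j) x)
       + L \<mu> (\<lambda>x t. \<Sum>i\<in>UNIV. dx i (F i) x t) x - (\<Sum>i\<in>UNIV. \<Sum>j\<in>UNIV. of_real (b_co m x i j) * dMh \<mu> i j x)" if x: "x \<in> \<Omega>" for x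
  proof -
    have c1: "cont_ext \<Omega> (\<lambda>x t. \<Sum>i\<in>UNIV. \<Sum>j\<in>UNIV. a_co m x i j * dt (strain u i j) x t)"
      by (rule ce_sum2[OF C1c(4) cont_ext_dt_strain])
    have c1': "cont_ext \<Omega> (\<lambda>x t. - (\<Sum>i\<in>UNIV. \<Sum>j\<in>UNIV. a_co m x i j * dt (strain u i j) x t))"
      using cont_ext_cmult[OF continuous_on_const[of _ "-1"] c1] by simp
    have c2: "cont_ext \<Omega> (\<lambda>x t. \<Sum>i\<in>UNIV. dx i (F i) x t)" by (intro cont_ext_sum XC_cont_ext_dx XF)
    have c3: "cont_ext \<Omega> (\<lambda>x t. \<Sum>i\<in>UNIV. \<Sum>j\<in>UNIV. b_co m x i j * dx j (dt (R i)) x t)"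
      by (rule ce_sum2[OF C1c(5) ce(4)[OF C2(3)]])
    have "of_real (c_heat m x) * rate \<mu> ?\<theta> (S (dt \<tau>)) x = L \<mu> (\<lambda>x t. c_heat m x * dt (dt \<tau>) x t) x"
      by (simp only: tr_cmult[OF op bd d dT] tr_dt2[OF C2(2) late(2) x])
    also have "\<dots> = L \<mu> (\<lambda>x t. - (\<Sum>i\<in>UNIV. \<Sum>j\<in>UNIV. a_co m x i j * dt (strain u i j) x t) + (\<Sum>i\<in>UNIV. dx i (F i) x t)
         - (\<Sum>i\<in>UNIV. \<Sum>j\<in>UNIV. b_co m x i j * dx j (dt (R i)) x t)) x"
      by (rule tr_cong[OF op bd d dT]) (use sol x in \<open>simp add: is_solution_def energy_eq_def F_def\<close>)
    also have "\<dots> = - (\<Sum>i\<in>UNIV. \<Sum>j\<in>UNIV. of_real (a_co m x i j) * rate \<mu> (symg (du \<mu>) i j) (symg du0 i j) x)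
       + L \<mu> (\<lambda>x t. \<Sum>i\<in>UNIV. dx i (F i) x t) x - (\<Sum>i\<in>UNIV. \<Sum>j\<in>UNIV. of_real (b_co m x i j) * dMh \<mu> i j x)"
      by (simp only: tr_diff[OF op bd d dT cont_ext_add[OF c1' c2] c3 x] tr_add[OF op bd d dT c1' c2 x] tr_minus[OF op bd d dT]
          tr_sum2[OF C1c(4) cont_ext_dt_strain x] tr_sum2[OF C1c(5) ce(4)[OF C2(3)] x] tr_dt_strain[OF x] tr_dx_dt[OF C2(3) late(3) x])
    finally show ?thesis .
  qed
  have bE: "bc \<Omega> (rate \<mu> (symg (du \<mu>) i j) (symg du0 i j))" for i j by (intro bc_rate bc_symg bch)
  have bF: "bc \<Omega> (L \<mu> (\<lambda>x t. \<Sum>i\<in>UNIV. dx i (F i) x t))" by (intro bcL cont_ext_sum XC_cont_ext_dx XF)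
  have b1: "bc \<Omega> (\<lambda>x. \<Sum>i\<in>UNIV. \<Sum>j\<in>UNIV. of_real (a_co m x i j) * rate \<mu> (symg (du \<mu>) i j) (symg du0 i j) x)"
    "bc \<Omega> (\<lambda>x. \<Sum>i\<in>UNIV. \<Sum>j\<in>UNIV. of_real (b_co m x i j) * dMh \<mu> i j x)"
    by (intro bc_intros bcc bE bch)+
  have "ipc (c_heat m) (rate \<mu> ?\<theta> (S (dt \<tau>))) ?\<theta>
     = (LINT x:\<Omega>|lborel. (L \<mu> (\<lambda>x t. \<Sum>i\<in>UNIV. dx i (F i) x t) x
       - (\<Sum>i\<in>UNIV. \<Sum>j\<in>UNIV. of_real (a_co m x i j) * rate \<mu> (symg (du \<mu>) i j) (symg du0 i j) x)
       - (\<Sum>i\<in>UNIV. \<Sum>j\<in>UNIV. of_real (b_co m x i j) * dMh \<mu> i j x)) * cnj (?\<theta> x))"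
    unfolding ip_def by (rule pair_cong) (simp add: eq)
  also have "\<dots> = (LINT x:\<Omega>|lborel. L \<mu> (\<lambda>x t. \<Sum>i\<in>UNIV. dx i (F i) x t) x * cnj (?\<theta> x))
     - (\<Sum>i\<in>UNIV. \<Sum>j\<in>UNIV. ipc (\<lambda>x. a_co m x i j) (rate \<mu> (symg (du \<mu>) i j) (symg du0 i j)) ?\<theta>)
     - (\<Sum>i\<in>UNIV. \<Sum>j\<in>UNIV. ipc (\<lambda>x. b_co m x i j) (dMh \<mu> i j) ?\<theta>)"
    by (simp only: pair_diff[OF bc_diff[OF bF b1(1)] b1(2) b\<theta>] pair_diff[OF bF b1(1) b\<theta>] pair_sum2[OF bcc(4) bE b\<theta>] pair_sum2[OF bcc(5) bch(8) b\<theta>])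
  also have "(LINT x:\<Omega>|lborel. L \<mu> (\<lambda>x t. \<Sum>i\<in>UNIV. dx i (F i) x t) x * cnj (?\<theta> x))
     = - (\<Sum>i\<in>UNIV. LINT x:\<Omega>|lborel. L \<mu> (F i) x * cnj (d\<theta>h \<mu> i x))"
    by (rule pair_divergence[OF XF t\<theta>])
  also have "(\<Sum>i\<in>UNIV. LINT x:\<Omega>|lborel. L \<mu> (F i) x * cnj (d\<theta>h \<mu> i x))
     = (\<Sum>i\<in>UNIV. \<Sum>j\<in>UNIV. - ipc (\<lambda>x. d_co m x i j) (Mh \<mu> j) (d\<theta>h \<mu> i) + ipc (\<lambda>x. K_co m x i j) (L \<mu> (dx j \<tau>)) (d\<theta>h \<mu> i)
        + ipc (\<lambda>x. Kt_co m x i j) (d\<theta>h \<mu> j) (d\<theta>h \<mu> i))"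
  proof (rule sum.cong[OF refl])
    fix i :: 3
    have b: "bc \<Omega> (\<lambda>x. - (of_real (d_co m x i j) * Mh \<mu> j x))" "bc \<Omega> (\<lambda>x. of_real (K_co m x i j) * L \<mu> (dx j \<tau>) x)" "bc \<Omega> (\<lambda>x. of_real (Kt_co m x i j) * d\<theta>h \<mu> j x)" for j
      by (intro bc_intros bcc bch)+
    have neg: "(LINT x:\<Omega>|lborel. - (of_real (d_co m x i j) * Mh \<mu> j x) * cnj (d\<theta>h \<mu> i x)) = - ipc (\<lambda>x. d_co m x i j) (Mh \<mu> j) (d\<theta>h \<mu> i)" for j
      by (simp add: ip_def set_lebesgue_integral_def)
    show "(LINT x:\<Omega>|lborel. L \<mu> (F i) x * cnj (d\<theta>h \<mu> i x))
     = (\<Sum>j\<in>UNIV. - ipc (\<lambda>x. d_co m x i j) (Mh \<mu> j) (d\<theta>h \<mu> i) + ipc (\<lambda>x. K_co m x i j) (L \<mu> (dx j \<tau>)) (d\<theta>h \<mu> i)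
        + ipc (\<lambda>x. Kt_co m x i j) (d\<theta>h \<mu> j) (d\<theta>h \<mu> i))"
      by (simp only: pair_cong[OF tF] pair_sum[OF bc_add[OF bc_add[OF b(1,2)] b(3)] bch(6)] pair_add[OF bc_add[OF b(1,2)] b(3) bch(6)]
          pair_add[OF b(1,2) bch(6)] neg ip_def[of _ _ "L \<mu> (dx _ \<tau>)"] ip_def[of _ "\<lambda>x. Kt_co m x i _"])
  qed
  finally show ?thesis unfolding weak_energy_def by (simp add: sum.distrib sum_negf sum_subtractf)
qed

lemma moment_weak:
  "weak_moment \<mu> (\<lambda>i. S (dt (R i))) (symg (du \<mu>)) (\<theta>h \<mu>) (d\<theta>h \<mu>) (dR \<mu>) (Mh \<mu>) (dMh \<mu>)"
proof -
  define F where "F = (\<lambda>i j y s. (\<Sum>k\<in>UNIV. \<Sum>l\<in>UNIV. B_co m y k l j i * strain u k l y s) - b_co m y j i * dt \<tau> y s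
        + (\<Sum>k\<in>UNIV. \<Sum>l\<in>UNIV. C_co m y j i k l * dx l (R k) y s + Ct_co m y j i k l * dx l (dt (R k)) y s))"
  have XF: "XC \<Omega> j' (F i j)" for i j j'
    unfolding F_def by (intro XC_add XC_diff XC_sum XC_cmult C1c XC_strain C2_spacetime_XC C2 Cr)
  have tF: "L \<mu> (F i j) x = (\<Sum>k\<in>UNIV. \<Sum>l\<in>UNIV. of_real (B_co m x k l j i) * symg (du \<mu>) k l x) - of_real (b_co m x j i) * \<theta>h \<mu> x
        + ((\<Sum>k\<in>UNIV. \<Sum>l\<in>UNIV. of_real (C_co m x j i k l) * dR \<mu> k l x) + (\<Sum>k\<in>UNIV. \<Sum>l\<in>UNIV. of_real (Ct_co m x j i k l) * dMh \<mu> k l x))"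
    if x: "x \<in> \<Omega>" for i j x
  proof -
    have c: "cont_ext \<Omega> (\<lambda>y s. \<Sum>k\<in>UNIV. \<Sum>l\<in>UNIV. B_co m y k l j i * strain u k l y s)"
      "cont_ext \<Omega> (\<lambda>y s. b_co m y j i * dt \<tau> y s)" "cont_ext \<Omega> (\<lambda>y s. \<Sum>k\<in>UNIV. \<Sum>l\<in>UNIV. C_co m y j i k l * dx l (R k) y s)"
      "cont_ext \<Omega> (\<lambda>y s. \<Sum>k\<in>UNIV. \<Sum>l\<in>UNIV. Ct_co m y j i k l * dx l (dt (R k)) y s)"
      by (rule XC_cont_ext[of _ j], intro XC_add XC_diff XC_sum XC_cmult C1c XC_strain C2_spacetime_XC C2 Cr)+
    have cd: "cont_ext \<Omega> (\<lambda>y s. (\<Sum>k\<in>UNIV. \<Sum>l\<in>UNIV. B_co m y k l j i * strain u k l y s) - b_co m y j i * dt \<tau> y s)"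
      by (rule XC_cont_ext[of _ j], intro XC_add XC_diff XC_sum XC_cmult C1c XC_strain C2_spacetime_XC C2)
    \<comment> \<open>Splitting the double sum lets \<open>C_co\<close> meet the transformed
      gradient and \<open>Ct_co\<close> its rate.\<close>
    have "L \<mu> (F i j) x = L \<mu> (\<lambda>y s. (\<Sum>k\<in>UNIV. \<Sum>l\<in>UNIV. B_co m y k l j i * strain u k l y s) - b_co m y j i * dt \<tau> y s
        + ((\<Sum>k\<in>UNIV. \<Sum>l\<in>UNIV. C_co m y j i k l * dx l (R k) y s) + (\<Sum>k\<in>UNIV. \<Sum>l\<in>UNIV. Ct_co m y j i k l * dx l (dt (R k)) y s))) x"
      by (rule tr_cong[OF op bd d dT]) (simp add: F_def sum.distrib)
    also have "\<dots> = (\<Sum>k\<in>UNIV. \<Sum>l\<in>UNIV. of_real (B_co m x k l j i) * symg (du \<mu>) k l x) - of_real (b_co m x j i) * \<theta>h \<mu> x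
        + ((\<Sum>k\<in>UNIV. \<Sum>l\<in>UNIV. of_real (C_co m x j i k l) * dR \<mu> k l x) + (\<Sum>k\<in>UNIV. \<Sum>l\<in>UNIV. of_real (Ct_co m x j i k l) * dMh \<mu> k l x))"
      by (simp only: tr_add[OF op bd d dT cd cont_ext_add[OF c(3,4)] x] tr_add[OF op bd d dT c(3,4) x] tr_diff[OF op bd d dT c(1,2) x]
          tr_sum2[OF C1c(10) XC_cont_ext[OF XC_strain] x] tr_sum2[OF C1c(11) ce(3)[OF C2(3)] x] tr_sum2[OF C1c(12) ce(4)[OF C2(3)] x]
          tr_cmult[OF op bd d dT] tr_strain[OF x] tr_dt1[OF C2(2) late(2) x] tr_dx_dt[OF C2(3) late(3) x])
    finally show ?thesis .
  qed
  have mi: "(\<Sum>j\<in>UNIV. ipc (\<lambda>x. cM m x i j) (rate \<mu> (Mh \<mu> j) (S (dt (R j)))) (Mh \<mu> i))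
     = - (\<Sum>j\<in>UNIV. (\<Sum>k\<in>UNIV. \<Sum>l\<in>UNIV. ipc (\<lambda>x. B_co m x k l j i) (symg (du \<mu>) k l) (dMh \<mu> i j))
        - ipc (\<lambda>x. b_co m x j i) (\<theta>h \<mu>) (dMh \<mu> i j)
        + ((\<Sum>k\<in>UNIV. \<Sum>l\<in>UNIV. ipc (\<lambda>x. C_co m x j i k l) (dR \<mu> k l) (dMh \<mu> i j))
          + (\<Sum>k\<in>UNIV. \<Sum>l\<in>UNIV. ipc (\<lambda>x. Ct_co m x j i k l) (dMh \<mu> k l) (dMh \<mu> i j))))
       - (\<Sum>j\<in>UNIV. ipc (\<lambda>x. d_co m x i j) (d\<theta>h \<mu> j) (Mh \<mu> i))" (is "?lhs = ?rhs") for i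
  proof -
    have tM: "trace0 \<Omega> (Mh \<mu> i) (dMh \<mu> i)" by (rule trace0_rate[OF traces(5,6)])
    have bM: "bc \<Omega> (Mh \<mu> i)" and bdM: "bc \<Omega> (dMh \<mu> i j)" for j by (rule bch)+
    have bMM: "bc \<Omega> (rate \<mu> (Mh \<mu> j) (S (dt (R j))))" for j by (intro bc_rate bch bc_snap ce C2)
    have bF: "bc \<Omega> (L \<mu> (\<lambda>x t. \<Sum>j\<in>UNIV. dx j (F i j) x t))" by (intro bcL cont_ext_sum XC_cont_ext_dx XF)
    have "?lhs = (LINT x:\<Omega>|lborel. (\<Sum>j\<in>UNIV. of_real (cM m x i j) * rate \<mu> (Mh \<mu> j) (S (dt (R j))) x) * cnj (Mh \<mu> i x))"
      unfolding ip_def by (rule pair_sum[symmetric]) (intro bc_intros bcc bMM bM)+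
    also have "\<dots> = (LINT x:\<Omega>|lborel. (L \<mu> (\<lambda>x t. \<Sum>j\<in>UNIV. dx j (F i j) x t) x - (\<Sum>j\<in>UNIV. of_real (d_co m x i j) * d\<theta>h \<mu> j x)) * cnj (Mh \<mu> i x))"
    proof (rule pair_cong)
      fix x assume x: "x \<in> \<Omega>"
      have cc: "continuous_on (closure \<Omega>) (\<lambda>x. cM m x i j)" "continuous_on (closure \<Omega>) (\<lambda>x. d_co m x i j)" for j
        using C1c(3,6)[of i j] by (auto simp: C1_closure_def)
      have cM1: "cont_ext \<Omega> (\<lambda>x t. cM m x i j * dt (dt (R j)) x t)" "cont_ext \<Omega> (\<lambda>x t. d_co m x i j * dx j (dt \<tau>) x t)" for j
        by (rule cont_ext_cmult[OF cc(1) ce(5)[OF C2(3)]], rule cont_ext_cmult[OF cc(2) ce(4)[OF C2(2)]])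
      have "(\<Sum>j\<in>UNIV. of_real (cM m x i j) * rate \<mu> (Mh \<mu> j) (S (dt (R j))) x) = L \<mu> (\<lambda>x t. \<Sum>j\<in>UNIV. cM m x i j * dt (dt (R j)) x t) x"
        by (subst tr_sum[OF op bd d dT cM1(1) x]) (simp_all only: finite tr_cmult[OF op bd d dT] tr_dt2[OF C2(3) late(3) x])
      also have "\<dots> = L \<mu> (\<lambda>x t. (\<Sum>j\<in>UNIV. dx j (F i j) x t) - (\<Sum>j\<in>UNIV. d_co m x i j * dx j (dt \<tau>) x t)) x"
        by (rule tr_cong[OF op bd d dT]) (use sol x in \<open>simp add: is_solution_def moment_eq_def F_def\<close>)
      also have "\<dots> = L \<mu> (\<lambda>x t. \<Sum>j\<in>UNIV. dx j (F i j) x t) x - L \<mu> (\<lambda>x t. \<Sum>j\<in>UNIV. d_co m x i j * dx j (dt \<tau>) x t) x"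
        by (rule tr_diff[OF op bd d dT _ _ x]) (intro cont_ext_sum XC_cont_ext_dx XF cM1)+
      also have "L \<mu> (\<lambda>x t. \<Sum>j\<in>UNIV. d_co m x i j * dx j (dt \<tau>) x t) x = (\<Sum>j\<in>UNIV. of_real (d_co m x i j) * d\<theta>h \<mu> j x)"
        by (subst tr_sum[OF op bd d dT cM1(2) x]) (simp_all only: finite tr_cmult[OF op bd d dT] tr_dx_dt[OF C2(2) late(2) x])
      finally show "(\<Sum>j\<in>UNIV. of_real (cM m x i j) * rate \<mu> (Mh \<mu> j) (S (dt (R j))) x)
         = L \<mu> (\<lambda>x t. \<Sum>j\<in>UNIV. dx j (F i j) x t) x - (\<Sum>j\<in>UNIV. of_real (d_co m x i j) * d\<theta>h \<mu> j x)" .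
    qed
    also have "\<dots> = (LINT x:\<Omega>|lborel. L \<mu> (\<lambda>x t. \<Sum>j\<in>UNIV. dx j (F i j) x t) x * cnj (Mh \<mu> i x))
       - (LINT x:\<Omega>|lborel. (\<Sum>j\<in>UNIV. of_real (d_co m x i j) * d\<theta>h \<mu> j x) * cnj (Mh \<mu> i x))"
      by (rule pair_diff) (intro bF bM bc_intros bcc bch)+
    also have "(LINT x:\<Omega>|lborel. (\<Sum>j\<in>UNIV. of_real (d_co m x i j) * d\<theta>h \<mu> j x) * cnj (Mh \<mu> i x)) = (\<Sum>j\<in>UNIV. ipc (\<lambda>x. d_co m x i j) (d\<theta>h \<mu> j) (Mh \<mu> i))"
      unfolding ip_def by (rule pair_sum) (intro bM bc_intros bcc bch)+
    also have "(LINT x:\<Omega>|lborel. L \<mu> (\<lambda>x t. \<Sum>j\<in>UNIV. dx j (F i j) x t) x * cnj (Mh \<mu> i x)) = - (\<Sum>j\<in>UNIV. LINT x:\<Omega>|lborel. L \<mu> (F i j) x * cnj (dMh \<mu> i j x))"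
      by (rule pair_divergence[OF XF tM])
    also have "(\<Sum>j\<in>UNIV. LINT x:\<Omega>|lborel. L \<mu> (F i j) x * cnj (dMh \<mu> i j x))
       = (\<Sum>j\<in>UNIV. (\<Sum>k\<in>UNIV. \<Sum>l\<in>UNIV. ipc (\<lambda>x. B_co m x k l j i) (symg (du \<mu>) k l) (dMh \<mu> i j))
        - ipc (\<lambda>x. b_co m x j i) (\<theta>h \<mu>) (dMh \<mu> i j)
        + ((\<Sum>k\<in>UNIV. \<Sum>l\<in>UNIV. ipc (\<lambda>x. C_co m x j i k l) (dR \<mu> k l) (dMh \<mu> i j))
          + (\<Sum>k\<in>UNIV. \<Sum>l\<in>UNIV. ipc (\<lambda>x. Ct_co m x j i k l) (dMh \<mu> k l) (dMh \<mu> i j))))"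
    proof (rule sum.cong[OF refl])
      fix j :: 3
      have b: "bc \<Omega> (\<lambda>x. \<Sum>k\<in>UNIV. \<Sum>l\<in>UNIV. of_real (B_co m x k l j i) * symg (du \<mu>) k l x)" "bc \<Omega> (\<lambda>x. of_real (b_co m x j i) * \<theta>h \<mu> x)"
        "bc \<Omega> (\<lambda>x. \<Sum>k\<in>UNIV. \<Sum>l\<in>UNIV. of_real (C_co m x j i k l) * dR \<mu> k l x)"
        "bc \<Omega> (\<lambda>x. \<Sum>k\<in>UNIV. \<Sum>l\<in>UNIV. of_real (Ct_co m x j i k l) * dMh \<mu> k l x)"
        by (intro bc_intros bcc bch bc_symg_du)+
      show "(LINT x:\<Omega>|lborel. L \<mu> (F i j) x * cnj (dMh \<mu> i j x)) =
         (\<Sum>k\<in>UNIV. \<Sum>l\<in>UNIV. ipc (\<lambda>x. B_co m x k l j i) (symg (du \<mu>) k l) (dMh \<mu> i j))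
        - ipc (\<lambda>x. b_co m x j i) (\<theta>h \<mu>) (dMh \<mu> i j)
        + ((\<Sum>k\<in>UNIV. \<Sum>l\<in>UNIV. ipc (\<lambda>x. C_co m x j i k l) (dR \<mu> k l) (dMh \<mu> i j))
          + (\<Sum>k\<in>UNIV. \<Sum>l\<in>UNIV. ipc (\<lambda>x. Ct_co m x j i k l) (dMh \<mu> k l) (dMh \<mu> i j)))"
        by (simp only: pair_cong[OF tF] pair_add[OF bc_diff[OF b(1,2)] bc_add[OF b(3,4)] bdM] pair_add[OF b(3,4) bdM] pair_diff[OF b(1,2) bdM]
            pair_sum2[OF bcc(10) bc_symg_du bdM] pair_sum2[OF bcc(11) bch(10) bdM] pair_sum2[OF bcc(12) bch(8) bdM] ip_def[of _ _ "\<theta>h \<mu>"])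
    qed
    finally show ?thesis .
  qed
  show ?thesis unfolding weak_moment_def mi by (simp add: sum.distrib sum_subtractf sum_negf)
qed

end

section \<open>Uniqueness\<close>

text \<open>Passes from the Lebesgue integral over a set to an integral over a box, where the order
  of integration of continuous functions can be exchanged.\<close>

lemma set_integral_eq_integral_cbox:
  fixes G :: "'a::euclidean_space \<Rightarrow> 'b::euclidean_space"
  assumes S: "S \<subseteq> cbox a b" and G: "continuous_on (cbox a b) G" "\<And>x. x \<notin> S \<Longrightarrow> G x = 0"
    and F: "\<And>x. x \<in> S \<Longrightarrow> F x = G x"
  shows "(LINT x:S|lborel. F x) = integral (cbox a b) G"
proof -
  have "(LINT x:S|lborel. F x) = (LINT x:cbox a b|lborel. G x)"
    unfolding set_lebesgue_integral_def
    by (intro Bochner_Integration.integral_cong) (use S G(2) F in \<open>auto simp: indicator_def\<close>)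
  also have "\<dots> = integral (cbox a b) G"
    by (rule set_borel_integral_eq_integral(2)) (simp add: set_integrable_def borel_integrable_compact[OF compact_cbox G(1)])
  finally show ?thesis .
qed

text \<open>Pairing the field at time \<open>t\<close> with its own value at the fixed time
  \<open>s\<close> reduces the estimate for a field-valued transform to the scalar function
  \<open>h\<close>, whose transform is bounded on the rays by Cauchy-Schwarz. The value
  \<open>h s\<close> is the integral of the square of the field at time \<open>s\<close>.\<close>

lemma transform_bound_imp_zero:
  assumes op: "open \<Omega>" and bd: "bounded \<Omega>" and f: "C2_spacetime \<Omega> f" and bf: "boundary_zero \<Omega> f"
    and d: "d > 0" and dT: "d < T" and k: "k > 0"
    and rays: "\<And>\<mu>. \<bar>Re \<mu>\<bar> = k * \<bar>Im \<mu>\<bar> \<Longrightarrow> cmod \<mu> \<ge> L \<Longrightarrow> nn2 \<Omega> (tr d T \<mu> f) \<le> N"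
    and x0: "x0 \<in> \<Omega>" and s: "s \<in> {d..T}"
  shows "f x0 s = 0"
proof -
  obtain a where a: "\<Omega> \<subseteq> box (- a) a" using bounded_subset_box_symmetric[OF bd] .
  let ?Q = "cbox (- a) a"
  have aQ: "\<Omega> \<subseteq> ?Q" using a box_subset_cbox by blast
  \<comment> \<open>Zero boundary values make the extension by 0 jointly continuous on the whole
    space, so \<Omega> can be replaced by a box when the integrals are exchanged.\<close>
  define g where "g = (\<lambda>x t. if x \<in> \<Omega> then f x t else 0)"
  have fc: "continuous_on (closure \<Omega> \<times> {0<..}) (\<lambda>z. f (fst z) (snd z))"
    using f unfolding C2_spacetime_def by (simp add: split_beta)
  have gc0: "continuous_on (closure \<Omega> \<times> {d..T} \<union> (- \<Omega>) \<times> {d..T}) (\<lambda>z. if fst z \<in> \<Omega> then f (fst z) (snd z) else 0)"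
  proof (rule continuous_on_cases)
    show "closed (closure \<Omega> \<times> {d..T})" "closed ((- \<Omega>) \<times> {d..T})" using op by (auto intro: closed_Times)
    show "continuous_on (closure \<Omega> \<times> {d..T}) (\<lambda>z. f (fst z) (snd z))"
      by (rule continuous_on_subset[OF fc]) (use d in auto)
    show "\<forall>z. z \<in> closure \<Omega> \<times> {d..T} \<and> fst z \<notin> \<Omega> \<or> z \<in> (- \<Omega>) \<times> {d..T} \<and> fst z \<in> \<Omega> \<longrightarrow> f (fst z) (snd z) = 0"
      using bf d op by (auto simp: boundary_zero_def frontier_def interior_open)
  qed simp
  have gc: "continuous_on (UNIV \<times> {d..T}) (\<lambda>z. g (fst z) (snd z))"
    unfolding g_def by (rule continuous_on_subset[OF gc0]) (use closure_subset in auto)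
  have gx: "continuous_on A (\<lambda>x. g x s)" for A
    by (rule continuous_on_compose2[OF gc, where f="\<lambda>x. (x, s)", simplified]) (use s in \<open>auto intro!: continuous_intros\<close>)
  have gQ: "continuous_on ({d..T} \<times> ?Q) (\<lambda>z. g (snd z) (fst z) * g (snd z) s)"
    by (intro continuous_on_mult continuous_on_compose2[OF gc, where f="\<lambda>z. (snd z, fst z)", simplified]
        continuous_on_compose2[OF gx[of UNIV]] continuous_intros) auto
  define h where "h = (\<lambda>t. integral ?Q (\<lambda>x. g x t * g x s))"
  have hc: "continuous_on {d..T} h"
    unfolding h_def interval_cbox[where 'a=real] by (rule integral_continuous_on_param, unfold split_beta cbox_interval[where 'a=real]) (rule gQ)
  define \<phi> where "\<phi> = (\<lambda>x. of_real (g x s) :: complex)"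
  have cs: "cont_ext \<Omega> f" by (rule XC_cont_ext[OF C2_spacetime_XC(1)[OF f]])
  have b\<phi>: "bc \<Omega> \<phi>"
    unfolding \<phi>_def by (intro bc_of_real bc_closure[OF bd] gx)
  have "h s = 0"
  proof (rule laplace_bounded_on_rays_imp_zero[OF dT hc k _ s])
    fix \<mu> :: complex assume \<mu>: "\<bar>Re \<mu>\<bar> = k * \<bar>Im \<mu>\<bar>" "cmod \<mu> \<ge> L"
    let ?E = "\<lambda>t. exp (- \<mu> * of_real (t - d))"
    let ?G = "\<lambda>x. integral {d..T} (\<lambda>t. ?E t * of_real (g x t * g x s))"
    have Gc: "continuous_on (?Q \<times> {d..T}) (\<lambda>z. ?E (snd z) * of_real (g (fst z) (snd z) * g (fst z) s))"
      by (intro continuous_on_mult continuous_on_of_real continuous_on_subset[OF gc]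
        continuous_on_compose2[OF gx[of UNIV]] continuous_intros) auto
    have h': "of_real (h t) = integral ?Q (\<lambda>x. of_real (g x t * g x s) :: complex)" if "t \<in> {d..T}" for t
    proof -
      have "continuous_on ?Q (\<lambda>x. g x t * g x s)"
        by (rule continuous_on_compose2[OF gQ, where f="\<lambda>x. (t, x)", simplified]) (use that in \<open>auto intro!: continuous_intros\<close>)
      then have "(\<lambda>x. g x t * g x s) integrable_on ?Q" by (rule integrable_continuous)
      moreover have "bounded_linear (of_real :: real \<Rightarrow> complex)" by (rule bounded_linear_of_real)
      ultimately show ?thesis unfolding h_def by (rule integral_linear[unfolded o_def, symmetric])
    qed
    have "integral {d..T} (\<lambda>t. ?E t * of_real (h t)) = integral {d..T} (\<lambda>t. integral ?Q (\<lambda>x. ?E t * of_real (g x t * g x s)))"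
      by (rule Henstock_Kurzweil_Integration.integral_cong) (simp only: h' integral_mult_right)
    also have "\<dots> = integral ?Q ?G"
      unfolding interval_cbox[where 'a=real]
      by (rule integral_swap_continuous[symmetric], unfold split_beta cbox_Pair_eq cbox_interval[where 'a=real]) (rule Gc)
    also have "\<dots> = ip \<Omega> (\<lambda>_. 1) (tr d T \<mu> f) \<phi>"
      unfolding ip_def
    proof (rule set_integral_eq_integral_cbox[OF aQ, symmetric])
      show "continuous_on ?Q ?G"
        unfolding interval_cbox[where 'a=real] by (rule integral_continuous_on_param, unfold split_beta cbox_interval[where 'a=real]) (rule Gc)
      show "?G x = 0" if "x \<notin> \<Omega>" for x using that by (simp add: g_def)
      show "of_real 1 * tr d T \<mu> f x * cnj (\<phi> x) = ?G x" if "x \<in> \<Omega>" for x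
        using that by (simp add: tr_def \<phi>_def g_def mult.assoc[symmetric])
    qed
    finally have "norm (integral {d..T} (\<lambda>t. ?E t * of_real (h t))) \<le> \<bar>1\<bar> * nn2 \<Omega> (tr d T \<mu> f) * nn2 \<Omega> \<phi>"
      using ip_bound[OF op bd bc_const tr_bc[OF op bd d dT cs] b\<phi>, of "1" 1 \<mu>] by simp
    also have "\<dots> \<le> N * nn2 \<Omega> \<phi>"
      using rays[OF \<mu>] by (simp add: mult_right_mono nn2_nonneg)
    finally show "norm (integral {d..T} (\<lambda>t. ?E t * of_real (h t))) \<le> N * nn2 \<Omega> \<phi>" .
  qed
  moreover have "(\<lambda>x. g x s * g x s) integrable_on ?Q"
    by (intro integrable_continuous continuous_on_mult gx)
  ultimately have "((\<lambda>x. g x s * g x s) has_integral 0) ?Q"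
    unfolding h_def by (metis integrable_integral)
  \<comment> \<open>A continuous nonnegative function with integral 0 over the box vanishes on
    it.\<close>
  then have "g x0 s * g x0 s = 0"
    by (rule has_integral_0_cbox_imp_0[rotated 2]) (use a aQ x0 in \<open>auto intro!: continuous_on_mult gx\<close>)
  then show ?thesis using x0 by (simp add: g_def)
qed

context solution
begin

lemma solution_zero:
  assumes "x \<in> \<Omega>" "t \<in> {d..T}"
  shows "u i x t = 0" "\<tau> x t = 0" "R i x t = 0"
proof -
  have p: "bc \<Omega> (S (dt (u i)))" "bc \<Omega> (S (dt \<tau>))" "bc \<Omega> (S (dt (R i)))" for i
    by (intro bc_snap ce C2)+
  obtain k l N where k: "k > 0" and
    h: "\<forall>\<mu> uh du \<tau>h d\<tau> Rh dR. \<bar>Re \<mu>\<bar> = k * \<bar>Im \<mu>\<bar> \<longrightarrow> cmod \<mu> \<ge> l \<longrightarrow>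
      (\<forall>i. trace0 \<Omega> (uh i) (du i)) \<longrightarrow> trace0 \<Omega> \<tau>h d\<tau> \<longrightarrow> (\<forall>i. trace0 \<Omega> (Rh i) (dR i)) \<longrightarrow>
      weak_momentum \<mu> u0 du0 (\<lambda>i. S (dt (u i))) uh du (rate \<mu> \<tau>h (S \<tau>)) dR \<longrightarrow>
      weak_energy \<mu> (S (dt \<tau>)) (\<lambda>i j. rate \<mu> (symg du i j) (symg du0 i j)) (rate \<mu> \<tau>h (S \<tau>)) d\<tau>
        (\<lambda>j. rate \<mu> (d\<tau> j) (S (dx j \<tau>))) (\<lambda>i. rate \<mu> (Rh i) (R0 i)) (\<lambda>i j. rate \<mu> (dR i j) (dR0 i j)) \<longrightarrow>
      weak_moment \<mu> (\<lambda>i. S (dt (R i))) (symg du) (rate \<mu> \<tau>h (S \<tau>)) (\<lambda>j. rate \<mu> (d\<tau> j) (S (dx j \<tau>))) dR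
        (\<lambda>i. rate \<mu> (Rh i) (R0 i)) (\<lambda>i j. rate \<mu> (dR i j) (dR0 i j)) \<longrightarrow>
      (\<forall>i. nn2 \<Omega> (uh i) \<le> N) \<and> nn2 \<Omega> \<tau>h \<le> N \<and> (\<forall>i. nn2 \<Omega> (Rh i) \<le> N)"
    using resolvent_estimate[of u0 du0 "S \<tau>" "\<lambda>j. S (dx j \<tau>)" R0 dR0 "\<lambda>i. S (dt (u i))" "S (dt \<tau>)" "\<lambda>i. S (dt (R i))", OF traces(2,4,6) p]
    by (elim exE conjE) (rule that)
  have N: "(\<forall>i. nn2 \<Omega> (L \<mu> (u i)) \<le> N) \<and> nn2 \<Omega> (L \<mu> \<tau>) \<le> N \<and> (\<forall>i. nn2 \<Omega> (L \<mu> (R i)) \<le> N)"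
    if "\<bar>Re \<mu>\<bar> = k * \<bar>Im \<mu>\<bar>" "cmod \<mu> \<ge> l" for \<mu>
    by (rule h[THEN spec, THEN spec, THEN spec, THEN spec, THEN spec, THEN spec, THEN spec, of \<mu> "uh \<mu>" "du \<mu>" "L \<mu> \<tau>" "\<lambda>j. L \<mu> (dx j \<tau>)" "Rh \<mu>" "dR \<mu>",
        THEN mp, THEN mp, THEN mp, THEN mp, THEN mp, THEN mp, THEN mp, THEN mp,
        OF that allI[OF traces(1)] traces(3) allI[OF traces(5)] momentum_weak energy_weak moment_weak])
  show "u i x t = 0"
    by (rule transform_bound_imp_zero[OF op bd C2(1) bu d dT k _ assms]) (use N in blast)
  show "\<tau> x t = 0"
    by (rule transform_bound_imp_zero[OF op bd C2(2) b\<tau> d dT k _ assms]) (use N in blast)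
  show "R i x t = 0"
    by (rule transform_bound_imp_zero[OF op bd C2(3) bR d dT k _ assms]) (use N in blast)
qed

end

text \<open>The one-sided derivative at 0 makes the field continuous from the right there, which
  links its initial value to the values at positive times.\<close>

lemma initial_value_zero:
  assumes f: "initial_data \<Omega> f f0 f1" and x: "x \<in> \<Omega>" and z: "\<And>t. t > 0 \<Longrightarrow> f x t = 0"
  shows "f x 0 = 0"
proof -
  have "((\<lambda>t. f x t) has_real_derivative f1 x) (at 0 within {0..})"
    using f x by (simp add: initial_data_def)
  then have "(f x \<longlongrightarrow> f x 0) (at 0 within {0..})"
    using DERIV_continuous continuous_within by blast
  then have "(f x \<longlongrightarrow> f x 0) (at_right 0)" by (rule tendsto_within_subset) auto
  moreover have "(f x \<longlongrightarrow> 0) (at_right 0)"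
    by (rule tendsto_eventually) (auto simp: eventually_at_filter z)
  ultimately show ?thesis by (rule tendsto_unique[OF trivial_limit_at_right_real])
qed

theorem theorem4:
  fixes \<Omega> :: "(real^3) set" and m :: material
    and u R :: "3 \<Rightarrow> real^3 \<Rightarrow> real \<Rightarrow> real" and \<tau> :: "real^3 \<Rightarrow> real \<Rightarrow> real"
    and u0 v0 R0 M0 :: "3 \<Rightarrow> real^3 \<Rightarrow> real" and \<tau>0 \<theta>0 :: "real^3 \<Rightarrow> real"
    and t0 :: real
  assumes "smooth_bounded_region \<Omega>"
    and "regular_coefficients \<Omega> m"
    and "symmetric_coefficients \<Omega> m"
    and "positive_density \<Omega> m" and "dissipation_nonneg \<Omega> m"
    and "coercive_energy \<Omega> m"
    and "dissipation_posdef \<Omega> m"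
    and "is_solution \<Omega> m u \<tau> R"
    and "\<forall>i. initial_data \<Omega> (u i) (u0 i) (v0 i)"
    and "initial_data \<Omega> \<tau> \<tau>0 \<theta>0"
    and "\<forall>i. initial_data \<Omega> (R i) (R0 i) (M0 i)"
    and "\<forall>i. boundary_zero \<Omega> (u i)"
    and "boundary_zero \<Omega> \<tau>"
    and "\<forall>i. boundary_zero \<Omega> (R i)"
    and "t0 \<ge> 0"
    and "\<forall>x\<in>\<Omega>. \<forall>t>t0. (\<forall>i. u i x t = 0) \<and> \<tau> x t = 0 \<and> (\<forall>i. R i x t = 0)"
  shows "\<forall>x\<in>\<Omega>. \<forall>t\<ge>0. (\<forall>i. u i x t = 0) \<and> \<tau> x t = 0 \<and> (\<forall>i. R i x t = 0)"
proof -
  have pos: "u i x t = 0" "\<tau> x t = 0" "R i x t = 0" if x: "x \<in> \<Omega>" and t: "t > 0" for x t i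
  proof -
    \<comment> \<open>The window starts at the time \<open>t\<close> in question and ends beyond
      both \<open>t\<close> and \<open>t0\<close>; vanishing on the window then includes its left
      end.\<close>
    interpret solution \<Omega> m u R \<tau> t "max t0 t + 1" t0
      by unfold_locales (use assms t in \<open>auto simp: smooth_bounded_region_def\<close>)
    show "u i x t = 0" "\<tau> x t = 0" "R i x t = 0" by (rule solution_zero[OF x], simp)+
  qed
  have zero: "u i x 0 = 0" "\<tau> x 0 = 0" "R i x 0 = 0" if x: "x \<in> \<Omega>" for x i
    using assms(9-11) pos[OF x] x by (blast intro: initial_value_zero)+
  show ?thesis
  proof (intro ballI allI impI)
    fix x t assume x: "x \<in> \<Omega>" and "t \<ge> (0::real)"
    then consider "t = 0" | "t > 0" by linarith
    then show "(\<forall>i. u i x t = 0) \<and> \<tau> x t = 0 \<and> (\<forall>i. R i x t = 0)"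
      using zero[OF x] pos[OF x] by cases auto
  qed
qed

end
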